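(* Let $K/F$ be a finite Galois extension of number fields with Galois group $G$. Then $$\operatorname{Po}(K/F)=\operatorname{Cl}(K)^G_{\mathrm{trans}}\qquad\text{and}\qquad \operatorname{Ost}(K/F)\simeq\operatorname{Coker}(\lambda),$$ where $\lambda:H^1(G,U_K)\to\bigoplus_{v\in M_F^0}H^1(G_w,U_{K_w})$ is the localization map.
   Context: For a number field $L$: $I(L)$ is the group of fractional ideals, $P(L)$ the subgroup of principal ones, $\operatorname{Cl}(L)$ the ideal class group, $U_L$ the group of units of the ring of integers. $M_F^0$ is the set of finite places of $F$; for each $v\in M_F^0$ a place $w$ of $K$ above $v$ is fixed, $G_w=\operatorname{Gal}(K_w/F_v)$ (viewed as the decomposition subgroup of $G$) and $U_{K_w}$ is the group of local units of $K_w$. The map $\lambda$ is induced in each component by restriction from $G$ to $G_w$ followed by the inclusion $U_K\to U_{K_w}$. For a prime $\mathfrak p$ of $F$ and an integer $f\ge1$, the relative Ostrowski ideal $\Pi_{\mathfrak p^f}(K/F)$ is the product of all primes $\mathfrak P$ of $K$ with $N_{K/F}(\mathfrak P)=\mathfrak p^f$ (equal to $\mathcal O_K$ if there are none). The relative Pólya group $\operatorname{Po}(K/F)$ is the subgroup of $\operatorname{Cl}(K)$ generated by the classes of all $\Pi_{\mathfrak p^f}(K/F)$. $\epsilon_{K/F}:\operatorname{Cl}(F)\to\operatorname{Cl}(K)$ is the capitulation map induced by extension of ideals. The Ostrowski quotient is $\operatorname{Ost}(K/F)=\operatorname{Po}(K/F)/\big(\operatorname{Po}(K/F)\cap\epsilon_{K/F}(\operatorname{Cl}(F))\big)$.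 The transgression map $\operatorname{trans}_{K/F}:\operatorname{Cl}(K)^G\to H^2(G,U_K)$ is the composite $\operatorname{Cl}(K)^G\to H^1(G,P(K))\hookrightarrow H^2(G,U_K)$ of the connecting homomorphisms attached to $0\to P(K)\to I(K)\to\operatorname{Cl}(K)\to0$ and $0\to U_K\to K^\times\to P(K)\to0$. $\operatorname{Cl}(K)^G_{\mathrm{trans}}$ denotes its kernel. *)

theory Defs
  imports Complex_Main "HOL-Algebra.Algebra" "HOL-Algebra.Algebraic_Closure_Type"
begin

section \<open>Number fields and their rings of integers\<close>

text \<open>Number fields are subfields of an arbitrary ambient field of characteristic 0; in
  particular the ambient field may be the number field itself, or the complex numbers.\<close>

abbreviation ring_on :: "'a::field_char_0 set \<Rightarrow> 'a ring" where
  "ring_on S \<equiv> ring_of_type_algebra\<lparr>carrier := S\<rparr>"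

definition number_field :: "'a::field_char_0 set \<Rightarrow> bool" where
  "number_field L \<longleftrightarrow>
     subfield L ring_of_type_algebra \<and> ring.finite_dimension ring_of_type_algebra \<rat> L"

definition integers_of :: "'a::field_char_0 set \<Rightarrow> 'a set" where
  "integers_of L = {x \<in> L. algebraic_int x}"

definition field_units :: "'a::field_char_0 set \<Rightarrow> 'a monoid" where
  "field_units L = units_of (ring_on L)"

definition integer_units :: "'a::field_char_0 set \<Rightarrow> 'a monoid" where
  "integer_units L = units_of (ring_on (integers_of L))"

section \<open>Ideals and class groups\<close>

definition fractional_ideal :: "'a::field_char_0 set \<Rightarrow> 'a set \<Rightarrow> bool" where
  "fractional_ideal L J \<longleftrightarrow>
     J \<subseteq> L \<and> 0 \<in> J \<and> J \<noteq> {0} \<and>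
     (\<forall>x\<in>J. \<forall>y\<in>J. x + y \<in> J) \<and> (\<forall>a\<in>integers_of L. \<forall>x\<in>J. a * x \<in> J) \<and>
     (\<exists>d\<in>integers_of L. d \<noteq> 0 \<and> (\<forall>x\<in>J. d * x \<in> integers_of L))"

definition ideal_prod :: "'a::field_char_0 set \<Rightarrow> 'a set \<Rightarrow> 'a set" where
  "ideal_prod I J = {(\<Sum>i<n. a i * b i) |(n::nat) a b. \<forall>i<n. a i \<in> I \<and> b i \<in> J}"

definition ideal_group :: "'a::field_char_0 set \<Rightarrow> 'a set monoid" where
  "ideal_group L =
     \<lparr>carrier = {J. fractional_ideal L J}, monoid.mult = ideal_prod, one = integers_of L\<rparr>"

definition principal_ideal :: "'a::field_char_0 set \<Rightarrow> 'a \<Rightarrow> 'a set" where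
  "principal_ideal L x = (\<lambda>a. a * x) ` integers_of L"

definition principal_ideals :: "'a::field_char_0 set \<Rightarrow> 'a set set" where
  "principal_ideals L = principal_ideal L ` (L - {0})"

definition principal_group :: "'a::field_char_0 set \<Rightarrow> 'a set monoid" where
  "principal_group L = (ideal_group L)\<lparr>carrier := principal_ideals L\<rparr>"

definition class_group :: "'a::field_char_0 set \<Rightarrow> 'a set set monoid" where
  "class_group L = ideal_group L Mod principal_ideals L"

definition ideal_class :: "'a::field_char_0 set \<Rightarrow> 'a set \<Rightarrow> 'a set set" where
  "ideal_class L J = principal_ideals L #>\<^bsub>ideal_group L\<^esub> J"

text \<open>The nonzero primes of the ring of integers; they also serve as the finite places.\<close>

definition primes_of :: "'a::field_char_0 set \<Rightarrow> 'a set set" where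
  "primes_of L = {P. primeideal P (ring_on (integers_of L)) \<and> P \<noteq> {0}}"

text \<open>Here and below, a map out of a quotient is written as a union over the representatives of
  its argument: all members of the union are one and the same coset, so the union is that coset.\<close>

definition capitulation :: "'a::field_char_0 set \<Rightarrow> 'a set set \<Rightarrow> 'a set set" where
  "capitulation K C = (\<Union>J\<in>C. ideal_class K (ideal_prod J (integers_of K)))"

section \<open>Galois extensions\<close>

definition galois_group ::
  "'a::field_char_0 set \<Rightarrow> 'a set \<Rightarrow> ('a \<Rightarrow> 'a) monoid" where
  "galois_group K F =
     \<lparr>carrier = {\<sigma> \<in> ring_iso (ring_on K) (ring_on K). \<sigma> \<in> extensional K \<and> (\<forall>x\<in>F. \<sigma> x = x)},
      monoid.mult = compose K, one = (\<lambda>x\<in>K. x)\<rparr>"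

definition galois_number_fields :: "'a::field_char_0 set \<Rightarrow> 'a set \<Rightarrow> bool" where
  "galois_number_fields K F \<longleftrightarrow>
     number_field K \<and> number_field F \<and> F \<subseteq> K \<and>
     {x \<in> K. \<forall>\<sigma>\<in>carrier (galois_group K F). \<sigma> x = x} = F"

definition decomposition_group ::
  "'a::field_char_0 set \<Rightarrow> 'a set \<Rightarrow> 'a set \<Rightarrow> ('a \<Rightarrow> 'a) monoid" where
  "decomposition_group K F P =
     (galois_group K F)\<lparr>carrier := {\<sigma> \<in> carrier (galois_group K F). \<sigma> ` P = P}\<rparr>"

section \<open>Relative Polya group and Ostrowski quotient\<close>

text \<open>The residue field of \<open>P \<inter> F\<close> is identified with its image in the residue field of \<open>P\<close>.\<close>

definition residue_degree :: "'a::field_char_0 set \<Rightarrow> 'a set \<Rightarrow> 'a set \<Rightarrow> nat" where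
  "residue_degree K F P =
     (let k = ring_on (integers_of K) Quot P
      in ring.dim k ((\<lambda>x. P +>\<^bsub>ring_on (integers_of K)\<^esub> x) ` integers_of F) (carrier k))"

definition prime_norm :: "'a::field_char_0 set \<Rightarrow> 'a set \<Rightarrow> 'a set \<Rightarrow> 'a set" where
  "prime_norm K F P = (P \<inter> F) [^]\<^bsub>ideal_group F\<^esub> residue_degree K F P"

definition ostrowski_ideal ::
  "'a::field_char_0 set \<Rightarrow> 'a set \<Rightarrow> 'a set \<Rightarrow> nat \<Rightarrow> 'a set" where
  "ostrowski_ideal K F p f =
     finprod (ideal_group K) (\<lambda>P. P)
       {P \<in> primes_of K. prime_norm K F P = p [^]\<^bsub>ideal_group F\<^esub> f}"

definition polya :: "'a::field_char_0 set \<Rightarrow> 'a set \<Rightarrow> 'a set set set" where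
  "polya K F =
     generate (class_group K) {ideal_class K (ostrowski_ideal K F p f) |p f. p \<in> primes_of F \<and> 1 \<le> f}"

definition ostrowski_quotient ::
  "'a::field_char_0 set \<Rightarrow> 'a set \<Rightarrow> 'a set set set monoid" where
  "ostrowski_quotient K F =
     (class_group K)\<lparr>carrier := polya K F\<rparr> Mod
       (polya K F \<inter> capitulation K ` carrier (class_group F))"

section \<open>Group cohomology in low degrees\<close>

text \<open>Inhomogeneous cochains of \<open>G\<close> with values in a multiplicatively written \<open>G\<close>-module \<open>A\<close>,
  where \<open>act s a\<close> is the action of \<open>s\<close> on \<open>a\<close>.\<close>

definition invariants ::
  "('g, 'r) monoid_scheme \<Rightarrow> 'm monoid \<Rightarrow> ('g \<Rightarrow> 'm \<Rightarrow> 'm) \<Rightarrow> 'm monoid" where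
  "invariants G A act = A\<lparr>carrier := {a \<in> carrier A. \<forall>s\<in>carrier G. act s a = a}\<rparr>"

abbreviation C1 :: "('g, 'r) monoid_scheme \<Rightarrow> 'm monoid \<Rightarrow> ('g \<Rightarrow> 'm) monoid" where
  "C1 G A \<equiv> product_group (carrier G) (\<lambda>_. A)"

abbreviation C2 :: "('g, 'r) monoid_scheme \<Rightarrow> 'm monoid \<Rightarrow> ('g \<times> 'g \<Rightarrow> 'm) monoid" where
  "C2 G A \<equiv> product_group (carrier G \<times> carrier G) (\<lambda>_. A)"

abbreviation C3 :: "('g, 'r) monoid_scheme \<Rightarrow> 'm monoid \<Rightarrow> ('g \<times> 'g \<times> 'g \<Rightarrow> 'm) monoid" where
  "C3 G A \<equiv> product_group (carrier G \<times> carrier G \<times> carrier G) (\<lambda>_. A)"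

definition d0 ::
  "('g, 'r) monoid_scheme \<Rightarrow> 'm monoid \<Rightarrow> ('g \<Rightarrow> 'm \<Rightarrow> 'm) \<Rightarrow> 'm \<Rightarrow> 'g \<Rightarrow> 'm" where
  "d0 G A act a = (\<lambda>s\<in>carrier G. act s a \<otimes>\<^bsub>A\<^esub> inv\<^bsub>A\<^esub> a)"

definition d1 ::
  "('g, 'r) monoid_scheme \<Rightarrow> 'm monoid \<Rightarrow> ('g \<Rightarrow> 'm \<Rightarrow> 'm) \<Rightarrow> ('g \<Rightarrow> 'm) \<Rightarrow> 'g \<times> 'g \<Rightarrow> 'm" where
  "d1 G A act h = (\<lambda>(s, t)\<in>carrier G \<times> carrier G.
     act s (h t) \<otimes>\<^bsub>A\<^esub> inv\<^bsub>A\<^esub> (h (s \<otimes>\<^bsub>G\<^esub> t)) \<otimes>\<^bsub>A\<^esub> h s)"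

definition d2 ::
  "('g, 'r) monoid_scheme \<Rightarrow> 'm monoid \<Rightarrow> ('g \<Rightarrow> 'm \<Rightarrow> 'm) \<Rightarrow> ('g \<times> 'g \<Rightarrow> 'm) \<Rightarrow>
     'g \<times> 'g \<times> 'g \<Rightarrow> 'm" where
  "d2 G A act h = (\<lambda>(s, t, u)\<in>carrier G \<times> carrier G \<times> carrier G.
     act s (h (t, u)) \<otimes>\<^bsub>A\<^esub> inv\<^bsub>A\<^esub> (h (s \<otimes>\<^bsub>G\<^esub> t, u)) \<otimes>\<^bsub>A\<^esub> h (s, t \<otimes>\<^bsub>G\<^esub> u) \<otimes>\<^bsub>A\<^esub> inv\<^bsub>A\<^esub> (h (s, t)))"

definition B1 ::
  "('g, 'r) monoid_scheme \<Rightarrow> 'm monoid \<Rightarrow> ('g \<Rightarrow> 'm \<Rightarrow> 'm) \<Rightarrow> ('g \<Rightarrow> 'm) set" where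
  "B1 G A act = d0 G A act ` carrier A"

definition B2 ::
  "('g, 'r) monoid_scheme \<Rightarrow> 'm monoid \<Rightarrow> ('g \<Rightarrow> 'm \<Rightarrow> 'm) \<Rightarrow> ('g \<times> 'g \<Rightarrow> 'm) set" where
  "B2 G A act = d1 G A act ` carrier (C1 G A)"

definition H1 ::
  "('g, 'r) monoid_scheme \<Rightarrow> 'm monoid \<Rightarrow> ('g \<Rightarrow> 'm \<Rightarrow> 'm) \<Rightarrow> ('g \<Rightarrow> 'm) set monoid" where
  "H1 G A act =
     (C1 G A)\<lparr>carrier := kernel (C1 G A) (C2 G A) (d1 G A act)\<rparr> Mod B1 G A act"

definition H2 ::
  "('g, 'r) monoid_scheme \<Rightarrow> 'm monoid \<Rightarrow> ('g \<Rightarrow> 'm \<Rightarrow> 'm) \<Rightarrow> ('g \<times> 'g \<Rightarrow> 'm) set monoid" where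
  "H2 G A act =
     (C2 G A)\<lparr>carrier := kernel (C2 G A) (C3 G A) (d2 G A act)\<rparr> Mod B2 G A act"

text \<open>Connecting homomorphisms of a short exact sequence \<open>1 \<rightarrow> A \<rightarrow> B \<rightarrow> C \<rightarrow> 1\<close> of \<open>G\<close>-modules in
  which \<open>A\<close> is a submodule of \<open>B\<close> and \<open>p\<close> is the surjection of \<open>B\<close> onto \<open>C\<close>: lift to \<open>B\<close>, take the
  coboundary there, and read it as a cocycle with values in \<open>A\<close>.\<close>

definition connecting0 ::
  "('g, 'r) monoid_scheme \<Rightarrow> 'm monoid \<Rightarrow> 'm monoid \<Rightarrow> ('m \<Rightarrow> 'c) \<Rightarrow> ('g \<Rightarrow> 'm \<Rightarrow> 'm) \<Rightarrow>
     'c \<Rightarrow> ('g \<Rightarrow> 'm) set" where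
  "connecting0 G A B p act c =
     (\<Union>b\<in>{b \<in> carrier B. p b = c}. B1 G A act #>\<^bsub>C1 G A\<^esub> d0 G B act b)"

definition connecting1 ::
  "('g, 'r) monoid_scheme \<Rightarrow> 'm monoid \<Rightarrow> 'm monoid \<Rightarrow> ('m \<Rightarrow> 'c) \<Rightarrow> ('g \<Rightarrow> 'm \<Rightarrow> 'm) \<Rightarrow>
     ('g \<Rightarrow> 'c) set \<Rightarrow> ('g \<times> 'g \<Rightarrow> 'm) set" where
  "connecting1 G A B p act c =
     (\<Union>f\<in>c. \<Union>h\<in>{h \<in> carrier (C1 G B). \<forall>s\<in>carrier G. p (h s) = f s}.
        B2 G A act #>\<^bsub>C2 G A\<^esub> d1 G B act h)"

section \<open>The transgression map\<close>

definition class_invariants ::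
  "'a::field_char_0 set \<Rightarrow> 'a set \<Rightarrow> 'a set set monoid" where
  "class_invariants K F = invariants (galois_group K F) (class_group K) (\<lambda>\<sigma> C. (\<lambda>J. \<sigma> ` J) ` C)"

definition transgression ::
  "'a::field_char_0 set \<Rightarrow> 'a set \<Rightarrow> 'a set set \<Rightarrow> (('a \<Rightarrow> 'a) \<times> ('a \<Rightarrow> 'a) \<Rightarrow> 'a) set" where
  "transgression K F c =
     connecting1 (galois_group K F) (integer_units K) (field_units K) (principal_ideal K) (\<lambda>\<sigma> x. \<sigma> x)
       (connecting0 (galois_group K F) (principal_group K) (ideal_group K) (ideal_class K)
          (\<lambda>\<sigma> J. \<sigma> ` J) c)"

definition transgression_kernel ::
  "'a::field_char_0 set \<Rightarrow> 'a set \<Rightarrow> 'a set set set" where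
  "transgression_kernel K F =
     kernel (class_invariants K F) (H2 (galois_group K F) (integer_units K) (\<lambda>\<sigma> x. \<sigma> x))
       (transgression K F)"

section \<open>Completions and local units\<close>

text \<open>\<open>x\<close> has valuation at least \<open>n\<close> at \<open>P\<close> iff it lies in the localization at \<open>P\<close> of the
  fractional ideal \<open>P\<^sup>n\<close>.\<close>

definition ord_at :: "'a::field_char_0 set \<Rightarrow> 'a set \<Rightarrow> 'a \<Rightarrow> int" where
  "ord_at K P x =
     (GREATEST n::int. \<exists>s\<in>integers_of K - P. s * x \<in> P [^]\<^bsub>ideal_group K\<^esub> n)"

text \<open>Any other base greater than 1 gives an equivalent absolute value, hence the same completion
  and the same local units.\<close>

definition abs_at :: "'a::field_char_0 set \<Rightarrow> 'a set \<Rightarrow> 'a \<Rightarrow> real" where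
  "abs_at K P x = (if x = 0 then 0 else 2 powi (- ord_at K P x))"

definition cauchy_ring :: "'a::field_char_0 set \<Rightarrow> 'a set \<Rightarrow> (nat \<Rightarrow> 'a) ring" where
  "cauchy_ring K P =
     \<lparr>carrier = {x. range x \<subseteq> K \<and> (\<forall>e>0. \<exists>N. \<forall>m\<ge>N. \<forall>n\<ge>N. abs_at K P (x m - x n) < e)},
      monoid.mult = (\<lambda>x y n. x n * y n), one = (\<lambda>_. 1),
      ring.zero = (\<lambda>_. 0), add = (\<lambda>x y n. x n + y n)\<rparr>"

definition null_seqs :: "'a::field_char_0 set \<Rightarrow> 'a set \<Rightarrow> (nat \<Rightarrow> 'a) set" where
  "null_seqs K P = {x \<in> carrier (cauchy_ring K P). (\<lambda>n. abs_at K P (x n)) \<longlonglongrightarrow> 0}"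

definition completion :: "'a::field_char_0 set \<Rightarrow> 'a set \<Rightarrow> (nat \<Rightarrow> 'a) set ring" where
  "completion K P = cauchy_ring K P Quot null_seqs K P"

definition completion_abs :: "'a::field_char_0 set \<Rightarrow> 'a set \<Rightarrow> (nat \<Rightarrow> 'a) set \<Rightarrow> real" where
  "completion_abs K P \<xi> = (THE r. \<forall>x\<in>\<xi>. (\<lambda>n. abs_at K P (x n)) \<longlonglongrightarrow> r)"

definition local_units :: "'a::field_char_0 set \<Rightarrow> 'a set \<Rightarrow> (nat \<Rightarrow> 'a) set monoid" where
  "local_units K P =
     units_of ((completion K P)
       \<lparr>carrier := {\<xi> \<in> carrier (completion K P). completion_abs K P \<xi> \<le> 1}\<rparr>)"

definition to_completion :: "'a::field_char_0 set \<Rightarrow> 'a set \<Rightarrow> 'a \<Rightarrow> (nat \<Rightarrow> 'a) set" where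
  "to_completion K P x = null_seqs K P +>\<^bsub>cauchy_ring K P\<^esub> (\<lambda>_. x)"

text \<open>The decomposition group acts on the completion by continuity, i.e. termwise on Cauchy
  sequences.\<close>

definition local_action :: "('a \<Rightarrow> 'a) \<Rightarrow> (nat \<Rightarrow> 'a) set \<Rightarrow> (nat \<Rightarrow> 'a) set" where
  "local_action \<sigma> \<xi> = (\<lambda>x. \<sigma> \<circ> x) ` \<xi>"

section \<open>The localization map\<close>

definition global_H1 ::
  "'a::field_char_0 set \<Rightarrow> 'a set \<Rightarrow> (('a \<Rightarrow> 'a) \<Rightarrow> 'a) set monoid" where
  "global_H1 K F = H1 (galois_group K F) (integer_units K) (\<lambda>\<sigma> x. \<sigma> x)"

definition local_H1 ::
  "'a::field_char_0 set \<Rightarrow> 'a set \<Rightarrow> 'a set \<Rightarrow> (('a \<Rightarrow> 'a) \<Rightarrow> (nat \<Rightarrow> 'a) set) set monoid" where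
  "local_H1 K F P = H1 (decomposition_group K F P) (local_units K P) local_action"

definition local_H1_sum ::
  "'a::field_char_0 set \<Rightarrow> 'a set \<Rightarrow> ('a set \<Rightarrow> 'a set) \<Rightarrow>
     ('a set \<Rightarrow> (('a \<Rightarrow> 'a) \<Rightarrow> (nat \<Rightarrow> 'a) set) set) monoid" where
  "local_H1_sum K F w = sum_group (primes_of F) (\<lambda>v. local_H1 K F (w v))"

definition localization ::
  "'a::field_char_0 set \<Rightarrow> 'a set \<Rightarrow> ('a set \<Rightarrow> 'a set) \<Rightarrow> (('a \<Rightarrow> 'a) \<Rightarrow> 'a) set \<Rightarrow>
     'a set \<Rightarrow> (('a \<Rightarrow> 'a) \<Rightarrow> (nat \<Rightarrow> 'a) set) set" where
  "localization K F w c = (\<lambda>v\<in>primes_of F. \<Union>f\<in>c.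
     B1 (decomposition_group K F (w v)) (local_units K (w v)) local_action
       #>\<^bsub>C1 (decomposition_group K F (w v)) (local_units K (w v))\<^esub>
         (\<lambda>\<sigma>\<in>carrier (decomposition_group K F (w v)). to_completion K (w v) (f \<sigma>)))"

definition localization_coker ::
  "'a::field_char_0 set \<Rightarrow> 'a set \<Rightarrow> ('a set \<Rightarrow> 'a set) \<Rightarrow>
     ('a set \<Rightarrow> (('a \<Rightarrow> 'a) \<Rightarrow> (nat \<Rightarrow> 'a) set) set) set monoid" where
  "localization_coker K F w =
     local_H1_sum K F w Mod (localization K F w ` carrier (global_H1 K F))"

end

theory Submission
  imports Defs "Jordan_Normal_Form.Char_Poly"
begin

text \<open>Both groups are quotients of the group of Galois-invariant fractional ideals of \<open>K\<close>. An invariant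
  ideal is determined by its orders at the places \<open>w v\<close>, and these are arbitrary integers, almost
  all of them zero. The nontrivial Ostrowski ideals are the invariant ideals with one order equal to 1 and all
  others 0, so \<open>Po(K/F)\<close> consists of the classes of the invariant ideals. If the transgression kills
  an invariant class of \<open>J\<close>, then generators of the principal ideals \<open>\<sigma>(J) J\<^sup>-\<^sup>1\<close> can be chosen so that they
  form a cocycle in \<open>K\<^sup>\<times>\<close>; by Hilbert 90 it is \<open>\<sigma> \<mapsto> \<sigma>(b)/b\<close>, and the ideal \<open>b\<^sup>-\<^sup>1 J\<close> is invariant.

  At a place \<open>w\<close>, every local cocycle is cohomologous to \<open>\<sigma> \<mapsto> \<sigma>(x)/x\<close> with \<open>x\<close> in \<open>K\<^sup>\<times>\<close>, by Hilbert 90 for the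
  completion and approximation; its class depends only on the order of \<open>x\<close> at \<open>w\<close> and is trivial iff the
  ramification index divides this order. Thus \<open>J \<mapsto> (ord\<^sub>w(J))\<^sub>v\<close> maps the invariant ideals onto the sum of
  the local cohomology groups, and its kernel consists of the ideals extended from \<open>F\<close>. Again by
  Hilbert 90, the image of \<open>\<lambda>\<close> is the image of the principal invariant ideals. Hence the cokernel of
  \<open>\<lambda>\<close> is the quotient of the classes of invariant ideals by those of extended ideals.\<close>

section \<open>Algebraic integers\<close>

definition int_span :: "'i set \<Rightarrow> ('i \<Rightarrow> 'a) \<Rightarrow> 'a::field_char_0 set" where
  "int_span I m = range (\<lambda>c::'i \<Rightarrow> int. \<Sum>i\<in>I. of_int (c i) * m i)"

lemma int_span_base: "finite I \<Longrightarrow> i \<in> I \<Longrightarrow> m i \<in> int_span I m"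
  unfolding int_span_def
  by (rule image_eqI[of _ _ "\<lambda>j. if j = i then 1 else 0"])
     (simp_all add: if_distrib if_distribR cong: if_cong)

lemma int_span_add: "x \<in> int_span I m \<Longrightarrow> y \<in> int_span I m \<Longrightarrow> x + y \<in> int_span I m"
  unfolding int_span_def
  by (auto simp: sum.distrib[symmetric] distrib_right[symmetric] of_int_add[symmetric]
           simp del: of_int_add)

lemma int_span_scale: "x \<in> int_span I m \<Longrightarrow> of_int c * x \<in> int_span I m"
  unfolding int_span_def
  by (auto simp: sum_distrib_left mult.assoc[symmetric] of_int_mult[symmetric]
           simp del: of_int_mult)

lemma int_span_0: "0 \<in> int_span I m"
  unfolding int_span_def by (rule image_eqI[of _ _ "\<lambda>_. 0"]) auto

lemma int_span_sum: "(\<And>j. j \<in> J \<Longrightarrow> f j \<in> int_span I m) \<Longrightarrow> sum f J \<in> int_span I m"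
  by (induction J rule: infinite_finite_induct) (auto intro: int_span_0 int_span_add)

lemma int_span_mult_stable:
  assumes "\<And>i. i \<in> I \<Longrightarrow> x * m i \<in> int_span I m" "z \<in> int_span I m"
  shows "x * z \<in> int_span I m"
proof -
  obtain c where z: "z = (\<Sum>i\<in>I. of_int (c i) * m i)"
    using assms(2) unfolding int_span_def by auto
  have "x * z = (\<Sum>i\<in>I. of_int (c i) * (x * m i))"
    unfolding z by (simp add: sum_distrib_left algebra_simps)
  also have "\<dots> \<in> int_span I m"
    by (intro int_span_sum int_span_scale assms(1))
  finally show ?thesis .
qed

text \<open>\<open>x\<close> is an eigenvalue of the integer matrix describing its action on the module, hence a root
  of the characteristic polynomial of that matrix.\<close>

lemma algebraic_int_if_stable_nat:
  fixes x :: "'a::field_char_0"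
  and m :: "nat \<Rightarrow> 'a"
  assumes stable: "\<And>i. i < n \<Longrightarrow> x * m i \<in> int_span {..<n} m" and nz: "i0 < n" "m i0 \<noteq> 0"
  shows "algebraic_int x"
proof -
  have "\<exists>c::nat \<Rightarrow> int. i < n \<longrightarrow> x * m i = (\<Sum>j<n. of_int (c j) * m j)" for i
    using stable[of i] unfolding int_span_def by auto
  then obtain A :: "nat \<Rightarrow> nat \<Rightarrow> int"
    where A: "\<And>i. i < n \<Longrightarrow> x * m i = (\<Sum>j<n. of_int (A i j) * m j)" by metis
  define B where "B = mat n n (\<lambda>(i,j). A i j)"
  have B: "B \<in> carrier_mat n n" unfolding B_def by simp
  let ?B = "map_mat of_int B :: 'a mat"
  have "eigenvector ?B (vec n m) x"
    unfolding eigenvector_def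
  proof (intro conjI)
    show "vec n m \<in> carrier_vec (dim_row ?B)" using B by auto
    show "vec n m \<noteq> 0\<^sub>v (dim_row ?B)"
    proof
      assume "vec n m = 0\<^sub>v (dim_row ?B)"
      hence "vec n m $ i0 = 0\<^sub>v (dim_row ?B) $ i0" by simp
      thus False using nz B by auto
    qed
    show "?B *\<^sub>v vec n m = x \<cdot>\<^sub>v vec n m"
      by (rule eq_vecI) (auto simp: B_def scalar_prod_def A lessThan_atLeast0)
  qed
  hence "eigenvalue ?B x" unfolding eigenvalue_def by blast
  hence "poly (char_poly ?B) x = 0"
    using eigenvalue_root_char_poly[of ?B n x] B by auto
  hence "poly (map_poly of_int (char_poly B)) x = 0"
    by (simp add: of_int_hom.char_poly_hom[OF B])
  moreover have "lead_coeff (char_poly B) = 1"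
    using degree_monic_char_poly[OF B] by simp
  ultimately show ?thesis unfolding algebraic_int_altdef_ipoly by blast
qed

lemma algebraic_int_if_stable:
  fixes x :: "'a::field_char_0"
  assumes "finite I" and stable: "\<And>i. i \<in> I \<Longrightarrow> x * m i \<in> int_span I m"
    and nz: "i0 \<in> I" "m i0 \<noteq> 0"
  shows "algebraic_int x"
proof -
  obtain h where h: "bij_betw h {..<card I} I"
    using ex_bij_betw_nat_finite[OF assms(1)] by (auto simp: lessThan_atLeast0)
  have eq: "int_span I m = int_span {..<card I} (m \<circ> h)"
  proof
    show "int_span I m \<subseteq> int_span {..<card I} (m \<circ> h)"
    proof
      fix z assume "z \<in> int_span I m"
      then obtain c where "z = (\<Sum>i\<in>I. of_int (c i) * m i)" unfolding int_span_def by auto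
      hence "z = (\<Sum>i<card I. of_int ((c \<circ> h) i) * (m \<circ> h) i)"
        by (simp add: sum.reindex_bij_betw[OF h, of "\<lambda>i. of_int (c i) * m i"])
      thus "z \<in> int_span {..<card I} (m \<circ> h)" unfolding int_span_def by blast
    qed
    show "int_span {..<card I} (m \<circ> h) \<subseteq> int_span I m"
    proof
      fix z assume "z \<in> int_span {..<card I} (m \<circ> h)"
      then obtain c where z: "z = (\<Sum>i<card I. of_int (c i) * m (h i))"
        unfolding int_span_def by auto
      show "z \<in> int_span I m" unfolding z
        using h assms(1)
        by (intro int_span_sum int_span_scale int_span_base) (auto simp: bij_betw_def)
    qed
  qed
  obtain j0 where "j0 < card I" "h j0 = i0"
    using h nz(1) unfolding bij_betw_def by (metis imageE lessThan_iff)
  show ?thesis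
  proof (rule algebraic_int_if_stable_nat[of "card I" x "m \<circ> h" j0])
    show "x * (m \<circ> h) i \<in> int_span {..<card I} (m \<circ> h)" if "i < card I" for i
      using stable[of "h i"] that h eq by (auto simp: bij_betw_def)
    show "j0 < card I" "(m \<circ> h) j0 \<noteq> 0"
      using \<open>j0 < card I\<close> \<open>h j0 = i0\<close> nz by auto
  qed
qed

lemma algebraic_int_power_relation:
  fixes x :: "'a::field_char_0"
  assumes "algebraic_int x"
  obtains a and c :: "nat \<Rightarrow> int" where "a > 0" "x ^ a = (\<Sum>k<a. of_int (c k) * x ^ k)"
proof -
  obtain p :: "int poly" where p: "poly (map_poly of_int p) x = 0" "lead_coeff p = 1"
    using assms unfolding algebraic_int_altdef_ipoly by blast
  define a where "a = degree p"
  have "(\<Sum>i\<le>a. of_int (coeff p i) * x ^ i) = 0"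
    using p(1) by (simp add: poly_altdef a_def coeff_map_poly degree_map_poly)
  hence eq: "(\<Sum>i<a. of_int (coeff p i) * x ^ i) + x ^ a = 0"
    using p(2) by (simp add: lessThan_Suc_atMost[symmetric] a_def)
  have "a > 0"
    using eq by (cases a) auto
  moreover have "x ^ a = (\<Sum>k<a. of_int (- coeff p k) * x ^ k)"
    using eq by (simp add: sum_negf add_eq_0_iff)
  ultimately show thesis using that[of a "\<lambda>k. - coeff p k"] by blast
qed

lemma algebraic_int_add_mult:
  fixes x y :: "'a::field_char_0"
  assumes "algebraic_int x" "algebraic_int y"
  shows "algebraic_int (x + y)" "algebraic_int (x * y)"
proof -
  obtain a c where a: "a > 0" "x ^ a = (\<Sum>k<a. of_int (c k) * x ^ k)"
    using algebraic_int_power_relation[OF assms(1)] by blast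
  obtain b d where b: "b > 0" "y ^ b = (\<Sum>k<b. of_int (d k) * y ^ k)"
    using algebraic_int_power_relation[OF assms(2)] by blast
  define I where "I = {..<a} \<times> {..<b}"
  define m where "m = (\<lambda>(i::nat,j::nat). x ^ i * y ^ j)"
  have fin: "finite I" unfolding I_def by simp
  have base: "x ^ i * y ^ j \<in> int_span I m" if "i < a" "j < b" for i j
    using int_span_base[OF fin, of "(i,j)" m] that unfolding I_def m_def by auto
  have X: "x * m k \<in> int_span I m" if "k \<in> I" for k
  proof -
    obtain i j where k: "k = (i,j)" "i < a" "j < b" using \<open>k \<in> I\<close> unfolding I_def by auto
    show ?thesis
    proof (cases "Suc i < a")
      case True thus ?thesis using base[of "Suc i" j] k by (simp add: m_def mult_ac)
    next
      case False
      hence "Suc i = a" using k by simp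
      hence "x * m k = x ^ a * y ^ j" using k by (auto simp: m_def mult_ac)
      also have "\<dots> = (\<Sum>l<a. of_int (c l) * (x ^ l * y ^ j))"
        unfolding a(2) by (simp add: sum_distrib_right mult.assoc)
      also have "\<dots> \<in> int_span I m"
        using k by (intro int_span_sum int_span_scale base) auto
      finally show ?thesis .
    qed
  qed
  have Y: "y * m k \<in> int_span I m" if "k \<in> I" for k
  proof -
    obtain i j where k: "k = (i,j)" "i < a" "j < b" using \<open>k \<in> I\<close> unfolding I_def by auto
    show ?thesis
    proof (cases "Suc j < b")
      case True thus ?thesis using base[of i "Suc j"] k by (simp add: m_def mult_ac)
    next
      case False
      hence "Suc j = b" using k by simp
      hence "y * m k = x ^ i * y ^ b" using k by (auto simp: m_def mult_ac)
      also have "\<dots> = (\<Sum>l<b. of_int (d l) * (x ^ i * y ^ l))"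
        unfolding b(2) by (simp add: sum_distrib_left algebra_simps)
      also have "\<dots> \<in> int_span I m"
        using k by (intro int_span_sum int_span_scale base) auto
      finally show ?thesis .
    qed
  qed
  have i0: "(0,0) \<in> I" "m (0,0) \<noteq> 0" using a b unfolding I_def m_def by auto
  show "algebraic_int (x + y)"
    by (rule algebraic_int_if_stable[where m = m, OF fin _ i0]) (simp add: distrib_right int_span_add X Y)
  show "algebraic_int (x * y)"
  proof (rule algebraic_int_if_stable[where m = m, OF fin _ i0])
    show "x * y * m i \<in> int_span I m" if "i \<in> I" for i
      using int_span_mult_stable[OF X Y[OF that]] by (simp add: mult.assoc)
  qed
qed

text \<open>The witness \<open>a\<^sub>n x\<close> for the leading coefficient \<open>a\<^sub>n\<close> of a relation.\<close>

lemma algebraic_int_multiple: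
  fixes x :: "'a::field_char_0" and a :: "nat \<Rightarrow> int"
  assumes rel: "(\<Sum>i\<le>n. of_int (a i) * x ^ i) = 0" and nz: "\<exists>i\<le>n. a i \<noteq> 0"
  obtains d :: int where "d > 0" "algebraic_int (of_int d * x)"
proof -
  define k where "k = Max {i. i \<le> n \<and> a i \<noteq> 0}"
  have "k \<in> {i. i \<le> n \<and> a i \<noteq> 0}"
    unfolding k_def using nz by (intro Max_in) auto
  hence k: "k \<le> n" "a k \<noteq> 0" by auto
  have zero: "a i = 0" if "i \<le> n" "i > k" for i
  proof (rule ccontr)
    assume "a i \<noteq> 0"
    hence "i \<le> k" unfolding k_def using that by (intro Max_ge) auto
    thus False using that by simp
  qed
  have "(\<Sum>i\<le>n. of_int (a i) * x ^ i) = (\<Sum>i\<le>k. of_int (a i) * x ^ i)"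
    using k zero by (intro sum.mono_neutral_right) auto
  hence rel': "(\<Sum>i<k. of_int (a i) * x ^ i) + of_int (a k) * x ^ k = 0"
    using rel by (simp add: lessThan_Suc_atMost[symmetric])
  define c where "c = a k"
  define z where "z = of_int c * x"
  have int: "algebraic_int z"
  proof (cases "k = 0")
    case True thus ?thesis using rel' k by simp
  next
    case False
    have *: "x * (of_int c * z ^ i) = z ^ Suc i" for i unfolding z_def by simp
    have "z ^ k = of_int (c ^ (k - 1)) * (of_int c * x ^ k)"
      using False by (simp add: z_def power_mult_distrib power_eq_if[of _ k])
    also have "of_int c * x ^ k = - (\<Sum>i<k. of_int (a i) * x ^ i)"
      using rel' by (simp add: c_def add_eq_0_iff)
    also have "of_int (c ^ (k - 1)) * \<dots> = (\<Sum>i<k. of_int (- a i * c ^ (k - 1 - i)) * z ^ i)"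
    proof -
      have "of_int (c ^ (k - 1)) * x ^ i = (of_int (c ^ (k - 1 - i)) * z ^ i)" if "i < k" for i
      proof -
        have "c ^ (k - 1) = c ^ (k - 1 - i) * c ^ i"
          using that by (simp add: power_add[symmetric])
        thus ?thesis by (simp add: z_def power_mult_distrib)
      qed
      thus ?thesis
        by (auto simp: sum_distrib_left sum_negf[symmetric] intro!: sum.cong)
    qed
    finally have zk: "z ^ k = (\<Sum>i<k. of_int (- a i * c ^ (k - 1 - i)) * z ^ i)" .
    show ?thesis
    proof (rule algebraic_int_if_stable[of "{..<k}" z "\<lambda>i. z ^ i" 0])
      fix i assume i: "i \<in> {..<k}"
      show "z * z ^ i \<in> int_span {..<k} ((^) z)"
      proof (cases "Suc i < k")
        case True
        thus ?thesis using int_span_base[of "{..<k}" "Suc i" "(^) z"] by simp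
      next
        case F: False
        hence "z * z ^ i = z ^ k" using i by (metis Suc_lessI lessThan_iff power_Suc)
        also have "\<dots> \<in> int_span {..<k} ((^) z)"
          unfolding zk by (intro int_span_sum int_span_scale int_span_base) auto
        finally show ?thesis .
      qed
    qed (use False in auto)
  qed
  show thesis
  proof (cases "c > 0")
    case True thus ?thesis using that[of c] int z_def by simp
  next
    case False
    hence "- c > 0" using k c_def by simp
    moreover have "algebraic_int (of_int (- c) * x)" using int z_def by simp
    ultimately show ?thesis using that by blast
  qed
qed

lemma algebraic_int_if_power_diff:
  fixes x :: "'a::field_char_0"
  assumes "algebraic_int (x ^ j - x ^ i)" "i < j"
  shows "algebraic_int x"
proof -
  obtain p :: "int poly" where p: "poly (map_poly of_int p) (x ^ j - x ^ i) = 0" "lead_coeff p = 1"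
    using assms(1) unfolding algebraic_int_altdef_ipoly by blast
  define q :: "int poly" where "q = monom 1 j - monom 1 i"
  have "degree q = j"
  proof (rule antisym)
    show "degree q \<le> j" unfolding q_def
      using assms(2) by (intro degree_diff_le) (auto simp: degree_monom_eq)
    show "j \<le> degree q" unfolding q_def using assms(2) by (intro le_degree) auto
  qed
  hence q: "degree q > 0" "lead_coeff q = 1"
    using assms(2) by (auto simp: q_def)
  have "lead_coeff (pcompose p q) = 1"
    using q p(2) by (subst lead_coeff_comp) auto
  moreover have "poly (map_poly of_int (pcompose p q)) x = 0"
  proof -
    have "map_poly of_int (pcompose p q) = pcompose (map_poly of_int p) (map_poly of_int q :: 'a poly)"
      by (rule of_int_hom.map_poly_pcompose)
    moreover have "poly (map_poly of_int q) x = x ^ j - x ^ i"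
      unfolding q_def by (simp add: of_int_poly_hom.hom_minus poly_monom)
    ultimately show ?thesis using p(1) by (simp add: poly_pcompose)
  qed
  ultimately show ?thesis unfolding algebraic_int_altdef_ipoly by blast
qed

section \<open>Number fields\<close>

lemma type_algebra_simps [simp]:
  "carrier (ring_of_type_algebra :: 'a::field_char_0 ring) = UNIV"
  "x \<otimes>\<^bsub>ring_of_type_algebra\<^esub> y = x * (y::'a)"
  "\<one>\<^bsub>ring_of_type_algebra\<^esub> = (1::'a)"
  "\<zero>\<^bsub>ring_of_type_algebra\<^esub> = (0::'a)"
  "x \<oplus>\<^bsub>ring_of_type_algebra\<^esub> y = x + (y::'a)"
  by (simp_all add: ring_of_type_algebra_def)

lemma type_algebra_combine:
  assumes "length ks = length us"
  shows "ring.combine ring_of_type_algebra ks us = (\<Sum>i<length us. ks ! i * us ! i :: 'a::field_char_0)"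
proof -
  interpret R: field "ring_of_type_algebra :: 'a ring" by (rule field_from_type_algebra)
  show ?thesis
    using assms
    by (induction ks us rule: list_induct2) (simp_all add: sum.lessThan_Suc_shift del: sum.lessThan_Suc)
qed

lemma common_denominator:
  fixes k :: "nat \<Rightarrow> 'a::field_char_0"
  assumes "\<And>i. i < n \<Longrightarrow> k i \<in> \<rat>"
  obtains d :: int where "d > 0" "\<And>i. i < n \<Longrightarrow> of_int d * k i \<in> \<int>"
proof -
  have "\<exists>d::int. d > 0 \<and> (\<forall>i<n. of_int d * k i \<in> \<int>)"
    using assms
  proof (induction n)
    case 0 show ?case by (intro exI[of _ 1]) auto
  next
    case (Suc n)
    then obtain d :: int where d: "d > 0" "\<forall>i<n. of_int d * k i \<in> \<int>" by auto
    have "k n \<in> \<rat>" using Suc.prems by auto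
    then obtain a b :: int where ab: "b > 0" "k n = of_int a / of_int b"
      by (auto elim: Rats_cases')
    show ?case
    proof (intro exI[of _ "d * b"] conjI allI impI)
      fix i assume "i < Suc n"
      show "of_int (d * b) * k i \<in> \<int>"
      proof (cases "i = n")
        case True thus ?thesis using ab by simp
      next
        case False
        hence "i < n" using \<open>i < Suc n\<close> by simp
        hence "of_int d * k i \<in> \<int>" using d by blast
        from Ints_mult[OF Ints_of_int this] have "of_int b * (of_int d * k i) \<in> \<int>" .
        thus ?thesis by (simp add: mult_ac)
      qed
    qed (use d ab in auto)
  qed
  thus thesis using that by blast
qed

locale number_ring =
  fixes L :: "'a::field_char_0 set"
  assumes number_field: "number_field L"
begin

lemma subfield_L: "subfield L ring_of_type_algebra"
  using number_field unfolding number_field_def by auto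

lemma L_closed:
  shows L_0 [simp]: "0 \<in> L" and L_1 [simp]: "1 \<in> L"
    and L_add [simp]: "x \<in> L \<Longrightarrow> y \<in> L \<Longrightarrow> x + y \<in> L"
    and L_mult [simp]: "x \<in> L \<Longrightarrow> y \<in> L \<Longrightarrow> x * y \<in> L"
    and L_uminus [simp]: "x \<in> L \<Longrightarrow> - x \<in> L"
    and L_inverse [simp]: "x \<in> L \<Longrightarrow> inverse x \<in> L"
proof -
  interpret R: field "ring_of_type_algebra :: 'a ring" by (rule field_from_type_algebra)
  note sr = subfieldE(1)[OF subfield_L]
  show "0 \<in> L" "1 \<in> L" using subringE(2,3)[OF sr] by auto
  show "x \<in> L \<Longrightarrow> y \<in> L \<Longrightarrow> x + y \<in> L" "x \<in> L \<Longrightarrow> y \<in> L \<Longrightarrow> x * y \<in> L" for x y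
    using subringE(6,7)[OF sr] by auto
  have "\<ominus>\<^bsub>ring_of_type_algebra\<^esub> x = - x" for x :: 'a
    by (rule R.minus_equality) auto
  thus "x \<in> L \<Longrightarrow> - x \<in> L" for x using subringE(5)[OF sr] by auto
  show "inverse x \<in> L" if "x \<in> L" for x
  proof (cases "x = 0")
    case False
    have "inv\<^bsub>ring_of_type_algebra\<^esub> x = inverse x"
      using False by (intro R.comm_inv_char) auto
    thus ?thesis using R.subfield_m_inv(1)[OF subfield_L, of x] False that by auto
  qed (use \<open>0 \<in> L\<close> in auto)
qed

lemma L_minus [simp]: "x \<in> L \<Longrightarrow> y \<in> L \<Longrightarrow> x - y \<in> L"
  using L_add[of x "- y"] by simp

lemma L_divide [simp]: "x \<in> L \<Longrightarrow> y \<in> L \<Longrightarrow> x / y \<in> L"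
  by (simp add: divide_inverse)

lemma L_power [simp]: "x \<in> L \<Longrightarrow> x ^ n \<in> L"
  by (induction n) auto

lemma L_of_nat [simp]: "of_nat n \<in> L"
  by (induction n) auto

lemma L_of_int [simp]: "of_int n \<in> L"
  by (cases n) auto

lemma L_sum [simp]: "(\<And>i. i \<in> I \<Longrightarrow> f i \<in> L) \<Longrightarrow> sum f I \<in> L"
  by (induction I rule: infinite_finite_induct) auto

lemma L_prod [simp]: "(\<And>i. i \<in> I \<Longrightarrow> f i \<in> L) \<Longrightarrow> prod f I \<in> L"
  by (induction I rule: infinite_finite_induct) auto

lemma Rats_subset_L: "\<rat> \<subseteq> L"
  by (auto elim!: Rats_cases')

lemma subfield_Rats: "subfield \<rat> (ring_of_type_algebra :: 'a ring)"
proof -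
  interpret R: field "ring_of_type_algebra :: 'a ring" by (rule field_from_type_algebra)
  have um: "\<ominus>\<^bsub>ring_of_type_algebra\<^esub> x = - x" for x :: 'a
    by (rule R.minus_equality) auto
  have "inv\<^bsub>ring_of_type_algebra\<^esub> x = inverse x" if "x \<noteq> 0" for x :: 'a
    using that by (intro R.comm_inv_char) auto
  thus ?thesis
    by (intro R.subfieldI' R.subringI) (auto simp: um)
qed

lemma Rats_basis:
  obtains us where "ring.independent ring_of_type_algebra \<rat> us" "set us \<subseteq> L"
    "ring.Span ring_of_type_algebra \<rat> us = L"
proof -
  interpret R: field "ring_of_type_algebra :: 'a ring" by (rule field_from_type_algebra)
  obtain n where "R.dimension n \<rat> L"
    using number_field unfolding number_field_def R.finite_dimension_def by auto
  then obtain us where us: "R.independent \<rat> us" "R.Span \<rat> us = L"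
    using R.exists_base[OF subfield_Rats] by blast
  moreover have "set us \<subseteq> L"
    using R.Span_base_incl[OF subfield_Rats, of us] us by auto
  ultimately show thesis using that by blast
qed

lemma Rats_span:
  obtains n and u :: "nat \<Rightarrow> 'a" where "\<And>i. i < n \<Longrightarrow> u i \<in> L"
    "\<And>x. x \<in> L \<Longrightarrow> \<exists>c. (\<forall>i<n. c i \<in> \<rat>) \<and> x = (\<Sum>i<n. c i * u i)"
proof -
  interpret R: field "ring_of_type_algebra :: 'a ring" by (rule field_from_type_algebra)
  obtain us where us: "set us \<subseteq> L" "R.Span \<rat> us = L"
    using Rats_basis by metis
  show thesis
  proof (rule that[of "length us" "(!) us"])
    show "us ! i \<in> L" if "i < length us" for i using us that by auto
    show "\<exists>c. (\<forall>i<length us. c i \<in> \<rat>) \<and> x = (\<Sum>i<length us. c i * us ! i)" if "x \<in> L" for x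
    proof -
      have "x \<in> R.Span \<rat> us" using that us by simp
      then obtain ks where "set ks \<subseteq> \<rat>" "length ks = length us" "x = R.combine ks us"
        using R.Span_mem_iff_length_version[OF subfield_Rats, of us x] by (auto simp del: R.Span.simps)
      thus ?thesis using type_algebra_combine[of ks us] by (intro exI[of _ "(!) ks"]) auto
    qed
  qed
qed

lemma int_dependent:
  obtains n where "\<And>x. (\<And>i. i \<le> n \<Longrightarrow> x i \<in> L) \<Longrightarrow>
    \<exists>a::nat \<Rightarrow> int. (\<exists>i\<le>n. a i \<noteq> 0) \<and> (\<Sum>i\<le>n. of_int (a i) * x i) = 0"
proof -
  interpret R: field "ring_of_type_algebra :: 'a ring" by (rule field_from_type_algebra)
  obtain us where us: "R.independent \<rat> us" "set us \<subseteq> L" "R.Span \<rat> us = L"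
    using Rats_basis by metis
  define n where "n = length us"
  show thesis
  proof (rule that[of n])
    fix x :: "nat \<Rightarrow> 'a" assume x: "\<And>i. i \<le> n \<Longrightarrow> x i \<in> L"
    define xs where "xs = map x [0..<Suc n]"
    have xs: "set xs \<subseteq> L" "length xs = Suc n" using x by (auto simp: xs_def)
    have "R.dependent \<rat> xs"
      using R.independent_length_le[OF subfield_Rats _ us(1), of xs] us(3) xs by (auto simp: n_def)
    then obtain ks where ks: "length ks = length xs" "R.combine ks xs = 0" "set ks \<subseteq> \<rat>" "set ks \<noteq> {0}"
      using R.dependent_imp_non_trivial_combine[OF subfield_Rats, of xs] by auto
    have len: "length ks = Suc n" using ks xs by simp
    have sum0: "(\<Sum>i<Suc n. ks ! i * x i) = 0"
      using ks(1,2) type_algebra_combine[OF ks(1)]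
      by (simp add: xs(2) del: sum.lessThan_Suc) (simp add: xs_def del: upt_Suc sum.lessThan_Suc)
    have "\<exists>i<Suc n. ks ! i \<noteq> 0"
    proof (rule ccontr)
      assume "\<not> ?thesis"
      hence "set ks \<subseteq> {0}" using len by (auto simp: in_set_conv_nth)
      moreover have "set ks \<noteq> {}" using len by auto
      ultimately show False using ks(4) subset_singletonD by metis
    qed
    then obtain i0 where i0: "i0 < Suc n" "ks ! i0 \<noteq> 0" by blast
    obtain d :: int where d: "d > 0" "\<And>i. i < Suc n \<Longrightarrow> of_int d * ks ! i \<in> \<int>"
      using common_denominator[of "Suc n" "(!) ks"] ks(3) len by (auto simp: subset_iff)
    have "\<exists>a::int. i < Suc n \<longrightarrow> of_int a = of_int d * ks ! i" for i
      using d(2)[of i] by (metis Ints_cases)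
    then obtain a :: "nat \<Rightarrow> int" where a: "\<And>i. i < Suc n \<Longrightarrow> of_int (a i) = of_int d * ks ! i"
      by metis
    have "(\<Sum>i\<le>n. of_int (a i) * x i) = of_int d * (\<Sum>i<Suc n. ks ! i * x i)"
      unfolding sum_distrib_left lessThan_Suc_atMost
      by (intro sum.cong) (auto simp: a mult.assoc)
    hence "(\<Sum>i\<le>n. of_int (a i) * x i) = 0" using sum0 by simp
    moreover have "a i0 \<noteq> 0" using a[OF i0(1)] i0(2) d(1) by auto
    ultimately show "\<exists>a::nat \<Rightarrow> int. (\<exists>i\<le>n. a i \<noteq> 0) \<and> (\<Sum>i\<le>n. of_int (a i) * x i) = 0"
      using i0(1) by (intro exI[of _ a]) auto
  qed
qed

lemma int_polynomial_relation:
  assumes "x \<in> L"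
  obtains n and a :: "nat \<Rightarrow> int" where "\<exists>i\<le>n. a i \<noteq> 0" "(\<Sum>i\<le>n. of_int (a i) * x ^ i) = 0"
proof -
  obtain n where n: "\<And>x. (\<And>i. i \<le> n \<Longrightarrow> x i \<in> L) \<Longrightarrow>
    \<exists>a::nat \<Rightarrow> int. (\<exists>i\<le>n. a i \<noteq> 0) \<and> (\<Sum>i\<le>n. of_int (a i) * x i) = 0"
    using int_dependent by blast
  have "\<exists>a::nat \<Rightarrow> int. (\<exists>i\<le>n. a i \<noteq> 0) \<and> (\<Sum>i\<le>n. of_int (a i) * x ^ i) = 0"
    using assms by (intro n) simp
  thus thesis using that by blast
qed

subsection \<open>Rings of integers\<close>

abbreviation OL :: "'a set" where "OL \<equiv> integers_of L"

lemma OL_subset_L: "OL \<subseteq> L"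
  unfolding integers_of_def by auto

lemma OL_iff: "x \<in> OL \<longleftrightarrow> x \<in> L \<and> algebraic_int x"
  unfolding integers_of_def by auto

lemma OL_closed:
  shows OL_0 [simp]: "0 \<in> OL" and OL_1 [simp]: "1 \<in> OL"
    and OL_add [simp]: "x \<in> OL \<Longrightarrow> y \<in> OL \<Longrightarrow> x + y \<in> OL"
    and OL_mult [simp]: "x \<in> OL \<Longrightarrow> y \<in> OL \<Longrightarrow> x * y \<in> OL"
    and OL_uminus [simp]: "x \<in> OL \<Longrightarrow> - x \<in> OL"
    and OL_of_int [simp]: "of_int n \<in> OL"
proof -
  show *: "of_int n \<in> OL" for n
    by (simp add: integers_of_def algebraic_int_of_int)
  show "0 \<in> OL" "1 \<in> OL" using *[of 0] *[of 1] by simp_all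
  show "x \<in> OL \<Longrightarrow> y \<in> OL \<Longrightarrow> x + y \<in> OL" "x \<in> OL \<Longrightarrow> y \<in> OL \<Longrightarrow> x * y \<in> OL" for x y
    by (simp_all add: integers_of_def algebraic_int_add_mult)
  show "x \<in> OL \<Longrightarrow> - x \<in> OL" for x
    by (simp add: integers_of_def)
qed

lemma OL_in_L [simp]: "x \<in> OL \<Longrightarrow> x \<in> L"
  using OL_subset_L by auto

lemma OL_minus [simp]: "x \<in> OL \<Longrightarrow> y \<in> OL \<Longrightarrow> x - y \<in> OL"
  using OL_add[of x "- y"] by simp

lemma OL_of_nat [simp]: "of_nat n \<in> OL"
  using OL_of_int[of "int n"] by simp

lemma OL_power [simp]: "x \<in> OL \<Longrightarrow> x ^ n \<in> OL"
  by (induction n) auto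

lemma OL_sum [simp]: "(\<And>i. i \<in> I \<Longrightarrow> f i \<in> OL) \<Longrightarrow> sum f I \<in> OL"
  by (induction I rule: infinite_finite_induct) auto

lemma OL_prod [simp]: "(\<And>i. i \<in> I \<Longrightarrow> f i \<in> OL) \<Longrightarrow> prod f I \<in> OL"
  by (induction I rule: infinite_finite_induct) auto

lemma integral_multiple:
  assumes "x \<in> L"
  obtains d :: int where "d > 0" "of_int d * x \<in> OL"
proof -
  obtain n and a :: "nat \<Rightarrow> int" where "\<exists>i\<le>n. a i \<noteq> 0" "(\<Sum>i\<le>n. of_int (a i) * x ^ i) = 0"
    using int_polynomial_relation[OF assms] by blast
  then obtain d :: int where "d > 0" "algebraic_int (of_int d * x)"
    using algebraic_int_multiple by metis
  thus thesis using that[of d] assms OL_iff L_mult L_of_int by blast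
qed

lemma divides_positive_int:
  assumes "x \<in> OL" "x \<noteq> 0"
  obtains m :: int and y where "m > 0" "y \<in> OL" "of_int m = x * y"
proof -
  have *: "\<exists>m y. m \<noteq> 0 \<and> y \<in> OL \<and> of_int m = x * y"
    if "p \<noteq> 0" "poly (map_poly of_int p) x = 0" for p :: "int poly"
    using that
  proof (induction p)
    case 0 thus ?case by simp
  next
    case (pCons c p)
    have eq: "of_int c + x * poly (map_poly of_int p) x = 0"
      using pCons.prems(2) by (simp add: of_int_hom.map_poly_pCons_hom)
    show ?case
    proof (cases "c = 0")
      case True
      thus ?thesis using pCons eq assms by auto
    next
      case False
      have "poly (map_poly of_int p) x \<in> OL"
        using assms by (simp add: poly_altdef coeff_map_poly)
      moreover have "of_int c = x * (- poly (map_poly of_int p) x)"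
        using eq by (simp add: add_eq_0_iff2)
      ultimately show ?thesis using False by (metis OL_uminus)
    qed
  qed
  obtain p :: "int poly" where "poly (map_poly of_int p) x = 0" "lead_coeff p = 1"
    using assms(1) unfolding integers_of_def algebraic_int_altdef_ipoly by blast
  then obtain m y where my: "m \<noteq> 0" "y \<in> OL" "of_int m = x * y"
    using *[of p] by fastforce
  show thesis
  proof (cases "m > 0")
    case True thus ?thesis using that my by blast
  next
    case False
    hence "- m > 0" using my by simp
    moreover have "of_int (- m) = x * (- y)" using my by simp
    ultimately show ?thesis using that my by (metis OL_uminus)
  qed
qed

definition finite_residues :: "'a \<Rightarrow> bool" where
  "finite_residues a \<longleftrightarrow> (\<exists>T. finite T \<and> T \<subseteq> OL \<and> (\<forall>x\<in>OL. \<exists>t\<in>T. \<exists>y\<in>OL. x = t + a * y))"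

lemma finite_residues_mult:
  assumes "finite_residues a" "finite_residues b" "a \<in> OL"
  shows "finite_residues (a * b)"
proof -
  obtain T where T: "finite T" "T \<subseteq> OL" "\<forall>x\<in>OL. \<exists>t\<in>T. \<exists>y\<in>OL. x = t + a * y"
    using assms unfolding finite_residues_def by blast
  obtain S where S: "finite S" "S \<subseteq> OL" "\<forall>x\<in>OL. \<exists>t\<in>S. \<exists>y\<in>OL. x = t + b * y"
    using assms unfolding finite_residues_def by blast
  define R where "R = (\<lambda>(t,s). t + a * s) ` (T \<times> S)"
  have "finite R" "R \<subseteq> OL"
    unfolding R_def using T(1,2) S(1,2) assms(3) by (auto simp: subset_iff)
  moreover have "\<exists>r\<in>R. \<exists>y\<in>OL. x = r + (a * b) * y" if x: "x \<in> OL" for x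
  proof -
    obtain t y where t: "t \<in> T" "y \<in> OL" "x = t + a * y" using T(3) x by blast
    obtain s z where s: "s \<in> S" "z \<in> OL" "y = s + b * z" using S(3) t(2) by blast
    have "x = (t + a * s) + (a * b) * z" using t(3) s(3) by (simp add: algebra_simps)
    moreover have "t + a * s \<in> R" unfolding R_def using t(1) s(1) by force
    ultimately show ?thesis using s(2) by blast
  qed
  ultimately show ?thesis unfolding finite_residues_def by blast
qed

text \<open>A maximal family that is linearly independent modulo \<open>p\<close> spans the integers modulo \<open>p\<close>.\<close>

lemma finite_residues_prime:
  fixes p :: int
  assumes p: "Factorial_Ring.prime p"
  shows "finite_residues (of_int p)"
proof -
  obtain n where n: "\<And>x. (\<And>i. i \<le> n \<Longrightarrow> x i \<in> L) \<Longrightarrow>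
    \<exists>a::nat \<Rightarrow> int. (\<exists>i\<le>n. a i \<noteq> 0) \<and> (\<Sum>i\<le>n. of_int (a i) * x i) = 0"
    using int_dependent by blast
  define pO where "pO = (\<lambda>y. of_int p * y) ` OL"
  define indep where "indep m x \<longleftrightarrow> (\<forall>i<m. x i \<in> OL) \<and>
      (\<forall>a::nat \<Rightarrow> int. (\<Sum>i<m. of_int (a i) * x i) \<in> pO \<longrightarrow> (\<forall>i<m. p dvd a i))" for m and x :: "nat \<Rightarrow> 'a"
  have pO: "0 \<in> pO" unfolding pO_def by (auto intro!: image_eqI[of _ _ 0])
  have not_indep: "\<not> indep (Suc n) x" for x
  proof
    assume ind: "indep (Suc n) x"
    hence x: "x i \<in> L" if "i \<le> n" for i using that unfolding indep_def by auto
    define rel where "rel a \<longleftrightarrow> (\<exists>i\<le>n. a i \<noteq> 0) \<and> (\<Sum>i\<le>n. of_int (a i) * x i) = 0" for a :: "nat \<Rightarrow> int"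
    obtain a0 where "rel a0" using n[of x] x unfolding rel_def by blast
    then obtain a where a: "rel a" and least: "\<And>b. rel b \<Longrightarrow> (\<Sum>i\<le>n. nat \<bar>a i\<bar>) \<le> (\<Sum>i\<le>n. nat \<bar>b i\<bar>)"
      using ex_has_least_nat[of rel a0 "\<lambda>a. \<Sum>i\<le>n. nat \<bar>a i\<bar>"] by blast
    have "(\<Sum>i<Suc n. of_int (a i) * x i) \<in> pO"
      using a pO unfolding rel_def by (simp add: lessThan_Suc_atMost del: sum.lessThan_Suc)
    hence dvd: "p dvd a i" if "i \<le> n" for i using ind that unfolding indep_def by auto
    define b where "b i = a i div p" for i
    have ab: "a i = p * b i" if "i \<le> n" for i using dvd[OF that] unfolding b_def by simp
    have p0: "p > 1" using p prime_gt_1_int by blast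
    have "of_int p * (\<Sum>i\<le>n. of_int (b i) * x i) = (\<Sum>i\<le>n. of_int (a i) * x i)"
      unfolding sum_distrib_left by (intro sum.cong) (auto simp: ab)
    also have "\<dots> = 0" using a unfolding rel_def by auto
    finally have sum0: "(\<Sum>i\<le>n. of_int (b i) * x i) = 0" using p0 by simp
    obtain i0 where i0: "i0 \<le> n" "a i0 \<noteq> 0" using a unfolding rel_def by auto
    hence "b i0 \<noteq> 0" using ab[OF i0(1)] by auto
    hence "rel b" using sum0 i0(1) unfolding rel_def by blast
    have le: "\<bar>b i\<bar> \<le> \<bar>a i\<bar>" if "i \<le> n" for i
      using ab[OF that] p0 by (simp add: abs_mult mult_le_cancel_right1)
    have "\<bar>b i0\<bar> < \<bar>a i0\<bar>"
      using ab[OF i0(1)] i0(2) p0 by (simp add: abs_mult)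
    hence "(\<Sum>i\<le>n. nat \<bar>b i\<bar>) < (\<Sum>i\<le>n. nat \<bar>a i\<bar>)"
      using i0 le by (intro sum_strict_mono_ex1) (auto intro!: bexI[of _ i0] nat_mono)
    thus False using least[OF \<open>rel b\<close>] by simp
  qed
  have indep0: "indep 0 x" for x unfolding indep_def by auto
  have "\<exists>m x. indep m x \<and> (\<forall>y. \<not> indep (Suc m) y)"
  proof (rule ccontr)
    assume "\<not> ?thesis"
    hence step: "\<exists>y. indep m y \<Longrightarrow> \<exists>y. indep (Suc m) y" for m by blast
    have "\<exists>y. indep m y" for m by (induction m) (use indep0 step in auto)
    thus False using not_indep by blast
  qed
  then obtain m x where ind: "indep m x" and max: "\<And>y. \<not> indep (Suc m) y" by blast
  have xO: "x i \<in> OL" if "i < m" for i using ind that unfolding indep_def by auto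
  define T where "T = (\<lambda>c. \<Sum>i<m. of_int (c i) * x i) ` ({..<m} \<rightarrow>\<^sub>E {0..<p})"
  have "finite T" unfolding T_def by (intro finite_imageI finite_PiE) auto
  moreover have "T \<subseteq> OL" unfolding T_def using xO by (auto intro!: OL_sum OL_mult)
  moreover have "\<exists>t\<in>T. \<exists>y\<in>OL. z = t + of_int p * y" if z: "z \<in> OL" for z
  proof -
    have "\<not> indep (Suc m) (x(m := z))" by (rule max)
    moreover have "\<forall>i<Suc m. (x(m := z)) i \<in> OL" using xO z by (auto simp: less_Suc_eq)
    ultimately obtain a i where a: "(\<Sum>i<Suc m. of_int (a i) * (x(m := z)) i) \<in> pO"
      and i: "i < Suc m" "\<not> p dvd a i"
      unfolding indep_def by blast
    have "(\<Sum>i<Suc m. of_int (a i) * (x(m := z)) i) = (\<Sum>i<m. of_int (a i) * x i) + of_int (a m) * z"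
      by simp
    then obtain y where y: "y \<in> OL" "(\<Sum>i<m. of_int (a i) * x i) + of_int (a m) * z = of_int p * y"
      using a unfolding pO_def by auto
    have "\<not> p dvd a m"
    proof
      assume "p dvd a m"
      then obtain k where "a m = p * k" by auto
      hence "(\<Sum>i<m. of_int (a i) * x i) = of_int p * (y - of_int k * z)"
        using y by (simp add: algebra_simps eq_diff_eq)
      hence "(\<Sum>i<m. of_int (a i) * x i) \<in> pO" unfolding pO_def using y z by auto
      hence "\<forall>i<m. p dvd a i" using ind unfolding indep_def by blast
      thus False using i \<open>p dvd a m\<close> by (auto simp: less_Suc_eq)
    qed
    hence "coprime (a m) p" using p prime_imp_coprime coprime_commute by blast
    then obtain u v where uv: "u * a m + v * p = 1"
      by (metis bezout_int coprime_iff_gcd_eq_1)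
    define c where "c = (\<lambda>i\<in>{..<m}. (- u * a i) mod p)"
    define k where "k i = (- u * a i) div p" for i
    have p0: "p > 0" using p prime_gt_0_int by blast
    have c: "of_int (c i) = - of_int u * of_int (a i) - of_int p * (of_int (k i) :: 'a)" if "i < m" for i
    proof -
      have "c i = - u * a i - p * k i" using that unfolding c_def k_def by (simp add: minus_mult_div_eq_mod[symmetric])
      thus ?thesis by simp
    qed
    have "c \<in> {..<m} \<rightarrow>\<^sub>E {0..<p}" unfolding c_def using p0 by auto
    moreover have "z = (\<Sum>i<m. of_int (c i) * x i) +
        of_int p * (of_int u * y + of_int v * z + (\<Sum>i<m. of_int (k i) * x i))"
    proof -
      have "(\<Sum>i<m. of_int (c i) * x i) =
          - of_int u * (\<Sum>i<m. of_int (a i) * x i) - of_int p * (\<Sum>i<m. of_int (k i) * x i)"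
        unfolding sum_distrib_left sum_subtractf[symmetric]
        by (intro sum.cong) (auto simp: c algebra_simps)
      also have "(\<Sum>i<m. of_int (a i) * x i) = of_int p * y - of_int (a m) * z"
        using y by (simp add: algebra_simps)
      finally have "(\<Sum>i<m. of_int (c i) * x i) = - of_int u * of_int p * y + of_int (u * a m) * z
          - of_int p * (\<Sum>i<m. of_int (k i) * x i)" by (simp add: algebra_simps)
      also have "u * a m = 1 - v * p" using uv by simp
      finally show ?thesis by (simp add: algebra_simps)
    qed
    moreover have "of_int u * y + of_int v * z + (\<Sum>i<m. of_int (k i) * x i) \<in> OL"
      using y z xO by (intro OL_add OL_sum OL_mult) auto
    ultimately show ?thesis unfolding T_def by blast
  qed
  ultimately show ?thesis unfolding finite_residues_def by blast
qed

lemma finite_residues_pos_int: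
  assumes "m > 0"
  shows "finite_residues (of_nat m)"
  using assms
proof (induction m rule: prime_divisors_induct)
  case zero thus ?case by simp
next
  case (unit m)
  hence "m = 1" by auto
  thus ?case unfolding finite_residues_def by (auto intro!: exI[of _ "{0}"])
next
  case (factor p m)
  hence "finite_residues (of_nat m)" by (cases "m = 0") auto
  moreover have "finite_residues (of_nat p)"
    using finite_residues_prime[of "int p"] factor by simp
  ultimately show ?case
    using finite_residues_mult[of "of_nat p" "of_nat m"] by simp
qed

lemma finite_residues_nonzero:
  assumes "a \<in> OL" "a \<noteq> 0"
  shows "finite_residues a"
proof -
  obtain m :: int and y where m: "m > 0" "y \<in> OL" "of_int m = a * y"
    using divides_positive_int[OF assms] by blast
  have "finite_residues (of_nat (nat m))" using m by (intro finite_residues_pos_int) auto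
  hence "finite_residues (of_int m)" using m by simp
  then obtain T where T: "finite T" "T \<subseteq> OL" "\<forall>x\<in>OL. \<exists>t\<in>T. \<exists>z\<in>OL. x = t + a * y * z"
    unfolding finite_residues_def m(3) by blast
  have "\<exists>t\<in>T. \<exists>z\<in>OL. x = t + a * z" if x: "x \<in> OL" for x
  proof -
    obtain t z where "t \<in> T" "z \<in> OL" "x = t + a * y * z" using T x by blast
    thus ?thesis using m(2) by (intro bexI[of _ t] bexI[of _ "y * z"]) (auto simp: mult.assoc)
  qed
  thus ?thesis unfolding finite_residues_def using T by blast
qed

lemma residues_pigeonhole:
  assumes "a \<in> OL" "a \<noteq> 0" "\<And>n::nat. f n \<in> OL"
  obtains i j y where "i < j" "y \<in> OL" "f j - f i = a * y"
proof -
  obtain T where T: "finite T" "T \<subseteq> OL" "\<forall>x\<in>OL. \<exists>t\<in>T. \<exists>y\<in>OL. x = t + a * y"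
    using finite_residues_nonzero[OF assms(1,2)] unfolding finite_residues_def by blast
  have "\<forall>n. \<exists>t. \<exists>y. t \<in> T \<and> y \<in> OL \<and> f n = t + a * y" using T assms(3) by metis
  then obtain t y where ty: "\<And>n. t n \<in> T" "\<And>n. y n \<in> OL" "\<And>n. f n = t n + a * y n" by metis
  have "\<not> inj t" using T(1) ty(1) by (meson finite_subset image_subsetI infinite_UNIV_nat finite_imageD)
  then obtain i j where "i \<noteq> j" "t i = t j" unfolding inj_on_def by blast
  then obtain i j where ij: "i < j" "t i = t j" by (metis linorder_neqE_nat)
  have "f j - f i = a * (y j - y i)" using ty(3)[of i] ty(3)[of j] ij(2) by (simp add: algebra_simps)
  thus thesis using that[of i j "y j - y i"] ij ty(2) by auto
qed

text \<open>Pigeonhole: if \<open>m x\<^sup>n\<close> is integral for all \<open>n\<close>, two of these agree modulo \<open>m\<close>, so that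
  \<open>x\<^sup>j - x\<^sup>i\<close> is integral.\<close>

lemma integral_if_powers_bounded:
  assumes "x \<in> L" "a \<in> L" "a \<noteq> 0" "\<And>n::nat. x ^ n * a \<in> OL"
  shows "x \<in> OL"
proof -
  have aO: "a \<in> OL" using assms(4)[of 0] by simp
  obtain i j y where "i < j" "y \<in> OL" "x ^ j * a - x ^ i * a = a * y"
    using residues_pigeonhole[of a "\<lambda>n. x ^ n * a"] aO assms by metis
  hence "a * (x ^ j - x ^ i) = a * y" by (simp add: algebra_simps)
  hence "x ^ j - x ^ i = y" using assms(3) by simp
  hence "algebraic_int (x ^ j - x ^ i)" using \<open>y \<in> OL\<close> OL_iff by blast
  hence "algebraic_int x" using \<open>i < j\<close> by (rule algebraic_int_if_power_diff)
  thus ?thesis using assms(1) OL_iff by blast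
qed

end

section \<open>Fractional ideals\<close>

notation ideal_prod (infixl "\<star>" 70)

lemma ideal_prod_0: "0 \<in> I \<star> J"
  unfolding ideal_prod_def by (rule CollectI, rule exI[of _ 0]) simp

lemma ideal_prod_add_mult:
  assumes "x \<in> I \<star> J" "a \<in> I" "b \<in> J"
  shows "x + a * b \<in> I \<star> J"
proof -
  obtain n f g where x: "x = (\<Sum>i<n. f i * g i)" "\<forall>i<(n::nat). f i \<in> I \<and> g i \<in> J"
    using assms(1) unfolding ideal_prod_def by blast
  have eq: "x + a * b = (\<Sum>i<Suc n. (f(n := a)) i * (g(n := b)) i)"
    unfolding x(1) by simp
  have mem: "\<forall>i<Suc n. (f(n := a)) i \<in> I \<and> (g(n := b)) i \<in> J"
    using x(2) assms(2,3) by (auto simp: less_Suc_eq)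
  show ?thesis
    unfolding ideal_prod_def
    by (rule CollectI, rule exI[of _ "Suc n"], rule exI[of _ "f(n := a)"],
        rule exI[of _ "g(n := b)"], rule conjI[OF eq mem])
qed

lemma ideal_prod_mem: "a \<in> I \<Longrightarrow> b \<in> J \<Longrightarrow> a * b \<in> I \<star> J"
  using ideal_prod_add_mult[OF ideal_prod_0, of a I b J] by simp

lemma ideal_prod_least:
  assumes "0 \<in> M" "\<And>x y. x \<in> M \<Longrightarrow> y \<in> M \<Longrightarrow> x + y \<in> M"
    and "\<And>a b. a \<in> I \<Longrightarrow> b \<in> J \<Longrightarrow> a * b \<in> M"
  shows "I \<star> J \<subseteq> M"
proof
  fix x assume "x \<in> I \<star> J"
  then obtain n f g where x: "x = (\<Sum>i<n. f i * g i)" "\<forall>i<(n::nat). f i \<in> I \<and> g i \<in> J"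
    unfolding ideal_prod_def by blast
  from x(2) have "(\<Sum>i<n. f i * g i) \<in> M"
    by (induction n) (simp_all add: assms)
  thus "x \<in> M" using x(1) by simp
qed

lemma ideal_prod_add:
  assumes "x \<in> I \<star> J" "y \<in> I \<star> J"
  shows "x + y \<in> I \<star> J"
proof -
  obtain n f g where y: "y = (\<Sum>i<n. f i * g i)" "\<forall>i<(n::nat). f i \<in> I \<and> g i \<in> J"
    using assms(2) unfolding ideal_prod_def by blast
  from y(2) have "x + (\<Sum>i<n. f i * g i) \<in> I \<star> J"
  proof (induction n)
    case (Suc n)
    thus ?case using ideal_prod_add_mult[of "x + (\<Sum>i<n. f i * g i)" I J "f n" "g n"]
      by (simp add: add.assoc)
  qed (use assms in simp)
  thus ?thesis using y(1) by simp
qed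

lemma ideal_prod_mono: "I \<subseteq> I' \<Longrightarrow> J \<subseteq> J' \<Longrightarrow> I \<star> J \<subseteq> I' \<star> J'"
  by (rule ideal_prod_least) (auto intro: ideal_prod_0 ideal_prod_add ideal_prod_mem)

lemma ideal_prod_commute: "I \<star> J = J \<star> I"
proof -
  have "I \<star> J \<subseteq> J \<star> I" for I J :: "'a set"
    by (rule ideal_prod_least)
       (simp_all add: ideal_prod_0 ideal_prod_add, subst mult.commute, simp add: ideal_prod_mem)
  thus ?thesis by blast
qed

lemma ideal_prod_assoc: "(I \<star> J) \<star> H = I \<star> (J \<star> H)"
proof -
  have *: "(I \<star> J) \<star> H \<subseteq> I \<star> (J \<star> H)" for I J H :: "'a set"
  proof (rule ideal_prod_least[OF ideal_prod_0 ideal_prod_add], assumption, assumption)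
    fix x h assume "x \<in> I \<star> J" "h \<in> H"
    have "I \<star> J \<subseteq> {x. x * h \<in> I \<star> (J \<star> H)}"
      using \<open>h \<in> H\<close>
      by (intro ideal_prod_least)
         (simp_all add: ideal_prod_0 ideal_prod_add distrib_right mult.assoc ideal_prod_mem)
    thus "x * h \<in> I \<star> (J \<star> H)" using \<open>x \<in> I \<star> J\<close> by blast
  qed
  show ?thesis
  proof
    show "I \<star> (J \<star> H) \<subseteq> (I \<star> J) \<star> H"
      using *[of H J I] by (simp add: ideal_prod_commute)
  qed (rule *)
qed

lemma ideal_prod_left_commute: "I \<star> (J \<star> H) = J \<star> (I \<star> H)"
  using ideal_prod_assoc[of I J H] ideal_prod_assoc[of J I H] ideal_prod_commute[of I J] by simp

lemmas ideal_prod_ac = ideal_prod_assoc ideal_prod_commute ideal_prod_left_commute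

context number_ring
begin

abbreviation frac :: "'a set \<Rightarrow> bool" where "frac \<equiv> fractional_ideal L"

lemma fracD:
  assumes "frac J"
  shows "J \<subseteq> L" "0 \<in> J" "x \<in> J \<Longrightarrow> y \<in> J \<Longrightarrow> x + y \<in> J" "a \<in> OL \<Longrightarrow> x \<in> J \<Longrightarrow> a * x \<in> J"
    "\<exists>x\<in>J. x \<noteq> 0" "\<exists>d\<in>OL. d \<noteq> 0 \<and> (\<forall>x\<in>J. d * x \<in> OL)"
proof -
  have 1: "J \<subseteq> L" "0 \<in> J" "J \<noteq> {0}" and 2: "\<forall>x\<in>J. \<forall>y\<in>J. x + y \<in> J"
    and 3: "\<forall>a\<in>OL. \<forall>x\<in>J. a * x \<in> J" and 4: "\<exists>d\<in>OL. d \<noteq> 0 \<and> (\<forall>x\<in>J. d * x \<in> OL)"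
    using assms unfolding fractional_ideal_def by blast+
  show "J \<subseteq> L" "0 \<in> J" by fact+
  show "x \<in> J \<Longrightarrow> y \<in> J \<Longrightarrow> x + y \<in> J" using 2 by blast
  show "a \<in> OL \<Longrightarrow> x \<in> J \<Longrightarrow> a * x \<in> J" using 3 by blast
  show "\<exists>x\<in>J. x \<noteq> 0" using 1 by blast
  show "\<exists>d\<in>OL. d \<noteq> 0 \<and> (\<forall>x\<in>J. d * x \<in> OL)" by (rule 4)
qed

lemma fracI:
  assumes "J \<subseteq> L" "0 \<in> J" "e \<in> J" "e \<noteq> 0" "\<And>x y. x \<in> J \<Longrightarrow> y \<in> J \<Longrightarrow> x + y \<in> J"
    "\<And>a x. a \<in> OL \<Longrightarrow> x \<in> J \<Longrightarrow> a * x \<in> J" "d \<in> OL" "d \<noteq> 0" "\<And>x. x \<in> J \<Longrightarrow> d * x \<in> OL"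
  shows "frac J"
  unfolding fractional_ideal_def
proof (intro conjI ballI bexI[of _ d])
  show "J \<noteq> {0}" using assms(3,4) by blast
qed (fact assms)+

lemma frac_uminus: "frac J \<Longrightarrow> x \<in> J \<Longrightarrow> - x \<in> J"
  using fracD(4)[of J "-1" x] by simp

lemma frac_diff: "frac J \<Longrightarrow> x \<in> J \<Longrightarrow> y \<in> J \<Longrightarrow> x - y \<in> J"
  using fracD(3)[of J x "- y"] frac_uminus by simp

lemma frac_OL [simp]: "frac OL"
  by (rule fracI[where e = 1 and d = 1]) (auto intro: OL_subset_L[THEN subsetD])

lemma frac_mult [simp]:
  assumes "frac I" "frac J"
  shows "frac (I \<star> J)"
proof -
  obtain x y where x: "x \<in> I" "x \<noteq> 0" and y: "y \<in> J" "y \<noteq> 0" using fracD(5) assms by metis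
  obtain d where d: "d \<in> OL" "d \<noteq> 0" "\<forall>x\<in>I. d * x \<in> OL" using fracD(6)[OF assms(1)] by blast
  obtain e where e: "e \<in> OL" "e \<noteq> 0" "\<forall>x\<in>J. e * x \<in> OL" using fracD(6)[OF assms(2)] by blast
  show ?thesis
  proof (rule fracI)
    show "I \<star> J \<subseteq> L"
      using fracD(1)[OF assms(1)] fracD(1)[OF assms(2)] by (intro ideal_prod_least) (auto simp: subset_iff)
    show "0 \<in> I \<star> J" "x * y \<in> I \<star> J" "x * y \<noteq> 0" using x y by (auto intro: ideal_prod_0 ideal_prod_mem)
    show "u + v \<in> I \<star> J" if "u \<in> I \<star> J" "v \<in> I \<star> J" for u v using that by (rule ideal_prod_add)
    show "a * u \<in> I \<star> J" if a: "a \<in> OL" and "u \<in> I \<star> J" for a u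
    proof -
      have "I \<star> J \<subseteq> {u. a * u \<in> I \<star> J}"
        using fracD(4)[OF assms(1) a]
        by (intro ideal_prod_least)
           (simp_all add: ideal_prod_0 ideal_prod_add distrib_left mult.assoc[symmetric] ideal_prod_mem)
      thus ?thesis using that by blast
    qed
    show "d * e \<in> OL" "d * e \<noteq> 0" using d e by auto
    show "d * e * u \<in> OL" if "u \<in> I \<star> J" for u
    proof -
      have "I \<star> J \<subseteq> {u. d * e * u \<in> OL}"
      proof (rule ideal_prod_least; clarsimp)
        fix a b assume "a \<in> I" "b \<in> J"
        hence "(d * a) * (e * b) \<in> OL" using d e by auto
        thus "d * e * (a * b) \<in> OL" by (simp add: mult_ac)
      qed (simp add: distrib_left)
      thus ?thesis using that by blast
    qed
  qed
qed

lemma ideal_prod_OL [simp]: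
  assumes "frac J" shows "OL \<star> J = J" "J \<star> OL = J"
proof -
  show "OL \<star> J = J"
  proof
    show "OL \<star> J \<subseteq> J" using fracD[OF assms] by (intro ideal_prod_least) auto
    show "J \<subseteq> OL \<star> J" using ideal_prod_mem[of 1 OL _ J] by auto
  qed
  thus "J \<star> OL = J" by (simp add: ideal_prod_commute)
qed

abbreviation pideal :: "'a \<Rightarrow> 'a set" where "pideal \<equiv> principal_ideal L"

lemma pideal_iff: "y \<in> pideal x \<longleftrightarrow> (\<exists>a\<in>OL. y = x * a)"
  unfolding principal_ideal_def by (auto simp: mult.commute)

lemma pideal_memI: "a \<in> OL \<Longrightarrow> x * a \<in> pideal x" "x \<in> pideal x"
  using OL_1 by (auto simp: pideal_iff)

lemma pideal_frac [simp]:
  assumes "x \<in> L" "x \<noteq> 0" shows "frac (pideal x)"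
proof -
  obtain d :: int where d: "d > 0" "of_int d * x \<in> OL" using integral_multiple[OF assms(1)] by blast
  show ?thesis
  proof (rule fracI[where e = x and d = "of_int d"])
    show "pideal x \<subseteq> L" using assms by (auto simp: pideal_iff)
    show "0 \<in> pideal x" by (auto simp: pideal_iff intro: bexI[of _ 0])
    show "x \<in> pideal x" by (auto simp: pideal_iff intro: bexI[of _ 1])
    show "u + v \<in> pideal x" if "u \<in> pideal x" "v \<in> pideal x" for u v
      using that unfolding pideal_iff by (auto simp: distrib_left[symmetric])
    show "a * u \<in> pideal x" if "a \<in> OL" "u \<in> pideal x" for a u
      using that unfolding pideal_iff by (auto simp: mult.left_commute[of a x])
    show "of_int d * u \<in> OL" if "u \<in> pideal x" for u
      using that d(2) unfolding pideal_iff by (auto simp: mult.assoc[symmetric])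
  qed (use assms d in auto)
qed

lemma pideal_prod:
  assumes "frac J" shows "pideal x \<star> J = (\<lambda>a. x * a) ` J"
proof
  show "pideal x \<star> J \<subseteq> (\<lambda>a. x * a) ` J"
  proof (rule ideal_prod_least)
    show "0 \<in> (*) x ` J" using fracD(2)[OF assms] by force
    show "u + v \<in> (*) x ` J" if "u \<in> (*) x ` J" "v \<in> (*) x ` J" for u v
      using that fracD(3)[OF assms] by (auto simp: distrib_left[symmetric])
    show "u * v \<in> (*) x ` J" if "u \<in> pideal x" "v \<in> J" for u v
      using that fracD(4)[OF assms] unfolding pideal_iff by (auto simp: mult.assoc)
  qed
  show "(\<lambda>a. x * a) ` J \<subseteq> pideal x \<star> J"
    by (auto intro!: ideal_prod_mem simp: pideal_iff) (metis OL_1 mult.right_neutral)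
qed

lemma pideal_mult: "x \<in> L \<Longrightarrow> x \<noteq> 0 \<Longrightarrow> y \<in> L \<Longrightarrow> y \<noteq> 0 \<Longrightarrow> pideal x \<star> pideal y = pideal (x * y)"
  by (subst pideal_prod) (auto simp: pideal_iff image_iff mult.assoc)

lemma pideal_1 [simp]: "pideal 1 = OL"
  by (auto simp: pideal_iff)

definition int_ideal :: "'a set \<Rightarrow> bool" where
  "int_ideal I \<longleftrightarrow> frac I \<and> I \<subseteq> OL"

lemma int_idealD: "int_ideal I \<Longrightarrow> frac I" "int_ideal I \<Longrightarrow> I \<subseteq> OL"
  unfolding int_ideal_def by auto

lemma int_idealI:
  assumes "I \<subseteq> OL" "0 \<in> I" "e \<in> I" "e \<noteq> 0" "\<And>x y. x \<in> I \<Longrightarrow> y \<in> I \<Longrightarrow> x + y \<in> I"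
    "\<And>a x. a \<in> OL \<Longrightarrow> x \<in> I \<Longrightarrow> a * x \<in> I"
  shows "int_ideal I"
  unfolding int_ideal_def using assms OL_subset_L
  by (intro conjI fracI[where e = e and d = 1]) auto

lemma int_ideal_OL [simp]: "int_ideal OL"
  unfolding int_ideal_def by auto

lemma int_ideal_mult [simp]: "int_ideal I \<Longrightarrow> int_ideal J \<Longrightarrow> int_ideal (I \<star> J)"
  unfolding int_ideal_def using ideal_prod_mono[of I OL J OL] by auto

lemma int_ideal_mult_subset:
  assumes "int_ideal I" "frac J" shows "I \<star> J \<subseteq> J"
  using ideal_prod_mono[OF int_idealD(2)[OF assms(1)], of J J] assms by simp

lemma int_ideal_pideal [simp]: "a \<in> OL \<Longrightarrow> a \<noteq> 0 \<Longrightarrow> int_ideal (pideal a)"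
  unfolding int_ideal_def by (auto simp: pideal_iff)

lemma int_ideal_power: "int_ideal I \<Longrightarrow> c \<in> I \<Longrightarrow> k > 0 \<Longrightarrow> c ^ k \<in> I"
  using fracD(4)[of I "c ^ (k - 1)" c] int_idealD[of I] OL_power[of c "k - 1"]
  by (cases k) (auto simp: mult.commute)

lemma int_ideal_eq_OL: "int_ideal I \<Longrightarrow> I = OL \<longleftrightarrow> 1 \<in> I"
  using fracD(4)[of I _ 1] unfolding int_ideal_def by auto

lemma finite_ideals_above:
  assumes "a \<in> OL" "a \<noteq> 0"
  shows "finite {I. int_ideal I \<and> a \<in> I}"
proof -
  obtain T where T: "finite T" "T \<subseteq> OL" "\<forall>x\<in>OL. \<exists>t\<in>T. \<exists>y\<in>OL. x = t + a * y"
    using finite_residues_nonzero[OF assms] unfolding finite_residues_def by blast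
  have sub: "I \<subseteq> J" if I: "int_ideal I" "a \<in> I" and J: "int_ideal J" "a \<in> J" and eq: "I \<inter> T = J \<inter> T" for I J
  proof
    fix x assume x: "x \<in> I"
    then obtain t y where t: "t \<in> T" "y \<in> OL" "x = t + a * y" using T I unfolding int_ideal_def by blast
    have "t = x - y * a" using t by simp
    hence "t \<in> I" using frac_diff[of I x "y * a"] x fracD(4)[of I y a] t I unfolding int_ideal_def by auto
    hence "t \<in> J" using t eq by blast
    thus "x \<in> J" using t fracD(3)[of J t "y * a"] fracD(4)[of J y a] J unfolding int_ideal_def
      by (auto simp: mult.commute)
  qed
  have "inj_on (\<lambda>I. I \<inter> T) {I. int_ideal I \<and> a \<in> I}"
  proof (rule inj_onI)
    fix I J assume *: "I \<in> {I. int_ideal I \<and> a \<in> I}" "J \<in> {I. int_ideal I \<and> a \<in> I}" "I \<inter> T = J \<inter> T"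
    show "I = J" using sub[of I J] sub[of J I] * by auto
  qed
  thus ?thesis by (rule inj_on_finite[of _ _ "Pow T"]) (use T in auto)
qed

lemma cring_OL: "cring (ring_on OL)"
proof -
  interpret R: field "ring_of_type_algebra :: 'a ring" by (rule field_from_type_algebra)
  have um: "\<ominus>\<^bsub>ring_of_type_algebra\<^esub> x = - x" for x :: 'a
    by (rule R.minus_equality) auto
  have "subring OL ring_of_type_algebra" by (rule R.subringI) (auto simp: um)
  hence "subcring OL ring_of_type_algebra" by (intro R.subcringI) (auto simp: mult.commute)
  thus ?thesis using R.subcring_iff[of OL] by simp
qed

lemma primes_of_iff:
  "P \<in> primes_of L \<longleftrightarrow> int_ideal P \<and> P \<noteq> OL \<and> (\<forall>a\<in>OL. \<forall>b\<in>OL. a * b \<in> P \<longrightarrow> a \<in> P \<or> b \<in> P)"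
proof
  interpret R: cring "ring_on OL" by (rule cring_OL)
  assume P: "P \<in> primes_of L"
  then interpret primeideal P "ring_on OL" unfolding primes_of_def by auto
  have sub: "P \<subseteq> OL" using a_subset by simp
  have z: "0 \<in> P" using additive_subgroup.zero_closed[OF additive_subgroup_axioms] by simp
  have "P \<noteq> {0}" using P unfolding primes_of_def by auto
  then obtain x0 where x0: "x0 \<in> P" "x0 \<noteq> 0" using z by blast
  have "int_ideal P"
  proof (rule int_idealI[OF sub z x0])
    show "x + y \<in> P" if "x \<in> P" "y \<in> P" for x y using a_closed[OF that] by simp
    show "a * x \<in> P" if "a \<in> OL" "x \<in> P" for a x using I_l_closed[of x a] that by simp
  qed
  moreover have "P \<noteq> OL" using I_notcarr by simp
  moreover have "\<forall>a\<in>OL. \<forall>b\<in>OL. a * b \<in> P \<longrightarrow> a \<in> P \<or> b \<in> P" using I_prime by simp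
  ultimately show "int_ideal P \<and> P \<noteq> OL \<and> (\<forall>a\<in>OL. \<forall>b\<in>OL. a * b \<in> P \<longrightarrow> a \<in> P \<or> b \<in> P)" by blast
next
  interpret R: cring "ring_on OL" by (rule cring_OL)
  assume P: "int_ideal P \<and> P \<noteq> OL \<and> (\<forall>a\<in>OL. \<forall>b\<in>OL. a * b \<in> P \<longrightarrow> a \<in> P \<or> b \<in> P)"
  hence fr: "frac P" "P \<subseteq> OL" unfolding int_ideal_def by auto
  have um: "\<ominus>\<^bsub>ring_on OL\<^esub> x = - x" if "x \<in> OL" for x
    by (rule R.minus_equality) (use that in auto)
  have "ideal P (ring_on OL)"
  proof (rule idealI)
    show "ring (ring_on OL)" by (rule R.ring_axioms)
    show "subgroup P (add_monoid (ring_on OL))"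
    proof (rule R.add.subgroupI)
      show "P \<noteq> {}" using fracD(2)[OF fr(1)] by blast
      show "\<ominus>\<^bsub>ring_on OL\<^esub> x \<in> P" if "x \<in> P" for x
        using um[of x] subsetD[OF fr(2) that] frac_uminus[OF fr(1) that] by simp
      show "x \<oplus>\<^bsub>ring_on OL\<^esub> y \<in> P" if "x \<in> P" "y \<in> P" for x y
        using fracD(3)[OF fr(1) that] by simp
      show "P \<subseteq> carrier (ring_on OL)" using fr(2) by simp
    qed
    show "x \<otimes>\<^bsub>ring_on OL\<^esub> a \<in> P" "a \<otimes>\<^bsub>ring_on OL\<^esub> x \<in> P" if "a \<in> P" "x \<in> carrier (ring_on OL)" for a x
      using fracD(4)[OF fr(1), of x a] that by (simp_all add: mult.commute)
  qed
  hence "primeideal P (ring_on OL)"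
  proof (rule primeidealI[OF _ R.cring_axioms])
    show "carrier (ring_on OL) \<noteq> P" using P by auto
    show "a \<in> P \<or> b \<in> P" if "a \<in> carrier (ring_on OL)" "b \<in> carrier (ring_on OL)"
      "a \<otimes>\<^bsub>ring_on OL\<^esub> b \<in> P" for a b
    proof -
      have "a \<in> OL" "b \<in> OL" "a * b \<in> P" using that by simp_all
      thus ?thesis using P by blast
    qed
  qed
  moreover have "P \<noteq> {0}" using fracD(5)[OF fr(1)] by blast
  ultimately show "P \<in> primes_of L" unfolding primes_of_def by blast
qed

lemma primeD:
  assumes "P \<in> primes_of L"
  shows "int_ideal P" "frac P" "P \<subseteq> OL" "1 \<notin> P"
    "a \<in> OL \<Longrightarrow> b \<in> OL \<Longrightarrow> a * b \<in> P \<Longrightarrow> a \<in> P \<or> b \<in> P"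
proof -
  have 1: "int_ideal P" "P \<noteq> OL" and 2: "\<forall>a\<in>OL. \<forall>b\<in>OL. a * b \<in> P \<longrightarrow> a \<in> P \<or> b \<in> P"
    using assms unfolding primes_of_iff by blast+
  show "int_ideal P" by (rule 1)
  show "frac P" "P \<subseteq> OL" using int_idealD[OF 1(1)] by blast+
  show "1 \<notin> P" using int_ideal_eq_OL[OF 1(1)] 1(2) by blast
  show "a \<in> OL \<Longrightarrow> b \<in> OL \<Longrightarrow> a * b \<in> P \<Longrightarrow> a \<in> P \<or> b \<in> P" using 2 by blast
qed

lemma prime_power_mem:
  assumes "P \<in> primes_of L" "a \<in> OL" "a ^ n \<in> P" shows "a \<in> P"
  using assms(3)
proof (induction n)
  case 0 thus ?case using primeD(4)[OF assms(1)] by simp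
next
  case (Suc n)
  thus ?case using primeD(5)[OF assms(1), of a "a ^ n"] assms(2) by auto
qed

lemma power_relation:
  assumes "a \<in> OL" "a \<noteq> 0" "c \<in> OL"
  obtains i k y where "k > 0" "y \<in> OL" "c ^ i * (1 - c ^ k) = a * y"
proof -
  obtain i j y where ij: "i < j" "y \<in> OL" "c ^ j - c ^ i = a * y"
    using residues_pigeonhole[OF assms(1,2), of "\<lambda>n. c ^ n"] assms(3) OL_power by blast
  have "c ^ i * (1 - c ^ (j - i)) = c ^ i - c ^ j"
    using ij(1) by (simp add: algebra_simps power_add[symmetric])
  also have "\<dots> = a * (- y)" using ij(3) by (simp add: algebra_simps)
  finally show thesis using that[of "j - i" "- y" i] ij by auto
qed

lemma prime_maximal:
  assumes P: "P \<in> primes_of L" and I: "int_ideal I" "P \<subseteq> I" "I \<noteq> P"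
  shows "I = OL"
proof -
  note PD = primeD[OF P]
  obtain a where a: "a \<in> P" "a \<noteq> 0" using fracD(5)[OF PD(2)] by blast
  obtain c where c: "c \<in> I" "c \<notin> P" using I by blast
  have cO: "c \<in> OL" using c(1) I(1) unfolding int_ideal_def by blast
  have aO: "a \<in> OL" using a(1) PD(3) by blast
  obtain i k y where k: "k > 0" "y \<in> OL" "c ^ i * (1 - c ^ k) = a * y"
    by (rule power_relation[OF aO a(2) cO])
  have "c ^ i * (1 - c ^ k) \<in> P"
    unfolding k(3) using fracD(4)[OF PD(2) k(2) a(1)] by (simp add: mult.commute)
  moreover have "c ^ i \<notin> P" using prime_power_mem[OF P cO] c(2) by blast
  ultimately have "1 - c ^ k \<in> P" using PD(5)[of "c ^ i" "1 - c ^ k"] cO by auto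
  hence "1 - c ^ k \<in> I" using I by blast
  moreover have "c ^ k \<in> I"
    using int_ideal_power[OF I(1) c(1) k(1)] .
  ultimately have "1 \<in> I" using fracD(3)[OF int_idealD(1)[OF I(1)], of "1 - c ^ k" "c ^ k"] by simp
  thus ?thesis using int_ideal_eq_OL[OF I(1)] by simp
qed

text \<open>Among the colon ideals \<open>(a : b)\<close> contained in \<open>P\<close> a maximal one equals \<open>P\<close>.\<close>

lemma prime_annihilator:
  assumes P: "P \<in> primes_of L" and a: "a \<in> P" "a \<noteq> 0"
  obtains b where "b \<in> OL" "b \<notin> pideal a" "\<And>p. p \<in> P \<Longrightarrow> p * b \<in> pideal a"
proof -
  note PD = primeD[OF P]
  have aO: "a \<in> OL" using a(1) PD(3) by blast
  note fa = int_idealD(1)[OF int_ideal_pideal[OF aO a(2)]]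
  define C where "C b = {c \<in> OL. c * b \<in> pideal a}" for b
  have aC: "pideal a \<subseteq> C b" if "b \<in> OL" for b
    using that aO by (auto simp: C_def pideal_iff) (metis OL_mult mult.assoc)
  have C_ideal: "int_ideal (C b)" if b: "b \<in> OL" for b
  proof (rule int_idealI[of _ a])
    show "0 \<in> C b" using fracD(2)[OF fa] by (simp add: C_def)
    show "a \<in> C b" using aC[OF b] pideal_memI(2) by blast
    show "x + y \<in> C b" if "x \<in> C b" "y \<in> C b" for x y
      using that fracD(3)[OF fa] by (simp add: C_def distrib_right)
    show "u * x \<in> C b" if "u \<in> OL" "x \<in> C b" for u x
      using that fracD(4)[OF fa] by (simp add: C_def mult.assoc)
  qed (use a in \<open>auto simp: C_def\<close>)
  have a_C: "a \<in> C b" if "b \<in> OL" for b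
    using aC[OF that] pideal_memI(2) by blast
  define S where "S = {C b | b. b \<in> OL \<and> C b \<subseteq> P}"
  have "S \<subseteq> {I. int_ideal I \<and> a \<in> I}" using C_ideal a_C unfolding S_def by auto
  hence "finite S" using finite_ideals_above[OF aO a(2)] finite_subset by blast
  moreover have "C 1 \<subseteq> P"
    using fracD(4)[OF PD(2) _ a(1)] by (auto simp: C_def pideal_iff mult.commute[of a])
  hence "C 1 \<in> S" unfolding S_def by auto
  ultimately obtain m where m: "m \<in> S" "\<And>Y. Y \<in> S \<Longrightarrow> m \<subseteq> Y \<Longrightarrow> m = Y"
    using finite_has_maximal[of S] by blast
  then obtain b where b: "b \<in> OL" "C b \<subseteq> P" "m = C b" unfolding S_def by auto
  have max: "C b' = C b" if "b' \<in> OL" "C b' \<subseteq> P" "C b \<subseteq> C b'" for b'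
    using m(2)[of "C b'"] that b(3) unfolding S_def by auto
  have mult_sub: "C b \<subseteq> C (s * b)" if "s \<in> OL" for s
  proof
    fix x assume "x \<in> C b"
    thus "x \<in> C (s * b)" using fracD(4)[OF fa that, of "x * b"] by (simp add: C_def mult_ac)
  qed
  have cancel: "x \<in> C b" if s: "s \<in> OL" "s \<notin> P" and x: "x \<in> OL" "x * s \<in> C b" for s x
  proof -
    have "C (s * b) \<subseteq> P"
    proof
      fix t assume t: "t \<in> C (s * b)"
      hence "t * s \<in> C b" using s by (auto simp: C_def mult.assoc)
      hence "t * s \<in> P" using b by blast
      thus "t \<in> P" using PD(5)[of t s] s t by (auto simp: C_def)
    qed
    hence "C (s * b) = C b" using max[of "s * b"] mult_sub s b by auto
    moreover have "x \<in> C (s * b)" using x by (auto simp: C_def mult.assoc)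
    ultimately show ?thesis by simp
  qed
  have "P \<subseteq> C b"
  proof (rule ccontr)
    assume "\<not> P \<subseteq> C b"
    then obtain c where c: "c \<in> P" "c \<notin> C b" by blast
    have cO: "c \<in> OL" using c(1) PD(3) by blast
    obtain i k y where k: "k > 0" "y \<in> OL" "c ^ i * (1 - c ^ k) = a * y"
      by (rule power_relation[OF aO a(2) cO])
    have ck: "c ^ k \<in> P"
      using int_ideal_power[OF PD(1) c(1) k(1)] .
    have s: "1 - c ^ k \<notin> P"
      using fracD(3)[OF PD(2), of "1 - c ^ k" "c ^ k"] ck PD(4) by auto
    have "a * y \<in> C b" using aC[OF b(1)] pideal_memI(1)[OF k(2)] by blast
    hence ex: "c ^ i \<in> C b" using cancel[of "1 - c ^ k" "c ^ i"] s cO k(3) by auto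
    define i0 where "i0 = (LEAST i. c ^ i \<in> C b)"
    have i0: "c ^ i0 \<in> C b" unfolding i0_def using ex by (rule LeastI)
    have less: "c ^ j \<notin> C b" if "j < i0" for j using that not_less_Least unfolding i0_def by blast
    have "i0 \<noteq> 0" using i0 b(2) PD(4) by (cases "i0 = 0") auto
    then obtain j where j: "i0 = Suc j" using not0_implies_Suc by blast
    have sub: "C b \<subseteq> C (c ^ j * b)" using mult_sub cO by simp
    have "c * (c ^ j * b) \<in> pideal a" using i0 j by (simp add: C_def mult.assoc)
    hence cC: "c \<in> C (c ^ j * b)" using cO by (simp add: C_def)
    show False
    proof (cases "C (c ^ j * b) \<subseteq> P")
      case True
      hence "C (c ^ j * b) = C b" using max[of "c ^ j * b"] sub cO b by auto
      thus False using cC c by simp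
    next
      case False
      then obtain s where s: "s \<in> C (c ^ j * b)" "s \<notin> P" by blast
      hence "c ^ j * s \<in> C b" using cO by (simp add: C_def mult_ac)
      hence "c ^ j \<in> C b" using cancel[of s "c ^ j"] s cO by (simp add: C_def)
      thus False using less[of j] j by simp
    qed
  qed
  moreover have "b \<notin> pideal a"
  proof
    assume "b \<in> pideal a"
    hence "1 \<in> C b" by (simp add: C_def)
    thus False using PD(4) b(2) by blast
  qed
  ultimately show thesis using that[of b] b(1) unfolding C_def by blast
qed

definition linv :: "'a set \<Rightarrow> 'a set" where
  "linv I = {x \<in> L. \<forall>a\<in>I. x * a \<in> OL}"

lemma linv_frac:
  assumes "int_ideal I" shows "frac (linv I)" "1 \<in> linv I"
proof -
  have I: "frac I" "I \<subseteq> OL" using assms unfolding int_ideal_def by auto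
  obtain a where a: "a \<in> I" "a \<noteq> 0" using fracD(5)[OF I(1)] by blast
  show one: "1 \<in> linv I" using I by (auto simp: linv_def)
  show "frac (linv I)"
  proof (rule fracI[of _ 1 a])
    show "a * x \<in> OL" if "x \<in> linv I" for x using that a by (auto simp: linv_def mult.commute)
    show "u * x \<in> linv I" if "u \<in> OL" "x \<in> linv I" for u x
      using that by (auto simp: linv_def mult.assoc)
  qed (use one a I in \<open>auto simp: linv_def distrib_right\<close>)
qed

lemma ideal_multiplier_integral:
  assumes "int_ideal I" "x \<in> L" "\<And>i. i \<in> I \<Longrightarrow> x * i \<in> I"
  shows "x \<in> OL"
proof -
  have I: "frac I" "I \<subseteq> OL" using assms unfolding int_ideal_def by auto
  obtain a where a: "a \<in> I" "a \<noteq> 0" using fracD(5)[OF I(1)] by blast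
  have pw: "x ^ n * a \<in> I" for n
  proof (induction n)
    case (Suc n)
    thus ?case using assms(3)[OF Suc] by (simp add: mult.assoc)
  qed (use a(1) in simp)
  show ?thesis
  proof (rule integral_if_powers_bounded[OF assms(2) _ a(2)])
    show "a \<in> L" using a(1) I(2) OL_subset_L by blast
    show "x ^ n * a \<in> OL" for n using pw[of n] I(2) by blast
  qed
qed

lemma linv_prime_proper:
  assumes "P \<in> primes_of L" obtains x where "x \<in> linv P" "x \<notin> OL"
proof -
  note PD = primeD[OF assms]
  obtain a where a: "a \<in> P" "a \<noteq> 0" using fracD(5)[OF PD(2)] by blast
  obtain b where b: "b \<in> OL" "b \<notin> pideal a" "\<And>p. p \<in> P \<Longrightarrow> p * b \<in> pideal a"
    using prime_annihilator[OF assms a] by blast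
  have aO: "a \<in> OL" using a PD by blast
  have "b / a * p \<in> OL" if "p \<in> P" for p
    using b(3)[OF that] a(2) by (auto simp: pideal_iff mult.commute)
  hence "b / a \<in> linv P" using b(1) aO by (auto simp: linv_def)
  moreover have "b / a \<notin> OL"
  proof
    assume "b / a \<in> OL"
    moreover have "b = a * (b / a)" using a by simp
    ultimately show False using b(2) unfolding pideal_iff by blast
  qed
  ultimately show thesis using that by blast
qed

lemma prime_linv:
  assumes P: "P \<in> primes_of L" shows "P \<star> linv P = OL"
proof (rule ccontr)
  note PD = primeD[OF P]
  note lf = linv_frac[OF PD(1)]
  assume ne: "P \<star> linv P \<noteq> OL"
  have "P \<star> linv P \<subseteq> OL"
    by (rule ideal_prod_least) (auto simp: linv_def mult.commute)
  hence int: "int_ideal (P \<star> linv P)" using PD lf unfolding int_ideal_def by auto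
  have "P \<subseteq> P \<star> linv P" using ideal_prod_mem[OF _ lf(2), of _ P] by auto
  hence eq: "P \<star> linv P = P" using prime_maximal[OF P int] ne by blast
  obtain x where x: "x \<in> linv P" "x \<notin> OL" using linv_prime_proper[OF P] by blast
  have "x * p \<in> P" if "p \<in> P" for p
    using ideal_prod_mem[OF that x(1)] eq by (simp add: mult.commute)
  hence "x \<in> OL" using ideal_multiplier_integral[OF PD(1)] x(1) by (auto simp: linv_def)
  thus False using x by blast
qed

lemma exists_prime_above:
  assumes I: "int_ideal I" "I \<noteq> OL" obtains P where "P \<in> primes_of L" "I \<subseteq> P"
proof -
  note fI = int_idealD[OF I(1)]
  obtain a where a: "a \<in> I" "a \<noteq> 0" using fracD(5)[OF fI(1)] by blast
  have aO: "a \<in> OL" using a fI by blast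
  define S where "S = {J. int_ideal J \<and> I \<subseteq> J \<and> J \<noteq> OL}"
  have "S \<subseteq> {J. int_ideal J \<and> a \<in> J}" unfolding S_def using a by blast
  hence "finite S" using finite_ideals_above[OF aO a(2)] finite_subset by blast
  moreover have "I \<in> S" unfolding S_def using I by simp
  ultimately obtain P where P: "P \<in> S" "\<And>Y. Y \<in> S \<Longrightarrow> P \<subseteq> Y \<Longrightarrow> P = Y"
    using finite_has_maximal[of S] by blast
  hence PD: "int_ideal P" "frac P" "P \<subseteq> OL" "I \<subseteq> P" "P \<noteq> OL" unfolding S_def int_ideal_def by auto
  have "u \<in> P \<or> v \<in> P" if uv: "u \<in> OL" "v \<in> OL" "u * v \<in> P" for u v
  proof (rule ccontr)
    assume nm: "\<not> (u \<in> P \<or> v \<in> P)"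
    define J where "J = {p + u * y | p y. p \<in> P \<and> y \<in> OL}"
    have JI: "p + u * y \<in> J" if "p \<in> P" "y \<in> OL" for p y unfolding J_def using that by blast
    have PJ: "P \<subseteq> J" using JI[of _ 0] by auto
    have "int_ideal J"
    proof (rule int_idealI[of _ a])
      show "J \<subseteq> OL" unfolding J_def using PD(3) uv by auto
      show "0 \<in> J" "a \<in> J" using PJ fracD(2)[OF PD(2)] a PD(4) by auto
      show "x + y \<in> J" if xy: "x \<in> J" "y \<in> J" for x y
      proof -
        obtain p y1 q y2 where "x = p + u * y1" "y = q + u * y2" "p \<in> P" "q \<in> P" "y1 \<in> OL" "y2 \<in> OL"
          using xy unfolding J_def by blast
        thus ?thesis using JI[of "p + q" "y1 + y2"] fracD(3)[OF PD(2)] by (simp add: algebra_simps)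
      qed
      show "c * x \<in> J" if cx: "c \<in> OL" "x \<in> J" for c x
      proof -
        obtain p y1 where "x = p + u * y1" "p \<in> P" "y1 \<in> OL"
          using cx unfolding J_def by blast
        thus ?thesis using JI[of "c * p" "c * y1"] fracD(4)[OF PD(2)] cx by (simp add: algebra_simps)
      qed
    qed (use a in auto)
    moreover have "u \<in> J" using JI[of 0 1] fracD(2)[OF PD(2)] by simp
    ultimately have "J = OL" using P(2)[of J] PJ PD(4) nm unfolding S_def by blast
    hence "1 \<in> J" by simp
    then obtain p y where py: "1 = p + u * y" "p \<in> P" "y \<in> OL" unfolding J_def by blast
    have "v = v * p + y * (u * v)" using arg_cong[OF py(1), of "\<lambda>z. v * z"] by (simp add: algebra_simps)
    moreover have "v * p + y * (u * v) \<in> P"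
      using fracD(3)[OF PD(2) fracD(4)[OF PD(2) uv(2) py(2)] fracD(4)[OF PD(2) py(3) uv(3)]] .
    ultimately show False using nm by simp
  qed
  hence "P \<in> primes_of L" using PD unfolding primes_of_iff by blast
  thus thesis using that PD by blast
qed

lemma int_ideal_induct [consumes 1, case_names OL mult]:
  assumes "int_ideal I" and "Q OL"
    and "\<And>P I. P \<in> primes_of L \<Longrightarrow> int_ideal I \<Longrightarrow> Q I \<Longrightarrow> Q (P \<star> I)"
  shows "Q I"
  using assms(1)
proof (induction "card {J. int_ideal J \<and> I \<subseteq> J}" arbitrary: I rule: less_induct)
  case less
  show ?case
  proof (cases "I = OL")
    case False
    then obtain P where P: "P \<in> primes_of L" "I \<subseteq> P" using exists_prime_above less.prems by blast
    note PD = primeD[OF P(1)] and fI = int_idealD[OF less.prems]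
    note lf = linv_frac[OF PD(1)]
    obtain a where a: "a \<in> I" "a \<noteq> 0" using fracD(5)[OF fI(1)] by blast
    have aO: "a \<in> OL" using a fI by blast
    define J where "J = linv P \<star> I"
    have "J \<subseteq> OL" unfolding J_def using P(2) by (intro ideal_prod_least) (auto simp: linv_def)
    hence J: "int_ideal J" using lf fI unfolding int_ideal_def J_def by simp
    have IJ: "I \<subseteq> J" unfolding J_def using ideal_prod_mem[OF lf(2), of _ I] by auto
    have "I \<noteq> J"
    proof
      assume eq: "I = J"
      obtain x where x: "x \<in> linv P" "x \<notin> OL" using linv_prime_proper[OF P(1)] by blast
      have "x * i \<in> I" if "i \<in> I" for i
        using ideal_prod_mem[OF x(1) that] eq unfolding J_def by simp
      hence "x \<in> OL" using ideal_multiplier_integral[OF less.prems] x(1) by (auto simp: linv_def)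
      thus False using x by blast
    qed
    have "finite {J. int_ideal J \<and> I \<subseteq> J}"
      by (rule finite_subset[OF _ finite_ideals_above[OF aO a(2)]]) (use a in auto)
    moreover have "{J'. int_ideal J' \<and> J \<subseteq> J'} \<subset> {J. int_ideal J \<and> I \<subseteq> J}"
      using IJ \<open>I \<noteq> J\<close> less.prems by blast
    ultimately have "card {J'. int_ideal J' \<and> J \<subseteq> J'} < card {J. int_ideal J \<and> I \<subseteq> J}"
      by (rule psubset_card_mono)
    hence "Q J" using less.hyps J by blast
    moreover have "P \<star> J = I"
      unfolding J_def ideal_prod_assoc[symmetric] prime_linv[OF P(1)] using fI by simp
    ultimately show ?thesis using assms(3)[OF P(1) J] by simp
  next
    case True
    thus ?thesis using assms(2) by simp
  qed
qed

lemma frac_decompose: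
  assumes "frac J" obtains d where "d \<in> OL" "d \<noteq> 0" "int_ideal (pideal d \<star> J)"
proof -
  obtain d where d: "d \<in> OL" "d \<noteq> 0" "\<forall>x\<in>J. d * x \<in> OL" using fracD(6)[OF assms] by blast
  have "pideal d \<star> J \<subseteq> OL"
  proof
    fix x assume "x \<in> pideal d \<star> J"
    then obtain a where "a \<in> J" "x = d * a" unfolding pideal_prod[OF assms] by (rule imageE)
    thus "x \<in> OL" using d(3) by blast
  qed
  moreover have "frac (pideal d \<star> J)" using d(1,2) assms by simp
  ultimately show thesis using that[OF d(1,2)] unfolding int_ideal_def by blast
qed

lemma frac_invertible:
  assumes "frac J" obtains J' where "frac J'" "J' \<star> J = OL"
proof -
  have *: "\<exists>J. frac J \<and> J \<star> I = OL" if "int_ideal I" for I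
    using that
  proof (induction rule: int_ideal_induct)
    case OL thus ?case using frac_OL by (intro exI[of _ OL]) simp
  next
    case (mult P I)
    then obtain J where J: "frac J" "J \<star> I = OL" by blast
    note lf = linv_frac[OF primeD(1)[OF mult(1)]]
    have "(J \<star> linv P) \<star> (P \<star> I) = (P \<star> linv P) \<star> (J \<star> I)"
      by (simp only: ideal_prod_ac)
    also have "\<dots> = OL" using J prime_linv[OF mult(1)] by simp
    finally show ?case using J lf by (intro exI[of _ "J \<star> linv P"]) auto
  qed
  obtain d where d: "d \<in> OL" "d \<noteq> 0" "int_ideal (pideal d \<star> J)"
    using frac_decompose[OF assms] by blast
  then obtain H where "frac H" "H \<star> (pideal d \<star> J) = OL" using * by blast
  thus thesis using that[of "H \<star> pideal d"] d by (simp add: ideal_prod_assoc)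
qed

lemma ideal_group_simps [simp]:
  "carrier (ideal_group L) = {J. frac J}" "I \<otimes>\<^bsub>ideal_group L\<^esub> J = I \<star> J"
  "\<one>\<^bsub>ideal_group L\<^esub> = OL"
  by (auto simp only: ideal_group_def partial_object.simps monoid.simps)

lemma comm_group_ideal_group: "comm_group (ideal_group L)"
proof (rule comm_groupI)
  fix x assume "x \<in> carrier (ideal_group L)"
  hence "frac x" by simp
  then obtain y where "frac y" "y \<star> x = OL" by (rule frac_invertible)
  thus "\<exists>y\<in>carrier (ideal_group L). y \<otimes>\<^bsub>ideal_group L\<^esub> x = \<one>\<^bsub>ideal_group L\<^esub>" by auto
next
  fix x y show "x \<otimes>\<^bsub>ideal_group L\<^esub> y = y \<otimes>\<^bsub>ideal_group L\<^esub> x"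
    by (simp add: ideal_prod_commute)
qed (simp_all add: ideal_prod_assoc)

end

section \<open>Valuations\<close>

context number_ring
begin

sublocale IG: comm_group "ideal_group L"
  by (rule comm_group_ideal_group)

abbreviation iv :: "'a set \<Rightarrow> 'a set" where "iv J \<equiv> inv\<^bsub>ideal_group L\<^esub> J"
abbreviation zpow :: "'a set \<Rightarrow> int \<Rightarrow> 'a set" where "zpow J n \<equiv> J [^]\<^bsub>ideal_group L\<^esub> n"

lemma frac_iv [simp]: "frac J \<Longrightarrow> frac (iv J)"
  using IG.inv_closed[of J] by simp

lemma iv_mult [simp]: "frac J \<Longrightarrow> iv J \<star> J = OL" "frac J \<Longrightarrow> J \<star> iv J = OL"
  using IG.l_inv[of J] IG.r_inv[of J] by simp_all

lemma frac_zpow [simp]: "frac J \<Longrightarrow> frac (zpow J n)"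
  using IG.int_pow_closed[of J n] by simp

lemma zpow_add: "frac J \<Longrightarrow> zpow J (m + n) = zpow J m \<star> zpow J n"
  using IG.int_pow_mult[of J m n] by simp

lemma ideal_cancel:
  assumes "frac I" "frac J" "frac H" "I \<star> J = I \<star> H" shows "J = H"
  using IG.l_cancel[of I J H] assms by simp

lemma int_ideal_npow [simp]: "int_ideal I \<Longrightarrow> int_ideal (I [^]\<^bsub>ideal_group L\<^esub> (n::nat))"
  by (induction n) simp_all

lemma int_ideal_zpow: "int_ideal I \<Longrightarrow> n \<ge> 0 \<Longrightarrow> int_ideal (zpow I n)"
  using int_ideal_npow[of I "nat n"] int_pow_int[of "ideal_group L" I "nat n"] by simp

lemma zpow_anti:
  assumes "int_ideal I" "m \<le> n" shows "zpow I n \<subseteq> zpow I m"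
proof -
  have "zpow I n = zpow I (n - m) \<star> zpow I m"
    using zpow_add[of I "n - m" m] assms int_idealD by simp
  thus ?thesis
    using int_ideal_mult_subset[OF int_ideal_zpow[OF assms(1), of "n - m"], of "zpow I m"] assms int_idealD
    by simp
qed

lemma power_mem_npow: "int_ideal I \<Longrightarrow> x \<in> I \<Longrightarrow> x ^ n \<in> I [^]\<^bsub>ideal_group L\<^esub> (n::nat)"
  by (induction n) (simp_all add: ideal_prod_mem, subst mult.commute, simp add: ideal_prod_mem)

lemma frac_divide:
  assumes "frac I" "frac J" shows "I \<star> (iv I \<star> J) = J"
  using assms by (simp add: ideal_prod_assoc[symmetric])

lemma frac_subset_divide:
  assumes "frac I" "frac J" "J \<subseteq> I" shows "int_ideal (iv I \<star> J)"
proof -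
  have "iv I \<star> J \<subseteq> iv I \<star> I" using assms(3) by (intro ideal_prod_mono) auto
  thus ?thesis unfolding int_ideal_def using assms by simp
qed

definition coprime_to :: "'a set \<Rightarrow> 'a set \<Rightarrow> bool" where
  "coprime_to P A \<longleftrightarrow> int_ideal A \<and> \<not> A \<subseteq> P"

lemma coprime_to_mult:
  assumes "P \<in> primes_of L" "coprime_to P A" "coprime_to P B"
  shows "coprime_to P (A \<star> B)"
proof -
  obtain a b where ab: "a \<in> A" "a \<notin> P" "b \<in> B" "b \<notin> P" using assms unfolding coprime_to_def by blast
  have "a \<in> OL" "b \<in> OL" using ab assms int_idealD unfolding coprime_to_def by blast+
  hence "a * b \<notin> P" using primeD(5)[OF assms(1)] ab by blast
  moreover have "a * b \<in> A \<star> B" using ab by (intro ideal_prod_mem)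
  ultimately show ?thesis using assms unfolding coprime_to_def by auto
qed

lemma coprime_to_OL: "P \<in> primes_of L \<Longrightarrow> coprime_to P OL"
  using primeD[of P] unfolding coprime_to_def by auto

lemma coprime_to_prime:
  assumes "P \<in> primes_of L" "Q \<in> primes_of L" "Q \<noteq> P" shows "coprime_to P Q"
proof -
  have "\<not> Q \<subseteq> P"
    using prime_maximal[OF assms(2) primeD(1)[OF assms(1)]] assms(3) primes_of_iff assms(1) by auto
  thus ?thesis using primeD(1)[OF assms(2)] unfolding coprime_to_def by simp
qed

definition has_ord :: "'a set \<Rightarrow> 'a set \<Rightarrow> int \<Rightarrow> bool" where
  "has_ord P J n \<longleftrightarrow> (\<exists>A B. coprime_to P A \<and> coprime_to P B \<and> J \<star> B = zpow P n \<star> A)"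

lemma coprime_toD: "coprime_to P A \<Longrightarrow> frac A" "coprime_to P A \<Longrightarrow> int_ideal A"
  unfolding coprime_to_def int_ideal_def by auto

lemma has_ord_mult:
  assumes P: "P \<in> primes_of L" and "has_ord P J n" "has_ord P J' m"
  shows "has_ord P (J \<star> J') (n + m)"
proof -
  obtain A B A' B' where AB: "coprime_to P A" "coprime_to P B" "J \<star> B = zpow P n \<star> A"
    "coprime_to P A'" "coprime_to P B'" "J' \<star> B' = zpow P m \<star> A'"
    using assms unfolding has_ord_def by blast
  have "(J \<star> J') \<star> (B \<star> B') = (J \<star> B) \<star> (J' \<star> B')"
    by (simp only: ideal_prod_ac)
  also have "\<dots> = (zpow P n \<star> zpow P m) \<star> (A \<star> A')"
    unfolding AB(3,6) by (simp only: ideal_prod_ac)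
  also have "zpow P n \<star> zpow P m = zpow P (n + m)" using zpow_add primeD(2)[OF P] by simp
  finally show ?thesis
    unfolding has_ord_def using coprime_to_mult[OF P AB(1,4)] coprime_to_mult[OF P AB(2,5)] by blast
qed

lemma has_ord_le:
  assumes P: "P \<in> primes_of L" and J: "frac J" and "has_ord P J n" "has_ord P J m"
  shows "m \<le> n"
proof (rule ccontr)
  assume nm: "\<not> m \<le> n"
  obtain A B A' B' where AB: "coprime_to P A" "coprime_to P B" "J \<star> B = zpow P n \<star> A"
    "coprime_to P A'" "coprime_to P B'" "J \<star> B' = zpow P m \<star> A'"
    using assms unfolding has_ord_def by blast
  note fr = AB(1,2,4,5)[THEN coprime_toD(1)] primeD(2)[OF P]
  have "zpow P n \<star> (A \<star> B') = (J \<star> B) \<star> B'" by (simp add: AB ideal_prod_assoc)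
  also have "\<dots> = (J \<star> B') \<star> B" by (simp only: ideal_prod_ac)
  also have "\<dots> = zpow P m \<star> (A' \<star> B)" by (simp add: AB ideal_prod_assoc)
  also have "zpow P m = zpow P n \<star> zpow P (m - n)" using zpow_add[of P n "m - n"] fr by simp
  finally have "A \<star> B' = zpow P (m - n) \<star> (A' \<star> B)"
    using fr ideal_cancel[of "zpow P n" "A \<star> B'" "zpow P (m - n) \<star> (A' \<star> B)"]
    by (simp add: ideal_prod_assoc)
  also have "\<dots> = P \<star> (zpow P (m - n - 1) \<star> (A' \<star> B))"
    using zpow_add[of P 1 "m - n - 1"] fr by (simp add: ideal_prod_assoc)
  also have "\<dots> \<subseteq> P"
  proof -
    have "int_ideal (zpow P (m - n - 1) \<star> (A' \<star> B))"
      using nm AB coprime_toD(2) primeD(1)[OF P] by (intro int_ideal_mult int_ideal_zpow) auto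
    from int_ideal_mult_subset[OF this fr(5)] show ?thesis by (simp only: ideal_prod_commute)
  qed
  finally show False using coprime_to_mult[OF P AB(1,5)] unfolding coprime_to_def by blast
qed

lemma has_ord_coprime: "P \<in> primes_of L \<Longrightarrow> coprime_to P A \<Longrightarrow> has_ord P A 0"
  unfolding has_ord_def using coprime_to_OL[of P] coprime_toD(1)[of P A]
  by (intro exI[of _ A] exI[of _ OL]) simp

lemma has_ord_self: "P \<in> primes_of L \<Longrightarrow> has_ord P P 1"
  unfolding has_ord_def using coprime_to_OL[of P] primeD(2)[of P]
  by (intro exI[of _ OL]) simp

lemma has_ord_int:
  assumes P: "P \<in> primes_of L" and "int_ideal I"
  shows "\<exists>n\<ge>0. has_ord P I n"
  using assms(2)
proof (induction rule: int_ideal_induct)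
  case OL
  show ?case using has_ord_coprime[OF P coprime_to_OL[OF P]] by blast
next
  case (mult Q I)
  then obtain n where n: "n \<ge> 0" "has_ord P I n" by blast
  have "\<exists>m\<ge>0. has_ord P Q m"
  proof (cases "Q = P")
    case True
    have "(1::int) \<ge> 0" by simp
    thus ?thesis using has_ord_self[OF P] True by blast
  next
    case False
    thus ?thesis using has_ord_coprime[OF P coprime_to_prime[OF P mult(1)]] by blast
  qed
  then obtain m where "m \<ge> 0" "has_ord P Q m" by blast
  thus ?case using has_ord_mult[OF P, of Q m I n] n by (intro exI[of _ "m + n"]) auto
qed

lemma has_ord_iv:
  assumes P: "P \<in> primes_of L" and J: "frac J" and "has_ord P J n"
  shows "has_ord P (iv J) (- n)"
proof -
  obtain A B where AB: "coprime_to P A" "coprime_to P B" "J \<star> B = zpow P n \<star> A"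
    using assms unfolding has_ord_def by blast
  note fr = AB(1,2)[THEN coprime_toD(1)] primeD(2)[OF P]
  have inv: "zpow P (- n) \<star> zpow P n = OL" using zpow_add[of P "- n" n] fr by simp
  have "iv J \<star> A = iv J \<star> ((zpow P (- n) \<star> zpow P n) \<star> A)" using inv fr by simp
  also have "\<dots> = iv J \<star> (zpow P (- n) \<star> (J \<star> B))" by (simp add: AB ideal_prod_assoc)
  also have "\<dots> = (iv J \<star> J) \<star> (zpow P (- n) \<star> B)" by (simp only: ideal_prod_ac)
  also have "\<dots> = zpow P (- n) \<star> B" using J fr by simp
  finally show ?thesis unfolding has_ord_def using AB by blast
qed

lemma has_ord_frac:
  assumes P: "P \<in> primes_of L" and J: "frac J" shows "\<exists>n. has_ord P J n"
proof -
  obtain d where d: "d \<in> OL" "d \<noteq> 0" "int_ideal (pideal d \<star> J)" by (rule frac_decompose[OF J])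
  obtain n where n: "has_ord P (pideal d \<star> J) n" using has_ord_int[OF P d(3)] by blast
  obtain m where m: "has_ord P (pideal d) m" using has_ord_int[OF P, of "pideal d"] d by auto
  have "frac (pideal d)" using d by simp
  hence "iv (pideal d) \<star> (pideal d \<star> J) = J" using J by (simp add: ideal_prod_assoc[symmetric])
  thus ?thesis
    using has_ord_mult[OF P has_ord_iv[OF P \<open>frac (pideal d)\<close> m] n] by metis
qed

definition vord :: "'a set \<Rightarrow> 'a set \<Rightarrow> int" where
  "vord P J = (THE n. has_ord P J n)"

lemma vord_eqI: "P \<in> primes_of L \<Longrightarrow> frac J \<Longrightarrow> has_ord P J n \<Longrightarrow> vord P J = n"
  unfolding vord_def by (rule the_equality) (auto intro: antisym has_ord_le)

lemma has_ord_vord: "P \<in> primes_of L \<Longrightarrow> frac J \<Longrightarrow> has_ord P J (vord P J)"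
  using has_ord_frac vord_eqI by metis

lemma vord_mult [simp]:
  "P \<in> primes_of L \<Longrightarrow> frac I \<Longrightarrow> frac J \<Longrightarrow> vord P (I \<star> J) = vord P I + vord P J"
  by (intro vord_eqI has_ord_mult has_ord_vord) auto

lemma vord_iv [simp]: "P \<in> primes_of L \<Longrightarrow> frac J \<Longrightarrow> vord P (iv J) = - vord P J"
  by (intro vord_eqI has_ord_iv has_ord_vord) auto

lemma vord_coprime: "P \<in> primes_of L \<Longrightarrow> coprime_to P A \<Longrightarrow> vord P A = 0"
  by (intro vord_eqI has_ord_coprime coprime_toD(1)[of P]) auto

lemma vord_OL [simp]: "P \<in> primes_of L \<Longrightarrow> vord P OL = 0"
  by (intro vord_coprime coprime_to_OL)

lemma vord_self [simp]: "P \<in> primes_of L \<Longrightarrow> vord P P = 1"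
  by (intro vord_eqI has_ord_self primeD(2))

lemma vord_other: "P \<in> primes_of L \<Longrightarrow> Q \<in> primes_of L \<Longrightarrow> Q \<noteq> P \<Longrightarrow> vord P Q = 0"
  by (intro vord_coprime coprime_to_prime)

lemma vord_int_nonneg: "P \<in> primes_of L \<Longrightarrow> int_ideal I \<Longrightarrow> 0 \<le> vord P I"
  using has_ord_int[of P I] vord_eqI[of P I] int_idealD(1)[of I] by metis

lemma vord_int_pos_iff:
  assumes "P \<in> primes_of L" "int_ideal I" shows "0 < vord P I \<longleftrightarrow> I \<subseteq> P"
proof
  assume "I \<subseteq> P"
  hence "int_ideal (iv P \<star> I)"
    using primeD(2)[OF assms(1)] int_idealD(1)[OF assms(2)] by (intro frac_subset_divide)
  hence "0 \<le> vord P (iv P \<star> I)" by (rule vord_int_nonneg[OF assms(1)])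
  thus "0 < vord P I" using primeD(2)[OF assms(1)] int_idealD(1)[OF assms(2)] assms(1) by simp
next
  assume "0 < vord P I"
  thus "I \<subseteq> P" using vord_coprime[OF assms(1), of I] assms(2) unfolding coprime_to_def by fastforce
qed

lemma vord_npow [simp]:
  "P \<in> primes_of L \<Longrightarrow> frac J \<Longrightarrow> vord P (J [^]\<^bsub>ideal_group L\<^esub> (n::nat)) = int n * vord P J"
proof (induction n)
  case (Suc n)
  have "frac (J [^]\<^bsub>ideal_group L\<^esub> n)" using IG.nat_pow_closed[of J n] Suc.prems by simp
  thus ?case using Suc by (simp add: algebra_simps)
qed simp

lemma vord_zpow [simp]: "P \<in> primes_of L \<Longrightarrow> frac J \<Longrightarrow> vord P (zpow J n) = n * vord P J"
proof (cases n rule: int_cases2)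
  case (nonneg k)
  assume "P \<in> primes_of L" "frac J"
  thus ?thesis unfolding nonneg int_pow_int by (rule vord_npow)
next
  case (nonpos k)
  assume *: "P \<in> primes_of L" "frac J"
  have "zpow J n = iv (J [^]\<^bsub>ideal_group L\<^esub> k)"
    using IG.int_pow_neg[of J "int k"] *(2) by (simp add: nonpos int_pow_int)
  thus ?thesis using * IG.nat_pow_closed[of J k] by (simp add: nonpos)
qed

lemma finite_vord_support:
  assumes "frac J" shows "finite {P \<in> primes_of L. vord P J \<noteq> 0}"
proof -
  have *: "finite {P \<in> primes_of L. vord P I \<noteq> 0}" if "int_ideal I" for I
    using that
  proof (induction rule: int_ideal_induct)
    case (mult Q I)
    have "{P \<in> primes_of L. vord P (Q \<star> I) \<noteq> 0} \<subseteq> insert Q {P \<in> primes_of L. vord P I \<noteq> 0}"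
    proof
      fix P assume P: "P \<in> {P \<in> primes_of L. vord P (Q \<star> I) \<noteq> 0}"
      hence "vord P (Q \<star> I) = vord P Q + vord P I"
        using primeD(2)[OF mult(1)] int_idealD(1)[OF mult(2)] by simp
      thus "P \<in> insert Q {P \<in> primes_of L. vord P I \<noteq> 0}"
        using P vord_other[OF _ mult(1), of P] by (cases "Q = P") auto
    qed
    thus ?case using mult(3) finite_subset by blast
  next
    case OL
    have "{P \<in> primes_of L. vord P OL \<noteq> 0} = {}" by auto
    thus ?case by (metis finite.emptyI)
  qed
  obtain d where d: "d \<in> OL" "d \<noteq> 0" "int_ideal (pideal d \<star> J)" by (rule frac_decompose[OF assms])
  have "{P \<in> primes_of L. vord P J \<noteq> 0} \<subseteq>
      {P \<in> primes_of L. vord P (pideal d \<star> J) \<noteq> 0} \<union> {P \<in> primes_of L. vord P (pideal d) \<noteq> 0}"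
    using assms d by auto
  thus ?thesis using *[OF d(3)] *[of "pideal d"] d finite_subset by auto
qed

lemma vord_le_imp_subset:
  assumes "int_ideal A" "int_ideal B" "\<And>P. P \<in> primes_of L \<Longrightarrow> vord P A \<le> vord P B"
  shows "B \<subseteq> A"
  using assms
proof (induction arbitrary: B rule: int_ideal_induct)
  case OL thus ?case using int_idealD(2) by simp
next
  case (mult Q I)
  note fr = primeD(2)[OF mult(1)] int_idealD(1)[OF mult(2)] int_idealD(1)[OF mult.prems(1)]
  have "vord Q (Q \<star> I) > 0"
    using vord_int_nonneg[OF mult(1,2)] mult(1) fr by simp
  hence "vord Q B > 0" using mult.prems(2)[OF mult(1)] by simp
  hence sub: "B \<subseteq> Q" using vord_int_pos_iff[OF mult(1) mult.prems(1)] by simp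
  define C where "C = iv Q \<star> B"
  have C: "int_ideal C" unfolding C_def using sub fr by (intro frac_subset_divide)
  have B: "B = Q \<star> C" unfolding C_def using frac_divide[OF fr(1,3)] by simp
  have "vord P I \<le> vord P C" if "P \<in> primes_of L" for P
    using mult.prems(2)[OF that] that fr int_idealD(1)[OF C] unfolding B by simp
  hence "C \<subseteq> I" using mult.IH[OF C] by blast
  thus ?case unfolding B by (intro ideal_prod_mono) auto
qed

lemma vord_nonneg_imp_subset:
  assumes "frac J" "\<And>P. P \<in> primes_of L \<Longrightarrow> 0 \<le> vord P J" shows "J \<subseteq> OL"
proof -
  obtain d where d: "d \<in> OL" "d \<noteq> 0" "int_ideal (pideal d \<star> J)" by (rule frac_decompose[OF assms(1)])
  have fd: "frac (pideal d)" using d by simp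
  have "pideal d \<star> J \<subseteq> pideal d"
    using d assms by (intro vord_le_imp_subset) auto
  hence "iv (pideal d) \<star> (pideal d \<star> J) \<subseteq> iv (pideal d) \<star> pideal d" by (intro ideal_prod_mono) auto
  thus ?thesis using fd assms(1) by (simp add: ideal_prod_assoc[symmetric])
qed

lemma frac_eqI:
  assumes "frac I" "frac J" "\<And>P. P \<in> primes_of L \<Longrightarrow> vord P I = vord P J" shows "I = J"
proof -
  have *: "I \<subseteq> J" if "frac I" "frac J" "\<And>P. P \<in> primes_of L \<Longrightarrow> vord P I = vord P J" for I J
  proof -
    have "iv J \<star> I \<subseteq> OL" using that by (intro vord_nonneg_imp_subset) auto
    hence "J \<star> (iv J \<star> I) \<subseteq> J \<star> OL" by (intro ideal_prod_mono) auto
    thus ?thesis using that(1,2) by (simp add: frac_divide)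
  qed
  show ?thesis using *[of I J] *[of J I] assms by auto
qed

lemma frac_finprod: "f \<in> S \<rightarrow> {J. frac J} \<Longrightarrow> frac (finprod (ideal_group L) f S)"
  using IG.finprod_closed[of f S] by simp

lemma vord_finprod:
  assumes "finite S" "f \<in> S \<rightarrow> {J. frac J}" "P \<in> primes_of L"
  shows "vord P (finprod (ideal_group L) f S) = (\<Sum>s\<in>S. vord P (f s))"
  using assms
proof (induction S rule: finite_induct)
  case (insert x S)
  hence "finprod (ideal_group L) f (insert x S) = f x \<star> finprod (ideal_group L) f S"
    using IG.finprod_insert[of S x f] by auto
  moreover have "frac (f x)" "frac (finprod (ideal_group L) f S)"
    using insert frac_finprod[of f S] by auto
  ultimately show ?case using insert by simp
qed simp

subsection \<open>Valuations of elements\<close>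

abbreviation vo :: "'a set \<Rightarrow> 'a \<Rightarrow> int" where "vo \<equiv> ord_at L"

lemma le_vord_pideal_iff:
  assumes P: "P \<in> primes_of L" and x: "x \<in> L" "x \<noteq> 0"
  shows "n \<le> vord P (pideal x) \<longleftrightarrow> (\<exists>s\<in>OL - P. s * x \<in> zpow P n)"
proof
  note fP = primeD(2)[OF P]
  assume n: "n \<le> vord P (pideal x)"
  obtain A B where AB: "coprime_to P A" "coprime_to P B"
    "pideal x \<star> B = zpow P (vord P (pideal x)) \<star> A"
    using has_ord_vord[OF P, of "pideal x"] x unfolding has_ord_def by auto
  obtain s where s: "s \<in> B" "s \<notin> P" using AB unfolding coprime_to_def by blast
  have "x * s \<in> zpow P (vord P (pideal x)) \<star> A"
    using ideal_prod_mem[OF pideal_memI(2) s(1), of x] AB(3) by simp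
  also have "\<dots> \<subseteq> zpow P (vord P (pideal x))"
    using int_ideal_mult_subset[OF coprime_toD(2)[OF AB(1)], of "zpow P (vord P (pideal x))"] fP
    by (simp add: ideal_prod_commute)
  also have "\<dots> \<subseteq> zpow P n" by (rule zpow_anti[OF primeD(1)[OF P] n])
  finally have "s * x \<in> zpow P n" by (simp add: mult.commute)
  moreover have "s \<in> OL" using s(1) AB(2) coprime_toD(2) int_idealD(2) by blast
  ultimately show "\<exists>s\<in>OL - P. s * x \<in> zpow P n" using s by blast
next
  note fP = primeD(2)[OF P]
  assume "\<exists>s\<in>OL - P. s * x \<in> zpow P n"
  then obtain s where s: "s \<in> OL" "s \<notin> P" "s * x \<in> zpow P n" by blast
  have "s \<noteq> 0" using s(2) fracD(2)[OF fP] by blast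
  hence fs: "frac (pideal s)" "frac (pideal x)" "pideal (s * x) = pideal s \<star> pideal x"
    using s x by (simp_all add: pideal_mult)
  have "\<not> pideal s \<subseteq> P" using s(2) pideal_memI(2) by blast
  hence vs: "vord P (pideal s) = 0"
    using vord_coprime[OF P, of "pideal s"] s \<open>s \<noteq> 0\<close> unfolding coprime_to_def by simp
  have "pideal (s * x) \<subseteq> zpow P n"
  proof
    fix y assume "y \<in> pideal (s * x)"
    then obtain a where "a \<in> OL" "y = a * (s * x)" by (auto simp: pideal_iff mult.commute)
    thus "y \<in> zpow P n" using fracD(4)[OF frac_zpow[OF fP], of a "s * x" n] s(3) by simp
  qed
  hence "int_ideal (iv (zpow P n) \<star> pideal (s * x))"
    using fP fs by (intro frac_subset_divide) auto
  hence "0 \<le> vord P (iv (zpow P n) \<star> pideal (s * x))" by (rule vord_int_nonneg[OF P])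
  thus "n \<le> vord P (pideal x)" using P fP fs vs by simp
qed

lemma vo_eq:
  assumes "P \<in> primes_of L" "x \<in> L" "x \<noteq> 0" shows "vo P x = vord P (pideal x)"
  unfolding ord_at_def le_vord_pideal_iff[OF assms, symmetric] by (rule Greatest_equality) auto

lemma le_vo_iff:
  assumes "P \<in> primes_of L" "x \<in> L" "x \<noteq> 0"
  shows "n \<le> vo P x \<longleftrightarrow> (\<exists>s\<in>OL - P. s * x \<in> zpow P n)"
  using le_vord_pideal_iff[OF assms] vo_eq[OF assms] by simp

lemma vo_mult:
  assumes "P \<in> primes_of L" "x \<in> L" "x \<noteq> 0" "y \<in> L" "y \<noteq> 0"
  shows "vo P (x * y) = vo P x + vo P y"
  using assms by (simp add: vo_eq pideal_mult[symmetric])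

lemma vo_1 [simp]: "P \<in> primes_of L \<Longrightarrow> vo P 1 = 0"
  by (simp add: vo_eq)

lemma vo_inverse:
  assumes "P \<in> primes_of L" "x \<in> L" "x \<noteq> 0" shows "vo P (inverse x) = - vo P x"
  using vo_mult[of P x "inverse x"] assms by simp

lemma vo_divide:
  assumes "P \<in> primes_of L" "x \<in> L" "x \<noteq> 0" "y \<in> L" "y \<noteq> 0"
  shows "vo P (x / y) = vo P x - vo P y"
  using assms vo_mult[of P x "inverse y"] vo_inverse[of P y] by (simp add: divide_inverse)

lemma vo_uminus:
  assumes "P \<in> primes_of L" "x \<in> L" "x \<noteq> 0" shows "vo P (- x) = vo P x"
proof -
  have "pideal (- x) = pideal x"
  proof (rule Set.set_eqI)
    show "y \<in> pideal (- x) \<longleftrightarrow> y \<in> pideal x" for y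
      unfolding pideal_iff
    proof
      assume "\<exists>a\<in>OL. y = - x * a"
      then obtain a where "a \<in> OL" "y = - x * a" by blast
      thus "\<exists>a\<in>OL. y = x * a" by (intro bexI[of _ "- a"]) simp_all
    next
      assume "\<exists>a\<in>OL. y = x * a"
      then obtain a where "a \<in> OL" "y = x * a" by blast
      thus "\<exists>a\<in>OL. y = - x * a" by (intro bexI[of _ "- a"]) simp_all
    qed
  qed
  thus ?thesis using assms by (simp add: vo_eq)
qed

lemma vo_add:
  assumes P: "P \<in> primes_of L" and x: "x \<in> L" "x \<noteq> 0" and y: "y \<in> L" "y \<noteq> 0" and "x + y \<noteq> 0"
  shows "min (vo P x) (vo P y) \<le> vo P (x + y)"
proof -
  define n where "n = min (vo P x) (vo P y)"
  have n: "n \<le> vo P x" "n \<le> vo P y" unfolding n_def by auto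
  obtain s where s: "s \<in> OL" "s \<notin> P" "s * x \<in> zpow P n" using n(1) le_vo_iff[OF P x] by blast
  obtain t where t: "t \<in> OL" "t \<notin> P" "t * y \<in> zpow P n" using n(2) le_vo_iff[OF P y] by blast
  have st: "s * t \<in> OL - P" using s t primeD(5)[OF P, of s t] by auto
  note fz = frac_zpow[OF primeD(2)[OF P], of n]
  have "t * (s * x) + s * (t * y) \<in> zpow P n"
    by (intro fracD(3)[OF fz] fracD(4)[OF fz] s t)
  hence "s * t * (x + y) \<in> zpow P n" by (simp add: algebra_simps)
  thus ?thesis using le_vo_iff[OF P, of "x + y" n] st x y assms(6) unfolding n_def by auto
qed

lemma vo_OL_nonneg: "P \<in> primes_of L \<Longrightarrow> x \<in> OL \<Longrightarrow> x \<noteq> 0 \<Longrightarrow> 0 \<le> vo P x"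
  by (simp add: vo_eq vord_int_nonneg)

lemma vo_pos_iff:
  assumes "P \<in> primes_of L" "x \<in> OL" "x \<noteq> 0" shows "0 < vo P x \<longleftrightarrow> x \<in> P"
proof -
  have "pideal x \<subseteq> P \<longleftrightarrow> x \<in> P"
    using pideal_memI(2) fracD(4)[OF primeD(2)[OF assms(1)]] by (auto simp: pideal_iff mult.commute)
  thus ?thesis using assms vord_int_pos_iff[of P "pideal x"] by (simp add: vo_eq)
qed

lemma npow_mem_le_vo:
  assumes "P \<in> primes_of L" "x \<in> OL" "x \<noteq> 0" "x \<in> P [^]\<^bsub>ideal_group L\<^esub> (n::nat)"
  shows "int n \<le> vo P x"
  using assms primeD(4)[OF assms(1)] le_vo_iff[of P x "int n"]
  by (auto simp: int_pow_int intro!: bexI[of _ 1])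

lemma uniformizer:
  assumes P: "P \<in> primes_of L" obtains x where "x \<in> L" "x \<noteq> 0" "vo P x = n"
proof -
  note PD = primeD[OF P]
  have "\<not> P \<subseteq> P \<star> P"
  proof
    assume "P \<subseteq> P \<star> P"
    hence "P = P \<star> P" using int_ideal_mult_subset[OF PD(1,2)] by blast
    hence "vord P P = vord P P + vord P P" using vord_mult[OF P PD(2,2)] by simp
    thus False using P by simp
  qed
  then obtain x where x: "x \<in> P" "x \<notin> P \<star> P" by blast
  have xO: "x \<in> OL" "x \<noteq> 0" using x PD(3) ideal_prod_0 by blast+
  have fx: "frac (pideal x)" "int_ideal (pideal x)" using xO by auto
  have sub: "pideal x \<subseteq> P"
    using fracD(4)[OF PD(2) _ x(1)] by (auto simp: pideal_iff mult.commute)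
  define J where "J = iv P \<star> pideal x"
  have J: "int_ideal J" unfolding J_def using sub PD fx by (intro frac_subset_divide)
  have eq: "pideal x = P \<star> J" unfolding J_def using frac_divide[OF PD(2) fx(1)] by simp
  have "\<not> J \<subseteq> P" using x(2) pideal_memI(2)[of x] ideal_prod_mono[of P P J P] unfolding eq by blast
  hence "vord P J = 0" using vord_coprime[OF P] J unfolding coprime_to_def by blast
  hence v1: "vo P x = 1" using xO P PD int_idealD(1)[OF J] by (simp add: vo_eq eq)
  have pow: "vo P (x ^ m) = int m" for m
    by (induction m) (use P xO v1 in \<open>simp_all add: vo_mult\<close>)
  show thesis
  proof (cases "n \<ge> 0")
    case True
    show ?thesis by (rule that[of "x ^ nat n"]) (use pow xO True in auto)
  next
    case False
    show ?thesis by (rule that[of "inverse (x ^ nat (- n))"]) (use pow[of "nat (- n)"] xO P False in \<open>auto simp: vo_inverse\<close>)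
  qed
qed

lemma weak_approximation:
  assumes P: "P \<in> primes_of L" and S: "finite S" "S \<subseteq> primes_of L" "P \<notin> S" and N: "N > 0"
  obtains z where "z \<in> OL" "z \<noteq> 0" "z = 1 \<or> int N \<le> vo P (z - 1)" "\<And>Q. Q \<in> S \<Longrightarrow> int N \<le> vo Q z"
proof -
  note PD = primeD[OF P]
  have "\<forall>Q\<in>S. \<exists>q. q \<in> Q \<and> q \<notin> P"
    using coprime_to_prime[OF P] S unfolding coprime_to_def by blast
  then obtain q where q: "\<And>Q. Q \<in> S \<Longrightarrow> q Q \<in> Q \<and> q Q \<notin> P" by metis
  have qO: "q Q \<in> OL" if "Q \<in> S" for Q using q[OF that] primeD(3) S(2) that by blast
  define M where "M = prod q S"
  have MO: "M \<in> OL" unfolding M_def using qO by (intro OL_prod)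
  have MQ: "M \<in> Q" if "Q \<in> S" for Q
  proof -
    have "M = prod q (S - {Q}) * q Q" unfolding M_def using S(1) that by (simp add: prod.remove mult.commute)
    moreover have "prod q (S - {Q}) \<in> OL" using qO by (intro OL_prod) auto
    ultimately show ?thesis using fracD(4)[of Q "prod q (S - {Q})" "q Q"] primeD(2) q that S(2) by auto
  qed
  have MP: "M \<notin> P"
  proof -
    have "prod q T \<notin> P" if "finite T" "T \<subseteq> S" for T
      using that
    proof (induction T rule: finite_induct)
      case (insert x T)
      have "prod q T \<in> OL" using insert qO by (intro OL_prod) auto
      thus ?case using insert q[of x] qO[of x] PD(5)[of "q x" "prod q T"] by auto
    qed (use PD in simp)
    thus ?thesis unfolding M_def using S(1) by blast
  qed
  obtain a0 where a0: "a0 \<in> P" "a0 \<noteq> 0" using fracD(5)[OF PD(2)] by blast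
  have a0O: "a0 \<in> OL" using a0 PD(3) by blast
  obtain i k y where k: "k > 0" "y \<in> OL" "M ^ i * (1 - M ^ k) = a0 * y"
    by (rule power_relation[OF a0O a0(2) MO])
  define a where "a = 1 - M ^ k"
  have aO: "a \<in> OL" unfolding a_def using MO by simp
  have "M ^ i * a \<in> P" unfolding a_def k(3) using fracD(4)[OF PD(2) k(2) a0(1)] by (simp add: mult.commute)
  moreover have "M ^ i \<notin> P" using prime_power_mem[OF P MO] MP by blast
  ultimately have aP: "a \<in> P" using PD(5)[of "M ^ i" a] MO aO by auto
  define b where "b = 1 - a ^ N"
  have bO: "b \<in> OL" unfolding b_def using aO by simp
  have bQ: "b \<in> Q" if "Q \<in> S" for Q
  proof -
    have Q: "int_ideal Q" using that S(2) primeD(1) by blast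
    have "b = (\<Sum>i<N. a ^ i) * M ^ k"
      using one_diff_power_eq[of a N] by (simp add: b_def a_def mult.commute)
    moreover have "(\<Sum>i<N. a ^ i) \<in> OL" using aO by (intro OL_sum) simp
    ultimately show ?thesis
      using fracD(4)[OF int_idealD(1)[OF Q]] int_ideal_power[OF Q MQ[OF that] k(1)] by simp
  qed
  define z where "z = b ^ N"
  have zO: "z \<in> OL" unfolding z_def using bO by simp
  have "1 - z = (1 - b) * (\<Sum>i<N. b ^ i)" unfolding z_def by (rule one_diff_power_eq)
  hence "1 - z = (\<Sum>i<N. b ^ i) * a ^ N" unfolding b_def by (simp add: mult.commute)
  moreover have "(\<Sum>i<N. b ^ i) \<in> OL" using bO by (intro OL_sum) simp
  moreover have fN: "int_ideal (P [^]\<^bsub>ideal_group L\<^esub> N)" using PD(1) by simp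
  ultimately have z1: "1 - z \<in> P [^]\<^bsub>ideal_group L\<^esub> N"
    using fracD(4)[OF int_idealD(1)[OF fN]] power_mem_npow[OF PD(1) aP, of N] by simp
  have "P [^]\<^bsub>ideal_group L\<^esub> N \<subseteq> P"
    using zpow_anti[OF PD(1), of 1 "int N"] N PD(2) by (simp add: int_pow_int)
  hence "1 - z \<in> P" using z1 by blast
  hence z0: "z \<noteq> 0" using PD(4) by auto
  show thesis
  proof (rule that[OF zO z0])
    show "z = 1 \<or> int N \<le> vo P (z - 1)"
    proof (cases "z = 1")
      case False
      hence "int N \<le> vo P (1 - z)" using npow_mem_le_vo[OF P _ _ z1] zO by simp
      also have "vo P (1 - z) = vo P (z - 1)" using vo_uminus[OF P, of "z - 1"] zO False by simp
      finally show ?thesis by simp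
    qed simp
    show "int N \<le> vo Q z" if "Q \<in> S" for Q
    proof -
      have Q: "Q \<in> primes_of L" using that S(2) by blast
      show ?thesis using npow_mem_le_vo[OF Q zO z0] power_mem_npow[OF primeD(1)[OF Q] bQ[OF that], of N]
        unfolding z_def by simp
    qed
  qed
qed

definition vge :: "'a set \<Rightarrow> int \<Rightarrow> 'a \<Rightarrow> bool" where
  "vge P n x \<longleftrightarrow> x \<in> L \<and> (x = 0 \<or> n \<le> vo P x)"

lemma vgeD: "vge P n x \<Longrightarrow> x \<in> L"
  unfolding vge_def by simp

lemma vge_0 [simp]: "vge P n 0"
  unfolding vge_def by simp

lemma vge_mono: "vge P n x \<Longrightarrow> m \<le> n \<Longrightarrow> vge P m x"
  unfolding vge_def by auto

lemma vge_add: "P \<in> primes_of L \<Longrightarrow> vge P n x \<Longrightarrow> vge P n y \<Longrightarrow> vge P n (x + y)"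
  using vo_add[of P x y] unfolding vge_def by (cases "x = 0"; cases "y = 0"; cases "x + y = 0") auto

lemma vge_uminus: "P \<in> primes_of L \<Longrightarrow> vge P n x \<Longrightarrow> vge P n (- x)"
  using vo_uminus[of P x] unfolding vge_def by (cases "x = 0") auto

lemma vge_diff: "P \<in> primes_of L \<Longrightarrow> vge P n x \<Longrightarrow> vge P n y \<Longrightarrow> vge P n (x - y)"
  using vge_add[of P n x "- y"] vge_uminus[of P n y] by simp

lemma vge_sum: "P \<in> primes_of L \<Longrightarrow> (\<And>i. i \<in> I \<Longrightarrow> vge P n (f i)) \<Longrightarrow> vge P n (sum f I)"
  by (induction I rule: infinite_finite_induct) (simp_all add: vge_add)

lemma vge_mult: "P \<in> primes_of L \<Longrightarrow> vge P n x \<Longrightarrow> vge P m y \<Longrightarrow> vge P (n + m) (x * y)"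
  using vo_mult[of P x y] unfolding vge_def by (cases "x = 0"; cases "y = 0") auto

lemma vge_OL: "P \<in> primes_of L \<Longrightarrow> x \<in> OL \<Longrightarrow> vge P 0 x"
  using vo_OL_nonneg[of P x] unfolding vge_def by auto

lemma vge_dominant:
  assumes P: "P \<in> primes_of L" and x: "x \<in> L" "x \<noteq> 0" and yx: "vge P (vo P x + 1) (y - x)"
  shows "y \<in> L" "y \<noteq> 0" "vo P y = vo P x"
proof -
  have "y = (y - x) + x" by simp
  thus yL: "y \<in> L" using vgeD[OF yx] x(1) L_add by metis
  show y0: "y \<noteq> 0"
  proof
    assume "y = 0"
    hence "vge P (vo P x + 1) (- x)" using yx by simp
    thus False using x vo_uminus[OF P x] unfolding vge_def by auto
  qed
  have "vge P (vo P x) (x + (y - x))"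
    using x by (intro vge_add[OF P _ vge_mono[OF yx]]) (auto simp: vge_def)
  hence le: "vo P x \<le> vo P y" using y0 unfolding vge_def by simp
  show "vo P y = vo P x"
  proof (rule ccontr)
    assume "vo P y \<noteq> vo P x"
    hence "vge P (vo P x + 1) y" using le yL unfolding vge_def by simp
    hence "vge P (vo P x + 1) (y - (y - x))" by (rule vge_diff[OF P _ yx])
    thus False using x unfolding vge_def by auto
  qed
qed

end

section \<open>Galois extensions of number fields\<close>

locale galois_ext =
  fixes K F :: "'a::field_char_0 set"
  assumes galois: "galois_number_fields K F"
begin

sublocale K: number_ring K
  using galois by unfold_locales (simp add: galois_number_fields_def)

sublocale F: number_ring F
  using galois by unfold_locales (simp add: galois_number_fields_def)

abbreviation GG :: "('a \<Rightarrow> 'a) monoid" where "GG \<equiv> galois_group K F"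

lemma F_subset_K: "F \<subseteq> K"
  using galois by (simp add: galois_number_fields_def)

lemma F_in_K [simp]: "x \<in> F \<Longrightarrow> x \<in> K"
  using F_subset_K by blast

lemma fixed_in_F: "x \<in> K \<Longrightarrow> (\<And>\<sigma>. \<sigma> \<in> carrier GG \<Longrightarrow> \<sigma> x = x) \<Longrightarrow> x \<in> F"
  using galois unfolding galois_number_fields_def by blast

lemma galD:
  assumes "\<sigma> \<in> carrier GG"
  shows gal_closed [simp]: "x \<in> K \<Longrightarrow> \<sigma> x \<in> K"
    and gal_add: "x \<in> K \<Longrightarrow> y \<in> K \<Longrightarrow> \<sigma> (x + y) = \<sigma> x + \<sigma> y"
    and gal_mult: "x \<in> K \<Longrightarrow> y \<in> K \<Longrightarrow> \<sigma> (x * y) = \<sigma> x * \<sigma> y"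
    and gal_1: "\<sigma> 1 = 1" and gal_bij: "bij_betw \<sigma> K K"
    and gal_ext: "\<sigma> \<in> extensional K" and gal_fix: "x \<in> F \<Longrightarrow> \<sigma> x = x"
proof -
  have *: "\<sigma> \<in> ring_iso (ring_on K) (ring_on K)" "\<sigma> \<in> extensional K" "\<forall>x\<in>F. \<sigma> x = x"
    using assms unfolding galois_group_def by simp_all
  hence h: "\<sigma> \<in> Ring.ring_hom (ring_on K) (ring_on K)" "bij_betw \<sigma> K K" unfolding ring_iso_def by simp_all
  show "x \<in> K \<Longrightarrow> \<sigma> x \<in> K" using ring_hom_closed[OF h(1)] by simp
  show "x \<in> K \<Longrightarrow> y \<in> K \<Longrightarrow> \<sigma> (x + y) = \<sigma> x + \<sigma> y" using ring_hom_add[OF h(1)] by simp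
  show "x \<in> K \<Longrightarrow> y \<in> K \<Longrightarrow> \<sigma> (x * y) = \<sigma> x * \<sigma> y" using ring_hom_mult[OF h(1)] by simp
  show "\<sigma> 1 = 1" using ring_hom_one[OF h(1)] by simp
  show "bij_betw \<sigma> K K" "\<sigma> \<in> extensional K" by fact+
  show "x \<in> F \<Longrightarrow> \<sigma> x = x" using * by blast
qed

lemma galI:
  assumes "bij_betw \<sigma> K K" "\<And>x y. x \<in> K \<Longrightarrow> y \<in> K \<Longrightarrow> \<sigma> (x + y) = \<sigma> x + \<sigma> y"
    "\<And>x y. x \<in> K \<Longrightarrow> y \<in> K \<Longrightarrow> \<sigma> (x * y) = \<sigma> x * \<sigma> y" "\<sigma> \<in> extensional K"
    "\<And>x. x \<in> F \<Longrightarrow> \<sigma> x = x"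
  shows "\<sigma> \<in> carrier GG"
proof -
  have "\<sigma> \<in> ring_iso (ring_on K) (ring_on K)"
    using assms bij_betwE[OF assms(1)] assms(5)[OF F.L_1]
    unfolding ring_iso_def by (auto intro!: ring_hom_memI)
  thus ?thesis using assms unfolding galois_group_def by simp
qed

lemma gal_mult_eq: "\<sigma> \<otimes>\<^bsub>GG\<^esub> \<tau> = compose K \<sigma> \<tau>"
  unfolding galois_group_def by simp

lemma gal_mult_apply [simp]: "x \<in> K \<Longrightarrow> (\<sigma> \<otimes>\<^bsub>GG\<^esub> \<tau>) x = \<sigma> (\<tau> x)"
  by (simp add: gal_mult_eq compose_def)

lemma gal_one_apply [simp]: "x \<in> K \<Longrightarrow> \<one>\<^bsub>GG\<^esub> x = x"
  unfolding galois_group_def by simp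

lemma gal_inj: "\<sigma> \<in> carrier GG \<Longrightarrow> x \<in> K \<Longrightarrow> y \<in> K \<Longrightarrow> \<sigma> x = \<sigma> y \<longleftrightarrow> x = y"
  using gal_bij unfolding bij_betw_def inj_on_def by blast

lemma gal_0: "\<sigma> \<in> carrier GG \<Longrightarrow> \<sigma> 0 = 0"
  using gal_fix[of \<sigma> 0] by simp

lemma gal_eq_0_iff: "\<sigma> \<in> carrier GG \<Longrightarrow> x \<in> K \<Longrightarrow> \<sigma> x = 0 \<longleftrightarrow> x = 0"
  using gal_inj[of \<sigma> x 0] gal_0[of \<sigma>] by simp

lemma gal_uminus: "\<sigma> \<in> carrier GG \<Longrightarrow> x \<in> K \<Longrightarrow> \<sigma> (- x) = - \<sigma> x"
  using gal_add[of \<sigma> x "- x"] gal_0[of \<sigma>] by (simp add: add_eq_0_iff)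

lemma gal_diff: "\<sigma> \<in> carrier GG \<Longrightarrow> x \<in> K \<Longrightarrow> y \<in> K \<Longrightarrow> \<sigma> (x - y) = \<sigma> x - \<sigma> y"
  using gal_add[of \<sigma> x "- y"] gal_uminus[of \<sigma> y] by simp

lemma gal_inverse: "\<sigma> \<in> carrier GG \<Longrightarrow> x \<in> K \<Longrightarrow> \<sigma> (inverse x) = inverse (\<sigma> x)"
proof (cases "x = 0")
  case False
  assume *: "\<sigma> \<in> carrier GG" "x \<in> K"
  have "\<sigma> x * \<sigma> (inverse x) = 1" using gal_mult[of \<sigma> x "inverse x"] gal_1[of \<sigma>] * False by simp
  thus ?thesis by (metis inverse_unique)
qed (simp add: gal_0)

lemma gal_divide: "\<sigma> \<in> carrier GG \<Longrightarrow> x \<in> K \<Longrightarrow> y \<in> K \<Longrightarrow> \<sigma> (x / y) = \<sigma> x / \<sigma> y"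
  using gal_mult[of \<sigma> x "inverse y"] gal_inverse[of \<sigma> y] by (simp add: divide_inverse)

lemma gal_sum:
  "\<sigma> \<in> carrier GG \<Longrightarrow> (\<And>i. i \<in> I \<Longrightarrow> f i \<in> K) \<Longrightarrow> \<sigma> (sum f I) = (\<Sum>i\<in>I. \<sigma> (f i))"
  by (induction I rule: infinite_finite_induct) (simp_all add: gal_0 gal_add)

lemma gal_prod:
  "\<sigma> \<in> carrier GG \<Longrightarrow> (\<And>i. i \<in> I \<Longrightarrow> f i \<in> K) \<Longrightarrow> \<sigma> (prod f I) = (\<Prod>i\<in>I. \<sigma> (f i))"
  by (induction I rule: infinite_finite_induct) (simp_all add: gal_1 gal_mult)

lemma gal_power: "\<sigma> \<in> carrier GG \<Longrightarrow> x \<in> K \<Longrightarrow> \<sigma> (x ^ n) = \<sigma> x ^ n"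
  by (induction n) (simp_all add: gal_1 gal_mult)

lemma gal_of_int: "\<sigma> \<in> carrier GG \<Longrightarrow> \<sigma> (of_int n) = of_int n"
  by (simp add: gal_fix)

lemma gal_eqI:
  assumes "\<sigma> \<in> carrier GG" "\<tau> \<in> carrier GG" "\<And>x. x \<in> K \<Longrightarrow> \<sigma> x = \<tau> x" shows "\<sigma> = \<tau>"
  using extensionalityI[OF gal_ext[OF assms(1)] gal_ext[OF assms(2)]] assms(3) by blast

lemma group_GG: "group GG"
proof (rule groupI)
  show "\<sigma> \<otimes>\<^bsub>GG\<^esub> \<tau> \<in> carrier GG" if "\<sigma> \<in> carrier GG" "\<tau> \<in> carrier GG" for \<sigma> \<tau>
  proof (rule galI)
    show "bij_betw (\<sigma> \<otimes>\<^bsub>GG\<^esub> \<tau>) K K"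
      unfolding gal_mult_eq using bij_betw_compose[OF gal_bij gal_bij] that by blast
    show "\<sigma> \<otimes>\<^bsub>GG\<^esub> \<tau> \<in> extensional K" unfolding gal_mult_eq by simp
  qed (use that in \<open>simp_all add: gal_add gal_mult gal_fix\<close>)
  show one: "\<one>\<^bsub>GG\<^esub> \<in> carrier GG"
    by (rule galI) (simp_all add: galois_group_def bij_betw_def inj_on_def)
  fix \<sigma> assume \<sigma>: "\<sigma> \<in> carrier GG"
  note inv_b = bij_betw_inv_into[OF gal_bij[OF \<sigma>]]
  define \<tau> where "\<tau> = restrict (inv_into K \<sigma>) K"
  have \<tau>K: "\<tau> x \<in> K" "\<sigma> (\<tau> x) = x" if "x \<in> K" for x
    using that gal_bij[OF \<sigma>] bij_betwE[OF inv_b] unfolding \<tau>_def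
    by (simp_all add: bij_betw_inv_into_right[of \<sigma> K K])
  have \<tau>\<sigma>: "\<tau> (\<sigma> x) = x" if "x \<in> K" for x
    using that gal_bij[OF \<sigma>] \<sigma> unfolding \<tau>_def by (simp add: bij_betw_inv_into_left[of \<sigma> K K])
  have "\<tau> \<in> carrier GG"
  proof (rule galI)
    show "bij_betw \<tau> K K" by (rule bij_betwI[where g = \<sigma>]) (use \<tau>K \<tau>\<sigma> \<sigma> in auto)
    show "\<tau> \<in> extensional K" unfolding \<tau>_def by simp
    show "\<tau> (x + y) = \<tau> x + \<tau> y" if "x \<in> K" "y \<in> K" for x y
      using \<tau>\<sigma>[of "\<tau> x + \<tau> y"] \<tau>K that gal_add[OF \<sigma>] by simp
    show "\<tau> (x * y) = \<tau> x * \<tau> y" if "x \<in> K" "y \<in> K" for x y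
      using \<tau>\<sigma>[of "\<tau> x * \<tau> y"] \<tau>K that gal_mult[OF \<sigma>] by simp
    show "\<tau> x = x" if "x \<in> F" for x using \<tau>\<sigma>[of x] gal_fix[OF \<sigma> that] that by simp
  qed
  moreover have "\<tau> \<otimes>\<^bsub>GG\<^esub> \<sigma> = \<one>\<^bsub>GG\<^esub>"
    unfolding gal_mult_eq using \<tau>\<sigma> by (auto simp: compose_def galois_group_def restrict_def fun_eq_iff)
  ultimately show "\<exists>\<tau>\<in>carrier GG. \<tau> \<otimes>\<^bsub>GG\<^esub> \<sigma> = \<one>\<^bsub>GG\<^esub>" by blast
next
  fix \<sigma> assume "\<sigma> \<in> carrier GG"
  thus "\<one>\<^bsub>GG\<^esub> \<otimes>\<^bsub>GG\<^esub> \<sigma> = \<sigma>"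
    using gal_ext[of \<sigma>] gal_closed[of \<sigma>]
    by (auto simp: gal_mult_eq compose_def galois_group_def restrict_def fun_eq_iff extensional_def)
next
  fix \<sigma> \<tau> \<rho> assume "\<sigma> \<in> carrier GG" "\<tau> \<in> carrier GG" "\<rho> \<in> carrier GG"
  thus "\<sigma> \<otimes>\<^bsub>GG\<^esub> \<tau> \<otimes>\<^bsub>GG\<^esub> \<rho> = \<sigma> \<otimes>\<^bsub>GG\<^esub> (\<tau> \<otimes>\<^bsub>GG\<^esub> \<rho>)"
    by (auto simp: gal_mult_eq compose_def restrict_def fun_eq_iff)
qed

sublocale GG: group GG
  by (rule group_GG)

abbreviation ginv :: "('a \<Rightarrow> 'a) \<Rightarrow> 'a \<Rightarrow> 'a" where "ginv \<sigma> \<equiv> inv\<^bsub>GG\<^esub> \<sigma>"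

lemma ginv_apply [simp]:
  assumes "\<sigma> \<in> carrier GG" "x \<in> K" shows "ginv \<sigma> (\<sigma> x) = x" "\<sigma> (ginv \<sigma> x) = x"
  using gal_mult_apply[OF assms(2), of "ginv \<sigma>" \<sigma>] gal_mult_apply[OF assms(2), of \<sigma> "ginv \<sigma>"] assms
  by simp_all

text \<open>An automorphism is determined by the images of a spanning family, and each image is a root
  of a fixed integer polynomial.\<close>

lemma finite_GG: "finite (carrier GG)"
proof -
  obtain n and u :: "nat \<Rightarrow> 'a" where u: "\<And>i. i < n \<Longrightarrow> u i \<in> K"
    "\<And>x. x \<in> K \<Longrightarrow> \<exists>c. (\<forall>i<n. c i \<in> \<rat>) \<and> x = (\<Sum>i<n. c i * u i)"
    using K.Rats_span by blast
  have "\<exists>R. finite R \<and> (\<forall>\<sigma>\<in>carrier GG. \<sigma> x \<in> R)" if x: "x \<in> K" for x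
  proof -
    obtain m and a :: "nat \<Rightarrow> int" where a: "\<exists>i\<le>m. a i \<noteq> 0" "(\<Sum>i\<le>m. of_int (a i) * x ^ i) = 0"
      by (rule K.int_polynomial_relation[OF x])
    define R where "R = {y::'a. (\<Sum>i\<le>m. of_int (a i) * y ^ i) = 0}"
    obtain i where i: "i \<le> m" "of_int (a i) \<noteq> (0::'a)" using a(1) by auto
    define p where "p = (\<Sum>j\<le>m. monom (of_int (a j) :: 'a) j)"
    have "coeff p i \<noteq> 0" using i by (simp add: p_def coeff_sum sum.delta)
    hence "finite {y. poly p y = 0}" by (intro poly_roots_finite) auto
    hence "finite R" unfolding R_def p_def by (simp add: poly_sum poly_monom)
    moreover have "\<sigma> x \<in> R" if \<sigma>: "\<sigma> \<in> carrier GG" for \<sigma>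
    proof -
      have "(\<Sum>i\<le>m. of_int (a i) * \<sigma> x ^ i) = \<sigma> (\<Sum>i\<le>m. of_int (a i) * x ^ i)"
        using x \<sigma> by (subst gal_sum) (simp_all add: gal_mult gal_of_int gal_power)
      thus ?thesis unfolding R_def a(2) using gal_0[OF \<sigma>] by simp
    qed
    ultimately show ?thesis by blast
  qed
  then obtain R where R: "\<And>x. x \<in> K \<Longrightarrow> finite (R x)" "\<And>x \<sigma>. x \<in> K \<Longrightarrow> \<sigma> \<in> carrier GG \<Longrightarrow> \<sigma> x \<in> R x"
    by metis
  let ?h = "\<lambda>\<sigma>. \<lambda>i\<in>{..<n}. \<sigma> (u i)"
  have "inj_on ?h (carrier GG)"
  proof (rule inj_onI)
    fix \<sigma> \<tau> assume st: "\<sigma> \<in> carrier GG" "\<tau> \<in> carrier GG" "?h \<sigma> = ?h \<tau>"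
    have eq: "\<sigma> (u i) = \<tau> (u i)" if "i < n" for i using fun_cong[OF st(3), of i] that by simp
    show "\<sigma> = \<tau>"
    proof (rule gal_eqI[OF st(1,2)])
      fix x assume "x \<in> K"
      then obtain c where c: "\<forall>i<n. c i \<in> \<rat>" "x = (\<Sum>i<n. c i * u i)" using u(2) by blast
      have cF: "c i \<in> F" if "i < n" for i using c(1) that F.Rats_subset_L by blast
      have rho: "\<rho> x = (\<Sum>i<n. c i * \<rho> (u i))" if "\<rho> \<in> carrier GG" for \<rho>
        unfolding c(2) using that u(1) cF by (subst gal_sum) (simp_all add: gal_mult gal_fix)
      show "\<sigma> x = \<tau> x" using rho[OF st(1)] rho[OF st(2)] eq by simp
    qed
  qed
  moreover have "?h ` carrier GG \<subseteq> (\<Pi>\<^sub>E i\<in>{..<n}. R (u i))"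
    using R(2) u(1) by (intro image_subsetI restrict_PiE_iff[THEN iffD2]) simp
  moreover have "finite (\<Pi>\<^sub>E i\<in>{..<n}. R (u i))" using R(1) u(1) by (intro finite_PiE) auto
  ultimately show ?thesis using inj_on_finite by blast
qed

lemma bij_betw_gal_mult: "\<tau> \<in> carrier GG \<Longrightarrow> bij_betw (\<lambda>\<sigma>. \<tau> \<otimes>\<^bsub>GG\<^esub> \<sigma>) (carrier GG) (carrier GG)"
  by (rule bij_betwI[where g = "\<lambda>\<sigma>. ginv \<tau> \<otimes>\<^bsub>GG\<^esub> \<sigma>"]) (auto simp: GG.m_assoc[symmetric])

lemma gal_trace_in_F:
  assumes "x \<in> K" shows "(\<Sum>\<sigma>\<in>carrier GG. \<sigma> x) \<in> F"
proof (rule fixed_in_F)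
  show "(\<Sum>\<sigma>\<in>carrier GG. \<sigma> x) \<in> K" using assms by simp
  fix \<tau> assume \<tau>: "\<tau> \<in> carrier GG"
  have "\<tau> (\<Sum>\<sigma>\<in>carrier GG. \<sigma> x) = (\<Sum>\<sigma>\<in>carrier GG. (\<tau> \<otimes>\<^bsub>GG\<^esub> \<sigma>) x)"
    using assms \<tau> by (subst gal_sum) simp_all
  also have "\<dots> = (\<Sum>\<sigma>\<in>carrier GG. \<sigma> x)"
    by (rule sum.reindex_bij_betw[OF bij_betw_gal_mult[OF \<tau>]])
  finally show "\<tau> (\<Sum>\<sigma>\<in>carrier GG. \<sigma> x) = (\<Sum>\<sigma>\<in>carrier GG. \<sigma> x)" .
qed

lemma gal_norm_in_F:
  assumes "x \<in> K" shows "(\<Prod>\<sigma>\<in>carrier GG. \<sigma> x) \<in> F"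
proof (rule fixed_in_F)
  show "(\<Prod>\<sigma>\<in>carrier GG. \<sigma> x) \<in> K" using assms by simp
  fix \<tau> assume \<tau>: "\<tau> \<in> carrier GG"
  have "\<tau> (\<Prod>\<sigma>\<in>carrier GG. \<sigma> x) = (\<Prod>\<sigma>\<in>carrier GG. (\<tau> \<otimes>\<^bsub>GG\<^esub> \<sigma>) x)"
    using assms \<tau> by (subst gal_prod) simp_all
  also have "\<dots> = (\<Prod>\<sigma>\<in>carrier GG. \<sigma> x)"
    by (rule prod.reindex_bij_betw[OF bij_betw_gal_mult[OF \<tau>]])
  finally show "\<tau> (\<Prod>\<sigma>\<in>carrier GG. \<sigma> x) = (\<Prod>\<sigma>\<in>carrier GG. \<sigma> x)" .
qed

subsection \<open>Galois action on ideals\<close>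

abbreviation OK :: "'a set" where "OK \<equiv> integers_of K"
abbreviation OF :: "'a set" where "OF \<equiv> integers_of F"

lemma OF_eq: "OF = OK \<inter> F"
  unfolding integers_of_def using F_subset_K by blast

lemma OF_in_OK [simp]: "x \<in> OF \<Longrightarrow> x \<in> OK"
  by (simp add: OF_eq)

lemma gal_OK [simp]:
  assumes \<sigma>: "\<sigma> \<in> carrier GG" and x: "x \<in> OK" shows "\<sigma> x \<in> OK"
proof -
  obtain p :: "int poly" where p: "poly (map_poly of_int p) x = 0" "lead_coeff p = 1"
    using x unfolding K.OL_iff algebraic_int_altdef_ipoly by blast
  have xK: "x \<in> K" using x by simp
  have "poly (map_poly of_int p) (\<sigma> x) = (\<Sum>i\<le>degree p. of_int (coeff p i) * \<sigma> x ^ i)"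
    by (simp add: poly_altdef coeff_map_poly)
  also have "\<dots> = \<sigma> (\<Sum>i\<le>degree p. of_int (coeff p i) * x ^ i)"
    using xK \<sigma> by (subst gal_sum) (simp_all add: gal_mult gal_of_int gal_power)
  also have "(\<Sum>i\<le>degree p. of_int (coeff p i) * x ^ i) = 0"
    using p(1) by (simp add: poly_altdef coeff_map_poly)
  finally have "poly (map_poly of_int p) (\<sigma> x) = 0" using gal_0[OF \<sigma>] by simp
  hence "algebraic_int (\<sigma> x)" unfolding algebraic_int_altdef_ipoly using p(2) by blast
  thus ?thesis using gal_closed[OF \<sigma> xK] K.OL_iff by blast
qed

lemma gal_image_eqI:
  assumes "\<And>\<sigma> x. \<sigma> \<in> carrier GG \<Longrightarrow> x \<in> A \<Longrightarrow> \<sigma> x \<in> A" "A \<subseteq> K" "\<sigma> \<in> carrier GG"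
  shows "\<sigma> ` A = A"
proof
  show "A \<subseteq> \<sigma> ` A"
  proof
    fix x assume x: "x \<in> A"
    hence "x = \<sigma> (ginv \<sigma> x)" "ginv \<sigma> x \<in> A" using assms by auto
    thus "x \<in> \<sigma> ` A" by blast
  qed
qed (use assms in auto)

lemma gal_image_OK [simp]: "\<sigma> \<in> carrier GG \<Longrightarrow> \<sigma> ` OK = OK"
  by (rule gal_image_eqI) (auto simp: K.OL_subset_L)

lemma gal_image_mult:
  "\<sigma> \<in> carrier GG \<Longrightarrow> \<tau> \<in> carrier GG \<Longrightarrow> J \<subseteq> K \<Longrightarrow> (\<sigma> \<otimes>\<^bsub>GG\<^esub> \<tau>) ` J = \<sigma> ` (\<tau> ` J)"
  unfolding image_image by (rule image_cong[OF refl]) auto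

lemma gal_image_one: "J \<subseteq> K \<Longrightarrow> \<one>\<^bsub>GG\<^esub> ` J = J"
  by (subst image_cong[OF refl, of J _ "\<lambda>x. x"]) auto

lemma gal_image_ginv:
  "\<sigma> \<in> carrier GG \<Longrightarrow> J \<subseteq> K \<Longrightarrow> ginv \<sigma> ` (\<sigma> ` J) = J" "\<sigma> \<in> carrier GG \<Longrightarrow> J \<subseteq> K \<Longrightarrow> \<sigma> ` (ginv \<sigma> ` J) = J"
  using gal_image_mult[of "ginv \<sigma>" \<sigma> J] gal_image_mult[of \<sigma> "ginv \<sigma>" J] gal_image_one[of J] by simp_all

lemma gal_image_mem_iff:
  "\<sigma> \<in> carrier GG \<Longrightarrow> J \<subseteq> K \<Longrightarrow> x \<in> K \<Longrightarrow> \<sigma> x \<in> \<sigma> ` J \<longleftrightarrow> x \<in> J"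
  using gal_inj[of \<sigma> x] by blast

lemma gal_image_subset_iff:
  assumes "\<sigma> \<in> carrier GG" "I \<subseteq> K" "J \<subseteq> K" shows "\<sigma> ` I \<subseteq> \<sigma> ` J \<longleftrightarrow> I \<subseteq> J"
  using gal_image_mem_iff[OF assms(1,3)] assms(2) by blast

lemma gal_frac [simp]:
  assumes \<sigma>: "\<sigma> \<in> carrier GG" and J: "K.frac J" shows "K.frac (\<sigma> ` J)"
proof -
  note D = K.fracD[OF J]
  obtain e where e: "e \<in> J" "e \<noteq> 0" using D(5) by blast
  obtain d where d: "d \<in> OK" "d \<noteq> 0" "\<forall>x\<in>J. d * x \<in> OK" using D(6) by blast
  have JK: "x \<in> K" if "x \<in> J" for x using D(1) that by blast
  show ?thesis
  proof (rule K.fracI)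
    show "\<sigma> ` J \<subseteq> K" using JK \<sigma> by auto
    show "0 \<in> \<sigma> ` J" using D(2) gal_0[OF \<sigma>] by force
    show "\<sigma> e \<in> \<sigma> ` J" "\<sigma> e \<noteq> 0" using e gal_eq_0_iff[OF \<sigma> JK[OF e(1)]] by auto
    show "\<sigma> d \<in> OK" "\<sigma> d \<noteq> 0" using d(1,2) \<sigma> gal_eq_0_iff[OF \<sigma>, of d] by auto
    fix u v assume "u \<in> \<sigma> ` J" "v \<in> \<sigma> ` J"
    then obtain x y where xy: "x \<in> J" "y \<in> J" "u = \<sigma> x" "v = \<sigma> y" by blast
    have "u + v = \<sigma> (x + y)" using gal_add[OF \<sigma> JK JK] xy by simp
    thus "u + v \<in> \<sigma> ` J" using D(3)[OF xy(1,2)] by blast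
  next
    fix a u assume a: "a \<in> OK" and "u \<in> \<sigma> ` J"
    then obtain x where x: "x \<in> J" "u = \<sigma> x" by blast
    have b: "ginv \<sigma> a \<in> OK" using a \<sigma> by simp
    have "a * u = \<sigma> (ginv \<sigma> a * x)" using gal_mult[OF \<sigma>, of "ginv \<sigma> a" x] JK[OF x(1)] b x(2) a \<sigma> by simp
    thus "a * u \<in> \<sigma> ` J" using D(4)[OF b x(1)] by blast
  next
    fix u assume "u \<in> \<sigma> ` J"
    then obtain x where x: "x \<in> J" "u = \<sigma> x" by blast
    have "\<sigma> d * u = \<sigma> (d * x)" using gal_mult[OF \<sigma>, of d x] JK[OF x(1)] d(1) x by simp
    moreover have "d * x \<in> OK" using d(3) x(1) by blast
    ultimately show "\<sigma> d * u \<in> OK" using gal_OK[OF \<sigma>] by simp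
  qed
qed

lemma gal_int_ideal [simp]: "\<sigma> \<in> carrier GG \<Longrightarrow> K.int_ideal J \<Longrightarrow> K.int_ideal (\<sigma> ` J)"
  unfolding K.int_ideal_def by auto

lemma gal_ideal_prod:
  assumes \<sigma>: "\<sigma> \<in> carrier GG" and IJ: "I \<subseteq> K" "J \<subseteq> K"
  shows "\<sigma> ` (I \<star> J) = \<sigma> ` I \<star> \<sigma> ` J"
proof
  have sub: "I \<star> J \<subseteq> K" if "I \<subseteq> K" "J \<subseteq> K" for I J
    using that by (intro ideal_prod_least) (auto simp: subset_iff)
  have *: "\<sigma> ` (I \<star> J) \<subseteq> \<sigma> ` I \<star> \<sigma> ` J" if \<sigma>: "\<sigma> \<in> carrier GG" and IJ: "I \<subseteq> K" "J \<subseteq> K" for \<sigma> I J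
  proof -
    have "I \<star> J \<subseteq> {x \<in> K. \<sigma> x \<in> \<sigma> ` I \<star> \<sigma> ` J}"
    proof (rule ideal_prod_least)
      show "0 \<in> {x \<in> K. \<sigma> x \<in> \<sigma> ` I \<star> \<sigma> ` J}" using gal_0[OF \<sigma>] by (simp add: ideal_prod_0)
      show "x + y \<in> {x \<in> K. \<sigma> x \<in> \<sigma> ` I \<star> \<sigma> ` J}"
        if "x \<in> {x \<in> K. \<sigma> x \<in> \<sigma> ` I \<star> \<sigma> ` J}" "y \<in> {x \<in> K. \<sigma> x \<in> \<sigma> ` I \<star> \<sigma> ` J}" for x y
        using that by (simp add: gal_add[OF \<sigma>] ideal_prod_add)
      show "a * b \<in> {x \<in> K. \<sigma> x \<in> \<sigma> ` I \<star> \<sigma> ` J}" if "a \<in> I" "b \<in> J" for a b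
      proof -
        have "a \<in> K" "b \<in> K" using that IJ by auto
        thus ?thesis using that by (simp add: gal_mult[OF \<sigma>] ideal_prod_mem)
      qed
    qed
    thus ?thesis by blast
  qed
  show "\<sigma> ` (I \<star> J) \<subseteq> \<sigma> ` I \<star> \<sigma> ` J" by (rule *[OF assms])
  have K: "\<sigma> ` I \<subseteq> K" "\<sigma> ` J \<subseteq> K" using IJ \<sigma> by auto
  have "ginv \<sigma> ` (\<sigma> ` I \<star> \<sigma> ` J) \<subseteq> I \<star> J"
    using *[OF GG.inv_closed[OF \<sigma>] K] gal_image_ginv(1)[OF \<sigma>] IJ by simp
  hence "\<sigma> ` (ginv \<sigma> ` (\<sigma> ` I \<star> \<sigma> ` J)) \<subseteq> \<sigma> ` (I \<star> J)" by (rule image_mono)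
  thus "\<sigma> ` I \<star> \<sigma> ` J \<subseteq> \<sigma> ` (I \<star> J)" using gal_image_ginv(2)[OF \<sigma> sub[OF K]] by simp
qed

lemma gal_image_hom: "\<sigma> \<in> carrier GG \<Longrightarrow> (\<lambda>J. \<sigma> ` J) \<in> hom (ideal_group K) (ideal_group K)"
  by (rule homI) (simp_all add: gal_ideal_prod K.fracD(1))

lemma gal_zpow: "\<sigma> \<in> carrier GG \<Longrightarrow> K.frac J \<Longrightarrow> \<sigma> ` (K.zpow J n) = K.zpow (\<sigma> ` J) n"
  using hom_int_pow[OF gal_image_hom, of \<sigma> J n] K.IG.is_group by simp

lemma gal_image_iv: "\<sigma> \<in> carrier GG \<Longrightarrow> K.frac J \<Longrightarrow> \<sigma> ` (K.iv J) = K.iv (\<sigma> ` J)"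
  using gal_zpow[of \<sigma> J "-1"] K.IG.int_pow_neg[of _ 1] by simp

lemma gal_pideal: "\<sigma> \<in> carrier GG \<Longrightarrow> x \<in> K \<Longrightarrow> \<sigma> ` K.pideal x = K.pideal (\<sigma> x)"
proof -
  assume \<sigma>: "\<sigma> \<in> carrier GG" and x: "x \<in> K"
  have *: "\<sigma> ` K.pideal x \<subseteq> K.pideal (\<sigma> x)" if \<sigma>: "\<sigma> \<in> carrier GG" and x: "x \<in> K" for \<sigma> x
  proof
    fix y assume "y \<in> \<sigma> ` K.pideal x"
    then obtain a where "a \<in> OK" "y = \<sigma> (x * a)" by (auto simp: K.pideal_iff)
    thus "y \<in> K.pideal (\<sigma> x)" using that K.pideal_memI(1)[OF gal_OK[OF \<sigma>, of a], of "\<sigma> x"] by (simp add: gal_mult)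
  qed
  have "K.pideal (\<sigma> x) \<subseteq> K" using \<sigma> x by (auto simp: K.pideal_iff)
  hence "K.pideal (\<sigma> x) = \<sigma> ` (ginv \<sigma> ` K.pideal (\<sigma> x))" using gal_image_ginv(2)[OF \<sigma>] by simp
  also have "\<dots> \<subseteq> \<sigma> ` K.pideal x" using *[of "ginv \<sigma>" "\<sigma> x"] \<sigma> x by (intro image_mono) simp
  finally show ?thesis using *[OF \<sigma> x] by blast
qed

lemma gal_prime [simp]:
  assumes \<sigma>: "\<sigma> \<in> carrier GG" and P: "P \<in> primes_of K" shows "\<sigma> ` P \<in> primes_of K"
proof -
  note PD = K.primeD[OF P]
  have PK: "P \<subseteq> K" using PD(3) K.OL_subset_L by blast
  have iff: "a \<in> \<sigma> ` P \<longleftrightarrow> ginv \<sigma> a \<in> P" if "a \<in> OK" for a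
    using gal_image_mem_iff[OF \<sigma> PK, of "ginv \<sigma> a"] \<sigma> that by simp
  have "\<sigma> ` P \<noteq> OK"
    using iff[of 1] PD(4) gal_1[of "ginv \<sigma>"] \<sigma> K.OL_1 by auto
  moreover have "a \<in> \<sigma> ` P \<or> b \<in> \<sigma> ` P" if "a \<in> OK" "b \<in> OK" "a * b \<in> \<sigma> ` P" for a b
    using PD(5)[of "ginv \<sigma> a" "ginv \<sigma> b"] iff[of a] iff[of b] iff[of "a * b"] gal_mult[of "ginv \<sigma>" a b] that \<sigma>
    by simp
  ultimately show ?thesis using \<sigma> PD(1) unfolding K.primes_of_iff by simp
qed

lemma gal_coprime_to:
  assumes \<sigma>: "\<sigma> \<in> carrier GG" and P: "P \<in> primes_of K" and A: "K.coprime_to P A"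
  shows "K.coprime_to (\<sigma> ` P) (\<sigma> ` A)"
  using A gal_image_subset_iff[OF \<sigma>, of A P] K.primeD(2)[OF P] K.fracD(1) \<sigma>
  unfolding K.coprime_to_def by (simp add: K.int_idealD(1))

lemma gal_vord:
  assumes \<sigma>: "\<sigma> \<in> carrier GG" and P: "P \<in> primes_of K" and J: "K.frac J"
  shows "K.vord (\<sigma> ` P) (\<sigma> ` J) = K.vord P J"
proof (rule K.vord_eqI)
  obtain A B where AB: "K.coprime_to P A" "K.coprime_to P B" "J \<star> B = K.zpow P (K.vord P J) \<star> A"
    using K.has_ord_vord[OF P J] unfolding K.has_ord_def by blast
  note fr = K.fracD(1)[OF K.coprime_toD(1)[OF AB(1)]] K.fracD(1)[OF K.coprime_toD(1)[OF AB(2)]]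
    K.fracD(1)[OF J] K.fracD(1)[OF K.frac_zpow[OF K.primeD(2)[OF P]]]
  have "\<sigma> ` J \<star> \<sigma> ` B = K.zpow (\<sigma> ` P) (K.vord P J) \<star> \<sigma> ` A"
    using arg_cong[OF AB(3), of "\<lambda>J. \<sigma> ` J"] gal_ideal_prod[OF \<sigma>] fr gal_zpow[OF \<sigma> K.primeD(2)[OF P]] by simp
  thus "K.has_ord (\<sigma> ` P) (\<sigma> ` J) (K.vord P J)"
    unfolding K.has_ord_def using gal_coprime_to[OF \<sigma> P] AB(1,2) by blast
qed (use assms in auto)

lemma gal_vo:
  assumes \<sigma>: "\<sigma> \<in> carrier GG" and P: "P \<in> primes_of K" and x: "x \<in> K" "x \<noteq> 0"
  shows "K.vo (\<sigma> ` P) (\<sigma> x) = K.vo P x"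
  using assms gal_vord[OF \<sigma> P, of "K.pideal x"] gal_eq_0_iff[OF \<sigma> x(1)] by (simp add: K.vo_eq gal_pideal)

lemma gal_vge:
  assumes \<sigma>: "\<sigma> \<in> carrier GG" and P: "P \<in> primes_of K" and "K.vge P n x"
  shows "K.vge (\<sigma> ` P) n (\<sigma> x)"
  using assms gal_vo[OF \<sigma> P, of x] gal_0[OF \<sigma>] unfolding K.vge_def by (cases "x = 0") auto

end

section \<open>Primes in Galois extensions\<close>

lemma (in number_ring) vge_diff_1_mem:
  assumes "P \<in> primes_of L" "z \<in> OL" "z = 1 \<or> 1 \<le> vo P (z - 1)" shows "1 - z \<in> P"
proof (cases "z = 1")
  case True thus ?thesis using fracD(2)[OF primeD(2)[OF assms(1)]] by simp
next
  case False
  hence "z - 1 \<in> P" using assms vo_pos_iff[of P "z - 1"] by auto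
  thus ?thesis using frac_uminus[OF primeD(2)[OF assms(1)], of "z - 1"] by simp
qed

context galois_ext
begin

lemma prime_below:
  assumes P: "P \<in> primes_of K" shows "P \<inter> F \<in> primes_of F"
proof -
  note PD = K.primeD[OF P]
  obtain a where a: "a \<in> P" "a \<noteq> 0" using K.fracD(5)[OF PD(2)] by blast
  have aO: "a \<in> OK" using a PD(3) by blast
  obtain m :: int and y where m: "m > 0" "y \<in> OK" "of_int m = a * y"
    by (rule K.divides_positive_int[OF aO a(2)])
  have mP: "of_int m \<in> P" unfolding m(3) using K.fracD(4)[OF PD(2) m(2) a(1)] by (simp add: mult.commute)
  have sub: "P \<inter> F \<subseteq> OF" using PD(3) OF_eq by blast
  have int: "F.int_ideal (P \<inter> F)"
  proof (rule F.int_idealI[OF sub])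
    show "0 \<in> P \<inter> F" using K.fracD(2)[OF PD(2)] by simp
    show "of_int m \<in> P \<inter> F" "of_int m \<noteq> (0::'a)" using mP m(1) by auto
    show "x + y \<in> P \<inter> F" if "x \<in> P \<inter> F" "y \<in> P \<inter> F" for x y
      using that K.fracD(3)[OF PD(2)] by simp
    show "b * x \<in> P \<inter> F" if "b \<in> OF" "x \<in> P \<inter> F" for b x
      using that K.fracD(4)[OF PD(2), of b x] by simp
  qed
  have "P \<inter> F \<noteq> OF" using PD(4) F.OL_1 by blast
  moreover have "\<forall>a\<in>OF. \<forall>b\<in>OF. a * b \<in> P \<inter> F \<longrightarrow> a \<in> P \<inter> F \<or> b \<in> P \<inter> F"
  proof (intro ballI impI)
    fix a b assume "a \<in> OF" "b \<in> OF" "a * b \<in> P \<inter> F"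
    thus "a \<in> P \<inter> F \<or> b \<in> P \<inter> F" using PD(5)[of a b] by auto
  qed
  ultimately show ?thesis using int unfolding F.primes_of_iff by blast
qed

text \<open>Otherwise an element of \<open>Q\<close> congruent to 1 modulo all conjugates of \<open>P\<close> would have its norm
  in \<open>Q \<inter> F = P \<inter> F\<close>.\<close>

lemma gal_transitive:
  assumes P: "P \<in> primes_of K" and Q: "Q \<in> primes_of K" and PQ: "P \<inter> F = Q \<inter> F"
  obtains \<sigma> where "\<sigma> \<in> carrier GG" "\<sigma> ` P = Q"
proof -
  have "\<exists>\<sigma>\<in>carrier GG. \<sigma> ` P = Q"
  proof (rule ccontr)
    assume no: "\<not> ?thesis"
    define S where "S = (\<lambda>\<sigma>. \<sigma> ` P) ` carrier GG"
    have S: "finite S" "S \<subseteq> primes_of K" "Q \<notin> S" using finite_GG gal_prime P no unfolding S_def by auto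
    have one: "0 < (1::nat)" by simp
    have "\<exists>x\<in>Q. \<forall>R\<in>S. x \<notin> R"
    proof (rule K.weak_approximation[OF Q S one])
      fix z assume z: "z \<in> OK" "z \<noteq> 0" "z = 1 \<or> int 1 \<le> K.vo Q (z - 1)" "\<And>R. R \<in> S \<Longrightarrow> int 1 \<le> K.vo R z"
      have zQ: "1 - z \<in> Q" using K.vge_diff_1_mem[OF Q z(1)] z(3) by simp
      have "1 - z \<notin> R" if R: "R \<in> S" for R
      proof
        assume "1 - z \<in> R"
        have RP: "R \<in> primes_of K" using R S(2) by blast
        have "z \<in> R" using z(4)[OF R] K.vo_pos_iff[OF RP z(1,2)] by simp
        hence "1 \<in> R" using K.fracD(3)[OF K.primeD(2)[OF RP] \<open>1 - z \<in> R\<close>, of z] by simp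
        thus False using K.primeD(4)[OF RP] by blast
      qed
      thus ?thesis using zQ by blast
    qed
    then obtain x where x: "x \<in> Q" "\<And>R. R \<in> S \<Longrightarrow> x \<notin> R" by blast
    have xO: "x \<in> OK" using x(1) K.primeD(3)[OF Q] by blast
    have N: "(\<Prod>\<sigma>\<in>carrier GG. \<sigma> x) = (\<Prod>\<sigma>\<in>carrier GG - {\<one>\<^bsub>GG\<^esub>}. \<sigma> x) * x"
      using finite_GG xO prod.remove[of "carrier GG" "\<one>\<^bsub>GG\<^esub>" "\<lambda>\<sigma>. \<sigma> x"] by (simp add: mult.commute)
    moreover have "(\<Prod>\<sigma>\<in>carrier GG - {\<one>\<^bsub>GG\<^esub>}. \<sigma> x) \<in> OK" using xO by (intro K.OL_prod) auto
    ultimately have "(\<Prod>\<sigma>\<in>carrier GG. \<sigma> x) \<in> Q" using K.fracD(4)[OF K.primeD(2)[OF Q] _ x(1)] by simp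
    hence NP: "(\<Prod>\<sigma>\<in>carrier GG. \<sigma> x) \<in> P" using gal_norm_in_F[of x] xO PQ by auto
    have "\<exists>\<sigma>\<in>T. \<sigma> x \<in> P" if "finite T" "T \<subseteq> carrier GG" "(\<Prod>\<sigma>\<in>T. \<sigma> x) \<in> P" for T
      using that
    proof (induction T rule: finite_induct)
      case empty thus ?case using K.primeD(4)[OF P] by simp
    next
      case (insert \<sigma> T)
      have "(\<Prod>\<sigma>\<in>T. \<sigma> x) \<in> OK" using insert.prems(1) xO by (intro K.OL_prod) auto
      moreover have "\<sigma> x \<in> OK" using insert.prems(1) xO by simp
      ultimately have "\<sigma> x \<in> P \<or> (\<Prod>\<sigma>\<in>T. \<sigma> x) \<in> P"
        using K.primeD(5)[OF P, of "\<sigma> x"] insert.prems(2) insert.hyps by simp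
      thus ?case using insert.IH insert.prems(1) by auto
    qed
    from this[OF finite_GG subset_refl NP] obtain \<sigma> where \<sigma>: "\<sigma> \<in> carrier GG" "\<sigma> x \<in> P" by blast
    have "x = ginv \<sigma> (\<sigma> x)" using \<sigma>(1) xO by simp
    hence "x \<in> ginv \<sigma> ` P" using \<sigma>(2) by blast
    moreover have "ginv \<sigma> ` P \<in> S" unfolding S_def using \<sigma>(1) by blast
    ultimately show False using x(2) by blast
  qed
  thus thesis using that by blast
qed

lemma gal_image_inter_F:
  assumes "\<sigma> \<in> carrier GG" "J \<subseteq> K" shows "\<sigma> ` J \<inter> F = J \<inter> F"
proof -
  have "x \<in> \<sigma> ` J \<longleftrightarrow> x \<in> J" if "x \<in> F" for x
    using gal_image_mem_iff[OF assms, of x] gal_fix[OF assms(1) that] that by simp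
  thus ?thesis by blast
qed

lemma prime_subset_K: "P \<in> primes_of K \<Longrightarrow> P \<subseteq> K"
  using K.primeD(2) K.fracD(1) by blast

subsection \<open>Extension of ideals\<close>

abbreviation ext :: "'a set \<Rightarrow> 'a set" where "ext J \<equiv> J \<star> OK"

lemma ext_frac [simp]:
  assumes "F.frac J" shows "K.frac (ext J)"
proof -
  note D = F.fracD[OF assms]
  obtain e where e: "e \<in> J" "e \<noteq> 0" using D(5) by blast
  obtain d where d: "d \<in> OF" "d \<noteq> 0" "\<forall>x\<in>J. d * x \<in> OF" using D(6) by blast
  have JK: "J \<subseteq> K" using D(1) by auto
  show ?thesis
  proof (rule K.fracI)
    show "ext J \<subseteq> K" using JK by (intro ideal_prod_least) (auto simp: subset_iff)
    show "0 \<in> ext J" by (rule ideal_prod_0)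
    show "e \<in> ext J" using ideal_prod_mem[OF e(1) K.OL_1] by simp
    show "e \<noteq> 0" "d \<in> OK" "d \<noteq> 0" using e d by auto
    show "x + y \<in> ext J" if "x \<in> ext J" "y \<in> ext J" for x y using that by (rule ideal_prod_add)
  next
    fix a x assume a: "a \<in> OK" and "x \<in> ext J"
    have "ext J \<subseteq> {x. a * x \<in> ext J}"
    proof (rule ideal_prod_least; clarify)
      show "a * 0 \<in> ext J" by (simp add: ideal_prod_0)
      show "a * (x + y) \<in> ext J" if "a * x \<in> ext J" "a * y \<in> ext J" for x y
        using ideal_prod_add[OF that] by (simp add: distrib_left)
      show "a * (x * b) \<in> ext J" if "x \<in> J" "b \<in> OK" for x b
        using ideal_prod_mem[OF that(1) K.OL_mult[OF a that(2)]] by (simp add: mult.left_commute)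
    qed
    thus "a * x \<in> ext J" using \<open>x \<in> ext J\<close> by blast
  next
    fix x assume "x \<in> ext J"
    have "ext J \<subseteq> {x. d * x \<in> OK}"
    proof (rule ideal_prod_least; clarify)
      show "d * (x + y) \<in> OK" if "d * x \<in> OK" "d * y \<in> OK" for x y
        using K.OL_add[OF that] by (simp add: distrib_left)
      show "d * (x * b) \<in> OK" if "x \<in> J" "b \<in> OK" for x b
      proof -
        have "d * x \<in> OF" using d(3) that(1) by blast
        from K.OL_mult[OF OF_in_OK[OF this] that(2)] show ?thesis by (simp add: mult.assoc)
      qed
    qed simp
    thus "d * x \<in> OK" using \<open>x \<in> ext J\<close> by blast
  qed (rule e(1))?
qed

lemma ext_mult: "ext (I \<star> J) = ext I \<star> ext J"
proof -
  have "ext I \<star> ext J = (I \<star> J) \<star> (OK \<star> OK)" by (simp only: ideal_prod_ac)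
  thus ?thesis by simp
qed

lemma ext_OF [simp]: "ext OF = OK"
proof
  show "ext OF \<subseteq> OK" by (rule ideal_prod_least) auto
  show "OK \<subseteq> ext OF" using ideal_prod_mem[OF F.OL_1, of _ OK] by auto
qed

lemma ext_hom: "ext \<in> hom (ideal_group F) (ideal_group K)"
  by (rule homI) (simp_all add: ext_mult)

lemma ext_zpow: "F.frac J \<Longrightarrow> ext (F.zpow J n) = K.zpow (ext J) n"
  using hom_int_pow[OF ext_hom, of J n] K.IG.is_group F.IG.is_group by simp

lemma subset_ext: "J \<subseteq> ext J"
  using ideal_prod_mem[OF _ K.OL_1, of _ J] by auto

lemma ext_pideal: assumes "x \<in> F" shows "ext (F.pideal x) = K.pideal x"
proof
  show "ext (F.pideal x) \<subseteq> K.pideal x"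
  proof (rule ideal_prod_least)
    show "0 \<in> K.pideal x" using K.pideal_memI(1)[OF K.OL_0, of x] by simp
    show "u + v \<in> K.pideal x" if "u \<in> K.pideal x" "v \<in> K.pideal x" for u v
      using that unfolding K.pideal_iff by (auto simp: distrib_left[symmetric])
    show "u * b \<in> K.pideal x" if "u \<in> F.pideal x" "b \<in> OK" for u b
      using that unfolding F.pideal_iff by (auto simp: mult.assoc intro!: K.pideal_memI(1))
  qed
  show "K.pideal x \<subseteq> ext (F.pideal x)"
    using ideal_prod_mem[OF F.pideal_memI(2)] by (auto simp: K.pideal_iff)
qed

lemma gal_ext_ideal: "\<sigma> \<in> carrier GG \<Longrightarrow> F.frac J \<Longrightarrow> \<sigma> ` ext J = ext J"
proof -
  assume *: "\<sigma> \<in> carrier GG" "F.frac J"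
  have JF: "J \<subseteq> F" by (rule F.fracD(1)[OF *(2)])
  hence "\<sigma> ` J = J" using gal_fix[OF *(1)] by force
  thus ?thesis using gal_ideal_prod[OF *(1), of J OK] JF F_subset_K K.OL_subset_L * by simp
qed

lemma ext_int_ideal: "F.int_ideal A \<Longrightarrow> K.int_ideal (ext A)"
proof -
  assume A: "F.int_ideal A"
  have "ext A \<subseteq> ext OF" by (intro ideal_prod_mono F.int_idealD(2)[OF A] subset_refl)
  thus ?thesis using F.int_idealD(1)[OF A] unfolding K.int_ideal_def by simp
qed

lemma ext_subset_iff:
  assumes "P \<in> primes_of K" "A \<subseteq> F" shows "ext A \<subseteq> P \<longleftrightarrow> A \<subseteq> P \<inter> F"
proof
  assume "ext A \<subseteq> P" thus "A \<subseteq> P \<inter> F" using subset_ext[of A] assms(2) by blast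
next
  assume "A \<subseteq> P \<inter> F"
  hence "ext A \<subseteq> P \<star> OK" by (intro ideal_prod_mono) auto
  thus "ext A \<subseteq> P" using K.primeD(2)[OF assms(1)] by simp
qed

definition ram :: "'a set \<Rightarrow> int" where
  "ram P = K.vord P (ext (P \<inter> F))"

lemma ram_pos:
  assumes P: "P \<in> primes_of K" shows "ram P > 0"
proof -
  have "ext (P \<inter> F) \<subseteq> P" using ext_subset_iff[OF P, of "P \<inter> F"] by blast
  moreover have "K.int_ideal (ext (P \<inter> F))" by (intro ext_int_ideal F.primeD(1) prime_below P)
  ultimately show ?thesis unfolding ram_def using K.vord_int_pos_iff[OF P] by blast
qed

lemma vord_ext:
  assumes P: "P \<in> primes_of K" and J: "F.frac J"
  shows "K.vord P (ext J) = ram P * F.vord (P \<inter> F) J"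
proof -
  define v where "v = P \<inter> F"
  have v: "v \<in> primes_of F" unfolding v_def by (rule prime_below[OF P])
  note fv = F.primeD(2)[OF v]
  have *: "K.vord P (ext A) = 0" if "F.coprime_to v A" for A
  proof (rule K.vord_coprime[OF P])
    have A: "F.int_ideal A" "\<not> A \<subseteq> v" using that unfolding F.coprime_to_def by auto
    have "A \<subseteq> F" using F.fracD(1) F.int_idealD(1)[OF A(1)] by blast
    thus "K.coprime_to P (ext A)"
      using A ext_subset_iff[OF P, of A] ext_int_ideal[OF A(1)] unfolding K.coprime_to_def v_def by blast
  qed
  obtain A B where AB: "F.coprime_to v A" "F.coprime_to v B" "J \<star> B = F.zpow v (F.vord v J) \<star> A"
    using F.has_ord_vord[OF v J] unfolding F.has_ord_def by blast
  note fr = F.coprime_toD(1)[OF AB(1)] F.coprime_toD(1)[OF AB(2)]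
  have "ext J \<star> ext B = K.zpow (ext v) (F.vord v J) \<star> ext A"
    using arg_cong[OF AB(3), of ext] ext_zpow[OF fv] by (simp only: ext_mult)
  hence "K.vord P (ext J \<star> ext B) = K.vord P (K.zpow (ext v) (F.vord v J) \<star> ext A)" by (rule arg_cong)
  hence "K.vord P (ext J) = F.vord v J * K.vord P (ext v)"
    using P J fv fr *[OF AB(1)] *[OF AB(2)] by simp
  thus ?thesis unfolding ram_def v_def by (simp add: mult.commute)
qed

lemma vo_F:
  assumes "P \<in> primes_of K" "x \<in> F" "x \<noteq> 0" shows "K.vo P x = ram P * F.vo (P \<inter> F) x"
  using assms vord_ext[OF assms(1), of "F.pideal x"] prime_below[OF assms(1)]
  by (simp add: K.vo_eq F.vo_eq ext_pideal)

subsection \<open>Almost invariant elements\<close>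

abbreviation Dec :: "'a set \<Rightarrow> ('a \<Rightarrow> 'a) set" where
  "Dec P \<equiv> carrier (decomposition_group K F P)"

lemma Dec_iff: "\<sigma> \<in> Dec P \<longleftrightarrow> \<sigma> \<in> carrier GG \<and> \<sigma> ` P = P"
  unfolding decomposition_group_def by simp

lemma finite_Dec: "finite (Dec P)"
  by (rule finite_subset[OF _ finite_GG]) (auto simp: Dec_iff)

text \<open>Localizing at \<open>P\<close> by weak approximation, the trace from \<open>K\<close> to \<open>F\<close> of an element that is nearly
  invariant under the decomposition group is close to a multiple of this element.\<close>

lemma ram_dvd_vo_almost_invariant:
  assumes P: "P \<in> primes_of K" and x: "x \<in> K" "x \<noteq> 0"
    and inv: "\<And>\<sigma>. \<sigma> \<in> Dec P \<Longrightarrow> K.vge P (K.vo P (of_nat (card (Dec P)) * x) + 1) (\<sigma> x - x)"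
  shows "ram P dvd K.vo P x"
proof -
  define d :: 'a where "d = of_nat (card (Dec P))"
  have "\<one>\<^bsub>GG\<^esub> \<in> Dec P" using gal_image_one[OF prime_subset_K[OF P]] by (simp add: Dec_iff)
  hence "card (Dec P) \<noteq> 0" using finite_Dec by auto
  hence d: "d \<in> F" "d \<noteq> 0" unfolding d_def by auto
  define n where "n = K.vo P (d * x) + 1"
  define S where "S = (\<lambda>\<sigma>. \<sigma> ` P) ` carrier GG - {P}"
  have S: "finite S" "S \<subseteq> primes_of K" "P \<notin> S" using finite_GG gal_prime P unfolding S_def by auto
  define N where "N = nat (Max ((\<lambda>Q. n - K.vo Q x) ` insert P S)) + 1"
  have N: "n - K.vo Q x \<le> int N" if "Q \<in> insert P S" for Q
  proof -
    have "n - K.vo Q x \<le> Max ((\<lambda>Q. n - K.vo Q x) ` insert P S)" using S(1) that by (intro Max_ge) auto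
    thus ?thesis unfolding N_def by simp
  qed
  have "N > 0" unfolding N_def by simp
  obtain z where z: "z \<in> OK" "z \<noteq> 0" "z = 1 \<or> int N \<le> K.vo P (z - 1)" "\<And>Q. Q \<in> S \<Longrightarrow> int N \<le> K.vo Q z"
    using K.weak_approximation[OF P S \<open>N > 0\<close>] by blast
  have zK: "z \<in> K" using z(1) by simp
  define y where "y = (\<Sum>\<sigma>\<in>carrier GG. \<sigma> (z * x))"
  have yF: "y \<in> F" unfolding y_def using zK x by (intro gal_trace_in_F) simp
  have inD: "K.vge P n (\<sigma> (z * x) - x)" if \<sigma>: "\<sigma> \<in> Dec P" for \<sigma>
  proof -
    have \<sigma>G: "\<sigma> \<in> carrier GG" "\<sigma> ` P = P" using \<sigma> by (simp_all add: Dec_iff)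
    have "K.vge P (int N) (z - 1)" using z(3) zK unfolding K.vge_def by auto
    hence "K.vge P (int N) (\<sigma> (z - 1))" using gal_vge[OF \<sigma>G(1) P] \<sigma>G(2) by simp
    moreover have "K.vge P (K.vo P x) x" using x unfolding K.vge_def by simp
    ultimately have "K.vge P (int N + K.vo P x) (\<sigma> (z - 1) * x)" by (rule K.vge_mult[OF P])
    hence 1: "K.vge P n (\<sigma> (z - 1) * x)" by (rule K.vge_mono) (use N[of P] in simp)
    have "K.vge P (0 + n) (\<sigma> z * (\<sigma> x - x))"
      using inv[OF \<sigma>] \<sigma>G z(1) unfolding n_def d_def by (intro K.vge_mult[OF P K.vge_OL[OF P]]) auto
    hence 2: "K.vge P n (\<sigma> z * (\<sigma> x - x))" by simp
    have e: "\<sigma> (z - 1) = \<sigma> z - 1" using gal_diff[OF \<sigma>G(1) zK K.L_1] gal_1[OF \<sigma>G(1)] by simp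
    have "\<sigma> (z * x) - x = \<sigma> z * (\<sigma> x - x) + \<sigma> (z - 1) * x"
      unfolding gal_mult[OF \<sigma>G(1) zK x(1)] e by (simp add: algebra_simps)
    thus ?thesis using K.vge_add[OF P 2 1] by simp
  qed
  have notD: "K.vge P n (\<sigma> (z * x))" if \<sigma>: "\<sigma> \<in> carrier GG" "\<sigma> \<notin> Dec P" for \<sigma>
  proof -
    define Q where "Q = ginv \<sigma> ` P"
    have \<sigma>Q: "\<sigma> ` Q = P" unfolding Q_def using gal_image_ginv(2)[OF \<sigma>(1) prime_subset_K[OF P]] .
    have "Q \<noteq> P" using \<sigma>Q \<sigma> by (auto simp: Dec_iff)
    hence QS: "Q \<in> S" unfolding S_def Q_def using \<sigma>(1) by auto
    hence Q: "Q \<in> primes_of K" using S(2) by blast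
    have "n \<le> K.vo Q z + K.vo Q x" using N[of Q] QS z(4)[OF QS] by simp
    hence "K.vge Q n (z * x)" using K.vo_mult[OF Q zK z(2) x] zK x unfolding K.vge_def by simp
    thus ?thesis using gal_vge[OF \<sigma>(1) Q] \<sigma>Q by simp
  qed
  have "y = (\<Sum>\<sigma>\<in>Dec P. \<sigma> (z * x)) + (\<Sum>\<sigma>\<in>carrier GG - Dec P. \<sigma> (z * x))"
    unfolding y_def using finite_GG by (subst sum.subset_diff[of "Dec P"]) (auto simp: Dec_iff add.commute)
  hence "y - d * x = (\<Sum>\<sigma>\<in>Dec P. \<sigma> (z * x) - x) + (\<Sum>\<sigma>\<in>carrier GG - Dec P. \<sigma> (z * x))"
    by (simp add: sum_subtractf d_def)
  moreover have "K.vge P n \<dots>"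
    by (intro K.vge_add[OF P] K.vge_sum[OF P] inD notD) auto
  ultimately have yd: "K.vge P (K.vo P (d * x) + 1) (y - d * x)" unfolding n_def by simp
  have dx: "d * x \<in> K" "d * x \<noteq> 0" using d x by auto
  note y = K.vge_dominant[OF P dx yd]
  have "K.vo P x = K.vo P y - K.vo P d"
    using y(3) K.vo_mult[OF P _ d(2) x] d(1) by simp
  also have "\<dots> = ram P * (F.vo (P \<inter> F) y - F.vo (P \<inter> F) d)"
    using vo_F[OF P yF y(2)] vo_F[OF P d] by (simp add: algebra_simps)
  finally show ?thesis by simp
qed

end

section \<open>Class groups\<close>

context number_ring
begin

abbreviation cls :: "'a set \<Rightarrow> 'a set set" where "cls \<equiv> ideal_class L"

lemma principal_ideals_iff: "J \<in> principal_ideals L \<longleftrightarrow> (\<exists>x\<in>L. x \<noteq> 0 \<and> J = pideal x)"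
  unfolding principal_ideals_def by auto

lemma pideal_inverse: "x \<in> L \<Longrightarrow> x \<noteq> 0 \<Longrightarrow> iv (pideal x) = pideal (inverse x)"
  using IG.inv_equality[of "pideal (inverse x)" "pideal x"] by (simp add: pideal_mult)

lemma subgroup_principal: "subgroup (principal_ideals L) (ideal_group L)"
proof (rule IG.subgroupI)
  show "principal_ideals L \<subseteq> carrier (ideal_group L)" by (auto simp: principal_ideals_iff)
  show "principal_ideals L \<noteq> {}"
  proof -
    have "pideal 1 \<in> principal_ideals L" unfolding principal_ideals_iff by (intro bexI[of _ 1]) simp_all
    thus ?thesis by blast
  qed
  show "iv J \<in> principal_ideals L" if J: "J \<in> principal_ideals L" for J
  proof -
    obtain x where x: "x \<in> L" "x \<noteq> 0" "J = pideal x" using J by (auto simp: principal_ideals_iff)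
    thus ?thesis unfolding principal_ideals_iff
      by (intro bexI[of _ "inverse x"]) (simp_all add: pideal_inverse)
  qed
  show "I \<otimes>\<^bsub>ideal_group L\<^esub> J \<in> principal_ideals L" if IJ: "I \<in> principal_ideals L" "J \<in> principal_ideals L" for I J
  proof -
    obtain x y where "x \<in> L" "x \<noteq> 0" "I = pideal x" "y \<in> L" "y \<noteq> 0" "J = pideal y"
      using IJ by (auto simp: principal_ideals_iff)
    thus ?thesis unfolding principal_ideals_iff by (intro bexI[of _ "x * y"]) (simp_all add: pideal_mult)
  qed
qed

lemma normal_principal: "normal (principal_ideals L) (ideal_group L)"
  by (rule IG.subgroup_imp_normal[OF subgroup_principal])

lemma comm_group_class_group: "comm_group (class_group L)"
  unfolding class_group_def by (rule IG.abelian_FactGroup[OF subgroup_principal])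

sublocale CG: comm_group "class_group L"
  by (rule comm_group_class_group)

lemma carrier_class_group: "carrier (class_group L) = cls ` {J. frac J}"
  unfolding class_group_def ideal_class_def carrier_FactGroup by simp

lemma cls_hom: "cls \<in> hom (ideal_group L) (class_group L)"
  unfolding class_group_def
  using normal.r_coset_hom_Mod[OF normal_principal] by (simp add: ideal_class_def[abs_def])

lemma cls_closed [simp]: "frac J \<Longrightarrow> cls J \<in> carrier (class_group L)"
  by (simp add: carrier_class_group)

lemma cls_mult: "frac I \<Longrightarrow> frac J \<Longrightarrow> cls (I \<star> J) = cls I \<otimes>\<^bsub>class_group L\<^esub> cls J"
  using hom_mult[OF cls_hom, of I J] by simp

lemma mem_cls_iff: "I \<in> cls J \<longleftrightarrow> (\<exists>x\<in>L. x \<noteq> 0 \<and> I = pideal x \<star> J)"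
  unfolding ideal_class_def r_coset_def by (auto simp: principal_ideals_def)

lemma cls_self: "frac J \<Longrightarrow> J \<in> cls J"
  unfolding mem_cls_iff by (intro bexI[of _ 1]) simp_all

lemma cls_eqI: "frac J \<Longrightarrow> I \<in> cls J \<Longrightarrow> cls I = cls J"
  unfolding ideal_class_def
  using IG.repr_independence[OF _ _ subgroup_principal, of I J] by simp

lemma cls_eq_iff:
  assumes "frac I" "frac J" shows "cls I = cls J \<longleftrightarrow> (\<exists>x\<in>L. x \<noteq> 0 \<and> I = pideal x \<star> J)"
  using cls_eqI[OF assms(2), of I] cls_self[OF assms(1)] mem_cls_iff[of I J] by metis

lemma class_mem:
  assumes "C \<in> carrier (class_group L)" "J \<in> C" shows "frac J" "C = cls J"
proof -
  obtain I where I: "frac I" "C = cls I" using assms(1) by (auto simp: carrier_class_group)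
  obtain x where x: "x \<in> L" "x \<noteq> 0" "J = pideal x \<star> I" using assms(2) I by (auto simp: mem_cls_iff)
  thus "frac J" using I by simp
  show "C = cls J" using cls_eqI[OF I(1), of J] assms(2) I(2) by simp
qed

end

section \<open>Residue degrees\<close>

context galois_ext
begin

abbreviation RK :: "'a ring" where "RK \<equiv> ring_on OK"
abbreviation resf :: "'a set \<Rightarrow> 'a set ring" where "resf P \<equiv> RK Quot P"
abbreviation rpi :: "'a set \<Rightarrow> 'a \<Rightarrow> 'a set" where "rpi P x \<equiv> P +>\<^bsub>RK\<^esub> x"

lemma rpi_eq: "rpi P x = (\<lambda>p. p + x) ` P"
  by (auto simp: a_r_coset_def')

lemma carrier_resf: "carrier (resf P) = rpi P ` OK"
  by (auto simp: FactRing_def A_RCOSETS_def' )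

context
  fixes P assumes P: "P \<in> primes_of K"
begin

interpretation RK: cring RK by (rule K.cring_OL)
interpretation Pr: primeideal P RK using P by (simp add: primes_of_def)
interpretation kP: domain "resf P" by (rule Pr.quotient_is_domain)

lemma rpi_hom: "rpi P \<in> Ring.ring_hom RK (resf P)"
  by (rule Pr.rcos_ring_hom)

lemma rpi_mult: "x \<in> OK \<Longrightarrow> y \<in> OK \<Longrightarrow> rpi P x \<otimes>\<^bsub>resf P\<^esub> rpi P y = rpi P (x * y)"
  using ring_hom_mult[OF rpi_hom, of x y] by simp

lemma rpi_add: "x \<in> OK \<Longrightarrow> y \<in> OK \<Longrightarrow> rpi P x \<oplus>\<^bsub>resf P\<^esub> rpi P y = rpi P (x + y)"
  using ring_hom_add[OF rpi_hom, of x y] by simp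

lemma rpi_1: "rpi P 1 = \<one>\<^bsub>resf P\<^esub>"
  using ring_hom_one[OF rpi_hom] by simp

lemma rpi_closed: "x \<in> OK \<Longrightarrow> rpi P x \<in> carrier (resf P)"
  using ring_hom_closed[OF rpi_hom, of x] by simp

lemma rpi_eqI: assumes "x - y \<in> P" shows "rpi P x = rpi P y"
proof -
  note fP = K.primeD(2)[OF P]
  have "rpi P x \<subseteq> rpi P y" if xy: "x - y \<in> P" for x y
  proof
    fix z assume "z \<in> rpi P x"
    then obtain p where p: "p \<in> P" "z = p + x" by (auto simp: rpi_eq)
    have "z = (p + (x - y)) + y" using p by simp
    thus "z \<in> rpi P y" using K.fracD(3)[OF fP p(1) xy] unfolding rpi_eq by blast
  qed
  from this[of x y] this[of y x] show ?thesis using assms K.frac_uminus[OF fP assms] by simp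
qed

lemma rpi_0_iff: "x \<in> OK \<Longrightarrow> rpi P x = \<zero>\<^bsub>resf P\<^esub> \<longleftrightarrow> x \<in> P"
proof -
  assume x: "x \<in> OK"
  have z: "\<zero>\<^bsub>resf P\<^esub> = P" by (simp add: FactRing_def)
  have "x \<in> rpi P x" using K.fracD(2)[OF K.primeD(2)[OF P]] by (auto simp: rpi_eq image_iff intro: bexI[of _ 0])
  moreover have "rpi P x = rpi P 0" if "x \<in> P" using rpi_eqI[of x 0] that by simp
  moreover have "rpi P 0 = P" by (simp add: rpi_eq)
  ultimately show ?thesis using z by auto
qed

lemma finite_resf: "finite (carrier (resf P))"
proof -
  note PD = K.primeD[OF P]
  obtain a where a: "a \<in> P" "a \<noteq> 0" using K.fracD(5)[OF PD(2)] by blast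
  have aO: "a \<in> OK" using a PD(3) by blast
  obtain T where T: "finite T" "T \<subseteq> OK" "\<forall>x\<in>OK. \<exists>t\<in>T. \<exists>y\<in>OK. x = t + a * y"
    using K.finite_residues_nonzero[OF aO a(2)] unfolding K.finite_residues_def by blast
  have "carrier (resf P) \<subseteq> rpi P ` T"
  proof
    fix U assume "U \<in> carrier (resf P)"
    then obtain x where x: "x \<in> OK" "U = rpi P x" by (auto simp: carrier_resf)
    obtain t y where t: "t \<in> T" "y \<in> OK" "x = t + a * y" using T(3) x(1) by blast
    have "x - t \<in> P" using K.fracD(4)[OF PD(2) t(2) a(1)] t(3) by (simp add: mult.commute)
    thus "U \<in> rpi P ` T" using rpi_eqI[of x t] x t by blast
  qed
  thus ?thesis using T(1) finite_subset by blast
qed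

lemma subfield_residue: "subfield (rpi P ` OF) (resf P)"
proof (rule kP.subfieldI)
  interpret h: ring_hom_ring RK "resf P" "rpi P"
    by (rule ring_hom_ringI2[OF RK.ring_axioms kP.ring_axioms rpi_hom])
  have um: "\<ominus>\<^bsub>RK\<^esub> x = - x" if "x \<in> OK" for x
    by (rule RK.minus_equality) (use that in auto)
  have "subring OF RK"
    by (rule RK.subringI) (auto simp: um)
  hence "subring (rpi P ` OF) (resf P)" by (rule h.img_is_subring)
  thus "subcring (rpi P ` OF) (resf P)" by (rule kP.subcringI')
  show "Units (resf P\<lparr>carrier := rpi P ` OF\<rparr>) = rpi P ` OF - {\<zero>\<^bsub>resf P\<^esub>}"
  proof
    show "Units (resf P\<lparr>carrier := rpi P ` OF\<rparr>) \<subseteq> rpi P ` OF - {\<zero>\<^bsub>resf P\<^esub>}"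
    proof
      fix u assume "u \<in> Units (resf P\<lparr>carrier := rpi P ` OF\<rparr>)"
      then obtain y where u: "u \<in> rpi P ` OF" "y \<in> rpi P ` OF" "y \<otimes>\<^bsub>resf P\<^esub> u = \<one>\<^bsub>resf P\<^esub>"
        unfolding Units_def by auto
      have "y \<in> carrier (resf P)" using u(2) rpi_closed by auto
      hence "u \<noteq> \<zero>\<^bsub>resf P\<^esub>" using u(3) kP.one_not_zero by auto
      thus "u \<in> rpi P ` OF - {\<zero>\<^bsub>resf P\<^esub>}" using u(1) by blast
    qed
    show "rpi P ` OF - {\<zero>\<^bsub>resf P\<^esub>} \<subseteq> Units (resf P\<lparr>carrier := rpi P ` OF\<rparr>)"
    proof
      fix u assume "u \<in> rpi P ` OF - {\<zero>\<^bsub>resf P\<^esub>}"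
      then obtain x where x: "x \<in> OF" "u = rpi P x" "u \<noteq> \<zero>\<^bsub>resf P\<^esub>" by blast
      hence x: "x \<in> OF" "u = rpi P x" "x \<notin> P" using rpi_0_iff[of x] by simp_all
      have v: "P \<inter> F \<in> primes_of F" by (rule prime_below[OF P])
      note vD = F.primeD[OF v]
      obtain a where a: "a \<in> P \<inter> F" "a \<noteq> 0" using F.fracD(5)[OF vD(2)] by blast
      have aO: "a \<in> OF" using a vD(3) by blast
      obtain i k y where k: "k > 0" "y \<in> OF" "x ^ i * (1 - x ^ k) = a * y"
        by (rule F.power_relation[OF aO a(2) x(1)])
      have "x ^ i * (1 - x ^ k) \<in> P \<inter> F"
        unfolding k(3) using F.fracD(4)[OF vD(2) k(2) a(1)] by (simp add: mult.commute)
      moreover have "x ^ i \<notin> P \<inter> F" using F.prime_power_mem[OF v x(1)] x(3) x(1) by auto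
      ultimately have "1 - x ^ k \<in> P" using vD(5)[of "x ^ i" "1 - x ^ k"] x(1) by auto
      hence 1: "rpi P (x ^ k) = \<one>\<^bsub>resf P\<^esub>" using rpi_eqI[of 1 "x ^ k"] rpi_1 by simp
      define w where "w = x ^ (k - 1)"
      have e: "w * x = x ^ k" "x * w = x ^ k" unfolding w_def using k(1) by (cases k; simp)+
      have wO: "w \<in> OF" unfolding w_def using x by simp
      hence "rpi P w \<otimes>\<^bsub>resf P\<^esub> u = \<one>\<^bsub>resf P\<^esub>" "u \<otimes>\<^bsub>resf P\<^esub> rpi P w = \<one>\<^bsub>resf P\<^esub>"
        using 1 x rpi_mult[of w x] rpi_mult[of x w] by (simp_all add: e)
      moreover have "rpi P w \<in> rpi P ` OF" "u \<in> rpi P ` OF" using x wO by auto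
      ultimately have "\<exists>y\<in>rpi P ` OF. y \<otimes>\<^bsub>resf P\<^esub> u = \<one>\<^bsub>resf P\<^esub> \<and> u \<otimes>\<^bsub>resf P\<^esub> y = \<one>\<^bsub>resf P\<^esub>" by blast
      thus "u \<in> Units (resf P\<lparr>carrier := rpi P ` OF\<rparr>)"
        using \<open>u \<in> rpi P ` OF\<close> unfolding Units_def by simp
    qed
  qed
qed

lemma residue_dimension: "ring.dimension (resf P) (residue_degree K F P) (rpi P ` OF) (carrier (resf P))"
proof -
  obtain us where us: "set us = carrier (resf P)" using finite_list[OF finite_resf] by blast
  have "kP.Span (rpi P ` OF) us = carrier (resf P)"
    using kP.Span_base_incl[OF subfield_residue, of us] kP.Span_subgroup_props(1)[OF subfield_residue, of us] us
    by auto
  hence "kP.finite_dimension (rpi P ` OF) (carrier (resf P))"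
    using kP.Span_finite_dimension[OF subfield_residue, of us] us by simp
  from kP.finite_dimensionE[OF subfield_residue this] show ?thesis
    unfolding residue_degree_def Let_def over_def .
qed

lemma residue_degree_pos: "residue_degree K F P > 0"
proof (rule ccontr)
  assume "\<not> ?thesis"
  hence "carrier (resf P) = {\<zero>\<^bsub>resf P\<^esub>}"
    using residue_dimension kP.dimension_zero[OF subfield_residue] by simp
  thus False using kP.one_not_zero kP.one_closed by blast
qed

lemma residue_degree_eqI:
  "ring.dimension (resf P) n (rpi P ` OF) (carrier (resf P)) \<Longrightarrow> residue_degree K F P = n"
  using kP.dimension_is_inj[OF subfield_residue residue_dimension] by blast

lemma ring_residue: "ring (resf P)" "domain (resf P)"
  by (rule kP.ring_axioms kP.domain_axioms)+

end

lemma residue_degree_gal: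
  assumes \<sigma>: "\<sigma> \<in> carrier GG" and P: "P \<in> primes_of K"
  shows "residue_degree K F (\<sigma> ` P) = residue_degree K F P"
proof -
  note Q = gal_prime[OF \<sigma> P]
  note PK = prime_subset_K[OF P]
  have coset: "\<sigma> ` rpi P x = rpi (\<sigma> ` P) (\<sigma> x)" if "x \<in> OK" for x
    using that PK gal_add[OF \<sigma>] unfolding rpi_eq image_image by (intro image_cong refl) auto
  interpret h: ring_hom_ring "resf P" "resf (\<sigma> ` P)" "\<lambda>U. \<sigma> ` U"
  proof (rule ring_hom_ringI2[OF ring_residue(1)[OF P] ring_residue(1)[OF Q]], rule ring_hom_memI)
    show "\<sigma> ` U \<in> carrier (resf (\<sigma> ` P))" if "U \<in> carrier (resf P)" for U
      using that \<sigma> by (auto simp: carrier_resf coset)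
    show "\<sigma> ` (U \<otimes>\<^bsub>resf P\<^esub> V) = \<sigma> ` U \<otimes>\<^bsub>resf (\<sigma> ` P)\<^esub> \<sigma> ` V"
      "\<sigma> ` (U \<oplus>\<^bsub>resf P\<^esub> V) = \<sigma> ` U \<oplus>\<^bsub>resf (\<sigma> ` P)\<^esub> \<sigma> ` V"
      if XY: "U \<in> carrier (resf P)" "V \<in> carrier (resf P)" for U V
    proof -
      obtain x y where xy: "x \<in> OK" "U = rpi P x" "y \<in> OK" "V = rpi P y"
        using XY by (auto simp: carrier_resf)
      show "\<sigma> ` (U \<otimes>\<^bsub>resf P\<^esub> V) = \<sigma> ` U \<otimes>\<^bsub>resf (\<sigma> ` P)\<^esub> \<sigma> ` V"
        using xy \<sigma> by (simp add: rpi_mult[OF P] rpi_mult[OF Q] coset gal_mult[OF \<sigma>])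
      show "\<sigma> ` (U \<oplus>\<^bsub>resf P\<^esub> V) = \<sigma> ` U \<oplus>\<^bsub>resf (\<sigma> ` P)\<^esub> \<sigma> ` V"
        using xy \<sigma> by (simp add: rpi_add[OF P] rpi_add[OF Q] coset gal_add[OF \<sigma>])
    qed
    show "\<sigma> ` \<one>\<^bsub>resf P\<^esub> = \<one>\<^bsub>resf (\<sigma> ` P)\<^esub>"
      using coset[OF K.OL_1] gal_1[OF \<sigma>] by (simp add: rpi_1[OF P] rpi_1[OF Q])
  qed
  have inj: "inj_on (\<lambda>U. \<sigma> ` U) (carrier (resf P))"
  proof (rule inj_onI)
    fix U V assume XY: "U \<in> carrier (resf P)" "V \<in> carrier (resf P)" "\<sigma> ` U = \<sigma> ` V"
    have "U \<subseteq> K" "V \<subseteq> K" using XY(1,2) PK by (auto simp: carrier_resf rpi_eq)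
    thus "U = V" using gal_image_subset_iff[OF \<sigma>] XY(3) by (metis subset_antisym order_refl)
  qed
  have "(\<lambda>U. \<sigma> ` U) ` carrier (resf P) = carrier (resf (\<sigma> ` P))"
  proof -
    have "(\<lambda>U. \<sigma> ` U) ` carrier (resf P) = rpi (\<sigma> ` P) ` (\<sigma> ` OK)"
      unfolding carrier_resf image_image by (intro image_cong refl) (simp add: coset)
    thus ?thesis using \<sigma> by (simp add: carrier_resf)
  qed
  moreover have "(\<lambda>U. \<sigma> ` U) ` (rpi P ` OF) = rpi (\<sigma> ` P) ` OF"
    unfolding image_image by (intro image_cong refl) (simp add: coset gal_fix[OF \<sigma>])
  moreover have "\<one>\<^bsub>resf (\<sigma> ` P)\<^esub> \<noteq> \<zero>\<^bsub>resf (\<sigma> ` P)\<^esub>"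
    by (rule domain.one_not_zero[OF ring_residue(2)[OF Q]])
  ultimately have "h.S.dimension (residue_degree K F P) (rpi (\<sigma> ` P) ` OF) (carrier (resf (\<sigma> ` P)))"
    using h.inj_hom_dimension[OF subfield_residue[OF P] _ inj residue_dimension[OF P]] by simp
  thus ?thesis by (rule residue_degree_eqI[OF Q])
qed

end

section \<open>Invariant ideals and the relative Polya group\<close>

lemma quotient_hom:
  assumes f: "group_hom G A f" "f ` carrier G = carrier A" and N: "normal N A"
  shows "(G Mod {x \<in> carrier G. f x \<in> N}) \<cong> (A Mod N)" "group (G Mod {x \<in> carrier G. f x \<in> N})"
proof -
  interpret f: group_hom G A f by (rule f(1))
  interpret N: normal N A by (rule N)
  have hom: "(\<lambda>x. N #>\<^bsub>A\<^esub> f x) \<in> hom G (A Mod N)"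
    using hom_compose[OF f.homh N.r_coset_hom_Mod] by (simp add: comp_def)
  interpret q: group_hom G "A Mod N" "\<lambda>x. N #>\<^bsub>A\<^esub> f x"
    using hom N.factorgroup_is_group f.G.is_group by (intro group_hom.intro group_hom_axioms.intro)
  have ker: "kernel G (A Mod N) (\<lambda>x. N #>\<^bsub>A\<^esub> f x) = {x \<in> carrier G. f x \<in> N}"
    using f.H.coset_join1[OF _ _ N.subgroup_axioms] f.H.coset_join2[OF _ N.subgroup_axioms]
    by (auto simp: kernel_def)
  have surj: "(\<lambda>x. N #>\<^bsub>A\<^esub> f x) ` carrier G = carrier (A Mod N)"
    unfolding carrier_FactGroup f(2)[symmetric] by (simp add: image_image)
  show "(G Mod {x \<in> carrier G. f x \<in> N}) \<cong> (A Mod N)"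
    using q.FactGroup_iso[OF surj] unfolding ker .
  show "group (G Mod {x \<in> carrier G. f x \<in> N})"
    using normal.factorgroup_is_group[OF q.normal_kernel] unfolding ker .
qed

lemma quotient_iso:
  assumes f: "group_hom G A f" "f ` carrier G = carrier A" and g: "group_hom G B g" "g ` carrier G = carrier B"
    and N: "normal N A" and M: "normal M B" and NM: "\<And>x. x \<in> carrier G \<Longrightarrow> f x \<in> N \<longleftrightarrow> g x \<in> M"
  shows "A Mod N \<cong> B Mod M"
proof -
  have eq: "{x \<in> carrier G. f x \<in> N} = {x \<in> carrier G. g x \<in> M}" using NM by blast
  show ?thesis
    using group.iso_sym[OF quotient_hom(2)[OF f N] quotient_hom(1)[OF f N]] quotient_hom(1)[OF g M]
    unfolding eq by (rule iso_trans)
qed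

locale galois_ext_places = galois_ext +
  fixes w :: "'a set \<Rightarrow> 'a set"
  assumes w: "\<And>v. v \<in> primes_of F \<Longrightarrow> w v \<in> primes_of K \<and> w v \<inter> F = v"
begin

definition inv_ideals :: "'a set set" where
  "inv_ideals = {J. K.frac J \<and> (\<forall>\<sigma>\<in>carrier GG. \<sigma> ` J = J)}"

abbreviation places_above :: "'a set \<Rightarrow> 'a set set" where
  "places_above v \<equiv> {P \<in> primes_of K. P \<inter> F = v}"

lemma finite_places_above:
  assumes "v \<in> primes_of F" shows "finite (places_above v)"
proof -
  have "places_above v \<subseteq> {P \<in> primes_of K. K.vord P (ext v) \<noteq> 0}"
    using ram_pos unfolding ram_def by fastforce
  thus ?thesis
    using K.finite_vord_support[OF ext_frac[OF F.primeD(2)[OF assms]]] finite_subset by blast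
qed

lemma vord_finprod_primes:
  assumes "finite S" "S \<subseteq> primes_of K" "P \<in> primes_of K"
  shows "K.frac (finprod (ideal_group K) (\<lambda>P. P) S)"
    "K.vord P (finprod (ideal_group K) (\<lambda>P. P) S) = (if P \<in> S then 1 else 0)"
proof -
  have *: "(\<lambda>P. P) \<in> S \<rightarrow> {J. K.frac J}" using K.primeD(2) assms(2) by auto
  show "K.frac (finprod (ideal_group K) (\<lambda>P. P) S)" by (rule K.frac_finprod[OF *])
  have "(\<Sum>Q\<in>S. K.vord P Q) = (\<Sum>Q\<in>S. if Q = P then 1 else 0)"
    using K.vord_other[OF assms(3)] assms(2,3) by (intro sum.cong) auto
  thus "K.vord P (finprod (ideal_group K) (\<lambda>P. P) S) = (if P \<in> S then 1 else 0)"
    unfolding K.vord_finprod[OF assms(1) * assms(3)] using assms(1) by simp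
qed

lemma inv_idealsI:
  assumes "K.frac J" "\<And>\<sigma> P. \<sigma> \<in> carrier GG \<Longrightarrow> P \<in> primes_of K \<Longrightarrow> K.vord (\<sigma> ` P) J = K.vord P J"
  shows "J \<in> inv_ideals"
proof -
  have "\<sigma> ` J = J" if \<sigma>: "\<sigma> \<in> carrier GG" for \<sigma>
  proof (rule K.frac_eqI)
    fix P assume P: "P \<in> primes_of K"
    define Q where "Q = ginv \<sigma> ` P"
    have Q: "Q \<in> primes_of K" "\<sigma> ` Q = P"
      unfolding Q_def using \<sigma> P gal_image_ginv(2)[OF \<sigma> prime_subset_K[OF P]] by auto
    show "K.vord P (\<sigma> ` J) = K.vord P J"
      using gal_vord[OF \<sigma> Q(1) assms(1)] assms(2)[OF \<sigma> Q(1)] Q(2) by simp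
  qed (use assms(1) \<sigma> in auto)
  thus ?thesis unfolding inv_ideals_def using assms(1) by blast
qed

lemma inv_ideals_vord:
  assumes "J \<in> inv_ideals" "P \<in> primes_of K" "Q \<in> primes_of K" "P \<inter> F = Q \<inter> F"
  shows "K.vord P J = K.vord Q J"
proof -
  obtain \<sigma> where \<sigma>: "\<sigma> \<in> carrier GG" "\<sigma> ` P = Q" by (rule gal_transitive[OF assms(2-4)])
  have "K.frac J" "\<sigma> ` J = J" using assms(1) \<sigma>(1) unfolding inv_ideals_def by auto
  thus ?thesis using gal_vord[OF \<sigma>(1) assms(2), of J] \<sigma>(2) by simp
qed

lemma prime_norm_eq_iff:
  assumes P: "P \<in> primes_of K" and v: "v \<in> primes_of F" and f: "f \<ge> 1"
  shows "prime_norm K F P = v [^]\<^bsub>ideal_group F\<^esub> f \<longleftrightarrow> P \<inter> F = v \<and> residue_degree K F P = f"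
proof
  assume eq: "prime_norm K F P = v [^]\<^bsub>ideal_group F\<^esub> f"
  note u = prime_below[OF P]
  have "F.vord v (prime_norm K F P) = int f" unfolding eq using v F.primeD(2)[OF v] by simp
  moreover have "F.vord v (prime_norm K F P) = int (residue_degree K F P) * F.vord v (P \<inter> F)"
    unfolding prime_norm_def using v F.primeD(2)[OF u] by simp
  ultimately have e: "int (residue_degree K F P) * F.vord v (P \<inter> F) = int f" by simp
  have Pv: "P \<inter> F = v"
  proof (rule ccontr)
    assume "P \<inter> F \<noteq> v"
    hence "F.vord v (P \<inter> F) = 0" using F.vord_other[OF v u] by simp
    thus False using e f by simp
  qed
  thus "P \<inter> F = v \<and> residue_degree K F P = f" using e v by simp
qed (auto simp: prime_norm_def)

lemma ostrowski_ideal_eq: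
  assumes v: "v \<in> primes_of F" and f: "f \<ge> 1"
  shows "ostrowski_ideal K F v f =
    finprod (ideal_group K) (\<lambda>P. P) {P \<in> places_above v. residue_degree K F P = f}"
proof -
  have "{P \<in> primes_of K. prime_norm K F P = v [^]\<^bsub>ideal_group F\<^esub> f} =
      {P \<in> places_above v. residue_degree K F P = f}"
    using prime_norm_eq_iff[OF _ v f] by blast
  thus ?thesis unfolding ostrowski_ideal_def by simp
qed

lemma ostrowski_ideal_inv:
  assumes v: "v \<in> primes_of F" and f: "f \<ge> 1" shows "ostrowski_ideal K F v f \<in> inv_ideals"
proof -
  define S where "S = {P \<in> places_above v. residue_degree K F P = f}"
  have S: "finite S" "S \<subseteq> primes_of K"
    unfolding S_def by (rule finite_subset[OF _ finite_places_above[OF v]]) auto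
  have fr: "K.frac (ostrowski_ideal K F v f)"
    unfolding ostrowski_ideal_eq[OF v f] S_def[symmetric]
    using K.frac_finprod[of "\<lambda>P. P" S] S(2) K.primeD(2) by auto
  show ?thesis
  proof (rule inv_idealsI[OF fr])
    fix \<sigma> P assume \<sigma>: "\<sigma> \<in> carrier GG" and P: "P \<in> primes_of K"
    have "\<sigma> ` P \<in> S \<longleftrightarrow> P \<in> S"
      unfolding S_def using \<sigma> P gal_image_inter_F[OF \<sigma> prime_subset_K[OF P]] residue_degree_gal[OF \<sigma> P] by simp
    thus "K.vord (\<sigma> ` P) (ostrowski_ideal K F v f) = K.vord P (ostrowski_ideal K F v f)"
      unfolding ostrowski_ideal_eq[OF v f] S_def[symmetric]
      using vord_finprod_primes(2)[OF S] \<sigma> P by simp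
  qed
qed

lemma ostrowski_ideal_places_above:
  assumes v: "v \<in> primes_of F"
  shows "finprod (ideal_group K) (\<lambda>P. P) (places_above v) = ostrowski_ideal K F v (residue_degree K F (w v))"
proof -
  have wv: "w v \<in> primes_of K" "w v \<inter> F = v" using w[OF v] by auto
  have f: "residue_degree K F (w v) \<ge> 1" using residue_degree_pos[OF wv(1)] by simp
  have "residue_degree K F P = residue_degree K F (w v)" if P: "P \<in> places_above v" for P
  proof -
    have "P \<in> primes_of K" "w v \<inter> F = P \<inter> F" using P wv by auto
    then obtain \<sigma> where "\<sigma> \<in> carrier GG" "\<sigma> ` w v = P"
      using gal_transitive[OF wv(1)] by blast
    thus ?thesis using residue_degree_gal[OF _ wv(1)] by blast
  qed
  hence "{P \<in> places_above v. residue_degree K F P = residue_degree K F (w v)} = places_above v" by blast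
  thus ?thesis unfolding ostrowski_ideal_eq[OF v f] by simp
qed

definition "INV = (ideal_group K)\<lparr>carrier := inv_ideals\<rparr>"

lemma INV_simps [simp]: "carrier INV = inv_ideals" "I \<otimes>\<^bsub>INV\<^esub> J = I \<star> J" "\<one>\<^bsub>INV\<^esub> = OK"
  unfolding INV_def by (simp_all add: ideal_group_def)

lemma subgroup_inv_ideals: "subgroup inv_ideals (ideal_group K)"
proof (rule K.IG.subgroupI)
  show "inv_ideals \<subseteq> carrier (ideal_group K)" unfolding inv_ideals_def by auto
  have "OK \<in> inv_ideals" unfolding inv_ideals_def by simp
  thus "inv_ideals \<noteq> {}" by blast
  show "K.iv J \<in> inv_ideals" if "J \<in> inv_ideals" for J
    using that gal_image_iv[of _ J] unfolding inv_ideals_def by simp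
  show "I \<otimes>\<^bsub>ideal_group K\<^esub> J \<in> inv_ideals" if "I \<in> inv_ideals" "J \<in> inv_ideals" for I J
    using that gal_ideal_prod[of _ I J] K.fracD(1) unfolding inv_ideals_def by simp
qed

lemma comm_group_INV: "comm_group INV"
proof (rule group.group_comm_groupI)
  show "group INV" unfolding INV_def by (rule K.IG.subgroup_imp_group[OF subgroup_inv_ideals])
  show "I \<otimes>\<^bsub>INV\<^esub> J = J \<otimes>\<^bsub>INV\<^esub> I" for I J by (simp add: ideal_prod_commute)
qed

lemma inv_ideals_frac: "J \<in> inv_ideals \<Longrightarrow> K.frac J"
  unfolding inv_ideals_def by simp

lemma ext_inv: "F.frac J \<Longrightarrow> ext J \<in> inv_ideals"
  unfolding inv_ideals_def using gal_ext_ideal by simp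

abbreviation polya_group :: "'a set set set" where "polya_group \<equiv> polya K F"

lemma subgroup_cls_inv: "subgroup (K.cls ` inv_ideals) (class_group K)"
proof -
  interpret group_hom "ideal_group K" "class_group K" K.cls
    using K.cls_hom K.IG.is_group K.CG.is_group by (intro group_hom.intro group_hom_axioms.intro)
  show ?thesis by (rule subgroup_img_is_subgroup[OF subgroup_inv_ideals])
qed

lemma polya_gens: "{K.cls (ostrowski_ideal K F p f) |p f. p \<in> primes_of F \<and> 1 \<le> f} \<subseteq> K.cls ` inv_ideals"
  using ostrowski_ideal_inv by blast

lemma polya_subset: "polya_group \<subseteq> K.cls ` inv_ideals"
  unfolding polya_def by (rule K.CG.generate_subgroup_incl[OF polya_gens subgroup_cls_inv])

lemma subgroup_polya: "subgroup polya_group (class_group K)"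
  unfolding polya_def
  by (rule K.CG.generate_is_subgroup) (use polya_gens subgroup.subset[OF subgroup_cls_inv] in blast)

lemma exists_inv_ideal:
  assumes fin: "finite {v \<in> primes_of F. n v \<noteq> 0}"
  obtains J where "J \<in> inv_ideals" "\<And>P. P \<in> primes_of K \<Longrightarrow> K.vord P J = n (P \<inter> F)" "K.cls J \<in> polya_group"
proof -
  define S where "S = {v \<in> primes_of F. n v \<noteq> 0}"
  define pp where "pp v = finprod (ideal_group K) (\<lambda>P. P) (places_above v)" for v
  have frpp: "K.frac (pp v)" if "v \<in> S" for v
    unfolding pp_def using K.frac_finprod[of "\<lambda>P. P" "places_above v"] K.primeD(2) by auto
  define J where "J = finprod (ideal_group K) (\<lambda>v. K.zpow (pp v) (n v)) S"
  have mem: "(\<lambda>v. K.zpow (pp v) (n v)) \<in> S \<rightarrow> {J. K.frac J}" using frpp by auto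
  have frJ: "K.frac J" unfolding J_def by (rule K.frac_finprod[OF mem])
  have vJ: "K.vord P J = n (P \<inter> F)" if P: "P \<in> primes_of K" for P
  proof -
    have "K.vord P J = (\<Sum>v\<in>S. K.vord P (K.zpow (pp v) (n v)))"
      unfolding J_def using K.vord_finprod[OF _ mem P] fin unfolding S_def by simp
    also have "\<dots> = (\<Sum>v\<in>S. if v = P \<inter> F then n v else 0)"
    proof (rule sum.cong[OF refl])
      fix v assume v: "v \<in> S"
      hence "v \<in> primes_of F" unfolding S_def by simp
      hence "K.vord P (pp v) = (if P \<in> places_above v then 1 else 0)"
        unfolding pp_def using finite_places_above P by (intro vord_finprod_primes(2)) auto
      thus "K.vord P (K.zpow (pp v) (n v)) = (if v = P \<inter> F then n v else 0)"
        using P frpp[OF v] by auto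
    qed
    also have "\<dots> = n (P \<inter> F)" using fin prime_below[OF P] unfolding S_def by (simp add: sum.delta)
    finally show ?thesis .
  qed
  have inv: "J \<in> inv_ideals"
    using gal_image_inter_F prime_subset_K vJ by (intro inv_idealsI[OF frJ]) simp
  interpret h: group_hom "ideal_group K" "class_group K" K.cls
    using K.cls_hom K.IG.is_group K.CG.is_group by (intro group_hom.intro group_hom_axioms.intro)
  have "K.cls (finprod (ideal_group K) (\<lambda>v. K.zpow (pp v) (n v)) T) \<in> polya_group" if "finite T" "T \<subseteq> S" for T
    using that
  proof (induction T rule: finite_induct)
    case empty
    thus ?case using subgroup.one_closed[OF subgroup_polya] h.hom_one by simp
  next
    case (insert v T)
    have v: "v \<in> S" using insert by simp
    hence vF: "v \<in> primes_of F" unfolding S_def by simp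
    have memT: "(\<lambda>v. K.zpow (pp v) (n v)) \<in> T \<rightarrow> carrier (ideal_group K)" using mem insert.prems by auto
    have frT: "K.frac (finprod (ideal_group K) (\<lambda>v. K.zpow (pp v) (n v)) T)" using K.frac_finprod memT by simp
    have "K.cls (pp v) \<in> polya_group"
      unfolding pp_def ostrowski_ideal_places_above[OF vF] polya_def
      using residue_degree_pos[of "w v"] w[OF vF] vF by (intro generate.incl) force
    hence "K.cls (pp v) [^]\<^bsub>class_group K\<^esub> n v \<in> polya_group"
      by (rule K.CG.subgroup_int_pow_closed[OF subgroup_polya])
    hence "K.cls (K.zpow (pp v) (n v)) \<in> polya_group" using hom_int_pow[OF K.cls_hom, of "pp v" "n v"] frpp[OF v] K.IG.is_group K.CG.is_group by simp
    moreover have "finprod (ideal_group K) (\<lambda>v. K.zpow (pp v) (n v)) (insert v T) =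
        K.zpow (pp v) (n v) \<star> finprod (ideal_group K) (\<lambda>v. K.zpow (pp v) (n v)) T"
      using K.IG.finprod_insert[OF insert.hyps memT] frpp[OF v] by simp
    ultimately show ?case
      using K.cls_mult[OF K.frac_zpow[OF frpp[OF v]] frT] insert.IH insert.prems
        subgroup.m_closed[OF subgroup_polya] by simp
  qed
  from this[of S] have "K.cls J \<in> polya_group" unfolding J_def using fin S_def by simp
  thus thesis using that inv vJ by blast
qed

lemma finite_inv_ideal_support:
  assumes "K.frac J" shows "finite {v \<in> primes_of F. K.vord (w v) J \<noteq> 0}"
proof -
  have "w ` {v \<in> primes_of F. K.vord (w v) J \<noteq> 0} \<subseteq> {P \<in> primes_of K. K.vord P J \<noteq> 0}" using w by auto
  moreover have "inj_on w {v \<in> primes_of F. K.vord (w v) J \<noteq> 0}"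
    using w by (intro inj_onI) (metis (mono_tags, lifting) mem_Collect_eq)
  ultimately show ?thesis
    using K.finite_vord_support[OF assms] inj_on_finite by blast
qed

lemma inv_ideals_eqI:
  assumes "I \<in> inv_ideals" "J \<in> inv_ideals" "\<And>v. v \<in> primes_of F \<Longrightarrow> K.vord (w v) I = K.vord (w v) J"
  shows "I = J"
proof (rule K.frac_eqI[OF inv_ideals_frac[OF assms(1)] inv_ideals_frac[OF assms(2)]])
  fix P assume P: "P \<in> primes_of K"
  note u = prime_below[OF P]
  show "K.vord P I = K.vord P J"
    using inv_ideals_vord[OF assms(1) P, of "w (P \<inter> F)"] inv_ideals_vord[OF assms(2) P, of "w (P \<inter> F)"]
      w[OF u] assms(3)[OF u] by simp
qed

theorem polya_eq: "polya_group = K.cls ` inv_ideals"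
proof
  show "K.cls ` inv_ideals \<subseteq> polya_group"
  proof
    fix C assume "C \<in> K.cls ` inv_ideals"
    then obtain J where J: "J \<in> inv_ideals" "C = K.cls J" by blast
    obtain I where I: "I \<in> inv_ideals" "\<And>P. P \<in> primes_of K \<Longrightarrow> K.vord P I = K.vord (w (P \<inter> F)) J"
      "K.cls I \<in> polya_group"
      using exists_inv_ideal[of "\<lambda>v. K.vord (w v) J"] finite_inv_ideal_support[OF inv_ideals_frac[OF J(1)]] by blast
    have "I = J"
      by (rule inv_ideals_eqI[OF I(1) J(1)]) (use I(2) w in auto)
    thus "C \<in> polya_group" using I(3) J(2) by simp
  qed
qed (rule polya_subset)

lemma inv_ideal_is_ext_iff:
  assumes J: "J \<in> inv_ideals"
  shows "(\<exists>I. F.frac I \<and> J = ext I) \<longleftrightarrow> (\<forall>v\<in>primes_of F. ram (w v) dvd K.vord (w v) J)"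
proof
  assume "\<exists>I. F.frac I \<and> J = ext I"
  thus "\<forall>v\<in>primes_of F. ram (w v) dvd K.vord (w v) J" using vord_ext w by auto
next
  assume dvd: "\<forall>v\<in>primes_of F. ram (w v) dvd K.vord (w v) J"
  define k where "k v = K.vord (w v) J div ram (w v)" for v
  have k: "K.vord (w v) J = ram (w v) * k v" if "v \<in> primes_of F" for v
    using dvd that unfolding k_def by simp
  define S where "S = {v \<in> primes_of F. K.vord (w v) J \<noteq> 0}"
  have S: "finite S" unfolding S_def by (rule finite_inv_ideal_support[OF inv_ideals_frac[OF J]])
  define I where "I = finprod (ideal_group F) (\<lambda>v. F.zpow v (k v)) S"
  have mem: "(\<lambda>v. F.zpow v (k v)) \<in> S \<rightarrow> {J. F.frac J}" unfolding S_def using F.primeD(2) by auto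
  have frI: "F.frac I" unfolding I_def by (rule F.frac_finprod[OF mem])
  have vI: "F.vord u I = k u" if u: "u \<in> primes_of F" for u
  proof -
    have "F.vord u I = (\<Sum>v\<in>S. F.vord u (F.zpow v (k v)))"
      unfolding I_def by (rule F.vord_finprod[OF S mem u])
    also have "\<dots> = (\<Sum>v\<in>S. if v = u then k v else 0)"
      using u F.vord_other[OF u] F.primeD(2) unfolding S_def by (intro sum.cong) auto
    also have "\<dots> = k u" using S u k[OF u] unfolding S_def k_def by (simp add: sum.delta)
    finally show ?thesis .
  qed
  have "J = ext I"
    by (rule inv_ideals_eqI[OF J ext_inv[OF frI]]) (use k vI w vord_ext[OF _ frI] in auto)
  thus "\<exists>I. F.frac I \<and> J = ext I" using frI by blast
qed

lemma capitulation_cls: "F.frac J \<Longrightarrow> capitulation K (F.cls J) = K.cls (ext J)"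
proof -
  assume J: "F.frac J"
  have "K.cls (ext I) = K.cls (ext J)" if I: "I \<in> F.cls J" for I
  proof -
    obtain x where x: "x \<in> F" "x \<noteq> 0" "I = F.pideal x \<star> J" using I by (auto simp: F.mem_cls_iff)
    hence "ext I = K.pideal x \<star> ext J" by (simp add: ext_mult ext_pideal)
    moreover have "K.frac (ext I)" using x J by simp
    ultimately show ?thesis using x J by (subst K.cls_eq_iff) auto
  qed
  moreover have "J \<in> F.cls J" by (rule F.cls_self[OF J])
  ultimately show ?thesis unfolding capitulation_def by blast
qed

lemma capitulation_image: "capitulation K ` carrier (class_group F) = (\<lambda>J. K.cls (ext J)) ` {J. F.frac J}"
  unfolding F.carrier_class_group image_image by (intro image_cong refl) (simp add: capitulation_cls)

lemma capitulation_subset_polya: "capitulation K ` carrier (class_group F) \<subseteq> polya_group"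
  unfolding capitulation_image polya_eq using ext_inv by auto

end

section \<open>Group cohomology in degree one\<close>

lemma comm_group_product_group:
  assumes "\<And>i. i \<in> I \<Longrightarrow> comm_group (G i)" shows "comm_group (product_group I G)"
proof (rule group.group_comm_groupI)
  show "group (product_group I G)" using assms comm_group.axioms(2) by (intro product_group) blast
  fix x y assume "x \<in> carrier (product_group I G)" "y \<in> carrier (product_group I G)"
  thus "x \<otimes>\<^bsub>product_group I G\<^esub> y = y \<otimes>\<^bsub>product_group I G\<^esub> x"
    using assms by (auto simp: PiE_iff comm_group_def comm_monoid.m_comm intro!: restrict_ext)
qed

locale gmodule = G: group G + A: comm_group A
  for G :: "('g, 'r) monoid_scheme" and A :: "'m monoid" +
  fixes act :: "'g \<Rightarrow> 'm \<Rightarrow> 'm"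
  assumes act_hom: "s \<in> carrier G \<Longrightarrow> act s \<in> hom A A"
    and act_one [simp]: "a \<in> carrier A \<Longrightarrow> act \<one>\<^bsub>G\<^esub> a = a"
    and act_mult: "s \<in> carrier G \<Longrightarrow> t \<in> carrier G \<Longrightarrow> a \<in> carrier A \<Longrightarrow>
      act (s \<otimes>\<^bsub>G\<^esub> t) a = act s (act t a)"
begin

sublocale C1: comm_group "C1 G A"
  by (rule comm_group_product_group) (rule A.comm_group_axioms)

sublocale C2: comm_group "C2 G A"
  by (rule comm_group_product_group) (rule A.comm_group_axioms)

lemma act_closed [simp]: "s \<in> carrier G \<Longrightarrow> a \<in> carrier A \<Longrightarrow> act s a \<in> carrier A"
  using hom_in_carrier[OF act_hom] .

lemma act_m [simp]: "s \<in> carrier G \<Longrightarrow> a \<in> carrier A \<Longrightarrow> b \<in> carrier A \<Longrightarrow>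
    act s (a \<otimes>\<^bsub>A\<^esub> b) = act s a \<otimes>\<^bsub>A\<^esub> act s b"
  using hom_mult[OF act_hom] .

lemma act_inv [simp]: "s \<in> carrier G \<Longrightarrow> a \<in> carrier A \<Longrightarrow> act s (inv\<^bsub>A\<^esub> a) = inv\<^bsub>A\<^esub> (act s a)"
  using group_hom.hom_inv[of A A "act s" a] act_hom[of s]
  by (simp add: group_hom_def group_hom_axioms_def)

lemma C1_apply [simp]: "h \<in> carrier (C1 G A) \<Longrightarrow> s \<in> carrier G \<Longrightarrow> h s \<in> carrier A"
  by auto

lemma d0_hom: "d0 G A act \<in> hom A (C1 G A)"
  by (rule homI) (auto simp: d0_def A.inv_mult A.m_ac intro!: restrict_ext)

lemma d1_hom: "d1 G A act \<in> hom (C1 G A) (C2 G A)"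
proof (rule homI)
  fix h k assume h: "h \<in> carrier (C1 G A)" and k: "k \<in> carrier (C1 G A)"
  show "d1 G A act h \<in> carrier (C2 G A)" using C1_apply[OF h] by (auto simp: d1_def)
  show "d1 G A act (h \<otimes>\<^bsub>C1 G A\<^esub> k) = d1 G A act h \<otimes>\<^bsub>C2 G A\<^esub> d1 G A act k"
    using C1_apply[OF h] C1_apply[OF k]
    by (auto simp: d1_def A.inv_mult A.m_ac fun_eq_iff)
qed

sublocale d0: group_hom A "C1 G A" "d0 G A act"
  using d0_hom by unfold_locales

sublocale d1: group_hom "C1 G A" "C2 G A" "d1 G A act"
  using d1_hom by unfold_locales

definition "Z1 = kernel (C1 G A) (C2 G A) (d1 G A act)"

lemma Z1_iff:
  "h \<in> Z1 \<longleftrightarrow> h \<in> carrier (C1 G A) \<and>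
    (\<forall>s\<in>carrier G. \<forall>t\<in>carrier G. h (s \<otimes>\<^bsub>G\<^esub> t) = h s \<otimes>\<^bsub>A\<^esub> act s (h t))"
proof -
  have "d1 G A act h = \<one>\<^bsub>C2 G A\<^esub> \<longleftrightarrow>
      (\<forall>s\<in>carrier G. \<forall>t\<in>carrier G. h (s \<otimes>\<^bsub>G\<^esub> t) = h s \<otimes>\<^bsub>A\<^esub> act s (h t))"
    if h: "h \<in> carrier (C1 G A)"
  proof -
    have "d1 G A act h = \<one>\<^bsub>C2 G A\<^esub> \<longleftrightarrow>
        (\<forall>s\<in>carrier G. \<forall>t\<in>carrier G. act s (h t) \<otimes>\<^bsub>A\<^esub> inv\<^bsub>A\<^esub> h (s \<otimes>\<^bsub>G\<^esub> t) \<otimes>\<^bsub>A\<^esub> h s = \<one>\<^bsub>A\<^esub>)"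
      unfolding d1_def fun_eq_iff by (auto simp: restrict_def)
    also have "\<dots> \<longleftrightarrow> (\<forall>s\<in>carrier G. \<forall>t\<in>carrier G. h (s \<otimes>\<^bsub>G\<^esub> t) = h s \<otimes>\<^bsub>A\<^esub> act s (h t))"
    proof (intro ball_cong refl)
      fix s t assume st: "s \<in> carrier G" "t \<in> carrier G"
      have c: "h s \<in> carrier A" "h (s \<otimes>\<^bsub>G\<^esub> t) \<in> carrier A" "act s (h t) \<in> carrier A"
        using C1_apply[OF h] st by auto
      have "act s (h t) \<otimes>\<^bsub>A\<^esub> inv\<^bsub>A\<^esub> h (s \<otimes>\<^bsub>G\<^esub> t) \<otimes>\<^bsub>A\<^esub> h s = (h s \<otimes>\<^bsub>A\<^esub> act s (h t)) \<otimes>\<^bsub>A\<^esub> inv\<^bsub>A\<^esub> h (s \<otimes>\<^bsub>G\<^esub> t)"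
        using c by (simp add: A.m_ac)
      thus "act s (h t) \<otimes>\<^bsub>A\<^esub> inv\<^bsub>A\<^esub> h (s \<otimes>\<^bsub>G\<^esub> t) \<otimes>\<^bsub>A\<^esub> h s = \<one>\<^bsub>A\<^esub> \<longleftrightarrow>
          h (s \<otimes>\<^bsub>G\<^esub> t) = h s \<otimes>\<^bsub>A\<^esub> act s (h t)"
        using A.inv_solve_right'[of "\<one>\<^bsub>A\<^esub>" "h s \<otimes>\<^bsub>A\<^esub> act s (h t)" "h (s \<otimes>\<^bsub>G\<^esub> t)"] c by auto
    qed
    finally show ?thesis .
  qed
  thus ?thesis unfolding Z1_def kernel_def by blast
qed

lemma Z1_closed: "h \<in> Z1 \<Longrightarrow> h \<in> carrier (C1 G A)"
  by (simp add: Z1_iff)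

lemma subgroup_Z1: "subgroup Z1 (C1 G A)"
  unfolding Z1_def by (rule d1.subgroup_kernel)

lemma d0_Z1: "a \<in> carrier A \<Longrightarrow> d0 G A act a \<in> Z1"
  unfolding Z1_iff
proof (intro conjI ballI)
  assume a: "a \<in> carrier A"
  show "d0 G A act a \<in> carrier (C1 G A)" using a by (rule d0.hom_closed)
  fix s t assume st: "s \<in> carrier G" "t \<in> carrier G"
  define x y where "x = act s a" and "y = act s (act t a)"
  have c: "x \<in> carrier A" "y \<in> carrier A" unfolding x_def y_def using st a by auto
  have "d0 G A act a (s \<otimes>\<^bsub>G\<^esub> t) = y \<otimes>\<^bsub>A\<^esub> inv\<^bsub>A\<^esub> a"
    using st a by (simp add: d0_def act_mult y_def)
  also have "\<dots> = (x \<otimes>\<^bsub>A\<^esub> inv\<^bsub>A\<^esub> a) \<otimes>\<^bsub>A\<^esub> (y \<otimes>\<^bsub>A\<^esub> inv\<^bsub>A\<^esub> x)"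
  proof -
    have "(x \<otimes>\<^bsub>A\<^esub> inv\<^bsub>A\<^esub> a) \<otimes>\<^bsub>A\<^esub> (y \<otimes>\<^bsub>A\<^esub> inv\<^bsub>A\<^esub> x) =
        (y \<otimes>\<^bsub>A\<^esub> inv\<^bsub>A\<^esub> a) \<otimes>\<^bsub>A\<^esub> (x \<otimes>\<^bsub>A\<^esub> inv\<^bsub>A\<^esub> x)"
      using c a by (simp only: A.m_ac A.m_closed A.inv_closed)
    thus ?thesis using c a by simp
  qed
  also have "\<dots> = d0 G A act a s \<otimes>\<^bsub>A\<^esub> act s (d0 G A act a t)"
    using st a by (simp add: d0_def x_def y_def)
  finally show "d0 G A act a (s \<otimes>\<^bsub>G\<^esub> t) = d0 G A act a s \<otimes>\<^bsub>A\<^esub> act s (d0 G A act a t)" .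
qed

abbreviation "B \<equiv> B1 G A act"

lemma subgroup_B1: "subgroup B (C1 G A)"
  unfolding B1_def by (rule d0.img_is_subgroup)

lemma B1_subset_Z1: "B \<subseteq> Z1"
  unfolding B1_def using d0_Z1 by blast

abbreviation "ZG \<equiv> (C1 G A)\<lparr>carrier := Z1\<rparr>"

lemma comm_group_ZG: "comm_group ZG"
proof (rule group.group_comm_groupI)
  show "group ZG" by (rule C1.subgroup_imp_group[OF subgroup_Z1])
  fix x y assume "x \<in> carrier ZG" "y \<in> carrier ZG"
  thus "x \<otimes>\<^bsub>ZG\<^esub> y = y \<otimes>\<^bsub>ZG\<^esub> x" using C1.m_comm[of x y] Z1_closed by simp
qed

lemma subgroup_B1_ZG: "subgroup B ZG"
  using C1.subgroup_incl[OF subgroup_B1 subgroup_Z1 B1_subset_Z1] .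

lemma H1_eq: "H1 G A act = ZG Mod B"
  unfolding H1_def Z1_def ..

lemma comm_group_H1: "comm_group (H1 G A act)"
  unfolding H1_eq by (rule comm_group.abelian_FactGroup[OF comm_group_ZG subgroup_B1_ZG])

definition "cl f = B #>\<^bsub>C1 G A\<^esub> f"

lemma cl_ZG: "cl f = B #>\<^bsub>ZG\<^esub> f"
  unfolding cl_def r_coset_def by simp

lemma carrier_H1: "carrier (H1 G A act) = cl ` Z1"
  unfolding H1_eq carrier_FactGroup by (simp add: cl_ZG)

lemma cl_hom: "cl \<in> hom ZG (H1 G A act)"
proof -
  interpret ZG: comm_group ZG by (rule comm_group_ZG)
  show ?thesis
    using normal.r_coset_hom_Mod[OF ZG.subgroup_imp_normal[OF subgroup_B1_ZG]]
    unfolding H1_eq cl_ZG[abs_def] .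
qed

lemma cl_mult: "f \<in> Z1 \<Longrightarrow> g \<in> Z1 \<Longrightarrow> cl (f \<otimes>\<^bsub>C1 G A\<^esub> g) = cl f \<otimes>\<^bsub>H1 G A act\<^esub> cl g"
  using hom_mult[OF cl_hom, of f g] by simp

lemma H1_one: "\<one>\<^bsub>H1 G A act\<^esub> = B"
  unfolding H1_eq by simp

lemma mem_cl_iff: "f \<in> cl g \<longleftrightarrow> (\<exists>a\<in>carrier A. f = d0 G A act a \<otimes>\<^bsub>C1 G A\<^esub> g)"
  unfolding cl_def r_coset_def B1_def by auto

lemma cl_self: "f \<in> carrier (C1 G A) \<Longrightarrow> f \<in> cl f"
  unfolding cl_def by (rule C1.rcos_self[OF _ subgroup_B1])

lemma cl_eqI: "g \<in> carrier (C1 G A) \<Longrightarrow> f \<in> cl g \<Longrightarrow> cl f = cl g"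
  unfolding cl_def using C1.repr_independence[OF _ _ subgroup_B1, of f g] by simp

lemma cl_eq_one_iff: "f \<in> carrier (C1 G A) \<Longrightarrow> cl f = \<one>\<^bsub>H1 G A act\<^esub> \<longleftrightarrow> f \<in> B"
  unfolding H1_one cl_def using C1.coset_join1[OF _ _ subgroup_B1] C1.coset_join2[OF _ subgroup_B1] by blast

abbreviation "BB \<equiv> B2 G A act"

lemma subgroup_B2: "subgroup BB (C2 G A)"
  unfolding B2_def by (rule d1.img_is_subgroup)

lemma d1_d0: "a \<in> carrier A \<Longrightarrow> d1 G A act (d0 G A act a) = \<one>\<^bsub>C2 G A\<^esub>"
  using d0_Z1[of a] unfolding Z1_def kernel_def by simp

end

section \<open>Hilbert's Theorem 90\<close>

context galois_ext
begin

lemma field_units_simps [simp]: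
  "carrier (field_units K) = K - {0}" "x \<otimes>\<^bsub>field_units K\<^esub> y = x * y" "\<one>\<^bsub>field_units K\<^esub> = 1"
proof -
  have "\<exists>y\<in>K. y * x = 1 \<and> x * y = 1" if "x \<in> K" "x \<noteq> 0" for x
    using that by (intro bexI[of _ "inverse x"]) auto
  thus "carrier (field_units K) = K - {0}"
    unfolding field_units_def units_of_def Units_def by auto
qed (simp_all add: field_units_def units_of_def)

lemma integer_units_simps [simp]:
  "carrier (integer_units K) = {u \<in> OK. u \<noteq> 0 \<and> inverse u \<in> OK}"
  "x \<otimes>\<^bsub>integer_units K\<^esub> y = x * y" "\<one>\<^bsub>integer_units K\<^esub> = 1"
proof -
  have "(\<exists>y\<in>OK. y * x = 1 \<and> x * y = 1) \<longleftrightarrow> x \<noteq> 0 \<and> inverse x \<in> OK" for x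
  proof
    assume "\<exists>y\<in>OK. y * x = 1 \<and> x * y = 1"
    then obtain y where y: "y \<in> OK" "x * y = 1" by blast
    hence "x \<noteq> 0" "inverse x = y" using inverse_unique[of x y] by auto
    thus "x \<noteq> 0 \<and> inverse x \<in> OK" using y by simp
  next
    assume "x \<noteq> 0 \<and> inverse x \<in> OK"
    thus "\<exists>y\<in>OK. y * x = 1 \<and> x * y = 1" by (intro bexI[of _ "inverse x"]) auto
  qed
  thus "carrier (integer_units K) = {u \<in> OK. u \<noteq> 0 \<and> inverse u \<in> OK}"
    unfolding integer_units_def units_of_def Units_def by auto
qed (simp_all add: integer_units_def units_of_def)

lemma comm_group_field_units: "comm_group (field_units K)"
proof (rule comm_groupI)
  fix x assume "x \<in> carrier (field_units K)"
  thus "\<exists>y\<in>carrier (field_units K). y \<otimes>\<^bsub>field_units K\<^esub> x = \<one>\<^bsub>field_units K\<^esub>"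
    by (intro bexI[of _ "inverse x"]) auto
qed (auto simp: mult.assoc)

lemma comm_group_integer_units: "comm_group (integer_units K)"
proof (rule comm_groupI)
  fix x assume "x \<in> carrier (integer_units K)"
  thus "\<exists>y\<in>carrier (integer_units K). y \<otimes>\<^bsub>integer_units K\<^esub> x = \<one>\<^bsub>integer_units K\<^esub>"
    by (intro bexI[of _ "inverse x"]) auto
qed (auto simp: mult.assoc)

lemma field_units_inv [simp]: "x \<in> K \<Longrightarrow> x \<noteq> 0 \<Longrightarrow> inv\<^bsub>field_units K\<^esub> x = inverse x"
  using group.inv_equality[OF comm_group.axioms(2)[OF comm_group_field_units], of "inverse x" x] by simp

lemma integer_units_inv [simp]: "x \<in> carrier (integer_units K) \<Longrightarrow> inv\<^bsub>integer_units K\<^esub> x = inverse x"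
  using group.inv_equality[OF comm_group.axioms(2)[OF comm_group_integer_units], of "inverse x" x] by simp

sublocale KU: gmodule GG "field_units K" "\<lambda>\<sigma> x. \<sigma> x"
proof (rule gmodule.intro[OF group_GG comm_group_field_units gmodule_axioms.intro])
  show "\<sigma> \<in> hom (field_units K) (field_units K)" if "\<sigma> \<in> carrier GG" for \<sigma>
    using that by (intro homI) (auto simp: gal_eq_0_iff gal_mult)
qed auto

sublocale UU: gmodule GG "integer_units K" "\<lambda>\<sigma> x. \<sigma> x"
proof (rule gmodule.intro[OF group_GG comm_group_integer_units gmodule_axioms.intro])
  show "\<sigma> \<in> hom (integer_units K) (integer_units K)" if "\<sigma> \<in> carrier GG" for \<sigma>
    using that gal_OK[OF that] by (intro homI) (auto simp: gal_eq_0_iff gal_mult gal_inverse[symmetric])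
qed auto

text \<open>The element \<open>\<Prod>\<^sub>\<tau> (1 \<otimes> \<theta>\<^sub>\<tau> - \<tau> \<theta>\<^sub>\<tau> \<otimes> 1) / (\<theta>\<^sub>\<tau> - \<tau> \<theta>\<^sub>\<tau>)\<close> of \<open>K \<otimes> K\<close>, with \<open>\<tau>\<close> running through the
  nontrivial automorphisms and \<open>\<tau> \<theta>\<^sub>\<tau> \<noteq> \<theta>\<^sub>\<tau>\<close>, is the idempotent belonging to the identity.\<close>

lemma identity_idempotent:
  obtains xs where "set xs \<subseteq> K \<times> K"
    "\<And>\<sigma>. \<sigma> \<in> carrier GG \<Longrightarrow> (\<Sum>(d, a)\<leftarrow>xs. d * \<sigma> a) = (if \<sigma> = \<one>\<^bsub>GG\<^esub> then 1 else 0)"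
proof -
  have "\<exists>\<theta>. \<tau> \<in> carrier GG - {\<one>\<^bsub>GG\<^esub>} \<longrightarrow> \<theta> \<in> K \<and> \<tau> \<theta> \<noteq> \<theta>" for \<tau>
    using gal_eqI[of \<tau> "\<one>\<^bsub>GG\<^esub>"] by auto
  then obtain \<theta> where \<theta>: "\<And>\<tau>. \<tau> \<in> carrier GG \<Longrightarrow> \<tau> \<noteq> \<one>\<^bsub>GG\<^esub> \<Longrightarrow> \<theta> \<tau> \<in> K \<and> \<tau> (\<theta> \<tau>) \<noteq> \<theta> \<tau>" by (metis Diff_iff singletonD)
  define c where "c \<tau> = inverse (\<theta> \<tau> - \<tau> (\<theta> \<tau>))" for \<tau>
  have "\<exists>xs. set xs \<subseteq> K \<times> K \<and>
      (\<forall>\<sigma>\<in>carrier GG. (\<Sum>(d, a)\<leftarrow>xs. d * \<sigma> a) = (\<Prod>\<tau>\<in>T. (\<sigma> (\<theta> \<tau>) - \<tau> (\<theta> \<tau>)) * c \<tau>))"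
    if "finite T" "T \<subseteq> carrier GG - {\<one>\<^bsub>GG\<^esub>}" for T
    using that
  proof (induction T rule: finite_induct)
    case empty
    show ?case by (rule exI[of _ "[(1, 1)]"]) (auto simp: gal_1)
  next
    case (insert \<tau> T)
    then obtain xs where xs: "set xs \<subseteq> K \<times> K"
      "\<forall>\<sigma>\<in>carrier GG. (\<Sum>(d, a)\<leftarrow>xs. d * \<sigma> a) = (\<Prod>\<tau>\<in>T. (\<sigma> (\<theta> \<tau>) - \<tau> (\<theta> \<tau>)) * c \<tau>)" by auto
    have \<tau>: "\<tau> \<in> carrier GG" "\<theta> \<tau> \<in> K" "c \<tau> \<in> K" using insert.prems \<theta>[of \<tau>] by (auto simp: c_def)
    define ys where "ys = map (\<lambda>(d, a). (d * c \<tau>, a * \<theta> \<tau>)) xs @ map (\<lambda>(d, a). (- (d * (\<tau> (\<theta> \<tau>) * c \<tau>)), a)) xs"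
    have ysK: "set ys \<subseteq> K \<times> K" using xs(1) \<tau> by (auto simp: ys_def)
    have "(\<Sum>(d, a)\<leftarrow>ys. d * \<sigma> a) = (\<Sum>(d, a)\<leftarrow>xs. d * \<sigma> a) * ((\<sigma> (\<theta> \<tau>) - \<tau> (\<theta> \<tau>)) * c \<tau>)"
      if \<sigma>: "\<sigma> \<in> carrier GG" for \<sigma>
    proof -
      have "(\<Sum>(d, a)\<leftarrow>map (\<lambda>(d, a). (d * c \<tau>, a * \<theta> \<tau>)) zs. d * \<sigma> a) +
          (\<Sum>(d, a)\<leftarrow>map (\<lambda>(d, a). (- (d * (\<tau> (\<theta> \<tau>) * c \<tau>)), a)) zs. d * \<sigma> a) =
          (\<Sum>(d, a)\<leftarrow>zs. d * \<sigma> a) * ((\<sigma> (\<theta> \<tau>) - \<tau> (\<theta> \<tau>)) * c \<tau>)" if "set zs \<subseteq> K \<times> K" for zs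
        using that
      proof (induction zs)
        case (Cons z zs)
        obtain d a where z: "z = (d, a)" "d \<in> K" "a \<in> K" using Cons.prems by (cases z) auto
        have "set zs \<subseteq> K \<times> K" using Cons.prems by simp
        note IH = Cons.IH[OF this]
        have e: "\<sigma> (a * \<theta> \<tau>) = \<sigma> a * \<sigma> (\<theta> \<tau>)" using gal_mult[OF \<sigma> z(3) \<tau>(2)] .
        have "(\<Sum>(d, a)\<leftarrow>map (\<lambda>(d, a). (d * c \<tau>, a * \<theta> \<tau>)) (z # zs). d * \<sigma> a) +
            (\<Sum>(d, a)\<leftarrow>map (\<lambda>(d, a). (- (d * (\<tau> (\<theta> \<tau>) * c \<tau>)), a)) (z # zs). d * \<sigma> a) =
            d * \<sigma> a * ((\<sigma> (\<theta> \<tau>) - \<tau> (\<theta> \<tau>)) * c \<tau>) +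
            ((\<Sum>(d, a)\<leftarrow>map (\<lambda>(d, a). (d * c \<tau>, a * \<theta> \<tau>)) zs. d * \<sigma> a) +
            (\<Sum>(d, a)\<leftarrow>map (\<lambda>(d, a). (- (d * (\<tau> (\<theta> \<tau>) * c \<tau>)), a)) zs. d * \<sigma> a))"
          by (simp add: z(1) e algebra_simps)
        thus ?case unfolding IH by (simp add: z(1) algebra_simps)
      qed simp
      from this[OF xs(1)] show ?thesis unfolding ys_def by simp
    qed
    hence "\<forall>\<sigma>\<in>carrier GG. (\<Sum>(d, a)\<leftarrow>ys. d * \<sigma> a) =
        (\<Prod>\<tau>\<in>insert \<tau> T. (\<sigma> (\<theta> \<tau>) - \<tau> (\<theta> \<tau>)) * c \<tau>)"
      using xs(2) insert.hyps by (simp add: mult.commute)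
    thus ?case using ysK by blast
  qed
  from this[of "carrier GG - {\<one>\<^bsub>GG\<^esub>}"] finite_GG obtain xs where xs: "set xs \<subseteq> K \<times> K"
      "\<And>\<sigma>. \<sigma> \<in> carrier GG \<Longrightarrow> (\<Sum>(d, a)\<leftarrow>xs. d * \<sigma> a) =
        (\<Prod>\<tau>\<in>carrier GG - {\<one>\<^bsub>GG\<^esub>}. (\<sigma> (\<theta> \<tau>) - \<tau> (\<theta> \<tau>)) * c \<tau>)" by auto
  have "(\<Sum>(d, a)\<leftarrow>xs. d * \<sigma> a) = (if \<sigma> = \<one>\<^bsub>GG\<^esub> then 1 else 0)" if \<sigma>: "\<sigma> \<in> carrier GG" for \<sigma>
  proof (cases "\<sigma> = \<one>\<^bsub>GG\<^esub>")
    case True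
    have "(\<Prod>\<tau>\<in>carrier GG - {\<one>\<^bsub>GG\<^esub>}. (\<sigma> (\<theta> \<tau>) - \<tau> (\<theta> \<tau>)) * c \<tau>) = 1"
    proof (intro prod.neutral ballI)
      fix \<tau> assume "\<tau> \<in> carrier GG - {\<one>\<^bsub>GG\<^esub>}"
      hence "\<theta> \<tau> - \<tau> (\<theta> \<tau>) \<noteq> 0" "\<theta> \<tau> \<in> K" using \<theta>[of \<tau>] by auto
      thus "(\<sigma> (\<theta> \<tau>) - \<tau> (\<theta> \<tau>)) * c \<tau> = 1" using True by (simp add: c_def)
    qed
    thus ?thesis using xs(2)[OF \<sigma>] True by simp
  next
    case False
    hence "(\<Prod>\<tau>\<in>carrier GG - {\<one>\<^bsub>GG\<^esub>}. (\<sigma> (\<theta> \<tau>) - \<tau> (\<theta> \<tau>)) * c \<tau>) = 0"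
      using finite_GG \<sigma> by (intro prod_zero) auto
    thus ?thesis using xs(2)[OF \<sigma>] False by simp
  qed
  thus thesis using that[OF xs(1)] by blast
qed

lemma sum_list_sum_swap:
  "finite S \<Longrightarrow> (\<Sum>(d, a)\<leftarrow>xs. d * (\<Sum>\<sigma>\<in>S. g \<sigma> * \<sigma> a)) = (\<Sum>\<sigma>\<in>S. g \<sigma> * (\<Sum>(d, a)\<leftarrow>xs. d * \<sigma> a))"
  for g :: "('a \<Rightarrow> 'a) \<Rightarrow> 'a"
  by (induction xs) (auto simp: sum_distrib_left sum.distrib algebra_simps)

theorem hilbert90:
  assumes f: "f \<in> KU.Z1"
  obtains b where "b \<in> K" "b \<noteq> 0" "f = d0 GG (field_units K) (\<lambda>\<sigma> x. \<sigma> x) b"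
proof -
  have fK: "f \<sigma> \<in> K" "f \<sigma> \<noteq> 0" if "\<sigma> \<in> carrier GG" for \<sigma>
    using KU.C1_apply[OF KU.Z1_closed[OF f] that] by auto
  have cocycle: "f (\<sigma> \<otimes>\<^bsub>GG\<^esub> \<tau>) = f \<sigma> * \<sigma> (f \<tau>)" if "\<sigma> \<in> carrier GG" "\<tau> \<in> carrier GG" for \<sigma> \<tau>
    using f that unfolding KU.Z1_iff by simp
  obtain xs where xs: "set xs \<subseteq> K \<times> K"
    "\<And>\<sigma>. \<sigma> \<in> carrier GG \<Longrightarrow> (\<Sum>(d, a)\<leftarrow>xs. d * \<sigma> a) = (if \<sigma> = \<one>\<^bsub>GG\<^esub> then 1 else 0)"
    using identity_idempotent by blast
  define c where "c a = (\<Sum>\<sigma>\<in>carrier GG. f \<sigma> * \<sigma> a)" for a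
  have "(\<Sum>(d, a)\<leftarrow>xs. d * c a) = (\<Sum>\<sigma>\<in>carrier GG. f \<sigma> * (if \<sigma> = \<one>\<^bsub>GG\<^esub> then 1 else 0))"
    unfolding c_def sum_list_sum_swap[OF finite_GG] by (intro sum.cong refl) (simp add: xs(2))
  also have "\<dots> = f \<one>\<^bsub>GG\<^esub>" using finite_GG by (simp add: if_distrib cong: if_cong)
  finally have nz: "(\<Sum>(d, a)\<leftarrow>xs. d * c a) \<noteq> 0" using fK(2)[of "\<one>\<^bsub>GG\<^esub>"] by simp
  have "\<exists>(d, a)\<in>set xs. c a \<noteq> 0"
  proof (rule ccontr)
    assume "\<not> ?thesis"
    hence "(\<Sum>(d, a)\<leftarrow>xs. d * c a) = (\<Sum>x\<leftarrow>xs. 0)" by (intro arg_cong[of _ _ sum_list] map_cong) auto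
    thus False using nz by simp
  qed
  then obtain a where a: "a \<in> K" "c a \<noteq> 0" using xs(1) by auto
  have cK: "c a \<in> K" unfolding c_def using fK a(1) by simp
  have fc: "f \<tau> * \<tau> (c a) = c a" if \<tau>: "\<tau> \<in> carrier GG" for \<tau>
  proof -
    have "f \<tau> * \<tau> (c a) = (\<Sum>\<sigma>\<in>carrier GG. f (\<tau> \<otimes>\<^bsub>GG\<^esub> \<sigma>) * (\<tau> \<otimes>\<^bsub>GG\<^esub> \<sigma>) a)"
      unfolding c_def using \<tau> fK a(1)
      by (subst gal_sum) (simp_all add: sum_distrib_left gal_mult cocycle mult.assoc)
    also have "\<dots> = c a" unfolding c_def
      by (rule sum.reindex_bij_betw[OF bij_betw_gal_mult[OF \<tau>], of "\<lambda>\<sigma>. f \<sigma> * \<sigma> a"])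
    finally show ?thesis .
  qed
  define b where "b = inverse (c a)"
  have b: "b \<in> K" "b \<noteq> 0" unfolding b_def using cK a by auto
  have "f \<tau> = d0 GG (field_units K) (\<lambda>\<sigma> x. \<sigma> x) b \<tau>" if \<tau>: "\<tau> \<in> carrier GG" for \<tau>
  proof -
    have "\<tau> (c a) \<noteq> 0" using gal_eq_0_iff[OF \<tau> cK] a(2) by simp
    hence "f \<tau> = c a / \<tau> (c a)" using fc[OF \<tau>] by (simp add: field_simps)
    thus ?thesis using \<tau> b cK a(2) by (simp add: d0_def b_def gal_inverse divide_inverse mult.commute)
  qed
  hence "f = d0 GG (field_units K) (\<lambda>\<sigma> x. \<sigma> x) b"
    using KU.Z1_closed[OF f] KU.d0.hom_closed[of b] b
    by (intro PiE_ext[of f "carrier GG" "\<lambda>_. carrier (field_units K)"]) simp_all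
  thus thesis using that b by blast
qed

end

section \<open>The kernel of the transgression\<close>

context galois_ext_places
begin

sublocale IU: gmodule GG "ideal_group K" "\<lambda>\<sigma> J. \<sigma> ` J"
proof (rule gmodule.intro[OF group_GG K.comm_group_ideal_group gmodule_axioms.intro])
  show "(\<lambda>J. \<sigma> ` J) \<in> hom (ideal_group K) (ideal_group K)" if "\<sigma> \<in> carrier GG" for \<sigma>
    by (rule gal_image_hom[OF that])
  show "\<one>\<^bsub>GG\<^esub> ` J = J" if "J \<in> carrier (ideal_group K)" for J
    using that K.fracD(1) by (intro gal_image_one) auto
  show "(\<sigma> \<otimes>\<^bsub>GG\<^esub> \<tau>) ` J = \<sigma> ` \<tau> ` J"
    if "\<sigma> \<in> carrier GG" "\<tau> \<in> carrier GG" "J \<in> carrier (ideal_group K)" for \<sigma> \<tau> J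
    using that K.fracD(1) by (intro gal_image_mult) auto
qed

lemma principal_group_simps [simp]:
  "carrier (principal_group K) = principal_ideals K"
  "I \<otimes>\<^bsub>principal_group K\<^esub> J = I \<star> J" "\<one>\<^bsub>principal_group K\<^esub> = OK"
  by (simp_all add: principal_group_def ideal_group_def)

lemma comm_group_principal: "comm_group (principal_group K)"
proof (rule group.group_comm_groupI)
  show "group (principal_group K)"
    unfolding principal_group_def by (rule K.IG.subgroup_imp_group[OF K.subgroup_principal])
  show "I \<otimes>\<^bsub>principal_group K\<^esub> J = J \<otimes>\<^bsub>principal_group K\<^esub> I" for I J by (simp add: ideal_prod_commute)
qed

lemma principal_frac: "J \<in> principal_ideals K \<Longrightarrow> K.frac J"
  by (auto simp: K.principal_ideals_iff)

lemma principal_group_inv [simp]: "J \<in> principal_ideals K \<Longrightarrow> inv\<^bsub>principal_group K\<^esub> J = K.iv J"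
  unfolding principal_group_def by (rule K.IG.m_inv_consistent[OF K.subgroup_principal])

lemma pideal_principal [simp]: "x \<in> K \<Longrightarrow> x \<noteq> 0 \<Longrightarrow> K.pideal x \<in> principal_ideals K"
  by (auto simp: K.principal_ideals_iff)

sublocale PU: gmodule GG "principal_group K" "\<lambda>\<sigma> J. \<sigma> ` J"
proof (rule gmodule.intro[OF group_GG comm_group_principal gmodule_axioms.intro])
  show "(\<lambda>J. \<sigma> ` J) \<in> hom (principal_group K) (principal_group K)" if \<sigma>: "\<sigma> \<in> carrier GG" for \<sigma>
  proof (rule homI)
    fix J assume "J \<in> carrier (principal_group K)"
    then obtain x where x: "x \<in> K" "x \<noteq> 0" "J = K.pideal x" by (auto simp: K.principal_ideals_iff)
    thus "\<sigma> ` J \<in> carrier (principal_group K)" using gal_eq_0_iff[OF \<sigma>] \<sigma> by (simp add: gal_pideal)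
  next
    fix I J assume "I \<in> carrier (principal_group K)" "J \<in> carrier (principal_group K)"
    hence "I \<subseteq> K" "J \<subseteq> K" using principal_frac K.fracD(1) by auto
    thus "\<sigma> ` (I \<otimes>\<^bsub>principal_group K\<^esub> J) = \<sigma> ` I \<otimes>\<^bsub>principal_group K\<^esub> \<sigma> ` J"
      using gal_ideal_prod[OF \<sigma>] by simp
  qed
  show "\<one>\<^bsub>GG\<^esub> ` J = J" if "J \<in> carrier (principal_group K)" for J
    using that principal_frac K.fracD(1) by (intro gal_image_one) auto
  show "(\<sigma> \<otimes>\<^bsub>GG\<^esub> \<tau>) ` J = \<sigma> ` \<tau> ` J"
    if "\<sigma> \<in> carrier GG" "\<tau> \<in> carrier GG" "J \<in> carrier (principal_group K)" for \<sigma> \<tau> J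
    using that principal_frac K.fracD(1) by (intro gal_image_mult) auto
qed

lemma pideal_eq_imp_unit:
  assumes "x \<in> K" "x \<noteq> 0" "y \<in> K" "y \<noteq> 0" "K.pideal x = K.pideal y"
  shows "x / y \<in> carrier (integer_units K)"
proof -
  have *: "x / y \<in> OK" if "y \<noteq> 0" "K.pideal x = K.pideal y" for x y
  proof -
    have "x \<in> K.pideal y" using K.pideal_memI(2)[of x] that by simp
    then obtain a where "a \<in> OK" "x = y * a" by (auto simp: K.pideal_iff)
    thus ?thesis using that by simp
  qed
  from *[OF assms(4,5)] *[OF assms(2) assms(5)[symmetric]] show ?thesis using assms by simp
qed

lemma pideal_unit: "u \<in> carrier (integer_units K) \<Longrightarrow> K.pideal u = OK"
proof -
  assume u: "u \<in> carrier (integer_units K)"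
  show "K.pideal u = OK"
  proof
    show "K.pideal u \<subseteq> OK" using u by (auto simp: K.pideal_iff)
    show "OK \<subseteq> K.pideal u"
    proof
      fix y assume y: "y \<in> OK"
      have "u * (inverse u * y) \<in> K.pideal u" using u y by (intro K.pideal_memI(1)) simp
      thus "y \<in> K.pideal u" using u by (simp add: mult.assoc[symmetric])
    qed
  qed
qed

lemma C1_units: "u \<in> carrier (C1 GG (integer_units K)) \<Longrightarrow> u \<in> carrier (C1 GG (field_units K))"
  by (auto simp: PiE_iff)

lemma d1_units:
  assumes u: "u \<in> carrier (C1 GG (integer_units K))"
  shows "d1 GG (field_units K) (\<lambda>\<sigma> x. \<sigma> x) u = d1 GG (integer_units K) (\<lambda>\<sigma> x. \<sigma> x) u"
  unfolding d1_def
proof (rule restrict_ext, clarify)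
  fix s t assume st: "s \<in> carrier GG" "t \<in> carrier GG"
  have "u (s \<otimes>\<^bsub>GG\<^esub> t) \<in> carrier (integer_units K)" using UU.C1_apply[OF u] st by blast
  moreover have "u (s \<otimes>\<^bsub>GG\<^esub> t) \<in> K" "u (s \<otimes>\<^bsub>GG\<^esub> t) \<noteq> 0" using calculation by auto
  ultimately show "s (u t) \<otimes>\<^bsub>field_units K\<^esub> inv\<^bsub>field_units K\<^esub> u (s \<otimes>\<^bsub>GG\<^esub> t) \<otimes>\<^bsub>field_units K\<^esub> u s =
      s (u t) \<otimes>\<^bsub>integer_units K\<^esub> inv\<^bsub>integer_units K\<^esub> u (s \<otimes>\<^bsub>GG\<^esub> t) \<otimes>\<^bsub>integer_units K\<^esub> u s"
    using field_units_inv integer_units_inv by simp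
qed

lemma d0_field_apply: "b \<in> K \<Longrightarrow> b \<noteq> 0 \<Longrightarrow> s \<in> carrier GG \<Longrightarrow> d0 GG (field_units K) (\<lambda>\<sigma> x. \<sigma> x) b s = s b / b"
  by (simp add: d0_def divide_inverse)

lemma gal_cls:
  assumes J: "J \<in> inv_ideals" and \<sigma>: "\<sigma> \<in> carrier GG"
  shows "(\<lambda>I. \<sigma> ` I) ` K.cls J = K.cls J"
proof -
  note frJ = inv_ideals_frac[OF J]
  have sub: "\<sigma> ` I \<in> K.cls J" if s: "\<sigma> \<in> carrier GG" and I: "I \<in> K.cls J" for \<sigma> I
  proof -
    obtain x where x: "x \<in> K" "x \<noteq> 0" "I = K.pideal x \<star> J" using I by (auto simp: K.mem_cls_iff)
    have "\<sigma> ` I = K.pideal (\<sigma> x) \<star> J"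
      using gal_ideal_prod[OF s, of "K.pideal x" J] x s K.fracD(1)[OF frJ] K.fracD(1)[OF K.pideal_frac] J
      by (simp add: gal_pideal inv_ideals_def)
    thus ?thesis using x gal_eq_0_iff[OF s x(1)] s unfolding K.mem_cls_iff by (intro bexI[of _ "\<sigma> x"]) auto
  qed
  show ?thesis
  proof
    show "(\<lambda>I. \<sigma> ` I) ` K.cls J \<subseteq> K.cls J" using sub[OF \<sigma>] by blast
    show "K.cls J \<subseteq> (\<lambda>I. \<sigma> ` I) ` K.cls J"
    proof
      fix I assume I: "I \<in> K.cls J"
      have "I \<subseteq> K" using K.fracD(1)[OF K.class_mem(1)[OF K.cls_closed[OF frJ] I]] .
      hence "I = \<sigma> ` (ginv \<sigma> ` I)" using gal_image_ginv(2)[OF \<sigma>] by simp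
      thus "I \<in> (\<lambda>I. \<sigma> ` I) ` K.cls J" using sub[OF GG.inv_closed[OF \<sigma>] I] by blast
    qed
  qed
qed

lemma transgression_eq:
  "transgression K F C = (\<Union>f\<in>connecting0 GG (principal_group K) (ideal_group K) K.cls (\<lambda>\<sigma> J. \<sigma> ` J) C.
     \<Union>h\<in>{h \<in> carrier (C1 GG (field_units K)). \<forall>s\<in>carrier GG. K.pideal (h s) = f s}.
       UU.BB #>\<^bsub>C2 GG (integer_units K)\<^esub> d1 GG (field_units K) (\<lambda>\<sigma> x. \<sigma> x) h)"
  unfolding transgression_def connecting1_def ..

lemma connecting0_eq:
  "connecting0 GG (principal_group K) (ideal_group K) K.cls (\<lambda>\<sigma> J. \<sigma> ` J) C =
    (\<Union>b\<in>{b. K.frac b \<and> K.cls b = C}. PU.cl (d0 GG (ideal_group K) (\<lambda>\<sigma> J. \<sigma> ` J) b))"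
  unfolding connecting0_def PU.cl_def by simp

lemma d0_ideal_apply: "s \<in> carrier GG \<Longrightarrow> d0 GG (ideal_group K) (\<lambda>\<sigma> J. \<sigma> ` J) b s = s ` b \<star> K.iv b"
  by (simp add: d0_def)

lemma transgression_inv:
  assumes J: "J \<in> inv_ideals" shows "transgression K F (K.cls J) = UU.BB"
proof -
  note frJ = inv_ideals_frac[OF J]
  have one: "UU.BB #>\<^bsub>C2 GG (integer_units K)\<^esub> d1 GG (field_units K) (\<lambda>\<sigma> x. \<sigma> x) h = UU.BB"
    if f: "f \<in> connecting0 GG (principal_group K) (ideal_group K) K.cls (\<lambda>\<sigma> J. \<sigma> ` J) (K.cls J)"
      and h: "h \<in> carrier (C1 GG (field_units K))" and hf: "\<And>s. s \<in> carrier GG \<Longrightarrow> K.pideal (h s) = f s" for f h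
  proof -
    obtain b where b: "K.frac b" "K.cls b = K.cls J" "f \<in> PU.cl (d0 GG (ideal_group K) (\<lambda>\<sigma> J. \<sigma> ` J) b)"
      using f unfolding connecting0_eq by blast
    obtain x where x: "x \<in> K" "x \<noteq> 0" "b = K.pideal x \<star> J" using K.cls_eq_iff[OF b(1) frJ] b(2) by blast
    obtain p where p: "p \<in> principal_ideals K"
      "f = d0 GG (principal_group K) (\<lambda>\<sigma> J. \<sigma> ` J) p \<otimes>\<^bsub>C1 GG (principal_group K)\<^esub> d0 GG (ideal_group K) (\<lambda>\<sigma> J. \<sigma> ` J) b"
      using b(3) unfolding PU.mem_cl_iff by auto
    obtain y where y: "y \<in> K" "y \<noteq> 0" "p = K.pideal y" using p(1) by (auto simp: K.principal_ideals_iff)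
    define z where "z = y * x"
    have z: "z \<in> K" "z \<noteq> 0" unfolding z_def using x y by auto
    have fs: "f s = K.pideal (s z / z)" if s: "s \<in> carrier GG" for s
    proof -
      have sx: "s x \<in> K" "s x \<noteq> 0" "s y \<in> K" "s y \<noteq> 0" using s x y gal_eq_0_iff[OF s] by auto
      have sb: "s ` b = K.pideal (s x) \<star> J"
        using gal_ideal_prod[OF s, of "K.pideal x" J] x s K.fracD(1)[OF frJ] K.fracD(1)[OF K.pideal_frac] J
        by (simp add: gal_pideal inv_ideals_def)
      have ivb: "K.iv b = K.pideal (inverse x) \<star> K.iv J"
        using x frJ K.IG.inv_mult[of "K.pideal x" J] by (simp add: K.pideal_inverse)
      have "f s = (s ` p \<star> K.iv p) \<star> (s ` b \<star> K.iv b)"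
        using s p(1) by (simp add: p(2) d0_def)
      also have "\<dots> = (K.pideal (s y) \<star> K.pideal (inverse y)) \<star> ((K.pideal (s x) \<star> J) \<star> (K.pideal (inverse x) \<star> K.iv J))"
        unfolding sb ivb y(3) using gal_pideal[OF s y(1)] y by (simp add: K.pideal_inverse)
      also have "\<dots> = (K.pideal (s y) \<star> K.pideal (inverse y) \<star> K.pideal (s x) \<star> K.pideal (inverse x)) \<star> (J \<star> K.iv J)"
        by (simp only: ideal_prod_ac)
      also have "\<dots> = K.pideal (s y * inverse y * s x * inverse x)"
        using sx x y frJ by (simp add: K.pideal_mult)
      also have "s y * inverse y * s x * inverse x = s z / z"
        using x y by (simp add: z_def gal_mult[OF s] divide_inverse)
      finally show ?thesis .
    qed
    define u where "u = (\<lambda>s\<in>carrier GG. h s / (s z / z))"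
    have hs: "h s \<in> K" "h s \<noteq> 0" if "s \<in> carrier GG" for s using KU.C1_apply[OF h that] by auto
    have sz: "s z / z \<in> K" "s z / z \<noteq> 0" if "s \<in> carrier GG" for s
      using that z gal_eq_0_iff[OF that z(1)] by auto
    have u: "u \<in> carrier (C1 GG (integer_units K))"
      unfolding u_def carrier_product_group
    proof (rule restrict_PiE_iff[THEN iffD2], intro ballI)
      fix s assume s: "s \<in> carrier GG"
      show "h s / (s z / z) \<in> carrier (integer_units K)"
        using pideal_eq_imp_unit[OF hs[OF s] sz[OF s]] hf[OF s] fs[OF s] by simp
    qed
    have "h = u \<otimes>\<^bsub>C1 GG (field_units K)\<^esub> d0 GG (field_units K) (\<lambda>\<sigma> x. \<sigma> x) z"
    proof (rule PiE_ext)
      show "h \<in> (\<Pi>\<^sub>E s\<in>carrier GG. carrier (field_units K))" using h by simp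
      show "u \<otimes>\<^bsub>C1 GG (field_units K)\<^esub> d0 GG (field_units K) (\<lambda>\<sigma> x. \<sigma> x) z \<in> (\<Pi>\<^sub>E s\<in>carrier GG. carrier (field_units K))"
        using KU.C1.m_closed[OF C1_units[OF u] KU.d0.hom_closed[of z]] z by simp
      show "h s = (u \<otimes>\<^bsub>C1 GG (field_units K)\<^esub> d0 GG (field_units K) (\<lambda>\<sigma> x. \<sigma> x) z) s" if "s \<in> carrier GG" for s
        using that sz[OF that] d0_field_apply[OF z that] by (simp add: u_def)
    qed
    hence "d1 GG (field_units K) (\<lambda>\<sigma> x. \<sigma> x) h = d1 GG (integer_units K) (\<lambda>\<sigma> x. \<sigma> x) u"
      using KU.d1.hom_mult[OF C1_units[OF u] KU.d0.hom_closed[of z]] KU.d1_d0[of z] z d1_units[OF u]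
        KU.C2.r_one[OF KU.d1.hom_closed[OF C1_units[OF u]]] by simp
    moreover have "d1 GG (integer_units K) (\<lambda>\<sigma> x. \<sigma> x) u \<in> UU.BB" unfolding B2_def using u by blast
    ultimately show ?thesis
      using UU.C2.coset_join2[OF UU.d1.hom_closed[OF u] UU.subgroup_B2] by simp
  qed
  define f where "f = d0 GG (ideal_group K) (\<lambda>\<sigma> J. \<sigma> ` J) J"
  have f1: "f s = OK" if "s \<in> carrier GG" for s
    using that J frJ by (simp add: f_def d0_ideal_apply inv_ideals_def)
  have "f \<in> carrier (C1 GG (principal_group K))"
  proof -
    have "OK \<in> principal_ideals K" using pideal_principal[OF K.L_1] by simp
    moreover have "f \<in> extensional (carrier GG)" unfolding f_def d0_def by simp
    ultimately show ?thesis using f1 by (simp add: PiE_iff)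
  qed
  hence "f \<in> PU.cl f" by (rule PU.cl_self)
  hence fc: "f \<in> connecting0 GG (principal_group K) (ideal_group K) K.cls (\<lambda>\<sigma> J. \<sigma> ` J) (K.cls J)"
    unfolding connecting0_eq using frJ f_def by blast
  define h where "h = (\<lambda>s\<in>carrier GG. 1::'a)"
  have h: "h \<in> carrier (C1 GG (field_units K))" "\<And>s. s \<in> carrier GG \<Longrightarrow> K.pideal (h s) = f s"
    unfolding h_def using f1 by simp_all
  show ?thesis
  proof
    show "transgression K F (K.cls J) \<subseteq> UU.BB"
      unfolding transgression_eq using one by blast
    show "UU.BB \<subseteq> transgression K F (K.cls J)"
      unfolding transgression_eq using one[OF fc h] fc h by blast
  qed
qed

lemma transgression_trivial_imp:
  assumes J: "K.frac J" and inv: "\<And>\<sigma>. \<sigma> \<in> carrier GG \<Longrightarrow> \<sigma> ` J \<in> K.cls J"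
    and tr: "transgression K F (K.cls J) = UU.BB"
  shows "K.cls J \<in> K.cls ` inv_ideals"
proof -
  have "\<exists>x. \<sigma> \<in> carrier GG \<longrightarrow> x \<in> K \<and> x \<noteq> 0 \<and> \<sigma> ` J = K.pideal x \<star> J" for \<sigma>
    using inv[of \<sigma>] by (auto simp: K.mem_cls_iff)
  then obtain h0 where h0: "\<And>\<sigma>. \<sigma> \<in> carrier GG \<Longrightarrow> h0 \<sigma> \<in> K \<and> h0 \<sigma> \<noteq> 0 \<and> \<sigma> ` J = K.pideal (h0 \<sigma>) \<star> J" by metis
  define h where "h = restrict h0 (carrier GG)"
  have hK: "h \<sigma> \<in> K" "h \<sigma> \<noteq> 0" "\<sigma> ` J = K.pideal (h \<sigma>) \<star> J" if "\<sigma> \<in> carrier GG" for \<sigma>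
    using h0[OF that] that unfolding h_def by simp_all
  have h: "h \<in> carrier (C1 GG (field_units K))" unfolding h_def using h0 by simp
  define f where "f = d0 GG (ideal_group K) (\<lambda>\<sigma> J. \<sigma> ` J) J"
  have fs: "f s = K.pideal (h s)" if "s \<in> carrier GG" for s
  proof -
    have "f s = K.pideal (h s) \<star> (J \<star> K.iv J)"
      using that hK(3)[OF that] by (simp add: f_def d0_ideal_apply ideal_prod_assoc)
    thus ?thesis using J hK[OF that] by simp
  qed
  have "f \<in> extensional (carrier GG)" unfolding f_def d0_def by simp
  hence "f \<in> carrier (C1 GG (principal_group K))" using fs hK by (simp add: PiE_iff)
  hence "f \<in> PU.cl f" by (rule PU.cl_self)
  hence fc: "f \<in> connecting0 GG (principal_group K) (ideal_group K) K.cls (\<lambda>\<sigma> J. \<sigma> ` J) (K.cls J)"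
    unfolding connecting0_eq using J f_def by blast
  let ?d = "d1 GG (field_units K) (\<lambda>\<sigma> x. \<sigma> x)"
  have e: "\<one>\<^bsub>C2 GG (integer_units K)\<^esub> \<otimes>\<^bsub>C2 GG (integer_units K)\<^esub> ?d h = ?d h"
    by (auto simp: d1_def fun_eq_iff)
  have "?d h \<in> UU.BB #>\<^bsub>C2 GG (integer_units K)\<^esub> ?d h"
    unfolding r_coset_def
    by (rule UN_I[OF subgroup.one_closed[OF UU.subgroup_B2]], simp only: e singleton_iff)
  hence "?d h \<in> transgression K F (K.cls J)"
    unfolding transgression_eq
  proof (intro UN_I[OF fc] UN_I)
    show "h \<in> {h \<in> carrier (C1 GG (field_units K)). \<forall>s\<in>carrier GG. K.pideal (h s) = f s}"
      using h fs by simp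
  qed
  then obtain u where u: "u \<in> carrier (C1 GG (integer_units K))" "?d h = d1 GG (integer_units K) (\<lambda>\<sigma> x. \<sigma> x) u"
    unfolding tr B2_def by blast
  note uC = C1_units[OF u(1)]
  define g where "g = h \<otimes>\<^bsub>C1 GG (field_units K)\<^esub> inv\<^bsub>C1 GG (field_units K)\<^esub> u"
  have gC: "g \<in> carrier (C1 GG (field_units K))" unfolding g_def using h uC by (intro KU.C1.m_closed KU.C1.inv_closed)
  have "?d g = ?d h \<otimes>\<^bsub>C2 GG (field_units K)\<^esub> inv\<^bsub>C2 GG (field_units K)\<^esub> ?d u"
    unfolding g_def using h uC KU.d1.hom_mult[OF h KU.C1.inv_closed[OF uC]] KU.d1.hom_inv[OF uC] by simp
  also have "?d h = ?d u" using u(2) d1_units[OF u(1)] by simp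
  also have "?d u \<otimes>\<^bsub>C2 GG (field_units K)\<^esub> inv\<^bsub>C2 GG (field_units K)\<^esub> ?d u = \<one>\<^bsub>C2 GG (field_units K)\<^esub>"
    by (rule KU.C2.r_inv[OF KU.d1.hom_closed[OF uC]])
  finally have "?d g = \<one>\<^bsub>C2 GG (field_units K)\<^esub>" .
  hence "g \<in> KU.Z1" unfolding KU.Z1_def kernel_def using gC by simp
  then obtain b where b: "b \<in> K" "b \<noteq> 0" "g = d0 GG (field_units K) (\<lambda>\<sigma> x. \<sigma> x) b" by (rule hilbert90)
  define J' where "J' = K.pideal (inverse b) \<star> J"
  have frJ': "K.frac J'" unfolding J'_def using b J by simp
  have "\<sigma> ` J' = J'" if \<sigma>: "\<sigma> \<in> carrier GG" for \<sigma>
  proof -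
    have sb: "\<sigma> b \<in> K" "\<sigma> b \<noteq> 0" using \<sigma> b gal_eq_0_iff[OF \<sigma> b(1)] by auto
    have us: "u \<sigma> \<in> carrier (integer_units K)" by (rule UU.C1_apply[OF u(1) \<sigma>])
    hence us': "u \<sigma> \<in> K" "u \<sigma> \<noteq> 0" by auto
    have "inv\<^bsub>C1 GG (field_units K)\<^esub> u = (\<lambda>s\<in>carrier GG. inv\<^bsub>field_units K\<^esub> u s)"
      using uC comm_group.axioms(2)[OF comm_group_field_units] by (intro inv_product_group) auto
    hence "g \<sigma> = h \<sigma> * inverse (u \<sigma>)" using \<sigma> us' by (simp add: g_def)
    moreover have "g \<sigma> = \<sigma> b / b" unfolding b(3) by (rule d0_field_apply[OF b(1,2) \<sigma>])
    ultimately have hs: "h \<sigma> = u \<sigma> * (\<sigma> b / b)" using us' by (simp add: field_simps)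
    have "\<sigma> ` J' = K.pideal (inverse (\<sigma> b)) \<star> \<sigma> ` J"
      unfolding J'_def using gal_ideal_prod[OF \<sigma>, of "K.pideal (inverse b)" J] b K.fracD(1)[OF J] K.fracD(1)[OF K.pideal_frac] \<sigma>
      by (simp add: gal_pideal gal_inverse)
    also have "\<sigma> ` J = K.pideal (u \<sigma> * (\<sigma> b / b)) \<star> J" using hK(3)[OF \<sigma>] hs by simp
    also have "K.pideal (u \<sigma> * (\<sigma> b / b)) = K.pideal (\<sigma> b / b)"
      using K.pideal_mult[of "u \<sigma>" "\<sigma> b / b"] us' sb b pideal_unit[OF us] by simp
    also have "K.pideal (inverse (\<sigma> b)) \<star> (K.pideal (\<sigma> b / b) \<star> J) = K.pideal (inverse (\<sigma> b) * (\<sigma> b / b)) \<star> J"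
      using sb b by (simp add: ideal_prod_assoc[symmetric] K.pideal_mult)
    also have "inverse (\<sigma> b) * (\<sigma> b / b) = inverse b" using sb b by (simp add: field_simps)
    finally show ?thesis unfolding J'_def .
  qed
  hence "J' \<in> inv_ideals" using frJ' unfolding inv_ideals_def by blast
  moreover have "K.cls J' = K.cls J"
  proof -
    have "\<exists>x\<in>K. x \<noteq> 0 \<and> J' = K.pideal x \<star> J"
      unfolding J'_def using b(1,2) by (intro bexI[of _ "inverse b"]) simp_all
    thus ?thesis using K.cls_eq_iff[OF frJ' J] by simp
  qed
  ultimately show ?thesis by (metis image_eqI)
qed

theorem transgression_kernel_eq: "transgression_kernel K F = K.cls ` inv_ideals"
proof -
  have car: "carrier (class_invariants K F) =
      {C \<in> carrier (class_group K). \<forall>\<sigma>\<in>carrier GG. (\<lambda>J. \<sigma> ` J) ` C = C}"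
    unfolding class_invariants_def invariants_def by simp
  have one: "\<one>\<^bsub>H2 GG (integer_units K) (\<lambda>\<sigma> x. \<sigma> x)\<^esub> = UU.BB" unfolding H2_def by simp
  show ?thesis
  proof
    show "K.cls ` inv_ideals \<subseteq> transgression_kernel K F"
      using gal_cls transgression_inv inv_ideals_frac
      unfolding transgression_kernel_def kernel_def car one by auto
    show "transgression_kernel K F \<subseteq> K.cls ` inv_ideals"
    proof
      fix C assume "C \<in> transgression_kernel K F"
      hence C: "C \<in> carrier (class_group K)" "\<And>\<sigma>. \<sigma> \<in> carrier GG \<Longrightarrow> (\<lambda>J. \<sigma> ` J) ` C = C"
        "transgression K F C = UU.BB"
        unfolding transgression_kernel_def kernel_def car one by auto
      obtain J where J: "K.frac J" "C = K.cls J" using C(1) by (auto simp: K.carrier_class_group)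
      have "\<sigma> ` J \<in> K.cls J" if "\<sigma> \<in> carrier GG" for \<sigma>
        using C(2)[OF that] K.cls_self[OF J(1)] unfolding J(2) by blast
      thus "C \<in> K.cls ` inv_ideals" using transgression_trivial_imp[OF J(1)] C(3) unfolding J(2) by blast
    qed
  qed
qed

end

section \<open>Completions and local units\<close>

context number_ring
begin

definition nul :: "'a set \<Rightarrow> (nat \<Rightarrow> 'a) \<Rightarrow> bool" where
  "nul P x \<longleftrightarrow> (\<forall>n. x n \<in> L) \<and> (\<forall>k. \<exists>N. \<forall>n\<ge>N. vge P k (x n))"

definition cau :: "'a set \<Rightarrow> (nat \<Rightarrow> 'a) \<Rightarrow> bool" where
  "cau P x \<longleftrightarrow> (\<forall>n. x n \<in> L) \<and> (\<forall>k. \<exists>N. \<forall>m\<ge>N. \<forall>n\<ge>N. vge P k (x m - x n))"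

lemma cau_L [simp]: "cau P x \<Longrightarrow> x n \<in> L"
  unfolding cau_def by blast

lemma nul_L: "nul P x \<Longrightarrow> x n \<in> L"
  unfolding nul_def by blast

lemma vge_abs_at:
  assumes "x \<in> L"
  shows "vge P k x \<Longrightarrow> abs_at L P x \<le> 2 powi (- k)"
    and "abs_at L P x < 2 powi (- k) \<Longrightarrow> vge P k x"
proof -
  show "vge P k x \<Longrightarrow> abs_at L P x \<le> 2 powi (- k)"
    unfolding vge_def abs_at_def using power_int_increasing[of "- vo P x" "- k" "2::real"] by auto
  show "vge P k x" if lt: "abs_at L P x < 2 powi (- k)"
  proof (rule ccontr)
    assume "\<not> vge P k x"
    hence "x \<noteq> 0" "- k \<le> - vo P x" using assms unfolding vge_def by auto
    thus False using lt power_int_increasing[of "- k" "- vo P x" "2::real"] by (simp add: abs_at_def)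
  qed
qed

lemma powi_small:
  assumes "e > 0" obtains k :: int where "2 powi (- k) < (e::real)"
proof -
  obtain n where "(1 / 2) ^ n < e" using real_arch_pow_inv[of e "1/2"] assms by auto
  hence "2 powi (- int n) < e" by (simp add: power_int_minus power_one_over inverse_eq_divide)
  thus thesis using that by blast
qed

lemma powi_le_1_imp:
  assumes "2 powi (- c) \<le> (1::real)" shows "c \<ge> 0"
proof (rule ccontr)
  assume c: "\<not> c \<ge> 0"
  hence "2 powi (- c) = (2::real) ^ nat (- c)" by (simp add: power_int_def)
  moreover have "(2::real) ^ nat (- c) > 1" using c by (intro one_less_power) auto
  ultimately show False using assms by simp
qed

lemma small_iff_vge:
  assumes "\<And>i. f i \<in> L"
  shows "(\<forall>e>0. \<exists>N::nat. \<forall>i. Q N i \<longrightarrow> abs_at L P (f i) < e) \<longleftrightarrow> (\<forall>k. \<exists>N. \<forall>i. Q N i \<longrightarrow> vge P k (f i))"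
proof
  assume *: "\<forall>e>0. \<exists>N. \<forall>i. Q N i \<longrightarrow> abs_at L P (f i) < e"
  show "\<forall>k. \<exists>N. \<forall>i. Q N i \<longrightarrow> vge P k (f i)"
  proof
    fix k
    have "(2::real) powi (- k) > 0" by simp
    then obtain N where "\<forall>i. Q N i \<longrightarrow> abs_at L P (f i) < 2 powi (- k)" using * by blast
    thus "\<exists>N. \<forall>i. Q N i \<longrightarrow> vge P k (f i)" using vge_abs_at(2)[OF assms] by blast
  qed
next
  assume *: "\<forall>k. \<exists>N. \<forall>i. Q N i \<longrightarrow> vge P k (f i)"
  show "\<forall>e>0. \<exists>N. \<forall>i. Q N i \<longrightarrow> abs_at L P (f i) < e"
  proof (intro allI impI)
    fix e :: real assume "e > 0"
    then obtain k :: int where k: "2 powi (- k) < e" by (rule powi_small)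
    obtain N where "\<forall>i. Q N i \<longrightarrow> vge P k (f i)" using * by blast
    thus "\<exists>N. \<forall>i. Q N i \<longrightarrow> abs_at L P (f i) < e"
      using vge_abs_at(1)[OF assms] k by (meson order.strict_trans1)
  qed
qed

lemma cau_iff: "x \<in> carrier (cauchy_ring L P) \<longleftrightarrow> cau P x"
proof (cases "range x \<subseteq> L")
  case True
  hence "x n \<in> L" for n by blast
  hence "(\<forall>e>0. \<exists>N::nat. \<forall>i. (fst i \<ge> N \<and> snd i \<ge> N) \<longrightarrow> abs_at L P (x (fst i) - x (snd i)) < e) \<longleftrightarrow>
      (\<forall>k. \<exists>N. \<forall>i. (fst i \<ge> N \<and> snd i \<ge> N) \<longrightarrow> vge P k (x (fst i) - x (snd i)))"
    by (intro small_iff_vge) simp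
  hence "(\<forall>e>0. \<exists>N. \<forall>m\<ge>N. \<forall>n\<ge>N. abs_at L P (x m - x n) < e) \<longleftrightarrow>
      (\<forall>k. \<exists>N. \<forall>m\<ge>N. \<forall>n\<ge>N. vge P k (x m - x n))"
    unfolding split_paired_All fst_conv snd_conv imp_conjL[of "_ \<le> _" "_ \<le> _"] by (simp only: imp_conjL all_simps)
  moreover have "(\<forall>n. x n \<in> L) \<longleftrightarrow> range x \<subseteq> L" by blast
  ultimately show ?thesis using True unfolding cauchy_ring_def cau_def by simp
next
  case False
  thus ?thesis unfolding cauchy_ring_def cau_def by auto
qed

lemma carrier_cauchy_ring [simp]: "carrier (cauchy_ring L P) = {x. cau P x}"
  using cau_iff by blast

lemma cauchy_ring_simps [simp]:
  "x \<otimes>\<^bsub>cauchy_ring L P\<^esub> y = (\<lambda>n. x n * y n)" "x \<oplus>\<^bsub>cauchy_ring L P\<^esub> y = (\<lambda>n. x n + y n)"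
  "\<one>\<^bsub>cauchy_ring L P\<^esub> = (\<lambda>_. 1)" "\<zero>\<^bsub>cauchy_ring L P\<^esub> = (\<lambda>_. 0)"
  unfolding cauchy_ring_def by simp_all

context
  fixes P assumes P: "P \<in> primes_of L"
begin

lemma nul_imp_cau: "nul P x \<Longrightarrow> cau P x"
proof -
  assume x: "nul P x"
  have "\<exists>N. \<forall>m\<ge>N. \<forall>n\<ge>N. vge P k (x m - x n)" for k
  proof -
    obtain N where "\<forall>n\<ge>N. vge P k (x n)" using x unfolding nul_def by blast
    thus ?thesis using vge_diff[OF P] by blast
  qed
  thus ?thesis using x unfolding cau_def nul_def by blast
qed

lemma null_seqs_eq: "null_seqs L P = {x. nul P x}"
proof -
  have "(\<lambda>n. abs_at L P (x n)) \<longlonglongrightarrow> 0 \<longleftrightarrow> (\<forall>k. \<exists>N. \<forall>n\<ge>N. vge P k (x n))" if "cau P x" for x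
  proof -
    have "abs_at L P y \<ge> 0" for y unfolding abs_at_def by simp
    hence "(\<lambda>n. abs_at L P (x n)) \<longlonglongrightarrow> 0 \<longleftrightarrow> (\<forall>e>0. \<exists>N. \<forall>n. n \<ge> N \<longrightarrow> abs_at L P (x n) < e)"
      unfolding LIMSEQ_def by simp
    also have "\<dots> \<longleftrightarrow> (\<forall>k. \<exists>N. \<forall>n. n \<ge> N \<longrightarrow> vge P k (x n))"
      using that by (intro small_iff_vge[of x "\<lambda>N n. n \<ge> N"]) simp
    finally show ?thesis .
  qed
  hence "x \<in> null_seqs L P \<longleftrightarrow> nul P x" for x
    unfolding null_seqs_def using nul_imp_cau[of x] cau_L[of P x] unfolding nul_def by auto
  thus ?thesis by blast
qed

lemma cau_const [simp]: "a \<in> L \<Longrightarrow> cau P (\<lambda>_. a)"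
  unfolding cau_def by simp

lemma cau_add:
  assumes "cau P x" "cau P y" shows "cau P (\<lambda>n. x n + y n)"
  unfolding cau_def
proof (intro conjI allI)
  fix k
  obtain N M where N: "\<forall>m\<ge>N. \<forall>n\<ge>N. vge P k (x m - x n)" and M: "\<forall>m\<ge>M. \<forall>n\<ge>M. vge P k (y m - y n)"
    using assms unfolding cau_def by metis
  have "vge P k ((x m + y m) - (x n + y n))" if "m \<ge> max N M" "n \<ge> max N M" for m n
  proof -
    have "vge P k ((x m - x n) + (y m - y n))" using N M that by (intro vge_add[OF P]) auto
    thus ?thesis by (simp add: algebra_simps)
  qed
  thus "\<exists>N. \<forall>m\<ge>N. \<forall>n\<ge>N. vge P k (x m + y m - (x n + y n))" by blast
qed (use assms in simp)

lemma cau_uminus: "cau P x \<Longrightarrow> cau P (\<lambda>n. - x n)"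
  unfolding cau_def
proof (elim conjE, intro conjI allI)
  fix k assume "\<forall>n. x n \<in> L" "\<forall>k. \<exists>N. \<forall>m\<ge>N. \<forall>n\<ge>N. vge P k (x m - x n)"
  then obtain N where N: "\<forall>m\<ge>N. \<forall>n\<ge>N. vge P k (x m - x n)" by blast
  have "vge P k (- x m - - x n)" if "m \<ge> N" "n \<ge> N" for m n
    using N that vge_uminus[OF P, of k "x m - x n"] by simp
  thus "\<exists>N. \<forall>m\<ge>N. \<forall>n\<ge>N. vge P k (- x m - - x n)" by blast
qed simp

lemma cau_bounded:
  assumes "cau P x" obtains B N where "\<And>n. n \<ge> N \<Longrightarrow> vge P B (x n)"
proof -
  obtain N where N: "\<forall>m\<ge>N. \<forall>n\<ge>N. vge P 0 (x m - x n)" using assms unfolding cau_def by blast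
  define B where "B = min 0 (vo P (x N))"
  have "vge P B (x n)" if "n \<ge> N" for n
  proof -
    have "vge P B (x n - x N)" using N that by (intro vge_mono[of P 0 _ B]) (auto simp: B_def)
    moreover have "vge P B (x N)" using assms by (simp add: vge_def B_def)
    ultimately show ?thesis using vge_add[OF P, of B "x n - x N" "x N"] by simp
  qed
  thus thesis using that by blast
qed

lemma cau_mult:
  assumes "cau P x" "cau P y" shows "cau P (\<lambda>n. x n * y n)"
  unfolding cau_def
proof (intro conjI allI)
  fix k
  obtain A N1 where A: "\<And>n. n \<ge> N1 \<Longrightarrow> vge P A (x n)" using cau_bounded[OF assms(1)] by blast
  obtain B N2 where B: "\<And>n. n \<ge> N2 \<Longrightarrow> vge P B (y n)" using cau_bounded[OF assms(2)] by blast
  obtain N3 where N3: "\<forall>m\<ge>N3. \<forall>n\<ge>N3. vge P (k - B) (x m - x n)" using assms(1) unfolding cau_def by blast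
  obtain N4 where N4: "\<forall>m\<ge>N4. \<forall>n\<ge>N4. vge P (k - A) (y m - y n)" using assms(2) unfolding cau_def by blast
  define N where "N = max (max N1 N2) (max N3 N4)"
  have "vge P k (x m * y m - x n * y n)" if "m \<ge> N" "n \<ge> N" for m n
  proof -
    have "vge P (A + (k - A)) (x m * (y m - y n))" "vge P ((k - B) + B) ((x m - x n) * y n)"
      using A B N3 N4 that unfolding N_def by (intro vge_mult[OF P]; simp)+
    hence "vge P k (x m * (y m - y n) + (x m - x n) * y n)" using vge_add[OF P] by simp
    thus ?thesis by (simp add: algebra_simps)
  qed
  thus "\<exists>N. \<forall>m\<ge>N. \<forall>n\<ge>N. vge P k (x m * y m - x n * y n)" by blast
qed (use assms in simp)

lemma cau_sum: "(\<And>i. i \<in> I \<Longrightarrow> cau P (f i)) \<Longrightarrow> cau P (\<lambda>n. \<Sum>i\<in>I. f i n)"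
  by (induction I rule: infinite_finite_induct) (simp_all add: cau_add)

lemma nul_0: "nul P (\<lambda>_. 0)"
  unfolding nul_def by simp

lemma nul_add:
  assumes "nul P x" "nul P y" shows "nul P (\<lambda>n. x n + y n)"
  unfolding nul_def
proof (intro conjI allI)
  fix k
  obtain N M where N: "\<forall>n\<ge>N. vge P k (x n)" and M: "\<forall>n\<ge>M. vge P k (y n)"
    using assms unfolding nul_def by metis
  have "vge P k (x n + y n)" if "n \<ge> max N M" for n
    using N M that by (intro vge_add[OF P]) auto
  thus "\<exists>N. \<forall>n\<ge>N. vge P k (x n + y n)" by blast
qed (use assms nul_L in simp)

lemma nul_uminus: "nul P x \<Longrightarrow> nul P (\<lambda>n. - x n)"
  unfolding nul_def using vge_uminus[OF P] L_uminus by blast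

lemma nul_diff: "nul P x \<Longrightarrow> nul P y \<Longrightarrow> nul P (\<lambda>n. x n - y n)"
  using nul_add[of x "\<lambda>n. - y n"] nul_uminus[of y] by simp

lemma nul_mult:
  assumes "cau P x" "nul P y" shows "nul P (\<lambda>n. x n * y n)"
  unfolding nul_def
proof (intro conjI allI)
  fix k
  obtain A N1 where A: "\<And>n. n \<ge> N1 \<Longrightarrow> vge P A (x n)" using cau_bounded[OF assms(1)] by blast
  obtain N where N: "\<forall>n\<ge>N. vge P (k - A) (y n)" using assms(2) unfolding nul_def by blast
  have "vge P k (x n * y n)" if "n \<ge> max N1 N" for n
    using vge_mult[OF P A[of n], of "k - A" "y n"] N that by simp
  thus "\<exists>N. \<forall>n\<ge>N. vge P k (x n * y n)" by blast
qed (use assms nul_L in simp)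

lemma nul_sum: "(\<And>i. i \<in> I \<Longrightarrow> nul P (f i)) \<Longrightarrow> nul P (\<lambda>n. \<Sum>i\<in>I. f i n)"
  by (induction I rule: infinite_finite_induct) (simp_all add: nul_add nul_0)

lemma nul_eventually_zero:
  assumes "\<And>n. x n \<in> L" "\<And>n. n \<ge> N \<Longrightarrow> x n = 0" shows "nul P x"
  unfolding nul_def
proof (intro conjI allI)
  show "\<exists>N. \<forall>n\<ge>N. vge P k (x n)" for k using assms(2) by (intro exI[of _ N]) simp
qed (rule assms(1))

lemma cau_eventually_vo:
  assumes x: "cau P x" "\<not> nul P x"
  obtains N c where "\<And>n. n \<ge> N \<Longrightarrow> x n \<noteq> 0 \<and> vo P (x n) = c"
proof -
  obtain k where k: "\<And>N. \<exists>n\<ge>N. \<not> vge P k (x n)"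
  proof -
    assume *: "\<And>k. (\<And>N. \<exists>n\<ge>N. \<not> vge P k (x n)) \<Longrightarrow> thesis"
    have "\<forall>n. x n \<in> L" using cau_L[OF x(1)] ..
    have "\<not> (\<forall>k. \<exists>N. \<forall>n\<ge>N. vge P k (x n))"
      by (rule notI, rule notE[OF x(2)], unfold nul_def, rule conjI[OF \<open>\<forall>n. x n \<in> L\<close>])
    then obtain k where "\<not> (\<exists>N. \<forall>n\<ge>N. vge P k (x n))" by (simp only: not_all) (erule exE)
    thus thesis by (intro *[of k]) simp
  qed
  obtain N where N: "\<forall>m\<ge>N. \<forall>n\<ge>N. vge P k (x m - x n)" using x(1) unfolding cau_def by blast
  obtain n where n: "n \<ge> N" "\<not> vge P k (x n)" using k by blast
  hence xn: "x n \<in> L" "x n \<noteq> 0" "vo P (x n) < k" using x(1) unfolding vge_def by auto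
  have "x m \<noteq> 0 \<and> vo P (x m) = vo P (x n)" if "m \<ge> N" for m
  proof -
    have "vge P (vo P (x n) + 1) (x m - x n)" using N[rule_format, OF that n(1)] by (rule vge_mono) (use xn(3) in simp)
    thus ?thesis using vge_dominant[OF P xn(1,2)] by blast
  qed
  thus thesis using that by blast
qed

interpretation CR: cring "cauchy_ring L P"
proof (rule cringI)
  show "abelian_group (cauchy_ring L P)"
  proof (rule abelian_groupI)
    fix x assume "x \<in> carrier (cauchy_ring L P)"
    thus "\<exists>y\<in>carrier (cauchy_ring L P). y \<oplus>\<^bsub>cauchy_ring L P\<^esub> x = \<zero>\<^bsub>cauchy_ring L P\<^esub>"
      by (intro bexI[of _ "\<lambda>n. - x n"]) (simp_all add: cau_uminus)
  qed (simp_all add: cau_add add_ac)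
  show "comm_monoid (cauchy_ring L P)"
    by (rule comm_monoidI) (simp_all add: cau_mult mult_ac)
qed (simp add: distrib_right)

interpretation NI: ideal "null_seqs L P" "cauchy_ring L P"
proof (rule idealI[OF CR.ring_axioms])
  have um: "\<ominus>\<^bsub>cauchy_ring L P\<^esub> x = (\<lambda>n. - x n)" if "cau P x" for x
    using that by (intro CR.minus_equality) (simp_all add: cau_uminus)
  show "subgroup (null_seqs L P) (add_monoid (cauchy_ring L P))"
  proof (rule CR.add.subgroupI)
    show "null_seqs L P \<subseteq> carrier (cauchy_ring L P)" using nul_imp_cau by (auto simp: null_seqs_eq)
    show "null_seqs L P \<noteq> {}" using nul_0 by (auto simp: null_seqs_eq)
    show "\<ominus>\<^bsub>cauchy_ring L P\<^esub> x \<in> null_seqs L P" if "x \<in> null_seqs L P" for x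
      using that um[OF nul_imp_cau, of x] nul_uminus by (simp add: null_seqs_eq)
    show "x \<oplus>\<^bsub>cauchy_ring L P\<^esub> y \<in> null_seqs L P" if "x \<in> null_seqs L P" "y \<in> null_seqs L P" for x y
      using that nul_add by (simp add: null_seqs_eq)
  qed
  fix x y assume *: "x \<in> null_seqs L P" "y \<in> carrier (cauchy_ring L P)"
  show "y \<otimes>\<^bsub>cauchy_ring L P\<^esub> x \<in> null_seqs L P" using * nul_mult by (simp add: null_seqs_eq)
  show "x \<otimes>\<^bsub>cauchy_ring L P\<^esub> y \<in> null_seqs L P"
    using * nul_mult[of y x] by (simp add: null_seqs_eq mult.commute)
qed

abbreviation cc :: "(nat \<Rightarrow> 'a) \<Rightarrow> (nat \<Rightarrow> 'a) set" where
  "cc x \<equiv> null_seqs L P +>\<^bsub>cauchy_ring L P\<^esub> x"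

lemma cc_hom: "(\<lambda>x. cc x) \<in> Ring.ring_hom (cauchy_ring L P) (completion L P)"
  unfolding completion_def by (rule NI.rcos_ring_hom)

lemma carrier_completion: "carrier (completion L P) = cc ` {x. cau P x}"
  unfolding completion_def by (auto simp: FactRing_def A_RCOSETS_def')

lemma cc_mult: "cau P x \<Longrightarrow> cau P y \<Longrightarrow> cc x \<otimes>\<^bsub>completion L P\<^esub> cc y = cc (\<lambda>n. x n * y n)"
  using ring_hom_mult[OF cc_hom, of x y] by simp

lemma cc_one: "\<one>\<^bsub>completion L P\<^esub> = cc (\<lambda>_. 1)"
  using ring_hom_one[OF cc_hom] by simp

lemma mem_cc_iff: "y \<in> cc x \<longleftrightarrow> nul P (\<lambda>n. y n - x n)"
proof
  assume "y \<in> cc x"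
  then obtain h where "nul P h" "y = (\<lambda>n. h n + x n)" by (auto simp: a_r_coset_def' null_seqs_eq)
  thus "nul P (\<lambda>n. y n - x n)" by simp
next
  assume "nul P (\<lambda>n. y n - x n)"
  moreover have "y = (\<lambda>n. (y n - x n) + x n)" by simp
  ultimately show "y \<in> cc x" unfolding a_r_coset_def' null_seqs_eq by auto
qed

lemma cc_eq_iff: "cau P x \<Longrightarrow> cau P y \<Longrightarrow> cc x = cc y \<longleftrightarrow> nul P (\<lambda>n. x n - y n)"
proof
  assume "cc x = cc y"
  moreover have "x \<in> cc x" using nul_0 by (simp add: mem_cc_iff)
  ultimately show "nul P (\<lambda>n. x n - y n)" by (simp add: mem_cc_iff)
next
  assume n: "nul P (\<lambda>n. x n - y n)"
  have n': "nul P (\<lambda>n. y n - x n)" using nul_uminus[OF n] by simp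
  show "cc x = cc y"
  proof (rule Set.set_eqI)
    show "z \<in> cc x \<longleftrightarrow> z \<in> cc y" for z
      using nul_add[OF _ n, of "\<lambda>n. z n - x n"] nul_add[OF _ n', of "\<lambda>n. z n - y n"] by (auto simp: mem_cc_iff)
  qed
qed

lemma completion_abs_eq:
  assumes x: "cau P x" and c: "\<And>n. n \<ge> N \<Longrightarrow> x n \<noteq> 0 \<and> vo P (x n) = c"
  shows "completion_abs L P (cc x) = 2 powi (- c)"
  unfolding completion_abs_def
proof (rule the_equality)
  have lim: "(\<lambda>n. abs_at L P (y n)) \<longlonglongrightarrow> 2 powi (- c)" if y: "y \<in> cc x" for y
  proof -
    obtain M where M: "\<forall>n\<ge>M. vge P (c + 1) (y n - x n)" using y unfolding mem_cc_iff nul_def by blast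
    have "abs_at L P (y n) = 2 powi (- c)" if "n \<ge> max N M" for n
    proof -
      have xn: "x n \<in> L" "x n \<noteq> 0" "vo P (x n) = c" using x c[of n] that by auto
      have "vge P (vo P (x n) + 1) (y n - x n)" using M that xn(3) by simp
      from vge_dominant[OF P xn(1,2) this] show ?thesis using xn(3) by (simp add: abs_at_def)
    qed
    hence "eventually (\<lambda>n. abs_at L P (y n) = 2 powi (- c)) sequentially"
      using eventually_sequentially by blast
    thus ?thesis by (rule tendsto_eventually)
  qed
  thus "\<forall>y\<in>cc x. (\<lambda>n. abs_at L P (y n)) \<longlonglongrightarrow> 2 powi (- c)" by blast
  fix r assume "\<forall>y\<in>cc x. (\<lambda>n. abs_at L P (y n)) \<longlonglongrightarrow> r"
  moreover have "x \<in> cc x" using nul_0 by (simp add: mem_cc_iff)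
  ultimately show "r = 2 powi (- c)" using lim LIMSEQ_unique by blast
qed

definition useq :: "(nat \<Rightarrow> 'a) \<Rightarrow> bool" where
  "useq x \<longleftrightarrow> cau P x \<and> (\<forall>n. x n \<noteq> 0 \<and> vo P (x n) = 0)"

lemma useqD: "useq x \<Longrightarrow> cau P x" "useq x \<Longrightarrow> x n \<in> L" "useq x \<Longrightarrow> x n \<noteq> 0" "useq x \<Longrightarrow> vo P (x n) = 0"
  unfolding useq_def by auto

lemma useq_const: "a \<in> L \<Longrightarrow> a \<noteq> 0 \<Longrightarrow> vo P a = 0 \<Longrightarrow> useq (\<lambda>_. a)"
  unfolding useq_def by simp

lemma useq_mult: "useq x \<Longrightarrow> useq y \<Longrightarrow> useq (\<lambda>n. x n * y n)"
proof -
  assume x: "useq x" and y: "useq y"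
  have "vo P (x n * y n) = 0" for n
    using vo_mult[OF P useqD(2,3)[OF x, of n] useqD(2,3)[OF y, of n]] useqD(4)[OF x] useqD(4)[OF y] by simp
  thus ?thesis using useqD(1,3)[OF x] useqD(1,3)[OF y] unfolding useq_def by (simp add: cau_mult)
qed

lemma useq_inverse:
  assumes x: "useq x" shows "useq (\<lambda>n. inverse (x n))"
  unfolding useq_def cau_def
proof (intro conjI allI)
  fix k
  obtain N where N: "\<forall>m\<ge>N. \<forall>n\<ge>N. vge P k (x m - x n)" using useqD(1)[OF x] unfolding cau_def by blast
  have v0: "vge P 0 (inverse (x n))" for n
    using useqD(2,3,4)[OF x, of n] vo_inverse[OF P, of "x n"] unfolding vge_def by simp
  have "vge P k (inverse (x m) - inverse (x n))" if "m \<ge> N" "n \<ge> N" for m n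
  proof -
    have "vge P ((0 + 0) + k) ((inverse (x m) * inverse (x n)) * (x n - x m))"
      using N that by (intro vge_mult[OF P] v0) simp
    moreover have "(inverse (x m) * inverse (x n)) * (x n - x m) = inverse (x m) - inverse (x n)"
      using useqD(3)[OF x] by (simp add: field_simps)
    ultimately show ?thesis by simp
  qed
  thus "\<exists>N. \<forall>m\<ge>N. \<forall>n\<ge>N. vge P k (inverse (x m) - inverse (x n))" by blast
qed (use useqD[OF x] vo_inverse[OF P] in simp_all)

lemma useq_of_eventually:
  assumes x: "cau P x" and c: "\<And>n. n \<ge> N \<Longrightarrow> x n \<noteq> 0 \<and> vo P (x n) = 0"
  obtains y where "useq y" "cc y = cc x" "\<And>n. n \<ge> N \<Longrightarrow> y n = x n"
proof -
  define y where "y n = (if n \<ge> N then x n else 1)" for n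
  have "nul P (\<lambda>n. y n - x n)"
    by (rule nul_eventually_zero[of _ N]) (use x in \<open>auto simp: y_def\<close>)
  note ny = this
  from cau_add[OF nul_imp_cau[OF this] x] have cy: "cau P y" by simp
  have "useq y" unfolding useq_def using cy c P by (auto simp: y_def)
  moreover have "cc y = cc x" using ny cc_eq_iff[OF cy x] by simp
  ultimately show thesis using that by (simp add: y_def)
qed

lemma useq_not_nul: "useq x \<Longrightarrow> \<not> nul P x"
proof
  assume x: "useq x" "nul P x"
  then obtain N where "\<forall>n\<ge>N. vge P 1 (x n)" unfolding nul_def by blast
  hence "vge P 1 (x N)" by blast
  thus False using useqD(3,4)[OF x(1), of N] unfolding vge_def by simp
qed

lemma carrier_local_units: "carrier (local_units L P) = cc ` {x. useq x}"
proof -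
  let ?O = "{\<xi> \<in> carrier (completion L P). completion_abs L P \<xi> \<le> 1}"
  have mem: "cc x \<in> ?O" if x: "useq x" for x
    using completion_abs_eq[of x 0 0] useqD[OF x] by (auto simp: carrier_completion)
  have "\<xi> \<in> carrier (local_units L P) \<longleftrightarrow> \<xi> \<in> ?O \<and> (\<exists>\<eta>\<in>?O. \<eta> \<otimes>\<^bsub>completion L P\<^esub> \<xi> = \<one>\<^bsub>completion L P\<^esub> \<and>
      \<xi> \<otimes>\<^bsub>completion L P\<^esub> \<eta> = \<one>\<^bsub>completion L P\<^esub>)" for \<xi>
    unfolding local_units_def units_of_def Units_def by auto
  note iff = this
  show ?thesis
  proof
    show "cc ` {x. useq x} \<subseteq> carrier (local_units L P)"
    proof clarify
      fix x assume x: "useq x"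
      note ix = useq_inverse[OF x]
      have "(\<lambda>n. inverse (x n) * x n) = (\<lambda>_. 1)" "(\<lambda>n. x n * inverse (x n)) = (\<lambda>_. 1)"
        using useqD(3)[OF x] by auto
      hence "cc (\<lambda>n. inverse (x n)) \<otimes>\<^bsub>completion L P\<^esub> cc x = \<one>\<^bsub>completion L P\<^esub>"
        "cc x \<otimes>\<^bsub>completion L P\<^esub> cc (\<lambda>n. inverse (x n)) = \<one>\<^bsub>completion L P\<^esub>"
        using useqD(1)[OF x] useqD(1)[OF ix] by (simp_all add: cc_mult cc_one)
      thus "cc x \<in> carrier (local_units L P)" unfolding iff using mem[OF x] mem[OF ix] by blast
    qed
    show "carrier (local_units L P) \<subseteq> cc ` {x. useq x}"
    proof
      fix \<xi> assume "\<xi> \<in> carrier (local_units L P)"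
      then obtain \<eta> where \<xi>: "\<xi> \<in> ?O" "\<eta> \<in> ?O" "\<xi> \<otimes>\<^bsub>completion L P\<^esub> \<eta> = \<one>\<^bsub>completion L P\<^esub>"
        unfolding iff by blast
      then obtain x y where xy: "cau P x" "\<xi> = cc x" "cau P y" "\<eta> = cc y" by (auto simp: carrier_completion)
      have n1: "nul P (\<lambda>n. x n * y n - 1)"
        using \<xi>(3) xy cc_eq_iff[OF cau_mult[OF xy(1,3)] cau_const[OF L_1]] by (simp add: cc_mult cc_one)
      then obtain N0 where N0: "\<forall>n\<ge>N0. vge P 1 (x n * y n - 1)" unfolding nul_def by blast
      have d: "x n * y n \<noteq> 0 \<and> vo P (x n * y n) = 0" if "n \<ge> N0" for n
        using vge_dominant[OF P, of 1 "x n * y n"] N0 that P by simp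
      have nn: "\<not> nul P x" "\<not> nul P y"
      proof -
        have not: "\<not> nul P (\<lambda>n. x n * y n)"
        proof
          assume "nul P (\<lambda>n. x n * y n)"
          hence "nul P (\<lambda>n. x n * y n - (x n * y n - 1))" using n1 by (rule nul_diff)
          thus False using useq_not_nul[OF useq_const[of 1]] P by simp
        qed
        show "\<not> nul P x" using not nul_mult[OF xy(3), of x] by (auto simp: mult.commute)
        show "\<not> nul P y" using not nul_mult[OF xy(1), of y] by auto
      qed
      obtain N1 a where a: "\<And>n. n \<ge> N1 \<Longrightarrow> x n \<noteq> 0 \<and> vo P (x n) = a" using cau_eventually_vo[OF xy(1) nn(1)] by blast
      obtain N2 b where b: "\<And>n. n \<ge> N2 \<Longrightarrow> y n \<noteq> 0 \<and> vo P (y n) = b" using cau_eventually_vo[OF xy(3) nn(2)] by blast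
      have "completion_abs L P (cc x) \<le> 1" "completion_abs L P (cc y) \<le> 1" using \<xi>(1,2) xy(2,4) by simp_all
      hence "2 powi (- a) \<le> (1::real)" "2 powi (- b) \<le> (1::real)"
        by (simp_all only: completion_abs_eq[OF xy(1) a] completion_abs_eq[OF xy(3) b])
      hence ab: "a \<ge> 0" "b \<ge> 0" by (simp_all only: powi_le_1_imp)
      define M where "M = max N0 (max N1 N2)"
      have "M \<ge> N0" "M \<ge> N1" "M \<ge> N2" unfolding M_def by auto
      hence "x M \<noteq> 0" "vo P (x M) = a" "y M \<noteq> 0" "vo P (y M) = b" using a[of M] b[of M] by simp_all
      hence "vo P (x M * y M) = a + b"
        using vo_mult[OF P cau_L[OF xy(1)] _ cau_L[OF xy(3)], of M M] by simp
      hence "a = 0" using d[OF \<open>M \<ge> N0\<close>] ab by simp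
      hence "x n \<noteq> 0 \<and> vo P (x n) = 0" if "n \<ge> N1" for n using a[OF that] by simp
      then obtain z where "useq z" "cc z = cc x"
        by (rule useq_of_eventually[OF xy(1)])
      thus "\<xi> \<in> cc ` {x. useq x}" using xy(2) by blast
    qed
  qed
qed

lemma local_units_mult: "useq x \<Longrightarrow> useq y \<Longrightarrow> cc x \<otimes>\<^bsub>local_units L P\<^esub> cc y = cc (\<lambda>n. x n * y n)"
  using cc_mult[OF useqD(1) useqD(1)] by (simp add: local_units_def units_of_def)

lemma local_units_one: "\<one>\<^bsub>local_units L P\<^esub> = cc (\<lambda>_. 1)"
  by (simp add: local_units_def units_of_def cc_one)

lemma useq_1: "useq (\<lambda>_. 1)"
  by (rule useq_const) (use P in auto)

lemma comm_group_local_units: "comm_group (local_units L P)"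
proof (rule comm_groupI)
  fix \<xi> \<eta> \<zeta> assume "\<xi> \<in> carrier (local_units L P)" "\<eta> \<in> carrier (local_units L P)" "\<zeta> \<in> carrier (local_units L P)"
  then obtain x y z where *: "useq x" "\<xi> = cc x" "useq y" "\<eta> = cc y" "useq z" "\<zeta> = cc z"
    unfolding carrier_local_units by blast
  show "\<xi> \<otimes>\<^bsub>local_units L P\<^esub> \<eta> \<otimes>\<^bsub>local_units L P\<^esub> \<zeta> = \<xi> \<otimes>\<^bsub>local_units L P\<^esub> (\<eta> \<otimes>\<^bsub>local_units L P\<^esub> \<zeta>)"
    using * by (simp add: local_units_mult useq_mult mult.assoc)
next
  fix \<xi> \<eta> assume "\<xi> \<in> carrier (local_units L P)" "\<eta> \<in> carrier (local_units L P)"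
  then obtain x y where *: "useq x" "\<xi> = cc x" "useq y" "\<eta> = cc y"
    unfolding carrier_local_units by blast
  show "\<xi> \<otimes>\<^bsub>local_units L P\<^esub> \<eta> \<in> carrier (local_units L P)"
    using * useq_mult by (simp add: local_units_mult carrier_local_units)
  show "\<xi> \<otimes>\<^bsub>local_units L P\<^esub> \<eta> = \<eta> \<otimes>\<^bsub>local_units L P\<^esub> \<xi>"
    using * by (simp add: local_units_mult mult.commute)
next
  show "\<one>\<^bsub>local_units L P\<^esub> \<in> carrier (local_units L P)"
    using useq_1 by (simp add: local_units_one carrier_local_units)
next
  fix \<xi> assume "\<xi> \<in> carrier (local_units L P)"
  then obtain x where x: "useq x" "\<xi> = cc x" unfolding carrier_local_units by blast
  show "\<one>\<^bsub>local_units L P\<^esub> \<otimes>\<^bsub>local_units L P\<^esub> \<xi> = \<xi>"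
    using x useq_1 by (simp add: local_units_one local_units_mult)
  have "(\<lambda>n. inverse (x n) * x n) = (\<lambda>_. 1)" using useqD(3)[OF x(1)] by auto
  hence "cc (\<lambda>n. inverse (x n)) \<otimes>\<^bsub>local_units L P\<^esub> \<xi> = \<one>\<^bsub>local_units L P\<^esub>"
    using x local_units_mult[OF useq_inverse[OF x(1)] x(1)] by (simp add: local_units_one)
  thus "\<exists>\<eta>\<in>carrier (local_units L P). \<eta> \<otimes>\<^bsub>local_units L P\<^esub> \<xi> = \<one>\<^bsub>local_units L P\<^esub>"
    using useq_inverse[OF x(1)] unfolding carrier_local_units by blast
qed

lemma local_units_inv:
  assumes x: "useq x" shows "inv\<^bsub>local_units L P\<^esub> cc x = cc (\<lambda>n. inverse (x n))"
proof -
  have "(\<lambda>n. inverse (x n) * x n) = (\<lambda>_. 1)" using useqD(3)[OF x] by auto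
  thus ?thesis
    using x useq_inverse[OF x] local_units_mult[OF useq_inverse[OF x] x]
    by (intro group.inv_equality[OF comm_group.axioms(2)[OF comm_group_local_units]])
       (auto simp: local_units_one carrier_local_units)
qed

lemma to_completion_eq: "to_completion L P a = cc (\<lambda>_. a)"
  unfolding to_completion_def ..

end

end

section \<open>Local cohomology classes of elements of \<open>K\<close>\<close>

context galois_ext
begin

lemma DecD: "\<sigma> \<in> Dec P \<Longrightarrow> \<sigma> \<in> carrier GG" "\<sigma> \<in> Dec P \<Longrightarrow> \<sigma> ` P = P"
  by (simp_all add: Dec_iff)

lemma decomposition_group_simps [simp]:
  "\<sigma> \<otimes>\<^bsub>decomposition_group K F P\<^esub> \<tau> = \<sigma> \<otimes>\<^bsub>GG\<^esub> \<tau>" "\<one>\<^bsub>decomposition_group K F P\<^esub> = \<one>\<^bsub>GG\<^esub>"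
  by (simp_all add: decomposition_group_def)

lemma subgroup_Dec:
  assumes "P \<subseteq> K" shows "subgroup (Dec P) GG"
proof (rule GG.subgroupI)
  show "Dec P \<subseteq> carrier GG" using DecD(1) by blast
  show "Dec P \<noteq> {}" using gal_image_one[OF assms] Dec_iff[of "\<one>\<^bsub>GG\<^esub>" P] by auto
  show "ginv \<sigma> \<in> Dec P" if \<sigma>: "\<sigma> \<in> Dec P" for \<sigma>
    using gal_image_ginv(1)[OF DecD(1)[OF \<sigma>] assms] DecD[OF \<sigma>] unfolding Dec_iff by simp
  show "\<sigma> \<otimes>\<^bsub>GG\<^esub> \<tau> \<in> Dec P" if "\<sigma> \<in> Dec P" "\<tau> \<in> Dec P" for \<sigma> \<tau>
    using gal_image_mult[OF DecD(1)[OF that(1)] DecD(1)[OF that(2)] assms] DecD[OF that(1)] DecD[OF that(2)]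
    unfolding Dec_iff by simp
qed

lemma group_Dec: "P \<subseteq> K \<Longrightarrow> group (decomposition_group K F P)"
  using GG.subgroup_imp_group[OF subgroup_Dec] by (simp add: decomposition_group_def)

definition dl :: "'a set \<Rightarrow> 'a \<Rightarrow> ('a \<Rightarrow> 'a) \<Rightarrow> (nat \<Rightarrow> 'a) set" where
  "dl P x = (\<lambda>\<sigma>\<in>Dec P. to_completion K P (\<sigma> x / x))"

context
  fixes P assumes P: "P \<in> primes_of K"
begin

abbreviation D :: "('a \<Rightarrow> 'a) monoid" where "D \<equiv> decomposition_group K F P"
abbreviation U :: "(nat \<Rightarrow> 'a) set monoid" where "U \<equiv> local_units K P"

lemma Dec_vge: "\<sigma> \<in> Dec P \<Longrightarrow> K.vge P n x \<Longrightarrow> K.vge P n (\<sigma> x)"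
  using gal_vge[OF _ P] Dec_iff by metis

lemma Dec_vo: "\<sigma> \<in> Dec P \<Longrightarrow> x \<in> K \<Longrightarrow> x \<noteq> 0 \<Longrightarrow> K.vo P (\<sigma> x) = K.vo P x"
  using gal_vo[OF _ P] Dec_iff by metis

lemma Dec_nul:
  assumes \<sigma>: "\<sigma> \<in> Dec P" and x: "K.nul P x" shows "K.nul P (\<lambda>n. \<sigma> (x n))"
  unfolding K.nul_def
proof (intro conjI allI)
  show "\<sigma> (x n) \<in> K" for n using DecD(1)[OF \<sigma>] K.nul_L[OF x] by simp
  fix k
  obtain N where "\<forall>n\<ge>N. K.vge P k (x n)" using x unfolding K.nul_def by blast
  thus "\<exists>N. \<forall>n\<ge>N. K.vge P k (\<sigma> (x n))" using Dec_vge[OF \<sigma>] by blast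
qed

lemma Dec_cau:
  assumes \<sigma>: "\<sigma> \<in> Dec P" and x: "K.cau P x" shows "K.cau P (\<lambda>n. \<sigma> (x n))"
  unfolding K.cau_def
proof (intro conjI allI)
  show "\<sigma> (x n) \<in> K" for n using DecD(1)[OF \<sigma>] K.cau_L[OF x] by simp
  fix k
  obtain N where N: "\<forall>m\<ge>N. \<forall>n\<ge>N. K.vge P k (x m - x n)" using x unfolding K.cau_def by blast
  have "K.vge P k (\<sigma> (x m) - \<sigma> (x n))" if "m \<ge> N" "n \<ge> N" for m n
    using Dec_vge[OF \<sigma> N[rule_format, OF that]] gal_diff[OF DecD(1)[OF \<sigma>] K.cau_L[OF x] K.cau_L[OF x]] by simp
  thus "\<exists>N. \<forall>m\<ge>N. \<forall>n\<ge>N. K.vge P k (\<sigma> (x m) - \<sigma> (x n))" by blast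
qed

lemma Dec_useq:
  assumes \<sigma>: "\<sigma> \<in> Dec P" and x: "K.useq P x" shows "K.useq P (\<lambda>n. \<sigma> (x n))"
proof -
  note D = K.useqD[OF P x]
  have "\<sigma> (x n) \<noteq> 0" "K.vo P (\<sigma> (x n)) = 0" for n
    using gal_eq_0_iff[OF DecD(1)[OF \<sigma>] D(2)] Dec_vo[OF \<sigma> D(2,3)] D(3,4) by simp_all
  thus ?thesis unfolding K.useq_def[OF P] using Dec_cau[OF \<sigma> D(1)] by simp
qed

lemma Dec_ginv: "\<sigma> \<in> Dec P \<Longrightarrow> ginv \<sigma> \<in> Dec P"
  by (rule subgroup.m_inv_closed[OF subgroup_Dec[OF prime_subset_K[OF P]]])

lemma Dec_mult: "\<sigma> \<in> Dec P \<Longrightarrow> \<tau> \<in> Dec P \<Longrightarrow> \<sigma> \<otimes>\<^bsub>GG\<^esub> \<tau> \<in> Dec P"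
  by (rule subgroup.m_closed[OF subgroup_Dec[OF prime_subset_K[OF P]]])

lemma Dec_one: "\<one>\<^bsub>GG\<^esub> \<in> Dec P"
  by (rule subgroup.one_closed[OF subgroup_Dec[OF prime_subset_K[OF P]]])

lemma local_action_cc:
  assumes \<sigma>: "\<sigma> \<in> Dec P" and x: "K.cau P x"
  shows "local_action \<sigma> (K.cc P x) = K.cc P (\<lambda>n. \<sigma> (x n))"
proof (rule Set.set_eqI)
  note xK = K.cau_L[OF x]
  note G = DecD(1)[OF \<sigma>] note G' = DecD(1)[OF Dec_ginv[OF \<sigma>]]
  fix z
  show "z \<in> local_action \<sigma> (K.cc P x) \<longleftrightarrow> z \<in> K.cc P (\<lambda>n. \<sigma> (x n))"
  proof
    assume "z \<in> local_action \<sigma> (K.cc P x)"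
    then obtain y where y: "K.nul P (\<lambda>n. y n - x n)" "z = (\<lambda>n. \<sigma> (y n))"
      unfolding local_action_def K.mem_cc_iff[OF P, symmetric] comp_def by blast
    have "\<sigma> (y n - x n) = \<sigma> (y n) - \<sigma> (x n)" for n
    proof -
      have "(y n - x n) + x n \<in> K" using K.nul_L[OF y(1), of n] xK[of n] by (intro K.L_add)
      thus ?thesis using gal_diff[OF G _ xK] by simp
    qed
    thus "z \<in> K.cc P (\<lambda>n. \<sigma> (x n))" using Dec_nul[OF \<sigma> y(1)] by (simp add: K.mem_cc_iff[OF P] y(2))
  next
    assume "z \<in> K.cc P (\<lambda>n. \<sigma> (x n))"
    hence z: "K.nul P (\<lambda>n. z n - \<sigma> (x n))" by (simp add: K.mem_cc_iff[OF P])
    have zK: "z n \<in> K" for n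
    proof -
      have "(z n - \<sigma> (x n)) + \<sigma> (x n) \<in> K" using K.nul_L[OF z, of n] xK[of n] G by (intro K.L_add) simp_all
      thus ?thesis by simp
    qed
    define y where "y n = ginv \<sigma> (z n)" for n
    have "ginv \<sigma> (z n - \<sigma> (x n)) = y n - x n" for n
      unfolding y_def using gal_diff[OF G' zK gal_closed[OF G xK], of n n] xK[of n] G by simp
    hence "K.nul P (\<lambda>n. y n - x n)" using Dec_nul[OF Dec_ginv[OF \<sigma>] z] by simp
    moreover have "z = \<sigma> \<circ> y" using zK G by (simp add: y_def fun_eq_iff)
    ultimately show "z \<in> local_action \<sigma> (K.cc P x)"
      unfolding local_action_def K.mem_cc_iff[OF P, symmetric] by blast
  qed
qed

lemma local_gmodule: "gmodule D U local_action"
proof (rule gmodule.intro[OF group_Dec[OF prime_subset_K[OF P]] K.comm_group_local_units[OF P] gmodule_axioms.intro])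
  note cu = K.carrier_local_units[OF P]
  show "\<sigma> \<in> Dec P \<Longrightarrow> local_action \<sigma> \<in> hom U U" for \<sigma>
  proof (rule homI)
    fix \<xi> \<eta> assume \<sigma>: "\<sigma> \<in> Dec P" and "\<xi> \<in> carrier U" "\<eta> \<in> carrier U"
    then obtain x y where xy: "K.useq P x" "\<xi> = K.cc P x" "K.useq P y" "\<eta> = K.cc P y" unfolding cu by blast
    note c = K.useqD(1)[OF P xy(1)] K.useqD(1)[OF P xy(3)]
    have "\<sigma> (x n * y n) = \<sigma> (x n) * \<sigma> (y n)" for n
      using gal_mult[OF DecD(1)[OF \<sigma>] K.cau_L[OF c(1)] K.cau_L[OF c(2)]] .
    thus "local_action \<sigma> (\<xi> \<otimes>\<^bsub>U\<^esub> \<eta>) = local_action \<sigma> \<xi> \<otimes>\<^bsub>U\<^esub> local_action \<sigma> \<eta>"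
      using \<sigma> c xy by (simp add: K.local_units_mult[OF P] local_action_cc K.cau_mult[OF P] Dec_useq)
    show "local_action \<sigma> \<xi> \<in> carrier U"
      using Dec_useq[OF \<sigma> xy(1)] unfolding cu xy(2) local_action_cc[OF \<sigma> c(1)] by blast
  qed
  fix \<xi> assume "\<xi> \<in> carrier U"
  then obtain x where x: "K.useq P x" "\<xi> = K.cc P x" unfolding cu by blast
  note c = K.useqD(1)[OF P x(1)]
  show "local_action \<one>\<^bsub>D\<^esub> \<xi> = \<xi>"
    using Dec_one by (simp add: x(2) local_action_cc[OF _ c] K.cau_L[OF c])
  show "local_action (\<sigma> \<otimes>\<^bsub>D\<^esub> \<tau>) \<xi> = local_action \<sigma> (local_action \<tau> \<xi>)"
    if "\<sigma> \<in> Dec P" "\<tau> \<in> Dec P" for \<sigma> \<tau>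
    using that Dec_mult[OF that] by (simp add: x(2) local_action_cc c Dec_cau K.cau_L[OF c])
qed

interpretation LM: gmodule D U local_action by (rule local_gmodule)

abbreviation lcl :: "(('a \<Rightarrow> 'a) \<Rightarrow> (nat \<Rightarrow> 'a) set) \<Rightarrow> (('a \<Rightarrow> 'a) \<Rightarrow> (nat \<Rightarrow> 'a) set) set" where
  "lcl \<equiv> gmodule.cl (decomposition_group K F P) (local_units K P) local_action"
abbreviation lZ :: "(('a \<Rightarrow> 'a) \<Rightarrow> (nat \<Rightarrow> 'a) set) set" where
  "lZ \<equiv> gmodule.Z1 (decomposition_group K F P) (local_units K P) local_action"

lemma dl_useq:
  assumes "\<sigma> \<in> Dec P" "x \<in> K" "x \<noteq> 0" shows "K.useq P (\<lambda>_. \<sigma> x / x)"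
proof (rule K.useq_const[OF P])
  note G = DecD(1)[OF assms(1)]
  have s: "\<sigma> x \<noteq> 0" using assms gal_eq_0_iff[OF G] by simp
  show "\<sigma> x / x \<in> K" "\<sigma> x / x \<noteq> 0" using assms G s by simp_all
  show "K.vo P (\<sigma> x / x) = 0"
    using K.vo_divide[OF P gal_closed[OF G assms(2)] s assms(2,3)] Dec_vo[OF assms] by simp
qed

lemma dl_apply: "\<sigma> \<in> Dec P \<Longrightarrow> dl P x \<sigma> = K.cc P (\<lambda>_. \<sigma> x / x)"
  unfolding dl_def K.to_completion_eq[OF P] by simp

lemma dl_C1:
  assumes "x \<in> K" "x \<noteq> 0" shows "dl P x \<in> carrier (C1 D U)"
proof -
  have "dl P x \<sigma> \<in> carrier U" if "\<sigma> \<in> Dec P" for \<sigma>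
    unfolding dl_apply[OF that] K.carrier_local_units[OF P] using dl_useq[OF that assms] by blast
  thus ?thesis unfolding dl_def by (simp add: PiE_def)
qed

lemma dl_Z1:
  assumes x: "x \<in> K" "x \<noteq> 0" shows "dl P x \<in> lZ"
  unfolding LM.Z1_iff
proof (intro conjI ballI)
  show "dl P x \<in> carrier (C1 D U)" using dl_C1[OF x] .
  fix \<sigma> \<tau> assume \<sigma>: "\<sigma> \<in> Dec P" and \<tau>: "\<tau> \<in> Dec P"
  note u = dl_useq[OF \<sigma> x] dl_useq[OF \<tau> x]
  note G = DecD(1)[OF \<sigma>] DecD(1)[OF \<tau>]
  have "local_action \<sigma> (dl P x \<tau>) = K.cc P (\<lambda>_. \<sigma> (\<tau> x / x))"
    unfolding dl_apply[OF \<tau>] by (rule local_action_cc[OF \<sigma> K.useqD(1)[OF P u(2)]])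
  hence "dl P x \<sigma> \<otimes>\<^bsub>U\<^esub> local_action \<sigma> (dl P x \<tau>) = K.cc P (\<lambda>_. \<sigma> x / x * \<sigma> (\<tau> x / x))"
    using K.local_units_mult[OF P u(1) Dec_useq[OF \<sigma> u(2)]] by (simp add: dl_apply[OF \<sigma>])
  also have "\<sigma> x / x * \<sigma> (\<tau> x / x) = \<sigma> (\<tau> x) / x"
    using gal_divide[OF G(1) gal_closed[OF G(2) x(1)] x(1)] gal_eq_0_iff[OF G(1) x(1)] x(2) by simp
  finally show "dl P x (\<sigma> \<otimes>\<^bsub>D\<^esub> \<tau>) = dl P x \<sigma> \<otimes>\<^bsub>U\<^esub> local_action \<sigma> (dl P x \<tau>)"
    using x(1) by (simp add: dl_apply[OF Dec_mult[OF \<sigma> \<tau>]])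
qed

lemma dl_mult:
  assumes "x \<in> K" "x \<noteq> 0" "y \<in> K" "y \<noteq> 0" shows "dl P (x * y) = dl P x \<otimes>\<^bsub>C1 D U\<^esub> dl P y"
proof (rule ext)
  fix \<sigma>
  show "dl P (x * y) \<sigma> = (dl P x \<otimes>\<^bsub>C1 D U\<^esub> dl P y) \<sigma>"
  proof (cases "\<sigma> \<in> Dec P")
    case True
    have "\<sigma> (x * y) / (x * y) = \<sigma> x / x * (\<sigma> y / y)"
      unfolding gal_mult[OF DecD(1)[OF True] assms(1,3)] by (rule times_divide_times_eq[symmetric])
    hence "dl P (x * y) \<sigma> = dl P x \<sigma> \<otimes>\<^bsub>U\<^esub> dl P y \<sigma>"
      unfolding dl_apply[OF True] K.local_units_mult[OF P dl_useq[OF True assms(1,2)] dl_useq[OF True assms(3,4)]]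
      by (rule arg_cong)
    thus ?thesis using True by simp
  next
    case False
    thus ?thesis by (simp add: dl_def)
  qed
qed

lemma d0_local:
  assumes u: "K.useq P u" and \<sigma>: "\<sigma> \<in> Dec P"
  shows "d0 D U local_action (K.cc P u) \<sigma> = K.cc P (\<lambda>n. \<sigma> (u n) / u n)"
proof -
  have "d0 D U local_action (K.cc P u) \<sigma> = K.cc P (\<lambda>n. \<sigma> (u n)) \<otimes>\<^bsub>U\<^esub> K.cc P (\<lambda>n. inverse (u n))"
    using \<sigma> by (simp add: d0_def local_action_cc[OF \<sigma> K.useqD(1)[OF P u]] K.local_units_inv[OF P u])
  also have "\<dots> = K.cc P (\<lambda>n. \<sigma> (u n) / u n)"
    unfolding K.local_units_mult[OF P Dec_useq[OF \<sigma> u] K.useq_inverse[OF P u]] divide_inverse ..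
  finally show ?thesis .
qed

lemma dl_unit:
  assumes x: "x \<in> K" "x \<noteq> 0" "K.vo P x = 0" shows "dl P x \<in> LM.B"
proof -
  note u = K.useq_const[OF P x]
  have c: "K.cc P (\<lambda>_. x) \<in> carrier U" unfolding K.carrier_local_units[OF P] using u by blast
  have "dl P x = d0 D U local_action (K.cc P (\<lambda>_. x))"
  proof (rule PiE_ext[of _ "Dec P" "\<lambda>_. carrier U"])
    show "dl P x \<in> Dec P \<rightarrow>\<^sub>E carrier U" "d0 D U local_action (K.cc P (\<lambda>_. x)) \<in> Dec P \<rightarrow>\<^sub>E carrier U"
      using dl_C1[OF x(1,2)] LM.d0.hom_closed[OF c] by simp_all
  qed (simp add: d0_local[OF u] dl_apply)
  thus ?thesis unfolding B1_def using c by blast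
qed

lemma dl_F:
  assumes x: "x \<in> F" "x \<noteq> 0" shows "dl P x = \<one>\<^bsub>C1 D U\<^esub>"
proof (rule ext)
  fix \<sigma>
  show "dl P x \<sigma> = \<one>\<^bsub>C1 D U\<^esub> \<sigma>"
  proof (cases "\<sigma> \<in> Dec P")
    case True
    hence "\<sigma> x / x = 1" using gal_fix[OF DecD(1)[OF True] x(1)] x(2) by simp
    thus ?thesis using True by (simp add: dl_apply K.local_units_one[OF P])
  qed (simp add: dl_def)
qed

lemma dl_cl_unit:
  assumes "x \<in> K" "x \<noteq> 0" "K.vo P x = 0" shows "lcl (dl P x) = \<one>\<^bsub>local_H1 K F P\<^esub>"
  using LM.cl_eq_one_iff[OF dl_C1[OF assms(1,2)]] dl_unit[OF assms] unfolding local_H1_def by simp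

lemma dl_cl_mult:
  assumes "x \<in> K" "x \<noteq> 0" "y \<in> K" "y \<noteq> 0"
  shows "lcl (dl P (x * y)) = lcl (dl P x) \<otimes>\<^bsub>local_H1 K F P\<^esub> lcl (dl P y)"
  unfolding dl_mult[OF assms] local_H1_def by (rule LM.cl_mult[OF dl_Z1[OF assms(1,2)] dl_Z1[OF assms(3,4)]])

lemma comm_group_local_H1: "comm_group (local_H1 K F P)"
  unfolding local_H1_def by (rule LM.comm_group_H1)

lemma lcl_closed: "f \<in> lZ \<Longrightarrow> lcl f \<in> carrier (local_H1 K F P)"
  unfolding local_H1_def LM.carrier_H1 by blast

lemma dl_cl_eqI:
  assumes x: "x \<in> K" "x \<noteq> 0" and y: "y \<in> K" "y \<noteq> 0" and v: "K.vo P x = K.vo P y"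
  shows "lcl (dl P x) = lcl (dl P y)"
proof -
  interpret H: comm_group "local_H1 K F P" by (rule comm_group_local_H1)
  have q: "x / y \<in> K" "x / y \<noteq> 0" "K.vo P (x / y) = 0" using x y v K.vo_divide[OF P x y] by simp_all
  have "lcl (dl P x) = lcl (dl P (x / y)) \<otimes>\<^bsub>local_H1 K F P\<^esub> lcl (dl P y)"
    using dl_cl_mult[OF q(1,2) y] y by simp
  thus ?thesis using dl_cl_unit[OF q] lcl_closed[OF dl_Z1[OF y]] by simp
qed

lemma dl_cl_ram_dvd:
  assumes x: "x \<in> K" "x \<noteq> 0" and r: "ram P dvd K.vo P x"
  shows "lcl (dl P x) = \<one>\<^bsub>local_H1 K F P\<^esub>"
proof -
  obtain m where m: "K.vo P x = ram P * m" using r by blast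
  obtain y where y: "y \<in> F" "y \<noteq> 0" "F.vo (P \<inter> F) y = m" using F.uniformizer[OF prime_below[OF P]] by blast
  have yK: "y \<in> K" using y(1) by simp
  have "K.vo P x = K.vo P y" using vo_F[OF P y(1,2)] m y(3) by simp
  hence "lcl (dl P x) = lcl (dl P y)" by (rule dl_cl_eqI[OF x yK y(2)])
  also have "\<dots> = \<one>\<^bsub>local_H1 K F P\<^esub>"
    unfolding dl_F[OF y(1,2)] local_H1_def
    by (simp only: LM.cl_eq_one_iff[OF LM.C1.one_closed] subgroup.one_closed[OF LM.subgroup_B1])
  finally show ?thesis .
qed

lemma dl_B1_imp_ram_dvd:
  assumes x: "x \<in> K" "x \<noteq> 0" and B: "dl P x \<in> LM.B"
  shows "ram P dvd K.vo P x"
proof -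
  obtain u where u: "K.useq P u" "dl P x = d0 D U local_action (K.cc P u)"
    using B unfolding B1_def K.carrier_local_units[OF P] by blast
  note uK = K.useqD(2)[OF P u(1)] note u0 = K.useqD(3)[OF P u(1)] note uv = K.useqD(4)[OF P u(1)]
  define d :: 'a where "d = of_nat (card (Dec P))"
  have "card (Dec P) \<noteq> 0" using finite_Dec Dec_one by (metis card_eq_0_iff empty_iff)
  hence d: "d \<in> K" "d \<noteq> 0" unfolding d_def by simp_all
  have "eventually (\<lambda>n. K.vge P (K.vo P d + 1) (\<sigma> x / x - \<sigma> (u n) / u n)) sequentially"
    if \<sigma>: "\<sigma> \<in> Dec P" for \<sigma>
  proof -
    have eq: "K.cc P (\<lambda>_. \<sigma> x / x) = K.cc P (\<lambda>n. \<sigma> (u n) / u n)"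
      using u(2) dl_apply[OF \<sigma>, of x] d0_local[OF u(1) \<sigma>] by simp
    have "K.useq P (\<lambda>n. \<sigma> (u n) / u n)"
      unfolding divide_inverse by (rule K.useq_mult[OF P Dec_useq[OF \<sigma> u(1)] K.useq_inverse[OF P u(1)]])
    hence "K.nul P (\<lambda>n. \<sigma> x / x - \<sigma> (u n) / u n)"
      using K.cc_eq_iff[OF P K.useqD(1)[OF P dl_useq[OF \<sigma> x]] K.useqD(1)[OF P]] eq by blast
    thus ?thesis unfolding K.nul_def eventually_sequentially by blast
  qed
  hence "eventually (\<lambda>n. \<forall>\<sigma>\<in>Dec P. K.vge P (K.vo P d + 1) (\<sigma> x / x - \<sigma> (u n) / u n)) sequentially"
    using finite_Dec by (intro eventually_ball_finite) blast+
  then obtain n where n: "\<And>\<sigma>. \<sigma> \<in> Dec P \<Longrightarrow> K.vge P (K.vo P d + 1) (\<sigma> x / x - \<sigma> (u n) / u n)"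
    unfolding eventually_sequentially by blast
  define y where "y = x / u n"
  have y: "y \<in> K" "y \<noteq> 0" "K.vo P y = K.vo P x"
    unfolding y_def using x uK[of n] u0[of n] K.vo_divide[OF P x uK u0, of n] uv[of n] by simp_all
  have "ram P dvd K.vo P y"
  proof (rule ram_dvd_vo_almost_invariant[OF P y(1,2)])
    fix \<sigma> assume \<sigma>: "\<sigma> \<in> Dec P"
    note G = DecD(1)[OF \<sigma>]
    have su: "\<sigma> (u n) \<in> K" "\<sigma> (u n) \<noteq> 0" "K.vo P (\<sigma> (u n)) = 0"
      using K.useqD(2-4)[OF P Dec_useq[OF \<sigma> u(1)]] by blast+
    have "K.vge P (K.vo P x) (x / \<sigma> (u n))"
      using x su K.vo_divide[OF P x su(1,2)] unfolding K.vge_def by simp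
    hence "K.vge P (K.vo P x + (K.vo P d + 1)) (x / \<sigma> (u n) * (\<sigma> x / x - \<sigma> (u n) / u n))"
      using n[OF \<sigma>] by (rule K.vge_mult[OF P])
    moreover have "x / \<sigma> (u n) * (\<sigma> x / x - \<sigma> (u n) / u n) = \<sigma> y - y"
      unfolding y_def gal_divide[OF G x(1) uK] using x(2) su(2) u0[of n] by (simp add: field_simps)
    moreover have "K.vo P x + (K.vo P d + 1) = K.vo P (of_nat (card (Dec P)) * y) + 1"
      using K.vo_mult[OF P d y(1,2)] y(3) unfolding d_def by simp
    ultimately show "K.vge P (K.vo P (of_nat (card (Dec P)) * y) + 1) (\<sigma> y - y)" by simp
  qed
  thus ?thesis unfolding y(3) .
qed

lemma dl_cl_one_iff:
  assumes x: "x \<in> K" "x \<noteq> 0"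
  shows "lcl (dl P x) = \<one>\<^bsub>local_H1 K F P\<^esub> \<longleftrightarrow> ram P dvd K.vo P x"
proof
  assume "lcl (dl P x) = \<one>\<^bsub>local_H1 K F P\<^esub>"
  thus "ram P dvd K.vo P x"
    using LM.cl_eq_one_iff[OF dl_C1[OF x]] dl_B1_imp_ram_dvd[OF x] unfolding local_H1_def by simp
qed (rule dl_cl_ram_dvd[OF x])

lemma dl_surj:
  assumes f: "f \<in> lZ"
  obtains x where "x \<in> K" "x \<noteq> 0" "lcl f = lcl (dl P x)"
proof -
  note cau_useq = K.useqD(1)[OF P]
  have fC: "f \<in> carrier (C1 D U)" using f by (rule LM.Z1_closed)
  have "\<exists>u. K.useq P u \<and> f \<sigma> = K.cc P u" if "\<sigma> \<in> Dec P" for \<sigma>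
    using LM.C1_apply[OF fC that] unfolding K.carrier_local_units[OF P] by blast
  then obtain u where u: "\<And>\<sigma>. \<sigma> \<in> Dec P \<Longrightarrow> K.useq P (u \<sigma>)" "\<And>\<sigma>. \<sigma> \<in> Dec P \<Longrightarrow> f \<sigma> = K.cc P (u \<sigma>)"
    by metis
  note uK = K.useqD(2)[OF P u(1)]
  have coc: "K.nul P (\<lambda>n. u \<sigma> n * \<sigma> (u \<tau> n) - u (\<sigma> \<otimes>\<^bsub>GG\<^esub> \<tau>) n)"
    if \<sigma>: "\<sigma> \<in> Dec P" and \<tau>: "\<tau> \<in> Dec P" for \<sigma> \<tau>
  proof -
    note v = u(1)[OF \<sigma>] Dec_useq[OF \<sigma> u(1)[OF \<tau>]] u(1)[OF Dec_mult[OF \<sigma> \<tau>]]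
    have "f (\<sigma> \<otimes>\<^bsub>GG\<^esub> \<tau>) = f \<sigma> \<otimes>\<^bsub>U\<^esub> local_action \<sigma> (f \<tau>)" using f \<sigma> \<tau> unfolding LM.Z1_iff by simp
    hence "K.cc P (\<lambda>n. u \<sigma> n * \<sigma> (u \<tau> n)) = K.cc P (u (\<sigma> \<otimes>\<^bsub>GG\<^esub> \<tau>))"
      using \<sigma> \<tau> Dec_mult[OF \<sigma> \<tau>] K.local_units_mult[OF P v(1,2)]
      by (simp add: u(2) local_action_cc[OF \<sigma> cau_useq[OF u(1)[OF \<tau>]]])
    thus ?thesis
      using K.cc_eq_iff[OF P cau_useq[OF K.useq_mult[OF P v(1,2)]] cau_useq[OF v(3)]] by blast
  qed
  obtain xs where xs: "set xs \<subseteq> K \<times> K"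
    "\<And>\<sigma>. \<sigma> \<in> carrier GG \<Longrightarrow> (\<Sum>(d, a)\<leftarrow>xs. d * \<sigma> a) = (if \<sigma> = \<one>\<^bsub>GG\<^esub> then 1 else 0)"
    using identity_idempotent by blast
  define c where "c a n = (\<Sum>\<sigma>\<in>Dec P. u \<sigma> n * \<sigma> a)" for a n
  have c_cau: "K.cau P (c a)" if a: "a \<in> K" for a
    unfolding c_def[abs_def]
    by (intro K.cau_sum[OF P] K.cau_mult[OF P] cau_useq[OF u(1)] K.cau_const[OF P] gal_closed[OF DecD(1) a])
  have c_sum: "(\<Sum>(d, a)\<leftarrow>xs. d * c a n) = u \<one>\<^bsub>GG\<^esub> n" for n
  proof -
    have "(\<Sum>(d, a)\<leftarrow>xs. d * c a n) = (\<Sum>\<sigma>\<in>Dec P. u \<sigma> n * (\<Sum>(d, a)\<leftarrow>xs. d * \<sigma> a))"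
      unfolding c_def by (rule sum_list_sum_swap[OF finite_Dec])
    also have "\<dots> = (\<Sum>\<sigma>\<in>Dec P. u \<sigma> n * (if \<sigma> = \<one>\<^bsub>GG\<^esub> then 1 else 0))"
      using DecD(1) by (intro sum.cong refl) (simp add: xs(2))
    also have "\<dots> = u \<one>\<^bsub>GG\<^esub> n" using finite_Dec Dec_one by (simp add: if_distrib cong: if_cong)
    finally show ?thesis .
  qed
  have "\<exists>(d, a)\<in>set xs. \<not> K.nul P (c a)"
  proof (rule ccontr)
    assume "\<not> ?thesis"
    hence n: "K.nul P (c a)" if "(d, a) \<in> set xs" for d a using that by blast
    have "K.nul P (\<lambda>n. \<Sum>(d, a)\<leftarrow>ys. d * c a n)" if "set ys \<subseteq> set xs" for ys
      using that
    proof (induction ys)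
      case (Cons y ys)
      obtain d a where y: "y = (d, a)" "(d, a) \<in> set xs" using Cons.prems by (cases y) simp
      hence dK: "d \<in> K" using xs(1) by blast
      have "set ys \<subseteq> set xs" using Cons.prems by simp
      from K.nul_add[OF P K.nul_mult[OF P K.cau_const[OF P dK] n[OF y(2)]] Cons.IH[OF this]]
      show ?case by (simp add: y(1))
    qed (simp add: K.nul_0[OF P])
    from this[OF subset_refl] have "K.nul P (u \<one>\<^bsub>GG\<^esub>)" by (simp add: c_sum)
    thus False using K.useq_not_nul[OF P u(1)[OF Dec_one]] by blast
  qed
  then obtain a where a: "a \<in> K" "\<not> K.nul P (c a)" using xs(1) by blast
  note cK = K.cau_L[OF c_cau[OF a(1)]]
  have c_inv: "K.nul P (\<lambda>n. u \<tau> n * \<tau> (c a n) - c a n)" if \<tau>: "\<tau> \<in> Dec P" for \<tau>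
  proof -
    note G = DecD(1)[OF \<tau>]
    have bij: "bij_betw (\<lambda>\<sigma>. \<tau> \<otimes>\<^bsub>GG\<^esub> \<sigma>) (Dec P) (Dec P)"
    proof (rule bij_betw_byWitness[of _ "\<lambda>\<sigma>. ginv \<tau> \<otimes>\<^bsub>GG\<^esub> \<sigma>"])
      show "\<forall>\<sigma>\<in>Dec P. ginv \<tau> \<otimes>\<^bsub>GG\<^esub> (\<tau> \<otimes>\<^bsub>GG\<^esub> \<sigma>) = \<sigma>" "\<forall>\<sigma>\<in>Dec P. \<tau> \<otimes>\<^bsub>GG\<^esub> (ginv \<tau> \<otimes>\<^bsub>GG\<^esub> \<sigma>) = \<sigma>"
        using G DecD(1) by (simp_all add: GG.m_assoc[symmetric])
    qed (use Dec_mult[OF \<tau>] Dec_mult[OF Dec_ginv[OF \<tau>]] in blast)+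
    have e: "u \<tau> n * \<tau> (c a n) - c a n =
        (\<Sum>\<sigma>\<in>Dec P. (\<tau> \<otimes>\<^bsub>GG\<^esub> \<sigma>) a * (u \<tau> n * \<tau> (u \<sigma> n) - u (\<tau> \<otimes>\<^bsub>GG\<^esub> \<sigma>) n))" for n
    proof -
      have "c a n = (\<Sum>\<sigma>\<in>Dec P. u (\<tau> \<otimes>\<^bsub>GG\<^esub> \<sigma>) n * (\<tau> \<otimes>\<^bsub>GG\<^esub> \<sigma>) a)"
        unfolding c_def by (rule sum.reindex_bij_betw[OF bij, of "\<lambda>\<sigma>. u \<sigma> n * \<sigma> a", symmetric])
      moreover have "\<tau> (c a n) = (\<Sum>\<sigma>\<in>Dec P. \<tau> (u \<sigma> n) * (\<tau> \<otimes>\<^bsub>GG\<^esub> \<sigma>) a)"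
        unfolding c_def using uK a(1) DecD(1)
        by (subst gal_sum[OF G]) (auto simp: gal_mult[OF G] intro!: sum.cong)
      ultimately show ?thesis by (simp add: sum_distrib_left sum_subtractf algebra_simps)
    qed
    have "K.nul P (\<lambda>n. \<Sum>\<sigma>\<in>Dec P. (\<tau> \<otimes>\<^bsub>GG\<^esub> \<sigma>) a * (u \<tau> n * \<tau> (u \<sigma> n) - u (\<tau> \<otimes>\<^bsub>GG\<^esub> \<sigma>) n))"
      by (intro K.nul_sum[OF P] K.nul_mult[OF P] K.cau_const[OF P] coc \<tau>
        gal_closed[OF DecD(1)[OF Dec_mult[OF \<tau>]] a(1)])
    thus ?thesis unfolding e .
  qed
  obtain N m where N: "\<And>n. n \<ge> N \<Longrightarrow> c a n \<noteq> 0 \<and> K.vo P (c a n) = m"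
    using K.cau_eventually_vo[OF P c_cau[OF a(1)] a(2)] by blast
  define x where "x = c a N"
  have x: "x \<in> K" "x \<noteq> 0" "K.vo P x = m" unfolding x_def using cK N[of N] by simp_all
  have ix: "inverse x \<in> K" "inverse x \<noteq> 0" using x(1,2) by simp_all
  have e1: "K.cau P (\<lambda>n. inverse x * c a n)"
    by (rule K.cau_mult[OF P K.cau_const[OF P ix(1)] c_cau[OF a(1)]])
  have e2: "inverse x * c a n \<noteq> 0 \<and> K.vo P (inverse x * c a n) = 0" if "n \<ge> N" for n
    using N[OF that] K.vo_mult[OF P ix cK, of n] K.vo_inverse[OF P x(1,2)] x by simp
  obtain e where e: "K.useq P e" "\<And>n. n \<ge> N \<Longrightarrow> e n = inverse x * c a n"
  proof (rule K.useq_of_eventually[OF P e1 e2])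
    fix y assume "K.useq P y" "\<And>n. n \<ge> N \<Longrightarrow> y n = inverse x * c a n"
    thus thesis by (rule that)
  qed
  define g where "g n = inverse (e n)" for n
  have g: "K.useq P g" unfolding g_def[abs_def] by (rule K.useq_inverse[OF P e(1)])
  note eK = K.useqD(2)[OF P e(1)] note e0 = K.useqD(3)[OF P e(1)]
  have key: "f \<tau> = K.cc P (\<lambda>n. \<tau> (g n) / g n * (\<tau> (inverse x) / inverse x))" if \<tau>: "\<tau> \<in> Dec P" for \<tau>
  proof -
    note G = DecD(1)[OF \<tau>]
    have se: "K.useq P (\<lambda>n. \<tau> (e n))" by (rule Dec_useq[OF \<tau> e(1)])
    have sx: "\<tau> x \<in> K" "\<tau> x \<noteq> 0" using G x gal_eq_0_iff[OF G x(1)] by simp_all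
    have gg: "K.useq P (\<lambda>n. \<tau> (g n) / g n * (\<tau> (inverse x) / inverse x))"
      unfolding divide_inverse[of "\<tau> (g _)"]
      by (rule K.useq_mult[OF P K.useq_mult[OF P Dec_useq[OF \<tau> g] K.useq_inverse[OF P g]] dl_useq[OF \<tau> ix]])
    have n1: "K.nul P (\<lambda>n. (u \<tau> n * \<tau> (x * e n) - x * e n) - (u \<tau> n * \<tau> (c a n) - c a n))"
    proof (rule K.nul_eventually_zero[OF P])
      show "(u \<tau> n * \<tau> (x * e n) - x * e n) - (u \<tau> n * \<tau> (c a n) - c a n) \<in> K" for n
        using uK[OF \<tau>] eK x(1) cK G by simp
      show "(u \<tau> n * \<tau> (x * e n) - x * e n) - (u \<tau> n * \<tau> (c a n) - c a n) = 0" if "n \<ge> N" for n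
        using x(2) by (simp add: e(2)[OF that] mult.assoc[symmetric])
    qed
    have "K.nul P (\<lambda>n. u \<tau> n * \<tau> (x * e n) - x * e n)"
      using K.nul_add[OF P n1 c_inv[OF \<tau>]] by simp
    hence n2: "K.nul P (\<lambda>n. inverse (\<tau> x) * inverse (\<tau> (e n)) * (u \<tau> n * \<tau> (x * e n) - x * e n))"
      using sx by (intro K.nul_mult[OF P] K.cau_mult[OF P] K.cau_const[OF P] cau_useq[OF K.useq_inverse[OF P se]]) simp_all
    have "inverse (\<tau> x) * inverse (\<tau> (e n)) * (u \<tau> n * \<tau> (x * e n) - x * e n) =
        u \<tau> n - \<tau> (g n) / g n * (\<tau> (inverse x) / inverse x)" for n
      unfolding g_def gal_inverse[OF G eK] gal_inverse[OF G x(1)] gal_mult[OF G x(1) eK]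
      using K.useqD(3)[OF P se, of n] e0[of n] sx(2) x(2) by (simp add: field_simps)
    hence "K.nul P (\<lambda>n. u \<tau> n - \<tau> (g n) / g n * (\<tau> (inverse x) / inverse x))" using n2 by simp
    thus ?thesis unfolding u(2)[OF \<tau>] using K.cc_eq_iff[OF P cau_useq[OF u(1)[OF \<tau>]] cau_useq[OF gg]] by blast
  qed
  have cg: "K.cc P g \<in> carrier U" unfolding K.carrier_local_units[OF P] using g by blast
  have "f = d0 D U local_action (K.cc P g) \<otimes>\<^bsub>C1 D U\<^esub> dl P (inverse x)"
  proof (rule PiE_ext[of _ "Dec P" "\<lambda>_. carrier U"])
    show "f \<in> Dec P \<rightarrow>\<^sub>E carrier U" using fC by simp
    show "d0 D U local_action (K.cc P g) \<otimes>\<^bsub>C1 D U\<^esub> dl P (inverse x) \<in> Dec P \<rightarrow>\<^sub>E carrier U"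
      using LM.C1.m_closed[OF LM.d0.hom_closed[OF cg] dl_C1[OF ix]] by simp
    fix \<tau> assume \<tau>: "\<tau> \<in> Dec P"
    have "K.useq P (\<lambda>n. \<tau> (g n) / g n)"
      unfolding divide_inverse by (rule K.useq_mult[OF P Dec_useq[OF \<tau> g] K.useq_inverse[OF P g]])
    from K.local_units_mult[OF P this dl_useq[OF \<tau> ix]]
    show "f \<tau> = (d0 D U local_action (K.cc P g) \<otimes>\<^bsub>C1 D U\<^esub> dl P (inverse x)) \<tau>"
      unfolding key[OF \<tau>] using \<tau> by (simp add: d0_local[OF g] dl_apply)
  qed
  hence "f \<in> lcl (dl P (inverse x))" unfolding LM.mem_cl_iff using cg by blast
  hence "lcl f = lcl (dl P (inverse x))" by (rule LM.cl_eqI[OF dl_C1[OF ix]])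
  thus thesis by (rule that[OF ix])
qed

end

end

section \<open>The localization map\<close>

context galois_ext
begin

text \<open>By \<open>dl_cl_eqI\<close> the class of \<open>dl P x\<close> depends only on the valuation of \<open>x\<close>, so that \<open>dcl P\<close> is
  the isomorphism of \<open>\<int>/e\<int>\<close> with the local cohomology group.\<close>

definition dcl :: "'a set \<Rightarrow> int \<Rightarrow> (('a \<Rightarrow> 'a) \<Rightarrow> (nat \<Rightarrow> 'a) set) set" where
  "dcl P n = lcl P (dl P (SOME x. x \<in> K \<and> x \<noteq> 0 \<and> K.vo P x = n))"

context
  fixes P assumes P: "P \<in> primes_of K"
begin

lemma dcl_eq:
  assumes x: "x \<in> K" "x \<noteq> 0" shows "dcl P (K.vo P x) = lcl P (dl P x)"
proof -
  define y where "y = (SOME y. y \<in> K \<and> y \<noteq> 0 \<and> K.vo P y = K.vo P x)"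
  have "y \<in> K \<and> y \<noteq> 0 \<and> K.vo P y = K.vo P x" unfolding y_def by (rule someI[of _ x]) (use x in simp)
  hence "lcl P (dl P y) = lcl P (dl P x)" by (intro dl_cl_eqI[OF P _ _ x]) simp_all
  thus ?thesis unfolding dcl_def y_def .
qed

lemma dcl_closed: "dcl P n \<in> carrier (local_H1 K F P)"
proof -
  obtain x where x: "x \<in> K" "x \<noteq> 0" "K.vo P x = n" using K.uniformizer[OF P] by blast
  show ?thesis using dcl_eq[OF x(1,2)] lcl_closed[OF P dl_Z1[OF P x(1,2)]] x(3) by simp
qed

lemma dcl_add: "dcl P (m + n) = dcl P m \<otimes>\<^bsub>local_H1 K F P\<^esub> dcl P n"
proof -
  obtain x where x: "x \<in> K" "x \<noteq> 0" "K.vo P x = m" using K.uniformizer[OF P] by blast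
  obtain y where y: "y \<in> K" "y \<noteq> 0" "K.vo P y = n" using K.uniformizer[OF P] by blast
  have "K.vo P (x * y) = m + n" using K.vo_mult[OF P x(1,2) y(1,2)] x(3) y(3) by simp
  thus ?thesis
    using dcl_eq[of "x * y"] dcl_eq[OF x(1,2)] dcl_eq[OF y(1,2)] dl_cl_mult[OF P x(1,2) y(1,2)] x y by simp
qed

lemma dcl_one_iff: "dcl P n = \<one>\<^bsub>local_H1 K F P\<^esub> \<longleftrightarrow> ram P dvd n"
proof -
  obtain x where x: "x \<in> K" "x \<noteq> 0" "K.vo P x = n" using K.uniformizer[OF P] by blast
  show ?thesis using dcl_eq[OF x(1,2)] dl_cl_one_iff[OF P x(1,2)] x(3) by simp
qed

lemma dcl_surj:
  assumes "h \<in> carrier (local_H1 K F P)" obtains n where "h = dcl P n"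
proof -
  obtain f where f: "f \<in> lZ P" "h = lcl P f"
    using assms unfolding local_H1_def gmodule.carrier_H1[OF local_gmodule[OF P]] by blast
  obtain x where x: "x \<in> K" "x \<noteq> 0" "lcl P f = lcl P (dl P x)" by (rule dl_surj[OF P f(1)])
  have "h = dcl P (K.vo P x)" using dcl_eq[OF x(1,2)] f(2) x(3) by simp
  thus thesis by (rule that)
qed

end

end

context galois_ext_places
begin

definition PHI :: "'a set \<Rightarrow> 'a set \<Rightarrow> (('a \<Rightarrow> 'a) \<Rightarrow> (nat \<Rightarrow> 'a) set) set" where
  "PHI J = (\<lambda>v\<in>primes_of F. dcl (w v) (K.vord (w v) J))"

lemma w_prime: "v \<in> primes_of F \<Longrightarrow> w v \<in> primes_of K"
  using w by blast

lemma group_local_H1: "v \<in> primes_of F \<Longrightarrow> group (local_H1 K F (w v))"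
  using comm_group_local_H1[OF w_prime] comm_group.axioms(2) by blast

lemma carrier_local_H1_sum:
  "carrier (local_H1_sum K F w) = {x \<in> \<Pi>\<^sub>E v\<in>primes_of F. carrier (local_H1 K F (w v)).
    finite {v \<in> primes_of F. x v \<noteq> \<one>\<^bsub>local_H1 K F (w v)\<^esub>}}"
  unfolding local_H1_sum_def by (rule carrier_sum_group[OF group_local_H1])

lemma comm_group_local_H1_sum: "comm_group (local_H1_sum K F w)"
proof (rule group.group_comm_groupI)
  show "group (local_H1_sum K F w)" unfolding local_H1_sum_def by (rule sum_group[OF group_local_H1])
  fix x y assume "x \<in> carrier (local_H1_sum K F w)" "y \<in> carrier (local_H1_sum K F w)"
  hence "x v \<in> carrier (local_H1 K F (w v))" "y v \<in> carrier (local_H1 K F (w v))" if "v \<in> primes_of F" for v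
    using that unfolding carrier_local_H1_sum by auto
  hence "x v \<otimes>\<^bsub>local_H1 K F (w v)\<^esub> y v = y v \<otimes>\<^bsub>local_H1 K F (w v)\<^esub> x v" if "v \<in> primes_of F" for v
    using comm_monoid.m_comm[OF comm_group.axioms(1)[OF comm_group_local_H1[OF w_prime[OF that]]]] that by simp
  thus "x \<otimes>\<^bsub>local_H1_sum K F w\<^esub> y = y \<otimes>\<^bsub>local_H1_sum K F w\<^esub> x"
    by (simp add: local_H1_sum_def cong: restrict_cong)
qed

lemma PHI_closed:
  assumes J: "J \<in> inv_ideals" shows "PHI J \<in> carrier (local_H1_sum K F w)"
proof -
  have "{v \<in> primes_of F. PHI J v \<noteq> \<one>\<^bsub>local_H1 K F (w v)\<^esub>} \<subseteq> {v \<in> primes_of F. K.vord (w v) J \<noteq> 0}"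
    using dcl_one_iff[OF w_prime] by (auto simp: PHI_def)
  hence "finite {v \<in> primes_of F. PHI J v \<noteq> \<one>\<^bsub>local_H1 K F (w v)\<^esub>}"
    using finite_inv_ideal_support[OF inv_ideals_frac[OF J]] by (rule finite_subset)
  moreover have "PHI J \<in> (\<Pi>\<^sub>E v\<in>primes_of F. carrier (local_H1 K F (w v)))"
    unfolding PHI_def using dcl_closed[OF w_prime] by simp
  ultimately show ?thesis unfolding carrier_local_H1_sum by simp
qed

lemma PHI_mult:
  assumes "I \<in> inv_ideals" "J \<in> inv_ideals"
  shows "PHI (I \<star> J) = PHI I \<otimes>\<^bsub>local_H1_sum K F w\<^esub> PHI J"
proof (rule ext)
  fix v
  show "PHI (I \<star> J) v = (PHI I \<otimes>\<^bsub>local_H1_sum K F w\<^esub> PHI J) v"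
  proof (cases "v \<in> primes_of F")
    case True
    show ?thesis
      using True K.vord_mult[OF w_prime[OF True] inv_ideals_frac[OF assms(1)] inv_ideals_frac[OF assms(2)]]
        dcl_add[OF w_prime[OF True]] by (simp add: PHI_def local_H1_sum_def)
  qed (simp add: PHI_def local_H1_sum_def)
qed

lemma PHI_hom: "group_hom INV (local_H1_sum K F w) PHI"
  using comm_group_INV comm_group_local_H1_sum PHI_closed PHI_mult
  by (intro group_hom.intro group_hom_axioms.intro homI) (simp_all add: comm_group.axioms(2))

lemma PHI_surj: "PHI ` carrier INV = carrier (local_H1_sum K F w)"
proof
  show "PHI ` carrier INV \<subseteq> carrier (local_H1_sum K F w)" using PHI_closed by auto
  show "carrier (local_H1_sum K F w) \<subseteq> PHI ` carrier INV"
  proof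
    fix h assume h: "h \<in> carrier (local_H1_sum K F w)"
    have "\<exists>n. h v = dcl (w v) n" if v: "v \<in> primes_of F" for v
    proof -
      have "h v \<in> carrier (local_H1 K F (w v))" using h v unfolding carrier_local_H1_sum by auto
      thus ?thesis using dcl_surj[OF w_prime[OF v]] by metis
    qed
    then obtain m where m: "\<And>v. v \<in> primes_of F \<Longrightarrow> h v = dcl (w v) (m v)" by metis
    define n where "n v = (if h v = \<one>\<^bsub>local_H1 K F (w v)\<^esub> then 0 else m v)" for v
    have "{v \<in> primes_of F. n v \<noteq> 0} \<subseteq> {v \<in> primes_of F. h v \<noteq> \<one>\<^bsub>local_H1 K F (w v)\<^esub>}"
      by (auto simp: n_def)
    moreover have "finite {v \<in> primes_of F. h v \<noteq> \<one>\<^bsub>local_H1 K F (w v)\<^esub>}"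
      using h unfolding carrier_local_H1_sum by blast
    ultimately have "finite {v \<in> primes_of F. n v \<noteq> 0}" by (rule finite_subset)
    then obtain J where J: "J \<in> inv_ideals" "\<And>P. P \<in> primes_of K \<Longrightarrow> K.vord P J = n (P \<inter> F)"
    proof (rule exists_inv_ideal)
      fix I assume "I \<in> inv_ideals" "\<And>P. P \<in> primes_of K \<Longrightarrow> K.vord P I = n (P \<inter> F)"
      thus thesis by (rule that)
    qed
    have "PHI J v = h v" if v: "v \<in> primes_of F" for v
    proof -
      have "PHI J v = dcl (w v) (n v)" using v J(2)[OF w_prime[OF v]] w[OF v] by (simp add: PHI_def)
      also have "\<dots> = h v" using m[OF v] dcl_one_iff[OF w_prime[OF v], of 0] by (simp add: n_def)
      finally show ?thesis .
    qed
    moreover have "PHI J \<in> (\<Pi>\<^sub>E v\<in>primes_of F. carrier (local_H1 K F (w v)))"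
      "h \<in> (\<Pi>\<^sub>E v\<in>primes_of F. carrier (local_H1 K F (w v)))"
      using PHI_closed[OF J(1)] h unfolding carrier_local_H1_sum mem_Collect_eq by simp_all
    ultimately have "PHI J = h" by (intro PiE_ext[of "PHI J" "primes_of F" _ h])
    thus "h \<in> PHI ` carrier INV" using J(1) by auto
  qed
qed

lemma PHI_one_iff:
  assumes J: "J \<in> inv_ideals"
  shows "PHI J = \<one>\<^bsub>local_H1_sum K F w\<^esub> \<longleftrightarrow> (\<exists>I. F.frac I \<and> J = ext I)"
proof -
  have "PHI J = \<one>\<^bsub>local_H1_sum K F w\<^esub> \<longleftrightarrow>
      (\<forall>v\<in>primes_of F. dcl (w v) (K.vord (w v) J) = \<one>\<^bsub>local_H1 K F (w v)\<^esub>)"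
    unfolding PHI_def local_H1_sum_def one_sum_group fun_eq_iff by auto
  also have "\<dots> \<longleftrightarrow> (\<forall>v\<in>primes_of F. ram (w v) dvd K.vord (w v) J)"
    using dcl_one_iff[OF w_prime] by simp
  finally show ?thesis unfolding inv_ideal_is_ext_iff[OF J] .
qed

lemma localization_cl:
  assumes b: "b \<in> K" "b \<noteq> 0" and f: "f \<in> UU.Z1" and fb: "\<And>\<sigma>. \<sigma> \<in> carrier GG \<Longrightarrow> f \<sigma> = \<sigma> b / b"
  shows "localization K F w (UU.cl f) = PHI (K.pideal b)"
proof (rule ext)
  fix v
  show "localization K F w (UU.cl f) v = PHI (K.pideal b) v"
  proof (cases "v \<in> primes_of F")
    case True
    note P = w_prime[OF True]
    have eq: "lcl (w v) (\<lambda>\<sigma>\<in>Dec (w v). to_completion K (w v) (g \<sigma>)) = dcl (w v) (K.vo (w v) b)"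
      if g: "g \<in> UU.cl f" for g
    proof -
      obtain u where u: "u \<in> carrier (integer_units K)" "g = d0 GG (integer_units K) (\<lambda>\<sigma> x. \<sigma> x) u \<otimes>\<^bsub>C1 GG (integer_units K)\<^esub> f"
        using g unfolding UU.mem_cl_iff by blast
      have uK: "u \<in> K" "u \<noteq> 0" using u(1) by simp_all
      have vu: "K.vo (w v) u = 0" using K.vo_eq[OF P uK] K.vo_eq[OF P K.L_1] pideal_unit[OF u(1)] K.vo_1[OF P] by simp
      have "g \<sigma> = \<sigma> (u * b) / (u * b)" if \<sigma>: "\<sigma> \<in> Dec (w v)" for \<sigma>
      proof -
        note G = DecD(1)[OF \<sigma>]
        have "g \<sigma> = (\<sigma> u * inverse u) * (\<sigma> b / b)"
          using G by (simp only: u(2) mult_product_group restrict_apply' d0_def integer_units_simps integer_units_inv[OF u(1)] fb[OF G])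
        thus ?thesis using gal_mult[OF G uK(1) b(1)] by (simp add: divide_inverse mult_ac)
      qed
      hence "(\<lambda>\<sigma>\<in>Dec (w v). to_completion K (w v) (g \<sigma>)) = dl (w v) (u * b)"
        unfolding dl_def by (intro restrict_ext) simp
      moreover have "K.vo (w v) (u * b) = K.vo (w v) b" using K.vo_mult[OF P uK b] vu by simp
      ultimately show ?thesis using dcl_eq[OF P, of "u * b"] uK b by simp
    qed
    have "localization K F w (UU.cl f) v =
        (\<Union>g\<in>UU.cl f. lcl (w v) (\<lambda>\<sigma>\<in>Dec (w v). to_completion K (w v) (g \<sigma>)))"
      using True by (simp add: localization_def gmodule.cl_def[OF local_gmodule[OF P]])
    also have "\<dots> = dcl (w v) (K.vo (w v) b)"
      using eq UU.cl_self[OF UU.Z1_closed[OF f]] by blast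
    also have "\<dots> = PHI (K.pideal b) v" using True K.vo_eq[OF P b] by (simp add: PHI_def)
    finally show ?thesis .
  qed (simp add: localization_def PHI_def)
qed

lemma localization_image:
  "localization K F w ` carrier (global_H1 K F) = PHI ` (inv_ideals \<inter> principal_ideals K)"
proof -
  have carr: "carrier (global_H1 K F) = UU.cl ` UU.Z1" unfolding global_H1_def by (rule UU.carrier_H1)
  have unit_coc: "\<exists>b. b \<in> K \<and> b \<noteq> 0 \<and> K.pideal b \<in> inv_ideals \<and> (\<forall>\<sigma>\<in>carrier GG. f \<sigma> = \<sigma> b / b)"
    if f: "f \<in> UU.Z1" for f
  proof -
    have fC: "f \<in> carrier (C1 GG (integer_units K))" by (rule UU.Z1_closed[OF f])
    have "f \<in> KU.Z1" using f C1_units[OF fC] unfolding KU.Z1_iff UU.Z1_iff by simp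
    then obtain b where b: "b \<in> K" "b \<noteq> 0" "f = d0 GG (field_units K) (\<lambda>\<sigma> x. \<sigma> x) b" by (rule hilbert90)
    have fs: "f \<sigma> = \<sigma> b / b" if "\<sigma> \<in> carrier GG" for \<sigma> using d0_field_apply[OF b(1,2) that] b(3) by simp
    have "\<sigma> ` K.pideal b = K.pideal b" if \<sigma>: "\<sigma> \<in> carrier GG" for \<sigma>
    proof -
      have u: "f \<sigma> \<in> carrier (integer_units K)" by (rule UU.C1_apply[OF fC \<sigma>])
      hence uK: "f \<sigma> \<in> K" "f \<sigma> \<noteq> 0" by simp_all
      have "\<sigma> b = f \<sigma> * b" using fs[OF \<sigma>] b(2) by simp
      hence "\<sigma> ` K.pideal b = K.pideal (f \<sigma>) \<star> K.pideal b"
        unfolding gal_pideal[OF \<sigma> b(1)] using K.pideal_mult[OF uK b(1,2)] by simp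
      thus ?thesis unfolding pideal_unit[OF u] using b by simp
    qed
    hence "K.pideal b \<in> inv_ideals" unfolding inv_ideals_def using b by simp
    thus ?thesis using b fs by blast
  qed
  have coc_unit: "\<exists>f\<in>UU.Z1. \<forall>\<sigma>\<in>carrier GG. f \<sigma> = \<sigma> b / b"
    if b: "b \<in> K" "b \<noteq> 0" "K.pideal b \<in> inv_ideals" for b
  proof
    define f where "f = d0 GG (field_units K) (\<lambda>\<sigma> x. \<sigma> x) b"
    have fs: "f \<sigma> = \<sigma> b / b" if "\<sigma> \<in> carrier GG" for \<sigma>
      unfolding f_def by (rule d0_field_apply[OF b(1,2) that])
    thus "\<forall>\<sigma>\<in>carrier GG. f \<sigma> = \<sigma> b / b" by blast
    have "f \<sigma> \<in> carrier (integer_units K)" if \<sigma>: "\<sigma> \<in> carrier GG" for \<sigma>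
      unfolding fs[OF \<sigma>]
    proof (rule pideal_eq_imp_unit)
      show "K.pideal (\<sigma> b) = K.pideal b"
        using b(3) gal_pideal[OF \<sigma> b(1)] \<sigma> unfolding inv_ideals_def by simp
    qed (use \<sigma> b gal_eq_0_iff[OF \<sigma> b(1)] in simp_all)
    moreover have fZ: "f \<in> KU.Z1" unfolding f_def by (rule KU.d0_Z1) (use b in simp)
    ultimately have "f \<in> carrier (C1 GG (integer_units K))"
      using KU.Z1_closed[OF fZ] unfolding carrier_product_group PiE_iff by blast
    thus "f \<in> UU.Z1" using fZ unfolding KU.Z1_iff UU.Z1_iff by simp
  qed
  show ?thesis
  proof
    show "localization K F w ` carrier (global_H1 K F) \<subseteq> PHI ` (inv_ideals \<inter> principal_ideals K)"
    proof
      fix y assume "y \<in> localization K F w ` carrier (global_H1 K F)"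
      then obtain f where f: "f \<in> UU.Z1" "y = localization K F w (UU.cl f)" unfolding carr by blast
      obtain b where b: "b \<in> K" "b \<noteq> 0" "K.pideal b \<in> inv_ideals" "\<forall>\<sigma>\<in>carrier GG. f \<sigma> = \<sigma> b / b"
        using unit_coc[OF f(1)] by blast
      have "y = PHI (K.pideal b)" unfolding f(2) by (rule localization_cl[OF b(1,2) f(1)]) (use b(4) in blast)
      moreover have "K.pideal b \<in> inv_ideals \<inter> principal_ideals K"
        using b(3) pideal_principal[OF b(1,2)] by (rule IntI)
      ultimately show "y \<in> PHI ` (inv_ideals \<inter> principal_ideals K)" by (rule image_eqI)
    qed
    show "PHI ` (inv_ideals \<inter> principal_ideals K) \<subseteq> localization K F w ` carrier (global_H1 K F)"
    proof
      fix y assume "y \<in> PHI ` (inv_ideals \<inter> principal_ideals K)"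
      then obtain J where J: "J \<in> inv_ideals" "J \<in> principal_ideals K" "y = PHI J" by blast
      then obtain b where b: "b \<in> K" "b \<noteq> 0" "J = K.pideal b" unfolding K.principal_ideals_iff by blast
      obtain f where f: "f \<in> UU.Z1" "\<forall>\<sigma>\<in>carrier GG. f \<sigma> = \<sigma> b / b"
        using coc_unit[OF b(1,2)] J(1) b(3) by blast
      have "localization K F w (UU.cl f) = y"
        unfolding J(3) b(3) by (rule localization_cl[OF b(1,2) f(1)]) (use f(2) in blast)
      thus "y \<in> localization K F w ` carrier (global_H1 K F)" unfolding carr using f(1) by blast
    qed
  qed
qed

lemma cls_capitulation_iff:
  assumes J: "J \<in> inv_ideals"
  shows "K.cls J \<in> capitulation K ` carrier (class_group F) \<longleftrightarrow> PHI J \<in> PHI ` (inv_ideals \<inter> principal_ideals K)"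
proof
  interpret PH: group_hom INV "local_H1_sum K F w" PHI by (rule PHI_hom)
  have JK: "K.frac J" by (rule inv_ideals_frac[OF J])
  {
    assume "K.cls J \<in> capitulation K ` carrier (class_group F)"
    then obtain I where I: "F.frac I" "K.cls J = K.cls (ext I)" unfolding capitulation_image by blast
    then obtain b where b: "b \<in> K" "b \<noteq> 0" "J = K.pideal b \<star> ext I"
      using K.cls_eq_iff[OF JK ext_frac[OF I(1)]] by blast
    note e = ext_inv[OF I(1)]
    have bf: "K.frac (K.pideal b)" using b by simp
    have "K.pideal b = J \<otimes>\<^bsub>ideal_group K\<^esub> inv\<^bsub>ideal_group K\<^esub> ext I"
      using K.IG.inv_solve_right[of "K.pideal b" J "ext I"] bf JK ext_frac[OF I(1)] b(3) by simp
    hence bi: "K.pideal b \<in> inv_ideals"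
      using subgroup.m_closed[OF subgroup_inv_ideals J subgroup.m_inv_closed[OF subgroup_inv_ideals e]] by simp
    have "PHI J = PHI (K.pideal b) \<otimes>\<^bsub>local_H1_sum K F w\<^esub> PHI (ext I)"
      unfolding b(3) by (rule PHI_mult[OF bi e])
    also have "PHI (ext I) = \<one>\<^bsub>local_H1_sum K F w\<^esub>" using PHI_one_iff[OF e] I(1) by blast
    finally have "PHI J = PHI (K.pideal b)" using PHI_closed[OF bi] by simp
    moreover have "K.pideal b \<in> inv_ideals \<inter> principal_ideals K"
      using bi pideal_principal[OF b(1,2)] by (rule IntI)
    ultimately show "PHI J \<in> PHI ` (inv_ideals \<inter> principal_ideals K)" by (rule image_eqI)
  }
  {
    assume "PHI J \<in> PHI ` (inv_ideals \<inter> principal_ideals K)"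
    then obtain B where B: "B \<in> inv_ideals" "B \<in> principal_ideals K" "PHI J = PHI B" by blast
    then obtain b where b: "b \<in> K" "b \<noteq> 0" "B = K.pideal b" unfolding K.principal_ideals_iff by blast
    define A where "A = J \<otimes>\<^bsub>INV\<^esub> inv\<^bsub>INV\<^esub> B"
    have Bc: "B \<in> carrier INV" "J \<in> carrier INV" using B J by simp_all
    have A: "A \<in> inv_ideals" "A \<otimes>\<^bsub>INV\<^esub> B = J"
      using PH.G.m_closed[OF Bc(2) PH.G.inv_closed[OF Bc(1)]] PH.G.inv_solve_right[OF _ Bc(2,1), of A] unfolding A_def by simp_all
    have "PHI A = PHI J \<otimes>\<^bsub>local_H1_sum K F w\<^esub> inv\<^bsub>local_H1_sum K F w\<^esub> PHI B"
      unfolding A_def using Bc PH.G.inv_closed[OF Bc(1)] by (simp only: PH.hom_mult PH.hom_inv)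
    hence "PHI A = \<one>\<^bsub>local_H1_sum K F w\<^esub>" unfolding B(3) using PH.hom_closed[OF Bc(1)] by simp
    then obtain I where I: "F.frac I" "A = ext I" unfolding PHI_one_iff[OF A(1)] by blast
    have "J = K.pideal b \<star> ext I" using A(2) unfolding I(2) b(3) INV_simps by (simp add: ideal_prod_commute)
    hence "K.cls J = K.cls (ext I)" using K.cls_eq_iff[OF JK ext_frac[OF I(1)]] b(1,2) by blast
    thus "K.cls J \<in> capitulation K ` carrier (class_group F)" unfolding capitulation_image using I(1) by blast
  }
qed

lemma ostrowski_iso: "ostrowski_quotient K F \<cong> localization_coker K F w"
  unfolding ostrowski_quotient_def localization_coker_def localization_image
proof (rule quotient_iso[where f = K.cls and g = PHI and G = INV])
  interpret PH: group_hom INV "local_H1_sum K F w" PHI by (rule PHI_hom)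
  interpret FC: group_hom "ideal_group F" "ideal_group K" ext
    using ext_hom F.IG.is_group K.IG.is_group by (intro group_hom.intro group_hom_axioms.intro)
  interpret KC: group_hom "ideal_group K" "class_group K" K.cls
    using K.cls_hom K.IG.is_group K.CG.is_group by (intro group_hom.intro group_hom_axioms.intro)
  interpret LS: comm_group "local_H1_sum K F w" by (rule comm_group_local_H1_sum)
  let ?A = "(class_group K)\<lparr>carrier := polya_group\<rparr>"
  have gA: "group ?A" by (rule K.CG.subgroup_imp_group[OF subgroup_polya])
  have cA: "comm_group ?A"
    by (rule group.group_comm_groupI[OF gA])
      (use K.CG.m_comm subgroup.subset[OF subgroup_polya] in \<open>auto simp: subset_iff\<close>)
  show "group_hom INV ?A K.cls"
  proof (intro group_hom.intro group_hom_axioms.intro homI)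
    show "group INV" by (rule PH.G.is_group)
    show "group ?A" by (rule gA)
  qed (auto simp: polya_eq K.cls_mult inv_ideals_frac)
  show "K.cls ` carrier INV = carrier ?A" by (simp add: polya_eq)
  show "group_hom INV (local_H1_sum K F w) PHI" by (rule PHI_hom)
  show "PHI ` carrier INV = carrier (local_H1_sum K F w)" by (rule PHI_surj)
  have "subgroup (capitulation K ` carrier (class_group F)) (class_group K)"
  proof -
    have "{J. F.frac J} = carrier (ideal_group F)" by auto
    hence "capitulation K ` carrier (class_group F) = K.cls ` ext ` carrier (ideal_group F)"
      unfolding capitulation_image by (simp add: image_image)
    thus ?thesis using KC.subgroup_img_is_subgroup[OF FC.img_is_subgroup] by simp
  qed
  hence "subgroup (polya_group \<inter> capitulation K ` carrier (class_group F)) (class_group K)"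
    using capitulation_subset_polya by (simp add: Int_absorb1)
  hence "subgroup (polya_group \<inter> capitulation K ` carrier (class_group F)) ?A"
    by (rule K.CG.subgroup_incl[OF _ subgroup_polya]) blast
  thus "polya_group \<inter> capitulation K ` carrier (class_group F) \<lhd> ?A"
    by (rule comm_group.subgroup_imp_normal[OF cA])
  have "subgroup (inv_ideals \<inter> principal_ideals K) INV"
    unfolding INV_def
    by (rule K.IG.subgroup_incl[OF K.IG.subgroups_Inter_pair[OF subgroup_inv_ideals K.subgroup_principal] subgroup_inv_ideals]) blast
  thus "PHI ` (inv_ideals \<inter> principal_ideals K) \<lhd> local_H1_sum K F w"
    by (intro LS.subgroup_imp_normal PH.subgroup_img_is_subgroup)
  fix J assume "J \<in> carrier INV"
  hence J: "J \<in> inv_ideals" by simp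
  show "K.cls J \<in> polya_group \<inter> capitulation K ` carrier (class_group F) \<longleftrightarrow>
      PHI J \<in> PHI ` (inv_ideals \<inter> principal_ideals K)"
    using cls_capitulation_iff[OF J] J unfolding polya_eq by blast
qed

end

theorem corollary2p3:
  fixes K F :: "'a::field_char_0 set" and w :: "'a set \<Rightarrow> 'a set"
  assumes "galois_number_fields K F"
    and "\<And>v. v \<in> primes_of F \<Longrightarrow> w v \<in> primes_of K \<and> w v \<inter> F = v"
  shows "polya K F = transgression_kernel K F
       \<and> ostrowski_quotient K F \<cong> localization_coker K F w"
proof -
  interpret galois_ext_places K F w
    by (intro galois_ext_places.intro galois_ext.intro galois_ext_places_axioms.intro assms)
  show ?thesis using polya_eq transgression_kernel_eq ostrowski_iso by simp
qed

end
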